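(* Let $N$ be a lattice of rank $r$, $\Sigma$ a complete simplicial rational polyhedral fan in $N\otimes\mathbb R$, and $\deg\colon N\to\mathbb C$ a function linear on each cone of $\Sigma$ with $\deg(d)\notin\mathbb Z$ for the primitive generator $d$ of every one-dimensional cone of $\Sigma$. Let $X$ be the toric variety of $\Sigma$, let $\widehat\Sigma$ be a refinement of $\Sigma$ whose toric variety $\widehat X$ is nonsingular (a desingularization of $X$), and let $\deg_1\colon N\to\mathbb C$ be a generic function linear on each cone of $\Sigma$. Let $d_1,\dots,d_s$ be the primitive generators of the one-dimensional cones of $\widehat\Sigma$ and $D_i\in H^2(\widehat X,\mathbb C)$ the classes of the corresponding torus-invariant divisors. Then $$f_{N,\deg}(q)=\lim_{\varepsilon\to0}\int_{\widehat X}\prod_{i=1}^s\frac{(D_i/2\pi i)\,\theta(D_i/2\pi i-\deg(d_i)-\varepsilon\deg_1(d_i),\tau)\,\theta'(0,\tau)}{\theta(D_i/2\pi i,\tau)\,\theta(-\deg(d_i)-\varepsilon\deg_1(d_i),\tau)}.$$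
   Context: $q=e^{2\pi i\tau}$, $\tau$ in the upper half plane. $\theta(z,\tau)=\frac1i\sum_{n\in\mathbb Z}(-1)^ne^{\pi i\tau(n+1/2)^2}e^{\pi iz(2n+1)}$, $\theta'=\partial\theta/\partial z$. A cone is simplicial if generated by $\dim C$ vectors. Each factor is a power series in $z=D_i/2\pi i$ holomorphic at $z=0$, evaluated on the nilpotent class $D_i/2\pi i$ in $H^*(\widehat X,\mathbb C)$; $\int_{\widehat X}$ takes the top-degree part paired with the fundamental class. Toric form: with $M$ the dual lattice, for $C\in\Sigma$, $m\in M$ let $f_C(q,m)$ be the rational function $\sum_{n\in C\cap N}e^{2\pi i\deg(n)}x^n$ (in Laurent monomials $x^n$) evaluated at $x^n=q^{m\cdot n}$ (the convergent sum $\sum_{n\in C\cap N}q^{m\cdot n}e^{2\pi i\deg n}$ when $m$ is positive on $C\setminus\{0\}$, analytically continued otherwise). Then $f_{N,\deg}(q)=\sum_{m\in M}\sum_{C\in\Sigma}(-1)^{r-\dim C}f_C(q,m)$, converging for small $|q|$. The toric variety of a fan is obtained by gluing $\mathrm{Spec}\,\mathbb C[C^\vee\cap M]$; it is nonsingular iff every cone is generated by part of a basis of $N$. *)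

theory Defs
  imports
    "HOL-Homology.Homology"
    "HOL-Complex_Analysis.Complex_Analysis"
    "HOL-Analysis.Sum_Topology"
begin

section \<open>Lattices, cones and fans\<close>

text \<open>
  The lattice \<open>N\<close> of rank \<open>r = CARD('n)\<close> is the type \<open>int ^ 'n\<close>, the ambient space
  \<open>N \<otimes> \<real>\<close> is \<open>real ^ 'n\<close>, and the dual lattice \<open>M\<close> is again \<open>int ^ 'n\<close>, paired with
  \<open>N\<close> by \<open>pairing\<close>.
\<close>

definition rvec :: "int ^ 'n \<Rightarrow> real ^ 'n" where
  "rvec v = (\<chi> i. real_of_int (v $ i))"

definition pairing :: "int ^ 'n \<Rightarrow> int ^ 'n \<Rightarrow> int" where
  "pairing m v = (\<Sum>i\<in>UNIV. m $ i * v $ i)"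

definition lattice_points :: "(real ^ 'n) set \<Rightarrow> (int ^ 'n) set" where
  "lattice_points C = {v. rvec v \<in> C}"

definition rational_cone :: "(real ^ 'n) set \<Rightarrow> bool" where
  "rational_cone C \<longleftrightarrow> (\<exists>S. finite S \<and> C = convex_cone hull (rvec ` S))"

definition is_fan :: "(real ^ 'n) set set \<Rightarrow> bool" where
  "is_fan \<Sigma> \<longleftrightarrow> finite \<Sigma> \<and> \<Sigma> \<noteq> {} \<and>
     (\<forall>C\<in>\<Sigma>. rational_cone C \<and> C \<inter> uminus ` C = {0}) \<and>
     (\<forall>C\<in>\<Sigma>. \<forall>F. F face_of C \<and> F \<noteq> {} \<longrightarrow> F \<in> \<Sigma>) \<and>
     (\<forall>C\<in>\<Sigma>. \<forall>C'\<in>\<Sigma>. (C \<inter> C') face_of C \<and> (C \<inter> C') face_of C')"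

definition complete_fan :: "(real ^ 'n) set set \<Rightarrow> bool" where
  "complete_fan \<Sigma> \<longleftrightarrow> is_fan \<Sigma> \<and> \<Union>\<Sigma> = UNIV"

definition simplicial_fan :: "(real ^ 'n) set set \<Rightarrow> bool" where
  "simplicial_fan \<Sigma> \<longleftrightarrow>
     (\<forall>C\<in>\<Sigma>. \<exists>S. finite S \<and> card S = dim C \<and> C = convex_cone hull S)"

definition lattice_basis :: "(int ^ 'n) set \<Rightarrow> bool" where
  "lattice_basis B \<longleftrightarrow> finite B \<and>
     (\<forall>v. \<exists>!c. (\<forall>b. b \<notin> B \<longrightarrow> c b = 0) \<and> v = (\<Sum>b\<in>B. c b *s b))"

definition nonsingular_fan :: "(real ^ 'n) set set \<Rightarrow> bool" where
  "nonsingular_fan \<Sigma> \<longleftrightarrow>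
     (\<forall>C\<in>\<Sigma>. \<exists>B S. lattice_basis B \<and> S \<subseteq> B \<and> C = convex_cone hull (rvec ` S))"

definition refinement_of :: "(real ^ 'n) set set \<Rightarrow> (real ^ 'n) set set \<Rightarrow> bool" where
  "refinement_of \<Sigma>' \<Sigma> \<longleftrightarrow> \<Union>\<Sigma>' = \<Union>\<Sigma> \<and> (\<forall>C'\<in>\<Sigma>'. \<exists>C\<in>\<Sigma>. C' \<subseteq> C)"

text \<open>Primitive generators of the one-dimensional cones.\<close>

definition ray_generators :: "(real ^ 'n) set set \<Rightarrow> (int ^ 'n) set" where
  "ray_generators \<Sigma> = {d. Gcd (range (($) d)) = 1 \<and> convex_cone hull {rvec d} \<in> \<Sigma>}"

definition linear_on_cones :: "(real ^ 'n) set set \<Rightarrow> (int ^ 'n \<Rightarrow> complex) \<Rightarrow> bool" where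
  "linear_on_cones \<Sigma> dg \<longleftrightarrow>
     (\<forall>C\<in>\<Sigma>. \<exists>c :: complex ^ 'n. \<forall>v\<in>lattice_points C. dg v = (\<Sum>i\<in>UNIV. c $ i * of_int (v $ i)))"


section \<open>The toric form\<close>

text \<open>
  A formal series \<open>\<Sum>\<^sub>n S n x\<^sup>n\<close> over \<open>N\<close> is a rational function in the Laurent monomials if
  \<open>Q \<cdot> S = P\<close> for Laurent polynomials \<open>P\<close>, \<open>Q\<close> with \<open>Q \<noteq> 0\<close>. Its value at a point
  \<open>x : N \<rightarrow> \<complex>\<^sup>*\<close> of the torus is \<open>P(x) / Q(x)\<close> for any such representation with
  \<open>Q(x) \<noteq> 0\<close>; two such representations give the same value since \<open>Q\<^sub>1 P\<^sub>2 = Q\<^sub>2 P\<^sub>1\<close>.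
\<close>

definition laurent_eval :: "(int ^ 'n \<Rightarrow>\<^sub>0 complex) \<Rightarrow> (int ^ 'n \<Rightarrow> complex) \<Rightarrow> complex" where
  "laurent_eval P x = (\<Sum>v\<in>Poly_Mapping.keys P. Poly_Mapping.lookup P v * x v)"

definition represents_series ::
    "(int ^ 'n \<Rightarrow>\<^sub>0 complex) \<Rightarrow> (int ^ 'n \<Rightarrow>\<^sub>0 complex) \<Rightarrow> (int ^ 'n \<Rightarrow> complex) \<Rightarrow> bool" where
  "represents_series P Q S \<longleftrightarrow>
     (\<forall>v. (\<Sum>k\<in>Poly_Mapping.keys Q. Poly_Mapping.lookup Q k * S (v - k)) = Poly_Mapping.lookup P v)"

definition rational_value :: "(int ^ 'n \<Rightarrow> complex) \<Rightarrow> (int ^ 'n \<Rightarrow> complex) \<Rightarrow> complex" where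
  "rational_value S x = (THE w. \<exists>P Q. represents_series P Q S \<and>
     laurent_eval Q x \<noteq> 0 \<and> w = laurent_eval P x / laurent_eval Q x)"

definition cone_function ::
    "(int ^ 'n \<Rightarrow> complex) \<Rightarrow> (real ^ 'n) set \<Rightarrow> complex \<Rightarrow> int ^ 'n \<Rightarrow> complex" where
  "cone_function dg C q m =
     rational_value
       (\<lambda>v. if v \<in> lattice_points C then exp (2 * of_real pi * \<i> * dg v) else 0)
       (\<lambda>v. q powi (pairing m v))"

definition toric_form_term ::
    "(real ^ 'n) set set \<Rightarrow> (int ^ 'n \<Rightarrow> complex) \<Rightarrow> complex \<Rightarrow> int ^ 'n \<Rightarrow> complex" where
  "toric_form_term \<Sigma> dg q m =
     (\<Sum>C\<in>\<Sigma>. (-1) ^ (CARD('n) - dim C) * cone_function dg C q m)"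

definition toric_form ::
    "(real ^ 'n) set set \<Rightarrow> (int ^ 'n \<Rightarrow> complex) \<Rightarrow> complex \<Rightarrow> complex" where
  "toric_form \<Sigma> dg q = infsum (toric_form_term \<Sigma> dg q) UNIV"


section \<open>The theta function\<close>

definition theta :: "complex \<Rightarrow> complex \<Rightarrow> complex" where
  "theta z \<tau> = 1 / \<i> * (\<Sum>\<^sub>\<infinity>n\<in>(UNIV :: int set).
     (-1) powi n * exp (of_real pi * \<i> * \<tau> * (of_int n + 1 / 2)\<^sup>2)
                 * exp (of_real pi * \<i> * z * (2 * of_int n + 1)))"

text \<open>
  The Taylor series at \<open>z = 0\<close> of \<open>z \<theta>(z - a) \<theta>'(0) / (\<theta>(z) \<theta>(-a))\<close>. The
  singularity at \<open>z = 0\<close> is removable because \<open>\<theta>\<close> has a simple zero there.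
\<close>

definition theta_factor :: "complex \<Rightarrow> complex \<Rightarrow> complex fps" where
  "theta_factor \<tau> a = fps_expansion
     (remove_sings (\<lambda>z. z * theta (z - a) \<tau> * deriv (\<lambda>w. theta w \<tau>) 0
                         / (theta z \<tau> * theta (- a) \<tau>))) 0"


section \<open>The toric variety with its classical topology\<close>

text \<open>
  The semigroup \<open>C\<^sup>\<or> \<inter> M\<close>. The complex points of \<open>Spec \<complex>[C\<^sup>\<or> \<inter> M]\<close> are the
  monoid homomorphisms \<open>C\<^sup>\<or> \<inter> M \<rightarrow> (\<complex>, \<cdot>)\<close>; the classical topology is that of
  pointwise convergence (the semigroup is finitely generated, and evaluation at a
  generating set is a closed embedding into affine space).
\<close>

definition dual_semigroup :: "(real ^ 'n) set \<Rightarrow> (int ^ 'n) set" where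
  "dual_semigroup C = {m. \<forall>y\<in>C. 0 \<le> rvec m \<bullet> y}"

definition affine_toric :: "(real ^ 'n) set \<Rightarrow> (int ^ 'n \<Rightarrow> complex) topology" where
  "affine_toric C = subtopology (product_topology (\<lambda>_. euclidean) (dual_semigroup C))
     {x. x 0 = 1 \<and> (\<forall>m\<in>dual_semigroup C. \<forall>m'\<in>dual_semigroup C. x (m + m') = x m * x m')}"

text \<open>
  The affine pieces of \<open>C\<close> and \<open>C'\<close> are glued along the piece of the common face
  \<open>C \<inter> C'\<close>, whose inclusions into both are the restrictions of homomorphisms.
  A point of the toric variety is an equivalence class of pairs \<open>(C, x)\<close>, and the
  topology is the quotient topology of the disjoint union.
\<close>

type_synonym 'n toric_point = "((real, 'n) vec set \<times> ((int, 'n) vec \<Rightarrow> complex)) set"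

definition toric_gluing ::
    "(real ^ 'n) set set \<Rightarrow>
     (((real ^ 'n) set \<times> (int ^ 'n \<Rightarrow> complex)) \<times> ((real ^ 'n) set \<times> (int ^ 'n \<Rightarrow> complex))) set" where
  "toric_gluing \<Sigma> = {((C, x), (C', x')). C \<in> \<Sigma> \<and> C' \<in> \<Sigma> \<and>
     (\<exists>y\<in>topspace (affine_toric (C \<inter> C')).
        x = restrict y (dual_semigroup C) \<and> x' = restrict y (dual_semigroup C'))}"

definition toric_chart_map ::
    "(real ^ 'n) set set \<Rightarrow> (real ^ 'n) set \<Rightarrow> (int ^ 'n \<Rightarrow> complex) \<Rightarrow> 'n toric_point" where
  "toric_chart_map \<Sigma> C x = toric_gluing \<Sigma> `` {(C, x)}"

definition toric_variety :: "(real ^ 'n) set set \<Rightarrow> 'n toric_point topology" where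
  "toric_variety \<Sigma> =
     (let Y = sum_topology affine_toric \<Sigma>; p = (\<lambda>(C, x). toric_chart_map \<Sigma> C x)
      in topology (\<lambda>U. U \<subseteq> p ` topspace Y \<and> openin Y {y \<in> topspace Y. p y \<in> U}))"

lemma istopology_quotient:
  "istopology (\<lambda>U. U \<subseteq> p ` topspace Y \<and> openin Y {y \<in> topspace Y. p y \<in> U})"
proof -
  have *: "{y \<in> topspace Y. p y \<in> S \<inter> T} = {y \<in> topspace Y. p y \<in> S} \<inter> {y \<in> topspace Y. p y \<in> T}"
    for S T by blast
  have **: "{y \<in> topspace Y. p y \<in> \<Union>K} = (\<Union>S\<in>K. {y \<in> topspace Y. p y \<in> S})" for K
    by blast
  show ?thesis
    unfolding istopology_def * ** by (auto intro!: openin_Union)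
qed

lemma openin_toric_variety:
  "openin (toric_variety \<Sigma>) U \<longleftrightarrow>
     U \<subseteq> (\<lambda>(C, x). toric_chart_map \<Sigma> C x) ` topspace (sum_topology affine_toric \<Sigma>) \<and>
     openin (sum_topology affine_toric \<Sigma>)
       {y \<in> topspace (sum_topology affine_toric \<Sigma>). (\<lambda>(C, x). toric_chart_map \<Sigma> C x) y \<in> U}"
  unfolding toric_variety_def Let_def by (subst topology_inverse'[OF istopology_quotient]) (rule refl)

definition toric_chart :: "(real ^ 'n) set set \<Rightarrow> (real ^ 'n) set \<Rightarrow> 'n toric_point set" where
  "toric_chart \<Sigma> C = toric_chart_map \<Sigma> C ` topspace (affine_toric C)"

definition toric_coords ::
    "(real ^ 'n) set set \<Rightarrow> (real ^ 'n) set \<Rightarrow> 'n toric_point \<Rightarrow> int ^ 'n \<Rightarrow> complex" where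
  "toric_coords \<Sigma> C = the_inv_into (topspace (affine_toric C)) (toric_chart_map \<Sigma> C)"

text \<open>
  The torus-invariant prime divisor of a ray is the closure of the codimension-one orbit,
  which consists of the homomorphisms that are non-zero exactly on \<open>\<rho>\<^sup>\<bottom> \<inter> M\<close>.
\<close>

definition toric_divisor :: "(real ^ 'n) set set \<Rightarrow> int ^ 'n \<Rightarrow> 'n toric_point set" where
  "toric_divisor \<Sigma> d =
     (let \<rho> = convex_cone hull {rvec d} in
      toric_variety \<Sigma> closure_of
        (toric_chart_map \<Sigma> \<rho> ` {x \<in> topspace (affine_toric \<rho>).
           \<forall>m\<in>dual_semigroup \<rho>. x m \<noteq> 0 \<longleftrightarrow> pairing m d = 0}))"

text \<open>
  The character of \<open>m\<close> is a local equation of the divisor on the affine piece of \<open>C\<close>: the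
  ideal of functions vanishing on the divisor is spanned by characters, and these are
  exactly the multiples of the character of \<open>m\<close>.
\<close>

definition local_equation ::
    "(real ^ 'n) set set \<Rightarrow> int ^ 'n \<Rightarrow> (real ^ 'n) set \<Rightarrow> int ^ 'n \<Rightarrow> bool" where
  "local_equation \<Sigma> d C m \<longleftrightarrow>
     {u \<in> dual_semigroup C. \<forall>p \<in> toric_chart \<Sigma> C \<inter> toric_divisor \<Sigma> d. toric_coords \<Sigma> C p u = 0}
       = (+) m ` dual_semigroup C"


section \<open>Singular cochains with complex coefficients\<close>

type_synonym 'a cochain = "((nat \<Rightarrow> real) \<Rightarrow> 'a) \<Rightarrow> complex"

definition eval_chain :: "'a cochain \<Rightarrow> 'a chain \<Rightarrow> complex" where
  "eval_chain \<phi> c = (\<Sum>s\<in>Poly_Mapping.keys c. of_int (Poly_Mapping.lookup c s) * \<phi> s)"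

definition coboundary :: "nat \<Rightarrow> 'a cochain \<Rightarrow> 'a cochain" where
  "coboundary p \<phi> s = eval_chain \<phi> (chain_boundary (Suc p) (frag_of s))"

definition cocycle :: "nat \<Rightarrow> 'a topology \<Rightarrow> 'a cochain \<Rightarrow> bool" where
  "cocycle p X \<phi> \<longleftrightarrow> (\<forall>s. singular_simplex (Suc p) X s \<longrightarrow> coboundary p \<phi> s = 0)"

definition front_face :: "nat \<Rightarrow> ((nat \<Rightarrow> real) \<Rightarrow> 'a) \<Rightarrow> (nat \<Rightarrow> real) \<Rightarrow> 'a" where
  "front_face p s = restrict s (standard_simplex p)"

definition back_face :: "nat \<Rightarrow> nat \<Rightarrow> ((nat \<Rightarrow> real) \<Rightarrow> 'a) \<Rightarrow> (nat \<Rightarrow> real) \<Rightarrow> 'a" where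
  "back_face p k s = restrict (\<lambda>x. s (\<lambda>i. if i < p then 0 else x (i - p))) (standard_simplex k)"

text \<open>
  Inhomogeneous cochains: the component in degree \<open>n\<close> is \<open>\<Phi> n\<close>. The cup product is the
  usual Alexander-Whitney product. The truncation in \<open>fps_at\<close> is harmless for a \<open>\<Phi>\<close>
  without component in degree 0, whose \<open>k\<close>-th power vanishes in degrees below \<open>k\<close>.
\<close>

type_synonym 'a graded_cochain = "nat \<Rightarrow> 'a cochain"

definition in_degree :: "nat \<Rightarrow> 'a cochain \<Rightarrow> 'a graded_cochain" where
  "in_degree p \<phi> = (\<lambda>n s. if n = p then \<phi> s else 0)"

definition cup_one :: "'a graded_cochain" where
  "cup_one = in_degree 0 (\<lambda>s. 1)"

definition cup :: "'a graded_cochain \<Rightarrow> 'a graded_cochain \<Rightarrow> 'a graded_cochain" where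
  "cup \<Phi> \<Psi> = (\<lambda>n s. \<Sum>p\<le>n. \<Phi> p (front_face p s) * \<Psi> (n - p) (back_face p (n - p) s))"

primrec cup_power :: "'a graded_cochain \<Rightarrow> nat \<Rightarrow> 'a graded_cochain" where
  "cup_power \<Phi> 0 = cup_one"
| "cup_power \<Phi> (Suc k) = cup \<Phi> (cup_power \<Phi> k)"

definition cup_prod :: "'a graded_cochain list \<Rightarrow> 'a graded_cochain" where
  "cup_prod \<Phi>s = foldr cup \<Phi>s cup_one"

definition fps_at :: "complex fps \<Rightarrow> 'a graded_cochain \<Rightarrow> 'a graded_cochain" where
  "fps_at g \<Phi> = (\<lambda>n s. \<Sum>k\<le>n. fps_nth g k * cup_power \<Phi> k n s)"


section \<open>Classes of divisors and the fundamental class\<close>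

definition simplex_path :: "((nat \<Rightarrow> real) \<Rightarrow> 'a) \<Rightarrow> real \<Rightarrow> 'a" where
  "simplex_path s t = s (\<lambda>i. if i = 0 then 1 - t else if i = 1 then t else 0)"

text \<open>
  A cocycle for the first Chern class of the line bundle with transition functions
  \<open>g i j : U i \<inter> U j \<rightarrow> \<complex>\<^sup>*\<close>. The pullback under \<open>g i j\<close> of the 1-cocycle
  \<open>(1 / 2 \<pi> \<i>) dz/z\<close> of \<open>\<complex>\<^sup>*\<close> assigns to a path \<open>s\<close> the (complex-valued) winding number
  of \<open>g i j \<circ> s\<close> about 0. As \<open>g\<close> satisfies the cocycle condition these are differences
  \<open>b i - b j\<close>, and the coboundaries of the \<open>b i\<close> agree on overlaps. This is the image of
  \<open>g\<close> under the connecting map of the exponential sequence, with the sign for which, when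
  \<open>g i j = f i / f j\<close> for local equations \<open>f i\<close> of a divisor, a transversal disc, positively
  oriented, has value \<open>+1\<close>.
\<close>

definition chern_cocycle ::
    "'a topology \<Rightarrow> 'i set \<Rightarrow> ('i \<Rightarrow> 'a set) \<Rightarrow> ('i \<Rightarrow> 'i \<Rightarrow> 'a \<Rightarrow> complex) \<Rightarrow> 'a cochain \<Rightarrow> bool" where
  "chern_cocycle X I U g c \<longleftrightarrow> cocycle 2 X c \<and>
     (\<exists>b :: 'i \<Rightarrow> 'a cochain.
        (\<forall>i\<in>I. \<forall>s. singular_simplex 2 (subtopology X (U i)) s \<longrightarrow> c s = coboundary 1 (b i) s) \<and>
        (\<forall>i\<in>I. \<forall>j\<in>I. \<forall>s. singular_simplex 1 (subtopology X (U i \<inter> U j)) s \<longrightarrow>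
           b i s - b j s = winding_number (g i j \<circ> simplex_path s) 0))"

text \<open>
  The class of the divisor of \<open>d\<close> is the first Chern class of the associated line bundle,
  whose transition functions are the quotients of local equations; the quotient of two
  characters is a character that is invertible on the overlap.
\<close>

definition divisor_cocycle ::
    "(real ^ 'n) set set \<Rightarrow> int ^ 'n \<Rightarrow> 'n toric_point cochain \<Rightarrow> bool" where
  "divisor_cocycle \<Sigma> d c \<longleftrightarrow>
     (\<exists>m. (\<forall>C\<in>\<Sigma>. local_equation \<Sigma> d C (m C)) \<and>
          chern_cocycle (toric_variety \<Sigma>) \<Sigma> (toric_chart \<Sigma>)
            (\<lambda>C C' p. toric_coords \<Sigma> (C \<inter> C') p (m C - m C')) c)"

text \<open>
  For a basis \<open>ds\<close> of \<open>N\<close> that generates a cone of \<open>\<Sigma>\<close>, the affine piece is \<open>\<complex>\<^sup>r\<close>; its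
  coordinates \<open>z 0, \<dots>, z (r - 1)\<close> are the characters of the dual basis.
\<close>

definition coordinate_point ::
    "(real ^ 'n) set set \<Rightarrow> (int ^ 'n) list \<Rightarrow> (nat \<Rightarrow> complex) \<Rightarrow> 'n toric_point" where
  "coordinate_point \<Sigma> ds z =
     (let C = convex_cone hull (rvec ` set ds) in
      toric_chart_map \<Sigma> C
        (restrict (\<lambda>m. \<Prod>j<length ds. z j ^ nat (pairing m (ds ! j))) (dual_semigroup C)))"

text \<open>
  The affine \<open>2r\<close>-simplex in the coordinates \<open>z\<close> with barycentre \<open>a\<close> and vertices \<open>v\<^sub>0\<close>,
  \<open>v\<^sub>0 + (2r + 1) e\<^sub>1\<close>, \<open>v\<^sub>0 + (2r + 1) \<i> e\<^sub>1\<close>, \<open>v\<^sub>0 + (2r + 1) e\<^sub>2\<close>, \<open>v\<^sub>0 + (2r + 1) \<i> e\<^sub>2\<close>, etc.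
  It generates the local homology at \<open>a\<close> and defines the complex orientation.
\<close>

definition orientation_simplex ::
    "(real ^ 'n) set set \<Rightarrow> (int ^ 'n) list \<Rightarrow> (nat \<Rightarrow> complex) \<Rightarrow> (nat \<Rightarrow> real) \<Rightarrow> 'n toric_point" where
  "orientation_simplex \<Sigma> ds a =
     restrict (\<lambda>t. coordinate_point \<Sigma> ds
         (\<lambda>j. a j - Complex 1 1 + of_nat (2 * length ds + 1) * Complex (t (2 * j + 1)) (t (2 * j + 2))))
       (standard_simplex (2 * length ds))"

text \<open>
  The cycles representing the fundamental class of the complex manifold: at every point
  they restrict to the complex orientation.
\<close>

definition fundamental_cycle :: "(real ^ 'n) set set \<Rightarrow> 'n toric_point chain \<Rightarrow> bool" where
  "fundamental_cycle \<Sigma> \<mu> \<longleftrightarrow>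
     singular_relcycle (2 * CARD('n)) (toric_variety \<Sigma>) {} \<mu> \<and>
     (\<forall>ds a. distinct ds \<and> lattice_basis (set ds) \<and> convex_cone hull (rvec ` set ds) \<in> \<Sigma> \<longrightarrow>
        homologous_rel (2 * CARD('n)) (toric_variety \<Sigma>)
          (topspace (toric_variety \<Sigma>) - {coordinate_point \<Sigma> ds a})
          \<mu> (frag_of (orientation_simplex \<Sigma> ds a)))"

text \<open>
  Integration over the toric variety pairs the component of top real degree \<open>2r\<close> with the
  fundamental class.
\<close>

definition toric_integral :: "'n toric_point chain \<Rightarrow> 'n::finite toric_point graded_cochain \<Rightarrow> complex" where
  "toric_integral \<mu> \<Phi> = eval_chain (\<Phi> (2 * CARD('n))) \<mu>"

end

theory Submission
 imports Defs
begin

text \<open>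
For a refinement with nonsingular toric variety the toric form does not change, and after
perturbing the degree along a generic direction v, half-open simplicial cones turn it into a sum over the
maximal cones G of products of Kronecker series, the factors of the fixed point formula.
By Kronecker's identity each series is a quotient of theta functions in a linear form on G.
The pole parts in these forms cancel by the linear relations among the torus-invariant divisors, and what
remains is the integral, because intersection numbers are determined by
the linear relations, the vanishing on non-cones and the value 1 on maximal cones.
That value is read off from explicit cochains: the class of a divisor is computed by winding numbers
of transition characters on the cells dual to the fan.
\<close>

text \<open>The series of a single half-open cone need not be summable over \<open>M\<close>, since
  its terms may fail to decay in some directions. A weight exp(-s m.v) with small s > 0 makes all of
  them summable at once, because boundary faces are kept or dropped according to the signs of v. The
  total term is the same for v and -v, hence it has majorants with weights of both signs; so the
  unweighted sum converges and is the limit s -> 0+, with s v acting as an equivariant parameter in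
  a localization formula. Rays of the refinement may have integral degree, so domination in epsilon
  takes place on the original fan and the refinement enters only for epsilon other than 0. In
  topology the cycle is arbitrary: after a change by coboundaries the cup product vanishes on
  simplices of a chart that miss one of its divisors, and barycentric subdivision reduces the
  evaluation to a cube around one fixed point. The cube is placed off centre, so that only one
  simplex of its triangulation contains this point.\<close>

section \<open>Lattice vectors, the pairing and coordinates in simplicial cones\<close>

lemma rvec_inject [simp]: "rvec x = rvec y \<longleftrightarrow> x = y"
 by (auto simp: rvec_def vec_eq_iff)

lemma rvec_0 [simp]: "rvec 0 = 0"
 by (auto simp: rvec_def vec_eq_iff)

lemma rvec_add: "rvec (x + y) = rvec x + rvec y"
 by (auto simp: rvec_def vec_eq_iff)

lemma rvec_diff: "rvec (x - y) = rvec x - rvec y"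
 by (auto simp: rvec_def vec_eq_iff)

lemma rvec_smult: "rvec (c *s x) = of_int c *\<^sub>R rvec x"
 by (auto simp: rvec_def vec_eq_iff)

lemma rvec_sum: "rvec (\<Sum>x\<in>A. f x) = (\<Sum>x\<in>A. rvec (f x))"
 by (induction A rule: infinite_finite_induct) (auto simp: rvec_add)

lemma inj_rvec: "inj_on rvec A"
 by (auto simp: inj_on_def)

lemma pairing_inner: "real_of_int (pairing m v) = rvec m \<bullet> rvec v"
 by (simp add: pairing_def rvec_def inner_vec_def)

lemma pairing_add_left: "pairing (m + m') v = pairing m v + pairing m' v"
 by (simp add: pairing_def algebra_simps sum.distrib)

lemma pairing_add_right: "pairing m (v + v') = pairing m v + pairing m v'"
 by (simp add: pairing_def algebra_simps sum.distrib)

lemma pairing_0 [simp]: "pairing 0 v = 0" "pairing m 0 = 0"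
 by (simp_all add: pairing_def)

lemma pairing_minus_left: "pairing (- m) v = - pairing m v"
 by (simp add: pairing_def sum_negf)

lemma pairing_diff_left: "pairing (m - m') v = pairing m v - pairing m' v"
 by (simp add: pairing_def algebra_simps sum_subtractf)

lemma pairing_smult_left: "pairing (c *s m) v = c * pairing m v"
 by (simp add: pairing_def algebra_simps sum_distrib_left)

lemma pairing_sum_left: "pairing (\<Sum>x\<in>A. f x) v = (\<Sum>x\<in>A. pairing (f x) v)"
 by (induction A rule: infinite_finite_induct) (auto simp: pairing_add_left)

lemma pairing_sum_right: "pairing m (\<Sum>x\<in>A. f x) = (\<Sum>x\<in>A. pairing m (f x))"
 by (induction A rule: infinite_finite_induct) (auto simp: pairing_add_right)

definition pos_cone :: "(int ^ 'n) set => (real ^ 'n) set" where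
 "pos_cone T = convex_cone hull (rvec ` T)"

lemma convex_coneI:
 assumes "0 \<in> S" "!!x y. x \<in> S ==> y \<in> S ==> x + y \<in> S" "!!c x. 0 <= c ==> x \<in> S ==> c *\<^sub>R x \<in> S"
 shows "convex_cone S"
 using assms by (auto simp: convex_cone_iff)

lemma convex_cone_sum:
 assumes "convex_cone S" "!!i. i \<in> I ==> f i \<in> S"
 shows "(\<Sum>i\<in>I. f i) \<in> S"
 using assms(2) by (induction I rule: infinite_finite_induct)
  (use assms(1) in \<open>auto intro: convex_cone_contains_0 convex_cone_add\<close>)

lemma convex_cone_hull_image:
 fixes f :: "'i => 'a :: real_vector"
 assumes "finite I"
 shows "convex_cone hull (f ` I) = {\<Sum>i\<in>I. c i *\<^sub>R f i | c. \<forall>i\<in>I. 0 <= c i}" (is "_ = ?R")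
proof
 have "convex_cone ?R"
 proof (rule convex_coneI)
  show "0 \<in> ?R" by (auto intro!: exI[of _ "%_. 0"])
  fix x y assume "x \<in> ?R" "y \<in> ?R"
  then obtain c c' where "x = (\<Sum>i\<in>I. c i *\<^sub>R f i)" "\<forall>i\<in>I. 0 <= c i" "y = (\<Sum>i\<in>I. c' i *\<^sub>R f i)" "\<forall>i\<in>I. 0 <= c' i"
  by auto
  thus "x + y \<in> ?R"
  by (auto intro!: exI[of _ "%i. c i + c' i"] simp: algebra_simps sum.distrib)
 next
  fix x and a :: real assume "0 <= a" "x \<in> ?R"
  then obtain c where "x = (\<Sum>i\<in>I. c i *\<^sub>R f i)" "\<forall>i\<in>I. 0 <= c i" by auto
  thus "a *\<^sub>R x \<in> ?R"
  using \<open>0 <= a\<close> by (auto intro!: exI[of _ "%i. a * c i"] simp: scaleR_sum_right)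
 qed
 moreover have "f ` I \<subseteq> ?R"
 proof clarify
  fix i assume "i \<in> I"
  have "(\<Sum>e\<in>I. (if e = i then 1 else 0) *\<^sub>R f e) = (\<Sum>e\<in>I. if e = i then f e else 0)"
  by (intro sum.cong) auto
  also have "... = f i" using assms \<open>i \<in> I\<close> by simp
  finally show "\<exists>c. f i = (\<Sum>i\<in>I. c i *\<^sub>R f i) \<and> (\<forall>i\<in>I. 0 <= c i)"
  by (intro exI[of _ "%e. if e = i then 1 else 0"]) auto
 qed
 ultimately show "convex_cone hull (f ` I) \<subseteq> ?R" by (intro hull_minimal) auto
next
 have "f i \<in> convex_cone hull (f ` I)" if "i \<in> I" for i using that by (simp add: hull_inc)
 thus "?R \<subseteq> convex_cone hull (f ` I)"
  by (auto intro!: convex_cone_sum convex_cone_scaleR simp: convex_cone_convex_cone_hull)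
qed

lemma pos_cone_explicit:
 assumes "finite T"
 shows "pos_cone T = {\<Sum>d\<in>T. c d *\<^sub>R rvec d | c. \<forall>d\<in>T. 0 <= c d}"
 unfolding pos_cone_def by (rule convex_cone_hull_image[OF assms])

lemma convex_cone_pos_cone: "convex_cone (pos_cone T)"
 by (simp add: pos_cone_def convex_cone_convex_cone_hull)

lemma zero_in_pos_cone [simp]: "0 \<in> pos_cone T"
 by (simp add: convex_cone_contains_0 convex_cone_pos_cone)

lemma rvec_in_pos_cone: "d \<in> T ==> rvec d \<in> pos_cone T"
 by (auto simp: pos_cone_def intro: hull_inc)

lemma pos_cone_mono: "T \<subseteq> T' ==> pos_cone T \<subseteq> pos_cone T'"
 by (auto simp: pos_cone_def intro!: hull_mono)

definition lin_indep :: "(int ^ 'n) set => bool" where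
 "lin_indep G \<longleftrightarrow> finite G \<and> independent (rvec ` G)"

text \<open>The coordinate of x at d relative to G. It is 0 for d outside G, so sums and products
  over all rays can be written with \<open>co G d\<close> without restricting them to G.\<close>

definition co :: "(int ^ 'n) set => int ^ 'n => real ^ 'n => real" where
 "co G d x = representation (rvec ` G) x (rvec d)"

lemma co_sum:
 assumes "lin_indep G" "d \<in> G"
 shows "co G d (\<Sum>e\<in>G. c e *\<^sub>R rvec e) = c d"
proof -
 have I: "independent (rvec ` G)" and F: "finite G" using assms by (auto simp: lin_indep_def)
 have "co G d (\<Sum>e\<in>G. c e *\<^sub>R rvec e) = (\<Sum>e\<in>G. representation (rvec ` G) (c e *\<^sub>R rvec e) (rvec d))"
  unfolding co_def using I
  by (subst real_vector.representation_sum) (blast intro: span_scale span_base)+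
 also have "... = (\<Sum>e\<in>G. c e * (if rvec d = rvec e then 1 else 0))"
  using I by (intro sum.cong refl)
  (auto simp: real_vector.representation_scale real_vector.representation_basis span_base)
 also have "... = (\<Sum>e\<in>G. if e = d then c e else 0)" by (intro sum.cong) auto
 also have "... = c d" using F assms(2) by simp
 finally show ?thesis .
qed

lemma co_expand:
 assumes "lin_indep G" "x \<in> span (rvec ` G)"
 shows "x = (\<Sum>d\<in>G. co G d x *\<^sub>R rvec d)"
proof -
 have "(\<Sum>b\<in>rvec ` G. representation (rvec ` G) x b *\<^sub>R b) = x"
  using assms by (intro real_vector.sum_representation_eq) (auto simp: lin_indep_def)
 thus ?thesis by (subst (asm) sum.reindex[OF inj_rvec]) (simp add: co_def)
qed

lemma co_pos:
 assumes "lin_indep G" "x \<in> pos_cone G" "d \<in> G"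
 shows "0 <= co G d x"
proof -
 have "finite G" using assms(1) by (simp add: lin_indep_def)
 with assms(2) obtain c where c: "x = (\<Sum>d\<in>G. c d *\<^sub>R rvec d)" "\<forall>d\<in>G. 0 <= c d"
  by (auto simp: pos_cone_explicit)
 with co_sum[OF assms(1,3), of c] assms(3) show ?thesis by simp
qed

lemma pos_cone_subset_span: "pos_cone G \<subseteq> span (rvec ` G)"
 unfolding pos_cone_def
 by (rule hull_minimal) (auto intro: span_base simp: convex_cone_span)

lemma pos_cone_iff:
 assumes "lin_indep G" "T \<subseteq> G"
 shows "x \<in> pos_cone T \<longleftrightarrow> x \<in> span (rvec ` G) \<and> (\<forall>d\<in>G. 0 <= co G d x) \<and> (\<forall>d\<in>G-T. co G d x = 0)"
proof -
 have fT: "finite T" and fG: "finite G" using assms finite_subset by (auto simp: lin_indep_def)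
 show ?thesis
 proof
  assume x: "x \<in> pos_cone T"
  then obtain c where c: "x = (\<Sum>d\<in>T. c d *\<^sub>R rvec d)" "\<forall>d\<in>T. 0 <= c d"
  using fT by (auto simp: pos_cone_explicit)
  have "x = (\<Sum>d\<in>G. (if d \<in> T then c d else 0) *\<^sub>R rvec d)"
  unfolding c using fG assms(2)
  by (intro sum.mono_neutral_cong_left) auto
  hence "co G d x = (if d \<in> T then c d else 0)" if "d \<in> G" for d
  using co_sum[OF assms(1) that, of "%d. if d \<in> T then c d else 0"] by simp
  moreover have "x \<in> span (rvec ` G)"
  using x pos_cone_mono[OF assms(2)] pos_cone_subset_span by blast
  ultimately show "x \<in> span (rvec ` G) \<and> (\<forall>d\<in>G. 0 <= co G d x) \<and> (\<forall>d\<in>G-T. co G d x = 0)"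
  using c(2) by auto
 next
  assume *: "x \<in> span (rvec ` G) \<and> (\<forall>d\<in>G. 0 <= co G d x) \<and> (\<forall>d\<in>G-T. co G d x = 0)"
  hence "x = (\<Sum>d\<in>G. co G d x *\<^sub>R rvec d)" using co_expand[OF assms(1)] by blast
  also have "... = (\<Sum>d\<in>T. co G d x *\<^sub>R rvec d)"
  using * fG assms(2) by (intro sum.mono_neutral_right) auto
  finally show "x \<in> pos_cone T"
  using * fT assms(2) by (auto simp: pos_cone_explicit intro!: exI[of _ "%d. co G d x"])
 qed
qed

lemma span_full:
 assumes "lin_indep (G :: (int ^ 'n) set)" "card G = CARD('n)"
 shows "span (rvec ` G) = UNIV"
proof -
 have "card (rvec ` G) = card G" by (rule card_image[OF inj_rvec])
 hence "dim (UNIV :: (real ^ 'n) set) <= card (rvec ` G)" using assms by simp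
 hence "UNIV \<subseteq> span (rvec ` G)"
  using assms by (intro card_ge_dim_independent) (auto simp: lin_indep_def)
 thus ?thesis by blast
qed

lemma card_le_rank:
 assumes "lin_indep (G :: (int ^ 'n) set)"
 shows "card G <= CARD('n)"
proof -
 have "card (rvec ` G) = card G" by (rule card_image[OF inj_rvec])
 moreover have "card (rvec ` G) <= dim (UNIV :: (real ^ 'n) set)"
  using assms by (intro independent_card_le_dim) (auto simp: lin_indep_def)
 ultimately show ?thesis by simp
qed

section \<open>Complete simplicial fans as complexes of generator sets, and their half-open
  decomposition\<close>

locale simplicial_complex_fan =
 fixes K :: "(int ^ 'n) set set"
 assumes fin: "finite K"
  and indep: "G \<in> K ==> lin_indep G"
  and down: "G \<in> K ==> T \<subseteq> G ==> T \<in> K"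
  and inter: "G \<in> K ==> G' \<in> K ==> pos_cone G \<inter> pos_cone G' \<subseteq> pos_cone (G \<inter> G')"
  and cover: "\<exists>G\<in>K. x \<in> pos_cone G"
begin

definition facets :: "(int ^ 'n) set set" where
 "facets = {G \<in> K. card G = CARD('n)}"

definition generic :: "real ^ 'n => bool" where
 "generic v \<longleftrightarrow> (\<forall>T\<in>K. card T < CARD('n) --> v \<notin> span (rvec ` T))"

text \<open>For generic v these are the points x such that x + t v lies in the interior of the cone
  of G for all small t > 0. A facet of the cone belongs to it if v points inwards there.\<close>

definition half :: "(int ^ 'n) set => real ^ 'n => (real ^ 'n) set" where
 "half G v = {x. \<forall>d\<in>G. (co G d v > 0 --> co G d x \<ge> 0) \<and> (co G d v < 0 --> co G d x > 0)}"

lemma facetsD: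
 assumes "G \<in> facets"
 shows "G \<in> K" "lin_indep G" "finite G" "card G = CARD('n)" "x \<in> span (rvec ` G)"
 using assms indep span_full[of G] by (auto simp: facets_def lin_indep_def)

lemma finite_facets: "finite facets"
 using fin by (auto simp: facets_def)

lemma finite_K_mem: "T \<in> K ==> finite T"
 using indep by (auto simp: lin_indep_def)

lemma facets_card_diff:
 assumes "G \<in> facets" "N \<subseteq> G"
 shows "CARD('n) - card (G - N) = card N"
proof -
 have "finite N" "card N <= card G" using assms facetsD(3) by (auto intro: finite_subset card_mono)
 thus ?thesis using assms facetsD(4)[OF assms(1)] by (simp add: card_Diff_subset)
qed

lemma co_add: "G \<in> facets ==> co G d (x + y) = co G d x + co G d y"
 using facetsD[of G] by (auto simp: co_def lin_indep_def real_vector.representation_add)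

lemma co_scaleR: "G \<in> facets ==> co G d (c *\<^sub>R x) = c * co G d x"
 using facetsD[of G] by (auto simp: co_def lin_indep_def real_vector.representation_scale)

lemma co_minus: "G \<in> facets ==> co G d (- x) = - co G d x"
 using co_scaleR[of G d "-1" x] by simp

lemma facets_expand: "G \<in> facets ==> x = (\<Sum>d\<in>G. co G d x *\<^sub>R rvec d)"
 using co_expand facetsD by blast

lemma co_outside: "G \<in> facets ==> d \<notin> G ==> co G d x = 0"
 unfolding co_def by (rule ccontr, drule real_vector.representation_ne_zero) auto

lemma generic_uminus: "generic v ==> generic (- v)"
 unfolding generic_def using span_neg by force

lemma generic_co:
 assumes "generic v" "G \<in> facets" "d \<in> G"
 shows "co G d v ~= 0"
proof
 assume 0: "co G d v = 0"
 have "v = (\<Sum>e\<in>G. co G e v *\<^sub>R rvec e)" using facets_expand[OF assms(2)] .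
 also have "... = (\<Sum>e\<in>G - {d}. co G e v *\<^sub>R rvec e)"
  using 0 facetsD(3)[OF assms(2)] by (intro sum.mono_neutral_right) auto
 also have "... \<in> span (rvec ` (G - {d}))"
  by (intro span_sum span_scale span_base) auto
 finally have "v \<in> span (rvec ` (G - {d}))" .
 moreover have "G - {d} \<in> K" using down facetsD(1)[OF assms(2)] by blast
 moreover have "card (G - {d}) < CARD('n)"
  using facetsD(3,4)[OF assms(2)] assms(3) by (metis card_Diff1_less)
 ultimately show False using assms(1) by (auto simp: generic_def)
qed

lemma generic_exists: "\<exists>v. generic v"
proof -
 let ?S = "\<Union>T\<in>{T\<in>K. card T < CARD('n)}. span (rvec ` T)"
 have "negligible ?S"
 proof (intro negligible_Union; clarify?)
  fix T assume T: "T \<in> K" "card T < CARD('n)"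
  from T(1) have "dim (span (rvec ` T)) <= card (rvec ` T)"
  using finite_K_mem by (auto simp: dim_span intro!: dim_le_card span_base)
  also have "... = card T" by (rule card_image[OF inj_rvec])
  finally show "negligible (span (rvec ` T))" using T by (intro negligible_lowdim) auto
 qed (use fin in auto)
 hence "?S ~= UNIV" by (metis non_negligible_UNIV)
 thus ?thesis by (auto simp: generic_def)
qed

text \<open>Moving x slightly along v leads into the interior of a maximal cone, and interiors of
  different maximal cones are disjoint.\<close>

lemma half_unique:
 assumes v: "generic v"
 shows "\<exists>!G. G \<in> facets \<and> x \<in> half G v"
proof -
 \<comment> \<open>Pigeonhole: finitely many cones cover infinitely many points x + v/(k+1) that
   converge to x.\<close>
 have "\<exists>G\<in>K. infinite {k::nat. x + (1 / Suc k) *\<^sub>R v \<in> pos_cone G}"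
 proof (rule ccontr)
  assume "\<not> ?thesis"
  hence "finite (\<Union>G\<in>K. {k::nat. x + (1 / Suc k) *\<^sub>R v \<in> pos_cone G})" using fin by auto
  moreover have "(\<Union>G\<in>K. {k::nat. x + (1 / Suc k) *\<^sub>R v \<in> pos_cone G}) = UNIV"
  using cover by blast
  ultimately show False by simp
 qed
 then obtain G where G: "G \<in> K" and inf: "infinite {k::nat. x + (1 / Suc k) *\<^sub>R v \<in> pos_cone G}"
  by blast
 \<comment> \<open>Two such points in a cone of smaller dimension would put their difference, a
   non-zero multiple of v, into its span.\<close>
 have GF: "G \<in> facets"
 proof (rule ccontr)
  assume "G \<notin> facets"
  hence c: "card G < CARD('n)"
  using G card_le_rank[OF indep[OF G]] by (auto simp: facets_def)
  obtain k where k: "x + (1 / Suc k) *\<^sub>R v \<in> pos_cone G"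
  using inf by (metis (mono_tags) empty_Collect_eq finite.emptyI)
  obtain l where l: "x + (1 / Suc l) *\<^sub>R v \<in> pos_cone G" "l > k"
  using inf by (metis (mono_tags, lifting) infinite_nat_iff_unbounded mem_Collect_eq)
  have "(x + (1 / Suc k) *\<^sub>R v) - (x + (1 / Suc l) *\<^sub>R v) \<in> span (rvec ` G)"
  using k l pos_cone_subset_span by (intro span_diff) blast+
  hence "(1 / Suc k - 1 / Suc l) *\<^sub>R v \<in> span (rvec ` G)" by (simp add: algebra_simps)
  hence "inverse (1 / real (Suc k) - 1 / Suc l) *\<^sub>R (1 / real (Suc k) - 1 / Suc l) *\<^sub>R v \<in> span (rvec ` G)"
  by (rule span_scale)
  moreover have "1 / real (Suc k) - 1 / Suc l ~= 0" using l(2) by (simp add: frac_eq_eq)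
  ultimately have "v \<in> span (rvec ` G)" by (simp add: scaleR_scaleR)
  with v c G show False by (auto simp: generic_def)
 qed
 have "x \<in> half G v"
  unfolding half_def
 proof (intro CollectI ballI)
  fix d assume d: "d \<in> G"
  have *: "infinite {k::nat. co G d x + co G d v / Suc k \<ge> 0}"
  using inf
  proof (rule infinite_super[rotated], intro Collect_mono impI)
  fix k :: nat assume "x + (1 / Suc k) *\<^sub>R v \<in> pos_cone G"
  hence "0 <= co G d (x + (1 / Suc k) *\<^sub>R v)" using co_pos[OF indep[OF G] _ d] by blast
  thus "co G d x + co G d v / Suc k \<ge> 0" using GF by (simp add: co_add co_scaleR)
  qed
  have ge: "0 <= co G d x"
  proof (rule ccontr)
  assume "\<not> ?thesis"
  hence neg: "co G d x < 0" by simp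
  have "(%k::nat. co G d x + co G d v / Suc k) \<longlonglongrightarrow> co G d x"
  by real_asymp
  hence "\<forall>\<^sub>F k in sequentially. co G d x + co G d v / Suc k < 0"
  using neg by (rule order_tendstoD)
  hence "finite {k::nat. \<not> co G d x + co G d v / Suc k < 0}"
  by (auto simp: eventually_cofinite[symmetric] cofinite_eq_sequentially)
  with * show False by (simp add: not_less)
  qed
  moreover have "co G d x ~= 0" if "co G d v < 0"
  proof
  assume "co G d x = 0"
  hence "{k::nat. co G d x + co G d v / Suc k \<ge> 0} = {}" using that
  by (auto simp: divide_less_0_iff not_le)
  with * show False by simp
  qed
  ultimately show "(co G d v > 0 --> co G d x \<ge> 0) \<and> (co G d v < 0 --> co G d x > 0)" by force
 qed
 moreover have "G' = G''" if G': "G' \<in> facets" "x \<in> half G' v" and G'': "G'' \<in> facets" "x \<in> half G'' v"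
  for G' G''
 proof -
  have pos: "\<forall>\<^sub>F e in at_right 0. co G d (x + e *\<^sub>R v) > 0"
  if "G \<in> facets" "x \<in> half G v" "d \<in> G" for G d
  proof (cases "co G d v > 0")
  case True
  hence "co G d x \<ge> 0" using that by (auto simp: half_def)
  hence "co G d (x + e *\<^sub>R v) > 0" if "e > 0" for e
  using True that \<open>G \<in> facets\<close> by (simp add: co_add co_scaleR add_nonneg_pos)
  thus ?thesis by (auto simp: eventually_at_right_field intro: exI[of _ 1])
  next
  case False
  hence "co G d v < 0" using generic_co[OF v that(1,3)] by linarith
  hence "co G d x > 0" using that by (auto simp: half_def)
  moreover have "((%e. co G d x + e * co G d v) \<longlongrightarrow> co G d x) (at_right 0)"
  by (rule tendsto_eq_rhs, (rule tendsto_intros)+) simp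
  ultimately have "\<forall>\<^sub>F e in at_right 0. co G d x + e * co G d v > 0"
  by (rule order_tendstoD[rotated])
  thus ?thesis using that(1) by (simp add: co_add co_scaleR)
  qed
  have all: "\<forall>\<^sub>F e in at_right 0. \<forall>d\<in>G. co G d (x + e *\<^sub>R v) > 0"
  if "G \<in> facets" "x \<in> half G v" for G
  using pos[OF that] facetsD(3)[OF that(1)] by (simp add: eventually_ball_finite_distrib)
  have "\<forall>\<^sub>F e in at_right (0::real). False \<or> ((\<forall>d\<in>G'. co G' d (x + e *\<^sub>R v) > 0) \<and> (\<forall>d\<in>G''. co G'' d (x + e *\<^sub>R v) > 0))"
  using all[OF G'] all[OF G''] by eventually_elim auto
  then obtain e where e: "\<forall>d\<in>G'. co G' d (x + e *\<^sub>R v) > 0" "\<forall>d\<in>G''. co G'' d (x + e *\<^sub>R v) > 0"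
  by (metis (mono_tags, lifting) eventually_happens trivial_limit_at_right_real)
  \<comment> \<open>All coordinates of y are positive in both cones, while a point of the common
    cone has coordinate 0 at every generator of G' missing from G''. Hence nothing is
    missing.\<close>
  define y where "y = x + e *\<^sub>R v"
  have "y \<in> pos_cone G'" "y \<in> pos_cone G''"
  using e pos_cone_iff[of G' G' y] pos_cone_iff[of G'' G'' y] facetsD[OF G'(1)] facetsD[OF G''(1)]
  by (auto simp: y_def less_imp_le)
  hence y: "y \<in> pos_cone (G' \<inter> G'')" using inter facetsD[OF G'(1)] facetsD[OF G''(1)] by blast
  have "G' \<subseteq> G''"
  proof
  fix d assume d: "d \<in> G'"
  show "d \<in> G''"
  proof (rule ccontr)
  assume "d \<notin> G''"
  hence "co G' d y = 0" using y pos_cone_iff[of G' "G' \<inter> G''" y] facetsD[OF G'(1)] d by auto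
  with e d show False by (auto simp: y_def)
  qed
  qed
  thus ?thesis
  by (metis G'(1) G''(1) card_subset_eq facetsD(3) facetsD(4))
 qed
 ultimately show ?thesis using GF by blast
qed

text \<open>The sum of the generators of T, moved a little along -v, enters exactly one maximal
  cone. This cone contains T, and since the sum has coordinate 0 outside T, it is recognised by the
  negative coordinates of v there.\<close>

lemma star_unique:
 assumes v: "generic v" and T: "T \<in> K"
 shows "\<exists>!G. G \<in> facets \<and> T \<subseteq> G \<and> (\<forall>d\<in>G-T. co G d v < 0)"
proof -
 define x where "x = (\<Sum>d\<in>T. rvec d)"
 have fT: "finite T" using finite_K_mem[OF T] .
 have xT: "x \<in> pos_cone T"
  using fT by (auto simp: pos_cone_explicit x_def intro!: exI[of _ "%_. 1"])
 have cx: "co G d x = (if d \<in> T then 1 else 0)" if "G \<in> facets" "T \<subseteq> G" "d \<in> G" for G d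
 proof -
  have "x = (\<Sum>d\<in>G. (if d \<in> T then 1 else 0) *\<^sub>R rvec d)"
  unfolding x_def using facetsD(3)[OF that(1)] that(2) by (intro sum.mono_neutral_cong_left) auto
  thus ?thesis
  using co_sum[of G d "%d. if d \<in> T then 1 else 0"] facetsD[OF that(1)] that by simp
 qed
 have "G \<in> facets \<and> x \<in> half G (- v) \<longleftrightarrow> G \<in> facets \<and> T \<subseteq> G \<and> (\<forall>d\<in>G-T. co G d v < 0)" for G
 proof (intro iffI conjI; (elim conjE)?)
  assume G: "G \<in> facets" and x: "x \<in> half G (- v)"
  show "G \<in> facets" by fact
  have ge: "\<forall>d\<in>G. 0 <= co G d x"
  using x generic_co[OF v G] G
  by (auto simp: half_def co_minus)
  hence "x \<in> pos_cone G" using pos_cone_iff[of G G x] facetsD[OF G] by auto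
  hence xi: "x \<in> pos_cone (T \<inter> G)" using inter[OF T facetsD(1)[OF G]] xT by blast
  have "co T d x = 1" if "d \<in> T" for d
  using co_sum[OF indep[OF T] that, of "%_. 1"] by (simp add: x_def)
  thus TG: "T \<subseteq> G"
  using xi pos_cone_iff[of T "T \<inter> G" x] indep[OF T] by force
  show "\<forall>d\<in>G-T. co G d v < 0"
  proof
  fix d assume d: "d \<in> G - T"
  hence "co G d x = 0" using cx[OF G TG] by auto
  with x d G have "\<not> co G d v > 0" by (auto simp: half_def co_minus)
  thus "co G d v < 0" using generic_co[OF v G, of d] d by auto
  qed
 next
  assume G: "G \<in> facets" and TG: "T \<subseteq> G" and neg: "\<forall>d\<in>G-T. co G d v < 0"
  show "x \<in> half G (- v)" using neg G TG cx[OF G TG] by (force simp: half_def co_minus)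
 qed
 thus ?thesis using half_unique[OF generic_uminus[OF v], of x] by simp
qed

text \<open>Sending T to its maximal cone from \<open>star_unique\<close> cuts the complex into
  Boolean intervals: below G lie the faces obtained by dropping some of the generators at which v is
  negative.\<close>

lemma sum_K_eq_sum_facets:
 fixes F :: "(int ^ 'n) set => 'b :: comm_monoid_add"
 assumes v: "generic v"
 shows "(\<Sum>T\<in>K. F T) = (\<Sum>G\<in>facets. \<Sum>N\<in>Pow {d\<in>G. co G d v < 0}. F (G - N))"
proof -
 let ?A = "SIGMA G:facets. Pow {d\<in>G. co G d v < 0}"
 have "bij_betw (%(G, N). G - N) ?A K"
  unfolding bij_betw_def
 proof
  show "inj_on (%(G, N). G - N) ?A"
  proof (rule inj_onI, clarify)
  fix G N G' N' assume *: "G \<in> facets" "N \<subseteq> {d\<in>G. co G d v < 0}" "G' \<in> facets"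
  "N' \<subseteq> {d\<in>G'. co G' d v < 0}" "G - N = G' - N'"
  have "G - N \<in> K" using down facetsD(1)[OF *(1)] by blast
  from star_unique[OF v this] obtain H where
  uniq: "!!y. y \<in> facets ==> G - N \<subseteq> y ==> \<forall>d\<in>y - (G - N). co y d v < 0 ==> y = H"
  by (elim ex1E) blast
  have "G = H" by (rule uniq) (use * in auto)
  moreover have "G' = H" by (rule uniq) (use * in auto)
  ultimately have "G = G'" by simp
  thus "G = G' \<and> N = N'" using * by blast
  qed
  show "(%(G, N). G - N) ` ?A = K"
  proof safe
  fix G N assume "G \<in> facets" thus "G - N \<in> K" using down facetsD(1) by blast
  next
  fix T assume T: "T \<in> K"
  from star_unique[OF v T] obtain G where "G \<in> facets" "T \<subseteq> G" "\<forall>d\<in>G-T. co G d v < 0" by blast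
  thus "T \<in> (%(G, N). G - N) ` ?A"
  by (intro image_eqI[of _ _ "(G, G - T)"]) auto
  qed
 qed
 hence "(\<Sum>T\<in>K. F T) = (\<Sum>(G, N)\<in>?A. F (G - N))"
  by (subst sum.reindex_bij_betw[symmetric]) (auto simp: case_prod_unfold)
 thus ?thesis
  using finite_facets facetsD(3) by (subst sum.Sigma) auto
qed

text \<open>On one Boolean interval the alternating sum expands the product of the factors
  \<open>\<phi> d - 1\<close> over the negative generators; the other generators are present in
  every face of the interval.\<close>

lemma alternating_prod_sum:
 fixes \<phi> :: "int ^ 'n => 'b :: comm_ring_1"
 assumes v: "generic v"
 shows "(\<Sum>T\<in>K. (-1) ^ (CARD('n) - card T) * (\<Prod>d\<in>T. \<phi> d)) =
  (\<Sum>G\<in>facets. \<Prod>d\<in>G. if co G d v > 0 then \<phi> d else \<phi> d - 1)"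
 unfolding sum_K_eq_sum_facets[OF v]
proof (intro sum.cong refl)
 fix G assume G: "G \<in> facets"
 let ?N = "{d\<in>G. co G d v < 0}"
 have fG: "finite G" using facetsD(3)[OF G] .
 have card: "CARD('n) - card (G - N) = card N" if "N \<in> Pow ?N" for N
  using that by (intro facets_card_diff[OF G]) auto
 have "(\<Sum>N\<in>Pow ?N. (-1) ^ (CARD('n) - card (G - N)) * prod \<phi> (G - N)) =
  (\<Sum>N\<in>Pow ?N. (-1) ^ card N * prod \<phi> (?N - N)) * prod \<phi> (G - ?N)"
  unfolding sum_distrib_right
 proof (intro sum.cong refl)
  fix N assume N: "N \<in> Pow ?N"
  hence eq: "G - N = (?N - N) \<union> (G - ?N)" by auto
  have "prod \<phi> (G - N) = prod \<phi> (?N - N) * prod \<phi> (G - ?N)"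
  unfolding eq using fG by (intro prod.union_disjoint) auto
  thus "(- 1) ^ (CARD('n) - card (G - N)) * prod \<phi> (G - N) = (- 1) ^ card N * prod \<phi> (?N - N) * prod \<phi> (G - ?N)"
  using card[OF N] by (simp add: mult.assoc)
 qed
 also have "(\<Sum>N\<in>Pow ?N. (-1) ^ card N * prod \<phi> (?N - N)) = (\<Prod>d\<in>?N. \<phi> d - 1)"
  using prod_diff_conv_sum[of ?N \<phi> "%_. 1"] fG by simp
 also have "(\<Prod>d\<in>?N. \<phi> d - 1) * prod \<phi> (G - ?N) = (\<Prod>d\<in>G. if co G d v > 0 then \<phi> d else \<phi> d - 1)"
 proof -
  have "(\<Prod>d\<in>G. if co G d v > 0 then \<phi> d else \<phi> d - 1) =
  (\<Prod>d\<in>G - ?N. if co G d v > 0 then \<phi> d else \<phi> d - 1) * (\<Prod>d\<in>?N. if co G d v > 0 then \<phi> d else \<phi> d - 1)"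
  by (rule prod.subset_diff) (use fG in auto)
  also have "(\<Prod>d\<in>G - ?N. if co G d v > 0 then \<phi> d else \<phi> d - 1) = prod \<phi> (G - ?N)"
  proof (intro prod.cong refl)
  fix d assume "d \<in> G - ?N"
  thus "(if co G d v > 0 then \<phi> d else \<phi> d - 1) = \<phi> d" using generic_co[OF v G, of d] by auto
  qed
  also have "(\<Prod>d\<in>?N. if co G d v > 0 then \<phi> d else \<phi> d - 1) = (\<Prod>d\<in>?N. \<phi> d - 1)"
  by (intro prod.cong refl) auto
  finally show ?thesis by (simp add: mult.commute)
 qed
 finally show "(\<Sum>N\<in>Pow ?N. (-1) ^ (CARD('n) - card (G - N)) * prod \<phi> (G - N)) =
  (\<Prod>d\<in>G. if co G d v > 0 then \<phi> d else \<phi> d - 1)" .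
qed

text \<open>On each Boolean interval inclusion-exclusion replaces the conditions co >= 0 at the
  negative generators by co > 0. What is left is the indicator of a half-open cone, and these cones
  partition the space.\<close>

lemma euler_relation:
 "(\<Sum>T\<in>K. (-1) ^ (CARD('n) - card T) * (if x \<in> pos_cone T then 1 else (0::'b::comm_ring_1))) = 1"
proof -
 obtain v where v: "generic v" using generic_exists by blast
 have "(\<Sum>T\<in>K. (-1) ^ (CARD('n) - card T) * (if x \<in> pos_cone T then 1 else (0::'b))) =
  (\<Sum>G\<in>facets. if x \<in> half G v then 1 else 0)"
  unfolding sum_K_eq_sum_facets[OF v]
 proof (intro sum.cong refl)
  fix G assume G: "G \<in> facets"
  let ?N = "{d\<in>G. co G d v < 0}" and ?i = "%b. if b then 1 else (0::'b)"
  let ?a = "%d. ?i (0 <= co G d x)" and ?b = "%d. ?i (co G d x = 0)"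
  have fG: "finite G" using facetsD(3)[OF G] .
  have iprod: "(\<Prod>d\<in>A. ?i (Q d)) = ?i (\<forall>d\<in>A. Q d)" if "finite A" for A and Q :: "int ^ 'n => bool"
  using that by (induction A rule: finite_induct) auto
  have "(\<Sum>N\<in>Pow ?N. (-1) ^ (CARD('n) - card (G - N)) * ?i (x \<in> pos_cone (G - N))) =
  (\<Sum>N\<in>Pow ?N. (-1) ^ card N * prod ?b N * prod ?a (?N - N)) * prod ?a (G - ?N)"
  unfolding sum_distrib_right
  proof (intro sum.cong refl)
  fix N assume N: "N \<in> Pow ?N"
  have fN: "finite N" using N fG finite_subset[of N G] by auto
  have card: "CARD('n) - card (G - N) = card N"
  using N by (intro facets_card_diff[OF G]) auto
  have "x \<in> pos_cone (G - N) \<longleftrightarrow> (\<forall>d\<in>N. co G d x = 0) \<and> (\<forall>d\<in>?N - N. 0 <= co G d x) \<and> (\<forall>d\<in>G - ?N. 0 <= co G d x)"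
  proof -
  have "G - (G - N) = N" using N by auto
  moreover have "x \<in> span (rvec ` G)" "lin_indep G" using facetsD[OF G] by auto
  ultimately have "x \<in> pos_cone (G - N) \<longleftrightarrow> (\<forall>d\<in>G. 0 <= co G d x) \<and> (\<forall>d\<in>N. co G d x = 0)"
  using pos_cone_iff[of G "G - N" x] by simp
  moreover have "G = N \<union> (?N - N) \<union> (G - ?N)" using N by auto
  ultimately show ?thesis by (metis (no_types, lifting) Un_iff order_refl)
  qed
  hence "?i (x \<in> pos_cone (G - N)) = prod ?b N * prod ?a (?N - N) * prod ?a (G - ?N)"
  using fG fN by (simp add: iprod)
  thus "(- 1) ^ (CARD('n) - card (G - N)) * ?i (x \<in> pos_cone (G - N)) =
  (-1) ^ card N * prod ?b N * prod ?a (?N - N) * prod ?a (G - ?N)"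
  using card by (simp only: mult.assoc)
  qed
  also have "(\<Sum>N\<in>Pow ?N. (-1) ^ card N * prod ?b N * prod ?a (?N - N)) = (\<Prod>d\<in>?N. ?a d - ?b d)"
  using prod_diff_conv_sum[of ?N ?a ?b] fG by simp
  also have "... = (\<Prod>d\<in>?N. ?i (0 < co G d x))" by (intro prod.cong) auto
  also have "(\<Prod>d\<in>?N. ?i (0 < co G d x)) * prod ?a (G - ?N) = ?i (x \<in> half G v)"
  proof -
  have "x \<in> half G v \<longleftrightarrow> (\<forall>d\<in>?N. 0 < co G d x) \<and> (\<forall>d\<in>G - ?N. 0 <= co G d x)"
  unfolding half_def using generic_co[OF v G]
  by (auto simp: not_less)
  thus ?thesis using fG by (simp add: iprod)
  qed
  finally show "(\<Sum>N\<in>Pow ?N. (-1) ^ (CARD('n) - card (G - N)) * ?i (x \<in> pos_cone (G - N))) = ?i (x \<in> half G v)" .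
 qed
 also have "... = 1"
 proof -
  obtain G where G: "G \<in> facets" "x \<in> half G v" and u: "!!H. H \<in> facets ==> x \<in> half H v ==> H = G"
  using half_unique[OF v, of x] by blast
  have "(\<Sum>H\<in>facets. if x \<in> half H v then 1 else 0) = (\<Sum>H\<in>facets. if H = G then 1 else (0::'b))"
  proof (intro sum.cong refl)
  fix H assume "H \<in> facets"
  hence "x \<in> half H v \<longleftrightarrow> H = G" using u G by blast
  thus "(if x \<in> half H v then 1 else 0) = (if H = G then 1 else (0::'b))" by (simp only:)
  qed
  thus ?thesis using finite_facets G(1) by simp
 qed
 finally show ?thesis .
qed

end

section \<open>From fans to complexes of ray generators\<close>

definition gens :: "(real ^ 'n) set set => (real ^ 'n) set => (int ^ 'n) set" where
 "gens Fn C = {d \<in> ray_generators Fn. rvec d \<in> C}"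

lemma convex_cone_hull_singleton: "convex_cone hull {x} = {c *\<^sub>R x | c. 0 <= c}"
proof -
 have "convex_cone hull ((%_. x) ` {()}) = {c *\<^sub>R x | c. 0 <= c}"
  by (subst convex_cone_hull_image) (auto intro: exI[of _ "%_. _"])
 thus ?thesis by simp
qed

lemma fan_face: "is_fan Fn ==> C \<in> Fn ==> F face_of C ==> F ~= {} ==> F \<in> Fn"
 by (simp add: is_fan_def)

lemma fan_inter: "is_fan Fn ==> C \<in> Fn ==> C' \<in> Fn ==> (C \<inter> C') face_of C"
 by (simp add: is_fan_def)

lemma primitive_nonzero:
 assumes "Gcd (range (($) (d :: int ^ 'n))) = 1"
 shows "d ~= 0"
proof
 assume "d = 0"
 hence "range (($) d) = {0}" by auto
 with assms show False by simp
qed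

text \<open>Cross-multiplication with one non-zero coordinate, followed by gcds on both sides, shows
  that this coordinate has the same absolute value in both vectors; the sign is settled by 0 <=
  c.\<close>

lemma primitive_unique:
 fixes d d' :: "int ^ 'n"
 assumes "Gcd (range (($) d)) = 1" "Gcd (range (($) d')) = 1" "rvec d' = c *\<^sub>R rvec d" "0 <= c"
 shows "d' = d"
proof -
 have c: "real_of_int (d' $ i) = c * real_of_int (d $ i)" for i
  using assms(3) by (auto simp: rvec_def vec_eq_iff)
 obtain i where i: "d $ i ~= 0" using primitive_nonzero[OF assms(1)] by (auto simp: vec_eq_iff)
 have eq: "\<bar>d $ i\<bar> * (d' $ j) = \<bar>d' $ i\<bar> * (d $ j)" for j
 proof -
  have "real_of_int (\<bar>d $ i\<bar> * (d' $ j)) = real_of_int (\<bar>d' $ i\<bar> * (d $ j))"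
  using c[of i] c[of j] assms(4) by (simp add: abs_mult)
  thus ?thesis by linarith
 qed
 have "\<bar>d $ i\<bar> = Gcd ((*) \<bar>d $ i\<bar> ` range (($) d'))" using assms(2) by (simp add: Gcd_mult)
 also have "(*) \<bar>d $ i\<bar> ` range (($) d') = (*) \<bar>d' $ i\<bar> ` range (($) d)"
  using eq by (auto simp: image_image)
 also have "Gcd ... = \<bar>d' $ i\<bar>" using assms(1) by (simp add: Gcd_mult)
 finally have "d' $ j = d $ j" for j using eq[of j] i by auto
 thus ?thesis by (simp add: vec_eq_iff)
qed

lemma primitive_multiple:
 fixes v :: "int ^ 'n"
 assumes "v ~= 0"
 obtains d :: "int ^ 'n" and c where "Gcd (range (($) d)) = 1" "0 < c" "v = c *s d"
proof -
 define g where "g = Gcd (range (($) v))"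
 obtain i where i: "v $ i ~= 0" using assms by (auto simp: vec_eq_iff)
 have g0: "g ~= 0" unfolding g_def using i by (auto simp: Gcd_0_iff)
 have gp: "g > 0" using g0 Gcd_int_greater_eq_0[of "range (($) v)"] by (simp only: g_def order_less_le) auto
 define d where "d = (\<chi> i. v $ i div g)"
 have dvd: "g dvd v $ i" for i unfolding g_def by (rule Gcd_dvd) auto
 have v: "v = g *s d" using dvd by (simp add: vec_eq_iff d_def)
 have "(*) g ` range (($) d) = range (($) v)" unfolding image_image by (subst v) simp
 hence "g = \<bar>g * Gcd (range (($) d))\<bar>" by (metis Gcd_mult g_def normalize_int_def)
 hence "Gcd (range (($) d)) = 1" using gp by (auto simp: abs_mult)
 with that[of d g] gp v show ?thesis by blast
qed

lemma pos_cone_face: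
 assumes "lin_indep G" "T \<subseteq> G"
 shows "pos_cone T face_of pos_cone G"
 unfolding face_of_def
proof (intro conjI ballI impI)
 show "pos_cone T \<subseteq> pos_cone G" by (rule pos_cone_mono[OF assms(2)])
 show "convex (pos_cone T)" using convex_cone_pos_cone[of T] by (simp add: convex_cone_def)
 fix a b x assume a: "a \<in> pos_cone G" and b: "b \<in> pos_cone G" and x: "x \<in> pos_cone T" "x \<in> open_segment a b"
 then obtain u where u: "0 < u" "u < 1" "x = (1 - u) *\<^sub>R a + u *\<^sub>R b" by (auto simp: in_segment)
 have as: "a \<in> span (rvec ` G)" and bs: "b \<in> span (rvec ` G)" using a b pos_cone_subset_span by blast+
 have "co G d a = 0 \<and> co G d b = 0" if d: "d \<in> G - T" for d
 proof -
  have "0 = co G d x" using x(1) pos_cone_iff[OF assms] d by auto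
  also have "... = (1 - u) * co G d a + u * co G d b"
  unfolding u(3) co_def using assms(1) as bs
  by (simp add: lin_indep_def real_vector.representation_add real_vector.representation_scale span_scale)
  finally have "(1 - u) * co G d a + u * co G d b = 0" by simp
  moreover have "0 <= (1 - u) * co G d a" "0 <= u * co G d b"
  using u co_pos[OF assms(1)] a b d by auto
  ultimately show ?thesis using u by (simp add: add_nonneg_eq_0_iff)
 qed
 thus "a \<in> pos_cone T" "b \<in> pos_cone T"
  using pos_cone_iff[OF assms] pos_cone_iff[OF assms(1) order_refl] a b by auto
qed

lemma dim_pos_cone:
 assumes "lin_indep T"
 shows "dim (pos_cone T) = card T"
proof -
 have "dim (pos_cone T) = card (rvec ` T)"
  using assms pos_cone_subset_span by (intro dim_unique) (auto simp: rvec_in_pos_cone lin_indep_def)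
 thus ?thesis by (simp add: card_image[OF inj_rvec])
qed

lemma pos_cone_member:
 assumes "lin_indep G" "T \<subseteq> G" "d \<in> G" "rvec d \<in> pos_cone T"
 shows "d \<in> T"
proof (rule ccontr)
 assume "d \<notin> T"
 hence "co G d (rvec d) = 0" using pos_cone_iff[OF assms(1,2)] assms(3,4) by auto
 moreover have "co G d (rvec d) = 1"
  using assms(1,3) by (simp add: co_def lin_indep_def real_vector.representation_basis)
 ultimately show False by simp
qed

text \<open>The given generators are real vectors. Each spans a face of C, hence a rational ray of
  the fan, and can be rescaled to a primitive lattice vector. Conversely a ray of the fan inside C
  is a face of C and so runs through one of the given generators.\<close>

lemma simplicial_cone_gens:
 assumes fan: "is_fan Fn" and C: "C \<in> Fn" and S: "finite S" "card S = dim C" "C = convex_cone hull S"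
 shows "lin_indep (gens Fn C)" "C = pos_cone (gens Fn C)"
proof -
 have "S \<subseteq> C" "C \<subseteq> span S"
  using S(3) hull_subset[of S convex_cone] hull_minimal[of S "span S" convex_cone]
  by (auto simp: convex_cone_span span_superset)
 hence I: "independent S" using card_eq_dim S(1,2) by blast
 have face: "convex_cone hull {s} face_of C" if s: "s \<in> S" for s
  unfolding face_of_def
 proof (intro conjI ballI impI)
  show "convex_cone hull {s} \<subseteq> C" using s S(3) by (auto intro: hull_mono[THEN subsetD])
  show "convex (convex_cone hull {s})" by (rule convex_convex_cone_hull)
  fix a b x assume a: "a \<in> C" and b: "b \<in> C" and x: "x \<in> convex_cone hull {s}" "x \<in> open_segment a b"
  let ?r = "%x. representation S x"
  have span: "a \<in> span S" "b \<in> span S" using a b \<open>C \<subseteq> span S\<close> by auto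
  have pos: "0 <= ?r y t" if "y \<in> C" for y t
  proof -
  have "C \<subseteq> {y \<in> span S. 0 <= ?r y t}"
  unfolding S(3)
  proof (rule hull_minimal)
  show "S \<subseteq> {y \<in> span S. 0 <= ?r y t}" using I by (auto simp: real_vector.representation_basis span_base)
  show "convex_cone {y \<in> span S. 0 <= ?r y t}"
  using I by (auto simp: convex_cone_iff real_vector.representation_zero
  real_vector.representation_add real_vector.representation_scale span_zero span_add span_scale)
  qed
  with that show ?thesis by auto
  qed
  obtain u where u: "0 < u" "u < 1" "x = (1 - u) *\<^sub>R a + u *\<^sub>R b" using x(2) by (auto simp: in_segment)
  obtain c where c: "x = c *\<^sub>R s" using x(1) by (auto simp: convex_cone_hull_singleton)
  have z: "?r a t = 0 \<and> ?r b t = 0" if t: "t ~= s" for t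
  proof -
  have "0 = ?r x t" using t s I by (simp add: c real_vector.representation_scale span_base real_vector.representation_basis)
  also have "... = (1 - u) * ?r a t + u * ?r b t"
  unfolding u(3) using I span by (simp add: real_vector.representation_add real_vector.representation_scale span_scale)
  finally have "(1 - u) * ?r a t + u * ?r b t = 0" by simp
  moreover have "0 <= (1 - u) * ?r a t" "0 <= u * ?r b t" using u pos a b by auto
  ultimately show ?thesis using u by (simp add: add_nonneg_eq_0_iff)
  qed
  have "y \<in> convex_cone hull {s}" if y: "y \<in> C" "!!t. t ~= s ==> ?r y t = 0" for y
  proof -
  have "y = (\<Sum>t\<in>S. ?r y t *\<^sub>R t)"
  using real_vector.sum_representation_eq[OF I _ S(1) order_refl, of y] y(1) \<open>C \<subseteq> span S\<close> by auto
  also have "... = (\<Sum>t\<in>{s}. ?r y t *\<^sub>R t)" using s S(1) y(2) by (intro sum.mono_neutral_right) auto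
  finally show ?thesis using pos[OF y(1), of s] by (auto simp: convex_cone_hull_singleton)
  qed
  with z a b show "a \<in> convex_cone hull {s}" "b \<in> convex_cone hull {s}" by auto
 qed
 have ex: "\<exists>d c. d \<in> gens Fn C \<and> 0 < c \<and> s = c *\<^sub>R rvec d" if s: "s \<in> S" for s
 proof -
  have s0: "s ~= 0" using I s dependent_zero by blast
  have ne: "convex_cone hull {s} ~= {}" by (rule convex_cone_hull_nonempty)
  have mem: "convex_cone hull {s} \<in> Fn" by (rule fan_face[OF fan C face[OF s] ne])
  then obtain S' where S': "finite S'" "convex_cone hull {s} = convex_cone hull (rvec ` S')"
  proof -
  have "rational_cone (convex_cone hull {s})" using fan mem by (simp add: is_fan_def)
  thus ?thesis using that unfolding rational_cone_def by blast
  qed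
  have "\<exists>v\<in>S'. v ~= 0"
  proof (rule ccontr)
  assume "\<not> ?thesis"
  hence "rvec ` S' \<subseteq> {0}" by auto
  hence "convex_cone hull (rvec ` S') \<subseteq> {0}" by (intro hull_minimal) auto
  moreover have "s \<in> convex_cone hull {s}" by (simp add: hull_inc)
  ultimately show False using S' s0 by auto
  qed
  then obtain v where v: "v \<in> S'" "v ~= 0" by blast
  hence "rvec v \<in> convex_cone hull {s}" by (simp add: S' hull_inc)
  then obtain a where a: "rvec v = a *\<^sub>R s" "0 <= a" by (auto simp: convex_cone_hull_singleton)
  have "a ~= 0" using a v(2) by (metis rvec_0 rvec_inject scaleR_zero_left)
  obtain d :: "int ^ 'a" and g where d: "Gcd (range (($) d)) = 1" "0 < g" "v = g *s d" by (rule primitive_multiple[OF v(2)])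
  define c where "c = real_of_int g / a"
  have "s = inverse a *\<^sub>R rvec v" using a(1) \<open>a ~= 0\<close> by simp
  hence sc: "s = c *\<^sub>R rvec d" by (simp add: d(3) rvec_smult c_def field_simps)
  have c: "0 < c" using d(2) a(2) \<open>a ~= 0\<close> by (simp add: c_def)
  have "convex_cone hull {rvec d} = convex_cone hull {s}"
  unfolding convex_cone_hull_singleton sc
  proof safe
  fix t :: real assume "0 <= t"
  thus "\<exists>t'. t *\<^sub>R rvec d = t' *\<^sub>R c *\<^sub>R rvec d \<and> 0 <= t'" using c by (intro exI[of _ "t / c"]) auto
  show "\<exists>t'. t *\<^sub>R c *\<^sub>R rvec d = t' *\<^sub>R rvec d \<and> 0 <= t'" using c \<open>0 <= t\<close> by (intro exI[of _ "t * c"]) auto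
  qed
  hence "d \<in> gens Fn C"
  using d(1) mem face_of_imp_subset[OF face[OF s]] hull_inc[of "rvec d" "{rvec d}" convex_cone]
  by (auto simp: gens_def ray_generators_def)
  with c sc show ?thesis by blast
 qed
 then obtain f g where f: "!!s. s \<in> S ==> f s \<in> gens Fn C" "!!s. s \<in> S ==> 0 < g s"
  "!!s. s \<in> S ==> s = g s *\<^sub>R rvec (f s)" by metis
 have gen: "gens Fn C = f ` S"
 proof
  show "f ` S \<subseteq> gens Fn C" using f(1) by auto
  show "gens Fn C \<subseteq> f ` S"
  proof
  fix d assume d: "d \<in> gens Fn C"
  hence dC: "rvec d \<in> C" and ray: "convex_cone hull {rvec d} \<in> Fn" and gc: "Gcd (range (($) d)) = 1"
  by (auto simp: gens_def ray_generators_def)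
  have "convex_cone hull {rvec d} \<subseteq> C" using dC S(3) by (intro hull_minimal) (auto simp: convex_cone_convex_cone_hull)
  hence "(convex_cone hull {rvec d}) \<inter> C = convex_cone hull {rvec d}" by blast
  hence fc: "convex_cone hull {rvec d} face_of C" using fan_inter[OF fan C ray] by (metis Int_commute fan_inter[OF fan C ray])
  have dspan: "rvec d \<in> span S" using dC \<open>C \<subseteq> span S\<close> by auto
  have rd: "rvec d = (\<Sum>t\<in>S. representation S (rvec d) t *\<^sub>R t)"
  using real_vector.sum_representation_eq[OF I dspan S(1) order_refl] by simp
  have "rvec d ~= 0" using primitive_nonzero[OF gc] by (metis rvec_0 rvec_inject)
  obtain c where c: "\<forall>s\<in>S. 0 <= c s" "rvec d = (\<Sum>s\<in>S. c s *\<^sub>R s)"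
  using dC convex_cone_hull_image[OF S(1), of "%x. x"] S(3) by auto
  obtain s where s: "s \<in> S" "c s > 0"
  proof (rule ccontr)
  assume "\<not> thesis"
  hence "\<forall>s\<in>S. c s = 0" using c(1) that by force
  with c(2) \<open>rvec d ~= 0\<close> show False by simp
  qed
  have cC: "convex_cone C" using S(3) by (simp add: convex_cone_convex_cone_hull)
  define y where "y = rvec d - c s *\<^sub>R s"
  have "y = (\<Sum>t\<in>S - {s}. c t *\<^sub>R t)" using c(2) s(1) S(1) by (simp add: y_def sum.remove[of S s])
  also have "... \<in> C"
  by (intro convex_cone_sum[OF cC] convex_cone_scaleR[OF cC]) (use c(1) \<open>S \<subseteq> C\<close> in auto)
  finally have yC: "y \<in> C" .
  have "c s *\<^sub>R s \<in> convex_cone hull {rvec d}"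
  proof (cases "y = c s *\<^sub>R s")
  case True
  hence "rvec d = c s *\<^sub>R s + c s *\<^sub>R s" by (simp add: y_def algebra_simps)
  hence "rvec d = 2 *\<^sub>R (c s *\<^sub>R s)" by (simp only: scaleR_2)
  hence "c s *\<^sub>R s = (1/2) *\<^sub>R rvec d" by simp
  thus ?thesis unfolding convex_cone_hull_singleton by (intro CollectI exI[of _ "1/2"]) auto
  next
  case False
  \<comment> \<open>Half of \<open>rvec d\<close> is the midpoint of y and c s times s. As the ray
    is a face of C, both end points lie on it.\<close>
  have m: "(1/2) *\<^sub>R rvec d \<in> open_segment (c s *\<^sub>R s) y"
  using False unfolding in_segment
  by (intro conjI exI[of _ "1/2"]) (auto simp: y_def algebra_simps)
  have "(1/2) *\<^sub>R rvec d \<in> convex_cone hull {rvec d}"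
  unfolding convex_cone_hull_singleton by (intro CollectI exI[of _ "1/2"]) auto
  moreover have "c s *\<^sub>R s \<in> C" using s \<open>S \<subseteq> C\<close> by (intro convex_cone_scaleR[OF cC]) auto
  ultimately show ?thesis using fc yC m unfolding face_of_def by blast
  qed
  then obtain a where a: "0 <= a" "c s *\<^sub>R s = a *\<^sub>R rvec d" by (auto simp: convex_cone_hull_singleton)
  have "rvec (f s) = (a / (c s * g s)) *\<^sub>R rvec d"
  proof -
  have "(c s * g s) *\<^sub>R rvec (f s) = a *\<^sub>R rvec d" using a(2) f(3)[OF s(1)] by (metis scaleR_scaleR)
  hence "(1 / (c s * g s)) *\<^sub>R (c s * g s) *\<^sub>R rvec (f s) = (1 / (c s * g s)) *\<^sub>R a *\<^sub>R rvec d" by simp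
  thus ?thesis using s f(2)[OF s(1)] by simp
  qed
  moreover have "0 <= a / (c s * g s)" using a(1) s f(2)[OF s(1)] by simp
  ultimately have "f s = d"
  using f(1)[OF s(1)] gc by (intro primitive_unique) (auto simp: gens_def ray_generators_def)
  thus "d \<in> f ` S" using s(1) by blast
  qed
 qed
 have inj: "inj_on f S"
 proof (rule inj_onI)
  fix s t assume st: "s \<in> S" "t \<in> S" "f s = f t"
  show "s = t"
  proof (rule ccontr)
  assume "s ~= t"
  have "inverse (g t) *\<^sub>R t = rvec (f t)"
  using arg_cong[OF f(3)[OF st(2)], of "%x. inverse (g t) *\<^sub>R x"] f(2)[OF st(2)] by simp
  hence "s = g s *\<^sub>R inverse (g t) *\<^sub>R t" using f(3)[OF st(1)] st(3) by simp
  moreover have "t \<in> span (S - {s})" using st \<open>s ~= t\<close> by (intro span_base) auto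
  ultimately have "s \<in> span (S - {s})" by (metis span_scale)
  thus False using I st(1) by (auto simp: dependent_def)
  qed
 qed
 have sub: "S \<subseteq> span (rvec ` gens Fn C)"
 proof
  fix s assume s: "s \<in> S"
  have "g s *\<^sub>R rvec (f s) \<in> span (rvec ` gens Fn C)"
  using f(1)[OF s] by (intro span_scale span_base) auto
  thus "s \<in> span (rvec ` gens Fn C)" using f(3)[OF s] by simp
 qed
 have "card (rvec ` gens Fn C) = card S"
  using gen inj by (simp add: card_image[OF inj_rvec] card_image)
 moreover have "card S <= dim (rvec ` gens Fn C)"
  using independent_card_le_dim[OF sub I] by (simp add: dim_span)
 ultimately have "card (rvec ` gens Fn C) <= dim (span (rvec ` gens Fn C))" by simp
 hence "independent (rvec ` gens Fn C)"
  using gen S(1) by (intro card_le_dim_spanning[of _ "span (rvec ` gens Fn C)"]) (auto simp: span_superset)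
 thus "lin_indep (gens Fn C)" using gen S(1) by (simp add: lin_indep_def)
 show "C = pos_cone (gens Fn C)"
 proof
  have "s \<in> pos_cone (gens Fn C)" if s: "s \<in> S" for s
  using f(2)[OF s] rvec_in_pos_cone[OF f(1)[OF s]]
  by (subst f(3)[OF s]) (auto intro: convex_cone_scaleR[OF convex_cone_pos_cone])
  thus "C \<subseteq> pos_cone (gens Fn C)"
  unfolding S(3) using convex_cone_pos_cone by (intro hull_minimal) (auto simp: S(3)[symmetric])
  show "pos_cone (gens Fn C) \<subseteq> C"
  unfolding pos_cone_def using S(3) by (intro hull_minimal) (auto simp: gens_def convex_cone_convex_cone_hull)
 qed
qed

lemma simplicial_fan_gens:
 assumes "is_fan Fn" "simplicial_fan Fn" "C \<in> Fn"
 shows "lin_indep (gens Fn C)" "C = pos_cone (gens Fn C)"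
proof -
 obtain S where "finite S" "card S = dim C" "C = convex_cone hull S"
  using assms(2,3) unfolding simplicial_fan_def by blast
 thus "lin_indep (gens Fn C)" "C = pos_cone (gens Fn C)"
  by (rule simplicial_cone_gens[OF assms(1,3)])+
qed

lemma gens_pos_cone:
 assumes "is_fan Fn" "simplicial_fan Fn" "C \<in> Fn" "T \<subseteq> gens Fn C"
 shows "pos_cone T \<in> Fn" "gens Fn (pos_cone T) = T"
proof -
 note G = simplicial_fan_gens[OF assms(1,2,3)]
 have "pos_cone T face_of C" using pos_cone_face[OF G(1) assms(4)] G(2) by simp
 moreover have "pos_cone T ~= {}" using zero_in_pos_cone by blast
 ultimately show "pos_cone T \<in> Fn" by (rule fan_face[OF assms(1,3)])
 show "gens Fn (pos_cone T) = T"
 proof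
  show "T \<subseteq> gens Fn (pos_cone T)" using assms(4) rvec_in_pos_cone by (auto simp: gens_def)
  show "gens Fn (pos_cone T) \<subseteq> T"
  proof
  fix d assume d: "d \<in> gens Fn (pos_cone T)"
  hence "d \<in> gens Fn C" using pos_cone_mono[OF assms(4)] G(2) by (auto simp: gens_def)
  thus "d \<in> T" using pos_cone_member[OF G(1) assms(4)] d by (auto simp: gens_def)
  qed
 qed
qed

lemma fan_complex:
 fixes Fn :: "(real ^ 'n) set set"
 assumes "complete_fan Fn" "simplicial_fan Fn"
 shows "simplicial_complex_fan (gens Fn ` Fn)"
proof -
 have fan: "is_fan Fn" using assms(1) by (simp add: complete_fan_def)
 note G = simplicial_fan_gens[OF fan assms(2)]
 show "simplicial_complex_fan (gens Fn ` Fn)"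
 proof
  show "finite (gens Fn ` Fn)" using fan by (simp add: is_fan_def)
  show "lin_indep T" if "T \<in> gens Fn ` Fn" for T using that G(1) by auto
  show "T \<in> gens Fn ` Fn" if "T' \<in> gens Fn ` Fn" "T \<subseteq> T'" for T T'
  proof -
  obtain C where C: "C \<in> Fn" "T \<subseteq> gens Fn C" using \<open>T' \<in> gens Fn ` Fn\<close> \<open>T \<subseteq> T'\<close> by blast
  show ?thesis using gens_pos_cone[OF fan assms(2) C] by (metis imageI)
  qed
  show "pos_cone T \<inter> pos_cone T' \<subseteq> pos_cone (T \<inter> T')"
  if T: "T \<in> gens Fn ` Fn" "T' \<in> gens Fn ` Fn" for T T'
  proof -
  obtain C C' where C: "C \<in> Fn" "T = gens Fn C" "C' \<in> Fn" "T' = gens Fn C'" using T by blast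
  have "C \<inter> C' face_of C" using fan_inter[OF fan C(1,3)] .
  moreover have "C \<inter> C' ~= {}" using G(2)[OF C(1)] G(2)[OF C(3)] zero_in_pos_cone by (metis Int_iff empty_iff)
  ultimately have "C \<inter> C' \<in> Fn" by (rule fan_face[OF fan C(1)])
  hence "C \<inter> C' = pos_cone (gens Fn (C \<inter> C'))" by (rule G(2))
  moreover have "gens Fn (C \<inter> C') = T \<inter> T'" using C by (auto simp: gens_def)
  ultimately show ?thesis using C G(2) by auto
  qed
  show "\<exists>G\<in>gens Fn ` Fn. x \<in> pos_cone G" for x
  proof -
  have "x \<in> \<Union>Fn" using assms(1) by (simp add: complete_fan_def)
  thus ?thesis using G(2) by auto
  qed
 qed
qed

lemma bij_betw_gens:
 assumes "is_fan Fn" "simplicial_fan Fn"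
 shows "bij_betw (gens Fn) Fn (gens Fn ` Fn)"
 using simplicial_fan_gens(2)[OF assms] by (intro inj_on_imp_bij_betw inj_onI) metis

text \<open>Uniqueness of coefficients makes the coefficient map additive, so each coefficient is
  given by its values on the standard basis, that is, by the pairing with a vector of the dual
  lattice.\<close>

lemma lattice_basis_dual:
 fixes B :: "(int ^ 'n) set"
 assumes B: "lattice_basis B"
 shows "\<exists>e. (\<forall>b\<in>B. \<forall>b'\<in>B. pairing (e b) b' = (if b = b' then 1 else 0)) \<and>
  (\<forall>v. v = (\<Sum>b\<in>B. pairing (e b) v *s b))"
proof -
 define P where "P v c \<longleftrightarrow> (\<forall>b. b \<notin> B --> c b = 0) \<and> v = (\<Sum>b\<in>B. c b *s b)" for v and c :: "int ^ 'n => int"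
 define c where "c v = (THE c. P v c)" for v
 have ex1: "\<exists>!c. P v c" for v using B unfolding lattice_basis_def P_def by blast
 have Pc: "P v (c v)" for v unfolding c_def using ex1 by (rule theI')
 have uniq: "c v = c'" if "P v c'" for v c' using that Pc ex1 by blast
 have fB: "finite B" using B by (simp add: lattice_basis_def)
 have add: "c (v + w) = (%b. c v b + c w b)" for v w
  by (rule uniq) (use Pc[of v] Pc[of w] in \<open>auto simp: P_def vector_sadd_rdistrib sum.distrib\<close>)
 have scale: "c (k *s v) = (%b. k * c v b)" for k v
 proof (rule uniq)
  have "k *s v = k *s (\<Sum>b\<in>B. c v b *s b)" using Pc[of v] by (simp add: P_def)
  also have "... = (\<Sum>b\<in>B. (k * c v b) *s b)"
  by (simp add: vec_eq_iff sum_distrib_left mult.assoc)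
  finally show "P (k *s v) (%b. k * c v b)" using Pc[of v] by (simp add: P_def)
 qed
 have zero: "c 0 = (%b. 0)" by (rule uniq) (auto simp: P_def)
 have csum: "c (\<Sum>i\<in>A. f i) = (%b. \<Sum>i\<in>A. c (f i) b)" if "finite A" for A and f :: "'n => int ^ 'n"
  using that by (induction A rule: finite_induct) (auto simp: zero add)
 define e where "e b = (\<chi> i. c (axis i 1) b)" for b
 have e: "pairing (e b) v = c v b" for b v
 proof -
  have "v = (\<Sum>i\<in>UNIV. v $ i *s axis i 1)" by (simp add: basis_expansion)
  hence "c v b = c (\<Sum>i\<in>UNIV. v $ i *s axis i 1) b" by simp
  also have "... = (\<Sum>i\<in>UNIV. v $ i * c (axis i 1) b)" by (simp add: csum scale)
  finally show ?thesis by (simp add: pairing_def e_def mult.commute)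
 qed
 show ?thesis
 proof (intro exI[of _ e] conjI ballI allI)
  fix b b' assume b: "b \<in> B" "b' \<in> B"
  have "c b' = (%b. if b = b' then 1 else 0)"
  proof (rule uniq)
  have "(\<Sum>b\<in>B. (if b = b' then 1 else 0) *s b) = (\<Sum>b\<in>B. if b = b' then b else 0)"
  by (intro sum.cong) auto
  also have "... = b'" using fB b by simp
  finally show "P b' (%b. if b = b' then 1 else 0)" using b by (auto simp: P_def)
  qed
  thus "pairing (e b) b' = (if b = b' then 1 else 0)" by (simp add: e)
 next
  fix v show "v = (\<Sum>b\<in>B. pairing (e b) v *s b)" using Pc[of v] by (simp add: e P_def)
 qed
qed

lemma lin_indep_dual:
 assumes "finite S" "!!b b'. b \<in> S ==> b' \<in> S ==> pairing (e b) b' = (if b = b' then 1 else 0)"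
 shows "lin_indep S"
proof -
 have "independent (rvec ` S)"
 proof (rule independent_if_scalars_zero)
  show "finite (rvec ` S)" using assms(1) by simp
  fix f x assume s: "(\<Sum>x\<in>rvec ` S. f x *\<^sub>R x) = 0" and x: "x \<in> rvec ` S"
  then obtain b where b: "b \<in> S" "x = rvec b" by auto
  have "0 = rvec (e b) \<bullet> (\<Sum>x\<in>rvec ` S. f x *\<^sub>R x)" by (simp add: s)
  also have "... = (\<Sum>b'\<in>S. f (rvec b') * (rvec (e b) \<bullet> rvec b'))"
  by (simp add: sum.reindex[OF inj_rvec] inner_sum_right)
  also have "... = (\<Sum>b'\<in>S. if b' = b then f (rvec b') else 0)"
  using assms(2)[OF b(1)] by (intro sum.cong) (auto simp flip: pairing_inner)
  also have "... = f x" using assms(1) b by simp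
  finally show "f x = 0" by simp
 qed
 with assms(1) show ?thesis by (simp add: lin_indep_def)
qed

text \<open>Members of a lattice basis are primitive, because their pairing with the dual vector is
  1, and each of them spans a ray of the cone. So S lies in \<open>gens Fn C\<close>, and both sets
  have as many elements as the dimension.\<close>

lemma nonsingular_fan_gens:
 assumes fan: "is_fan Fn" and ns: "nonsingular_fan Fn" and C: "C \<in> Fn"
 shows "\<exists>B. lattice_basis B \<and> gens Fn C \<subseteq> B" "lin_indep (gens Fn C)" "C = pos_cone (gens Fn C)"
proof -
 obtain B S where BS: "lattice_basis B" "S \<subseteq> B" "C = convex_cone hull (rvec ` S)"
  using ns C by (auto simp: nonsingular_fan_def)
 obtain e where e: "\<forall>b\<in>B. \<forall>b'\<in>B. pairing (e b) b' = (if b = b' then 1 else 0)"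
  using lattice_basis_dual[OF BS(1)] by blast
 have fS: "finite S" using BS finite_subset by (auto simp: lattice_basis_def)
 have IS: "lin_indep S" by (rule lin_indep_dual[of S e]) (use fS e BS(2) in \<open>auto simp: subset_iff\<close>)
 have CS: "C = pos_cone S" using BS(3) by (simp add: pos_cone_def)
 have "card (rvec ` S) = dim C" using dim_pos_cone[OF IS] CS by (simp add: card_image[OF inj_rvec])
 note G = simplicial_cone_gens[OF fan C _ this BS(3)]
 show 1: "lin_indep (gens Fn C)" "C = pos_cone (gens Fn C)" using G fS by auto
 have "S \<subseteq> gens Fn C"
 proof
  fix s assume s: "s \<in> S"
  have "Gcd (range (($) s)) dvd pairing (e s) s"
  unfolding pairing_def by (intro dvd_sum dvd_mult Gcd_dvd) auto
  hence "Gcd (range (($) s)) dvd 1" using e s BS(2) by auto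
  hence g: "Gcd (range (($) s)) = 1" using Gcd_int_greater_eq_0[of "range (($) s)"] by simp
  have "pos_cone {s} face_of C" using pos_cone_face[OF IS, of "{s}"] s CS by simp
  moreover have "pos_cone {s} ~= {}" using zero_in_pos_cone by blast
  ultimately have "pos_cone {s} \<in> Fn" by (rule fan_face[OF fan C])
  thus "s \<in> gens Fn C" using g CS rvec_in_pos_cone[OF s] by (auto simp: gens_def ray_generators_def pos_cone_def)
 qed
 moreover have "card S = card (gens Fn C)" using dim_pos_cone[OF IS] dim_pos_cone[OF 1(1)] CS 1(2) by metis
 ultimately have "S = gens Fn C" using 1(1) by (intro card_subset_eq) (auto simp: lin_indep_def)
 with BS show "\<exists>B. lattice_basis B \<and> gens Fn C \<subseteq> B" by blast
qed

lemma nonsingular_imp_simplicial: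
 assumes "is_fan Fn" "nonsingular_fan Fn"
 shows "simplicial_fan Fn"
 unfolding simplicial_fan_def
proof
 fix C assume C: "C \<in> Fn"
 note G = nonsingular_fan_gens[OF assms C]
 show "\<exists>S. finite S \<and> card S = dim C \<and> C = convex_cone hull S"
  using G(2,3) dim_pos_cone[OF G(2)] card_image[OF inj_rvec, of "gens Fn C"]
  by (intro exI[of _ "rvec ` gens Fn C"]) (auto simp: lin_indep_def pos_cone_def[symmetric])
qed

section \<open>Values of formal series that are rational functions\<close>

definition fin_supp :: "(int ^ 'n => complex) => bool" where
 "fin_supp f \<longleftrightarrow> finite {v. f v ~= 0}"

definition conv :: "(int ^ 'n => complex) => (int ^ 'n => complex) => (int ^ 'n => complex)" where
 "conv Q S v = (\<Sum>k | Q k ~= 0. Q k * S (v - k))"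

definition evs :: "(int ^ 'n => complex) => (int ^ 'n => complex) => complex" where
 "evs f x = (\<Sum>v | f v ~= 0. f v * x v)"

definition charac :: "(int ^ 'n => complex) => bool" where
 "charac x \<longleftrightarrow> x 0 = 1 \<and> (\<forall>v w. x (v + w) = x v * x w)"

text \<open>\<open>rational_value\<close> as a relation, on plain functions of finite support. Being
  linear in S, it carries identities between indicator series of cones over to their values, without
  any question of convergence.\<close>

definition has_value :: "(int ^ 'n => complex) => (int ^ 'n => complex) => complex => bool" where
 "has_value S x w \<longleftrightarrow>
  (\<exists>P Q. fin_supp P \<and> fin_supp Q \<and> conv Q S = P \<and> evs Q x ~= 0 \<and> w = evs P x / evs Q x)"

lemma evs_superset:
 assumes "finite A" "{v. f v ~= 0} \<subseteq> A"
 shows "evs f x = (\<Sum>v\<in>A. f v * x v)"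
 unfolding evs_def using assms by (intro sum.mono_neutral_left) auto

lemma conv_superset:
 assumes "finite A" "{v. Q v ~= 0} \<subseteq> A"
 shows "conv Q S v = (\<Sum>k\<in>A. Q k * S (v - k))"
 unfolding conv_def using assms by (intro sum.mono_neutral_left) auto

lemma conv_supp: "{v. conv Q f v ~= 0} \<subseteq> (%(a, b). a + b) ` ({v. Q v ~= 0} \<times> {v. f v ~= 0})"
proof
 fix v assume "v \<in> {v. conv Q f v ~= 0}"
 hence "conv Q f v ~= 0" by simp
 then obtain k where "Q k * f (v - k) ~= 0" "Q k ~= 0" unfolding conv_def
  by (auto elim: sum.not_neutral_contains_not_neutral)
 thus "v \<in> (%(a, b). a + b) ` ({v. Q v ~= 0} \<times> {v. f v ~= 0})"
  by (intro image_eqI[of _ _ "(k, v - k)"]) auto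
qed

lemma fin_supp_conv: "fin_supp Q ==> fin_supp f ==> fin_supp (conv Q f)"
 unfolding fin_supp_def by (rule finite_subset[OF conv_supp]) auto

lemma evs_conv:
 assumes "charac x" "fin_supp Q" "fin_supp f"
 shows "evs (conv Q f) x = evs Q x * evs f x"
proof -
 let ?A = "{v. Q v ~= 0}" and ?B = "{v. f v ~= 0}"
 let ?D = "(%(a, b). a + b) ` (?A \<times> ?B)"
 have fin: "finite ?A" "finite ?B" using assms by (auto simp: fin_supp_def)
 have "evs (conv Q f) x = (\<Sum>v\<in>?D. conv Q f v * x v)"
  using fin conv_supp[of Q f] by (intro evs_superset) auto
 also have "... = (\<Sum>v\<in>?D. \<Sum>k\<in>?A. Q k * x k * (f (v - k) * x (v - k)))"
  unfolding conv_def sum_distrib_right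
 proof (intro sum.cong refl)
  fix v k
  have "x v = x k * x (v - k)" using assms(1) by (metis charac_def add_diff_cancel_left' diff_add_cancel add.commute)
  thus "Q k * f (v - k) * x v = Q k * x k * (f (v - k) * x (v - k))" by simp
 qed
 also have "... = (\<Sum>k\<in>?A. Q k * x k * (\<Sum>v\<in>?D. f (v - k) * x (v - k)))"
  by (subst sum.swap) (simp add: sum_distrib_left)
 also have "... = (\<Sum>k\<in>?A. Q k * x k * evs f x)"
 proof (intro sum.cong refl arg_cong2[where f = "(*)"])
  fix k assume k: "k \<in> ?A"
  have "(\<Sum>v\<in>?D. f (v - k) * x (v - k)) = (\<Sum>v\<in>(%v. v - k) ` ?D. f v * x v)"
  by (subst sum.reindex) (auto simp: inj_on_def)
  also have "... = evs f x"
  proof (intro evs_superset[symmetric] finite_imageI)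
  show "{v. f v ~= 0} \<subseteq> (%j. j - k) ` ?D"
  proof
  fix l assume "l \<in> {v. f v ~= 0}"
  thus "l \<in> (%j. j - k) ` ?D"
  using k by (intro image_eqI[of _ _ "k + l"] image_eqI[of _ _ "(k, l)"]) auto
  qed
  qed (use fin in auto)
  finally show "(\<Sum>v\<in>?D. f (v - k) * x (v - k)) = evs f x" .
 qed
 also have "... = evs Q x * evs f x" by (simp add: evs_def[of Q] sum_distrib_right)
 finally show ?thesis .
qed

lemma conv_commute: "conv Q1 (conv Q2 S) = conv Q2 (conv Q1 S)"
proof
 fix v
 have "conv Q1 (conv Q2 S) v = (\<Sum>k | Q1 k ~= 0. \<Sum>l | Q2 l ~= 0. Q2 l * (Q1 k * S (v - l - k)))"
  unfolding conv_def sum_distrib_left by (intro sum.cong refl) (simp add: algebra_simps diff_diff_eq add.commute)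
 also have "... = conv Q2 (conv Q1 S) v"
  by (subst sum.swap) (simp add: conv_def sum_distrib_left)
 finally show "conv Q1 (conv Q2 S) v = conv Q2 (conv Q1 S) v" .
qed

lemma conv_assoc:
 assumes "fin_supp Q1" "fin_supp Q2"
 shows "conv (conv Q1 Q2) S = conv Q1 (conv Q2 S)"
proof
 fix v
 let ?A = "{v. Q1 v ~= 0}" and ?B = "{v. Q2 v ~= 0}"
 let ?D = "(%(a, b). a + b) ` (?A \<times> ?B)"
 have fin: "finite ?A" "finite ?B" using assms by (auto simp: fin_supp_def)
 have "conv (conv Q1 Q2) S v = (\<Sum>j\<in>?D. conv Q1 Q2 j * S (v - j))"
  using fin conv_supp[of Q1 Q2] by (intro conv_superset) auto
 also have "... = (\<Sum>k\<in>?A. \<Sum>j\<in>?D. Q1 k * (Q2 (j - k) * S (v - j)))"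
  unfolding conv_def sum_distrib_right by (subst sum.swap) (simp add: mult.assoc)
 also have "... = (\<Sum>k\<in>?A. Q1 k * conv Q2 S (v - k))"
  unfolding sum_distrib_left[symmetric]
 proof (intro sum.cong refl arg_cong2[where f = "(*)"])
  fix k assume k: "k \<in> ?A"
  have "(\<Sum>j\<in>?D. Q2 (j - k) * S (v - j)) = (\<Sum>j\<in>(%j. j - k) ` ?D. Q2 j * S (v - k - j))"
  by (subst sum.reindex) (auto simp: inj_on_def)
  also have "... = conv Q2 S (v - k)"
  proof (intro conv_superset[symmetric] finite_imageI)
  show "{v. Q2 v ~= 0} \<subseteq> (%j. j - k) ` ?D"
  proof
  fix l assume "l \<in> {v. Q2 v ~= 0}"
  thus "l \<in> (%j. j - k) ` ?D"
  using k by (intro image_eqI[of _ _ "k + l"] image_eqI[of _ _ "(k, l)"]) auto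
  qed
  qed (use fin in auto)
  finally show "(\<Sum>j\<in>?D. Q2 (j - k) * S (v - j)) = conv Q2 S (v - k)" .
 qed
 finally show "conv (conv Q1 Q2) S v = conv Q1 (conv Q2 S) v" by (simp add: conv_def[of Q1])
qed

lemma conv_add: "conv Q (%v. S v + S' v) = (%v. conv Q S v + conv Q S' v)"
 by (auto simp: conv_def algebra_simps sum.distrib)

lemma conv_cmul: "conv Q (%v. c * S v) = (%v. c * conv Q S v)"
 by (auto simp: conv_def algebra_simps sum_distrib_left)

lemma fin_supp_add: "fin_supp f ==> fin_supp g ==> fin_supp (%v. f v + g v)"
 unfolding fin_supp_def by (rule finite_subset[of _ "{v. f v ~= 0} \<union> {v. g v ~= 0}"]) auto

lemma fin_supp_cmul: "fin_supp f ==> fin_supp (%v. c * f v)"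
 unfolding fin_supp_def by (rule finite_subset[of _ "{v. f v ~= 0}"]) auto

lemma evs_add: "fin_supp f ==> fin_supp g ==> evs (%v. f v + g v) x = evs f x + evs g x"
proof -
 assume f: "fin_supp f" "fin_supp g"
 let ?A = "{v. f v ~= 0} \<union> {v. g v ~= 0}"
 have "finite ?A" using f by (auto simp: fin_supp_def)
 thus ?thesis
  by (subst (1 2 3) evs_superset[of ?A]) (auto simp: algebra_simps sum.distrib)
qed

lemma evs_cmul: "fin_supp f ==> evs (%v. c * f v) x = c * evs f x"
proof -
 assume f: "fin_supp f"
 hence "finite {v. f v ~= 0}" by (auto simp: fin_supp_def)
 thus ?thesis
  by (subst (1 2) evs_superset[of "{v. f v ~= 0}"]) (auto simp: algebra_simps sum_distrib_left)
qed

text \<open>Only products with a finite factor are formed: Q' * (Q * S) = Q * (Q' * S) gives Q' * P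
  = Q * P', and evaluation is multiplicative on finite supports.\<close>

lemma has_value_unique:
 assumes "charac x" "has_value S x w" "has_value S x w'"
 shows "w = w'"
proof -
 obtain P Q where 1: "fin_supp P" "fin_supp Q" "conv Q S = P" "evs Q x ~= 0" "w = evs P x / evs Q x"
  using assms(2) by (auto simp: has_value_def)
 obtain P' Q' where 2: "fin_supp P'" "fin_supp Q'" "conv Q' S = P'" "evs Q' x ~= 0" "w' = evs P' x / evs Q' x"
  using assms(3) by (auto simp: has_value_def)
 have "conv Q' P = conv Q P'" using conv_commute[of Q' Q S] by (simp add: 1(3) 2(3))
 hence "evs Q' x * evs P x = evs Q x * evs P' x" using evs_conv[OF assms(1)] 1 2 by metis
 hence "evs P x / evs Q x = evs P' x / evs Q' x" using 1(4) 2(4) by (simp add: frac_eq_eq mult.commute)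
 thus ?thesis using 1(5) 2(5) by simp
qed

lemma has_value_add:
 assumes "charac x" "has_value S x w" "has_value S' x w'"
 shows "has_value (%v. S v + S' v) x (w + w')"
proof -
 obtain P Q where 1: "fin_supp P" "fin_supp Q" "conv Q S = P" "evs Q x ~= 0" "w = evs P x / evs Q x"
  using assms(2) by (auto simp: has_value_def)
 obtain P' Q' where 2: "fin_supp P'" "fin_supp Q'" "conv Q' S' = P'" "evs Q' x ~= 0" "w' = evs P' x / evs Q' x"
  using assms(3) by (auto simp: has_value_def)
 have eq: "conv (conv Q Q') (%v. S v + S' v) = (%v. conv Q' P v + conv Q P' v)"
 proof -
  have "conv (conv Q Q') S = conv Q' P"
  using conv_assoc[OF 1(2) 2(2), of S] conv_commute[of Q Q' S] by (simp add: 1(3))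
  moreover have "conv (conv Q Q') S' = conv Q P'"
  using conv_assoc[OF 1(2) 2(2), of S'] by (simp add: 2(3))
  ultimately show ?thesis by (simp add: conv_add)
 qed
 have fs: "fin_supp (conv Q' P)" "fin_supp (conv Q P')" using fin_supp_conv 1 2 by auto
 have ev: "evs (%v. conv Q' P v + conv Q P' v) x = evs Q' x * evs P x + evs Q x * evs P' x"
  using evs_conv[OF assms(1)] 1(1,2) 2(1,2) by (simp add: evs_add[OF fs])
 show ?thesis
  unfolding has_value_def
 proof (intro exI conjI)
  show "conv (conv Q Q') (%v. S v + S' v) = (%v. conv Q' P v + conv Q P' v)" by (rule eq)
  show "fin_supp (%v. conv Q' P v + conv Q P' v)" using fs by (intro fin_supp_add) auto
  show "fin_supp (conv Q Q')" using fin_supp_conv 1 2 by auto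
  show "evs (conv Q Q') x ~= 0" using evs_conv[OF assms(1)] 1 2 by simp
  show "w + w' = evs (%v. conv Q' P v + conv Q P' v) x / evs (conv Q Q') x"
  unfolding ev 1(5) 2(5) evs_conv[OF assms(1) 1(2) 2(2)] using 1(4) 2(4)
  by (simp add: add_divide_distrib)
 qed
qed

lemma has_value_cmul:
 assumes "has_value S x w"
 shows "has_value (%v. c * S v) x (c * w)"
proof -
 obtain P Q where 1: "fin_supp P" "fin_supp Q" "conv Q S = P" "evs Q x ~= 0" "w = evs P x / evs Q x"
  using assms by (auto simp: has_value_def)
 thus ?thesis
  unfolding has_value_def
  by (intro exI[of _ "%v. c * P v"] exI[of _ Q]) (auto simp: conv_cmul fin_supp_cmul evs_cmul)
qed

lemma has_value_finite:
 assumes "charac x" "fin_supp f"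
 shows "has_value f x (evs f x)"
proof -
 let ?Q = "%v. if v = 0 then 1 else (0::complex)"
 have [simp]: "{v. (if v = 0 then 1 else (0::complex)) ~= 0} = {0}" by auto
 have "conv ?Q f = f" by (auto simp: conv_def)
 moreover have "evs ?Q x = 1" using assms(1) by (simp add: evs_def charac_def)
 moreover have "fin_supp ?Q" by (simp add: fin_supp_def)
 ultimately show ?thesis
  unfolding has_value_def using assms(2) by (intro exI[of _ f] exI[of _ ?Q]) auto
qed

lemma has_value_sum:
 assumes "charac x" "finite A" "!!i. i \<in> A ==> has_value (S i) x (w i)"
 shows "has_value (%v. \<Sum>i\<in>A. S i v) x (\<Sum>i\<in>A. w i)"
 using assms(2,3)
proof (induction A rule: finite_induct)
 case empty
 have "fin_supp (%v. 0 :: complex)" by (simp add: fin_supp_def)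
 from has_value_finite[OF assms(1) this] show ?case by (simp add: evs_def)
qed (auto intro: has_value_add[OF assms(1)])

text \<open>The recursion says that multiplication by 1 - a x^d turns S into S'. For d = 0 the two
  terms of this polynomial sit at the same exponent, hence the separate case.\<close>

lemma has_value_geometric:
 assumes x: "charac x" and S': "has_value S' x w'" and rec: "!!v. S v - a * S (v - d) = S' v"
  and ne: "1 - a * x d ~= 0"
 shows "has_value S x (w' / (1 - a * x d))"
proof (cases "d = 0")
 case True
 hence "1 - a ~= 0" using ne x by (simp add: charac_def)
 hence "S = (%v. (1 / (1 - a)) * S' v)" using rec True by (auto simp: fun_eq_iff field_simps)
 hence "has_value S x ((1 / (1 - a)) * w')" using has_value_cmul[OF S', of "1 / (1 - a)"] by simp
 thus ?thesis using True x by (simp add: charac_def)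
next
 case False
 obtain P Q where 1: "fin_supp P" "fin_supp Q" "conv Q S' = P" "evs Q x ~= 0" "w' = evs P x / evs Q x"
  using S' by (auto simp: has_value_def)
 let ?R = "%v. if v = 0 then 1 else if v = d then - a else (0::complex)"
 have supp: "{v. ?R v ~= 0} \<subseteq> {0, d}" by auto
 have fsR: "fin_supp ?R" unfolding fin_supp_def by (rule finite_subset[OF supp]) auto
 have "conv ?R S = S'"
  using False rec by (auto simp: conv_superset[OF _ supp] fun_eq_iff)
 hence "conv (conv Q ?R) S = P" using conv_assoc[OF 1(2) fsR] 1(3) by simp
 moreover have "evs ?R x = 1 - a * x d"
  using False x by (simp add: evs_superset[OF _ supp] charac_def)
 ultimately have "conv (conv Q ?R) S = P \<and> evs (conv Q ?R) x = evs Q x * (1 - a * x d)"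
  using evs_conv[OF x 1(2) fsR] by simp
 moreover have "fin_supp (conv Q ?R)" by (rule fin_supp_conv[OF 1(2) fsR])
 moreover have "w' / (1 - a * x d) = evs P x / (evs Q x * (1 - a * x d))" using 1(5) by simp
 moreover have "evs Q x * (1 - a * x d) ~= 0" using 1(4) ne by simp
 ultimately show ?thesis
  unfolding has_value_def by (intro exI[of _ P] exI[of _ "conv Q ?R"] conjI) (auto simp only: 1(1) conj_assoc simp_thms)
qed

lemma rational_value_eqI:
 assumes x: "charac x" and v: "has_value S x w"
 shows "rational_value S x = w"
proof -
 have iff: "(\<exists>P Q. represents_series P Q S \<and> laurent_eval Q x ~= 0 \<and> u = laurent_eval P x / laurent_eval Q x)
  \<longleftrightarrow> has_value S x u" for u
 proof
  assume "\<exists>P Q. represents_series P Q S \<and> laurent_eval Q x ~= 0 \<and> u = laurent_eval P x / laurent_eval Q x"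
  then obtain P Q where "represents_series P Q S" "laurent_eval Q x ~= 0" "u = laurent_eval P x / laurent_eval Q x"
  by blast
  thus "has_value S x u"
  unfolding has_value_def
  by (intro exI[of _ "Poly_Mapping.lookup P"] exI[of _ "Poly_Mapping.lookup Q"])
  (simp add: fin_supp_def evs_def conv_def laurent_eval_def represents_series_def keys.rep_eq fun_eq_iff)
 next
  assume "has_value S x u"
  then obtain P Q where 1: "fin_supp P" "fin_supp Q" "conv Q S = P" "evs Q x ~= 0" "u = evs P x / evs Q x"
  by (auto simp: has_value_def)
  have l: "Poly_Mapping.lookup (Abs_poly_mapping f) = f" if "fin_supp f" for f :: "int ^ 'a => complex"
  using that by (simp add: fin_supp_def lookup_Abs_poly_mapping)
  show "\<exists>P Q. represents_series P Q S \<and> laurent_eval Q x ~= 0 \<and> u = laurent_eval P x / laurent_eval Q x"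
  using 1(3-5) by (intro exI[of _ "Abs_poly_mapping P"] exI[of _ "Abs_poly_mapping Q"])
  (auto simp: evs_def conv_def laurent_eval_def represents_series_def keys.rep_eq l[OF 1(1)] l[OF 1(2)] fun_eq_iff)
 qed
 show ?thesis
  unfolding rational_value_def iff using has_value_unique[OF x] v by (intro the_equality) auto
qed

section \<open>Generating functions of half-open cones\<close>

text \<open>Lattice points of the fundamental parallelepiped, with (0,1] in place of [0,1) in the
  directions of N. Its translates by non-negative combinations of G tile the lattice points of the
  half-open cone.\<close>

definition box :: "(int ^ 'n) set => (int ^ 'n) set => (int ^ 'n) set" where
 "box G N = {h. rvec h \<in> span (rvec ` G) \<and>
  (\<forall>d\<in>G. if d \<in> N then 0 < co G d (rvec h) \<and> co G d (rvec h) <= 1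
  else 0 <= co G d (rvec h) \<and> co G d (rvec h) < 1)}"

definition half_cone :: "(int ^ 'n) set => (int ^ 'n) set => (real ^ 'n) set" where
 "half_cone G N = {y \<in> span (rvec ` G). \<forall>d\<in>G. if d \<in> N then 0 < co G d y else 0 <= co G d y}"

lemma half_cone_subset: "lin_indep G ==> half_cone G N \<subseteq> pos_cone G"
proof
 fix y assume G: "lin_indep G" and y: "y \<in> half_cone G N"
 have "0 <= co G d y" if "d \<in> G" for d
  using y that by (cases "d \<in> N") (force simp: half_cone_def)+
 moreover have "y \<in> span (rvec ` G)" using y by (simp add: half_cone_def)
 ultimately show "y \<in> pos_cone G" using pos_cone_iff[OF G order_refl, of y] by simp
qed

lemma finite_int_vec_bounded: "finite {v :: int ^ 'n. \<forall>i. \<bar>v $ i\<bar> <= B}"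
proof (rule finite_subset)
 show "{v :: int ^ 'n. \<forall>i. \<bar>v $ i\<bar> <= B} \<subseteq> vec_lambda ` (PiE UNIV (%_. {-B..B}))"
 proof
  fix v :: "int ^ 'n" assume "v \<in> {v. \<forall>i. \<bar>v $ i\<bar> <= B}"
  hence "vec_nth v \<in> PiE UNIV (%_. {-B..B})" by (auto simp: abs_le_iff minus_le_iff)
  thus "v \<in> vec_lambda ` (PiE UNIV (%_. {-B..B}))" by (metis image_eqI vec_nth_inverse)
 qed
qed (auto intro!: finite_imageI finite_PiE)

lemma finite_box:
 assumes "lin_indep G"
 shows "finite (box G N)"
proof -
 define B where "B = (\<Sum>d\<in>G. \<Sum>i\<in>UNIV. \<bar>d $ i\<bar>)"
 have fG: "finite G" using assms by (simp add: lin_indep_def)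
 have "box G N \<subseteq> {v. \<forall>i. \<bar>v $ i\<bar> <= B}"
 proof safe
  fix v i assume v: "v \<in> box G N"
  hence sp: "rvec v \<in> span (rvec ` G)" by (simp add: box_def)
  have c: "\<bar>co G d (rvec v)\<bar> <= 1" if "d \<in> G" for d
  using v that by (auto simp: box_def abs_le_iff split: if_splits)
  have "real_of_int (v $ i) = rvec v $ i" by (simp add: rvec_def)
  also have "... = (\<Sum>d\<in>G. co G d (rvec v) * real_of_int (d $ i))"
  by (subst co_expand[OF assms sp]) (simp add: rvec_def)
  finally have "\<bar>real_of_int (v $ i)\<bar> <= (\<Sum>d\<in>G. \<bar>co G d (rvec v) * real_of_int (d $ i)\<bar>)" by (simp only: sum_abs)
  also have "... <= (\<Sum>d\<in>G. \<bar>real_of_int (d $ i)\<bar>)"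
  using c by (intro sum_mono) (auto simp: abs_mult intro!: mult_left_le_one_le)
  also have "... <= (\<Sum>d\<in>G. \<Sum>i\<in>UNIV. \<bar>real_of_int (d $ i)\<bar>)"
  by (intro sum_mono member_le_sum) auto
  also have "... = real_of_int B" by (simp add: B_def)
  finally show "\<bar>v $ i\<bar> <= B" by linarith
 qed
 thus ?thesis using finite_int_vec_bounded finite_subset by blast
qed

definition ee :: "complex => complex" where
 "ee z = exp (2 * of_real pi * \<i> * z)"

lemma ee_add: "ee (a + b) = ee a * ee b"
 by (simp add: ee_def algebra_simps exp_add)

lemma ee_0 [simp]: "ee 0 = 1" by (simp add: ee_def)

lemma ee_nonzero [simp]: "ee z ~= 0" by (simp add: ee_def)

lemma ee_eq_1: "ee z = 1 \<longleftrightarrow> z \<in> \<int>"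
proof -
 have "ee z = 1 \<longleftrightarrow> Im z = 0 \<and> (\<exists>n::int. 2 * pi * Re z = of_int (2 * n) * pi)"
  by (simp add: ee_def exp_eq_1)
 also have "... \<longleftrightarrow> Im z = 0 \<and> (\<exists>n::int. Re z = of_int n)" by (simp add: mult.commute)
 also have "... \<longleftrightarrow> (\<exists>n::int. z = of_int n)" by (auto simp: complex_eq_iff)
 finally show ?thesis by (auto elim: Ints_cases)
qed

text \<open>The upper bounds of the box are released one generator at a time. Each release replaces
  the set by its translates along d and thus contributes one geometric factor.\<close>

lemma has_value_half_cone:
 fixes c :: "complex ^ 'n"
 assumes G: "lin_indep G" and x: "charac x"
  and ne: "!!d. d \<in> G ==> ee (\<Sum>i\<in>UNIV. c $ i * of_int (d $ i)) * x d ~= 1"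
 defines "lf \<equiv> %v :: int ^ 'n. \<Sum>i\<in>UNIV. c $ i * of_int (v $ i)"
 shows "has_value (%v. if rvec v \<in> half_cone G N then ee (lf v) else 0) x
  ((\<Sum>h\<in>box G N. ee (lf h) * x h) / (\<Prod>d\<in>G. 1 - ee (lf d) * x d))"
proof -
 have fG: "finite G" using G by (simp add: lin_indep_def)
 have ell_diff: "lf (v - w) = lf v - lf w" for v w by (simp add: lf_def algebra_simps sum_subtractf)
 define lo where "lo d v \<longleftrightarrow> (if d \<in> N then 0 < co G d (rvec v) else 0 <= co G d (rvec v))" for d and v :: "int ^ 'n"
 define hi where "hi d v \<longleftrightarrow> (if d \<in> N then co G d (rvec v) <= 1 else co G d (rvec v) < 1)" for d and v :: "int ^ 'n"
 define S where "S T v = (if rvec v \<in> span (rvec ` G) \<and> (\<forall>d\<in>G. lo d v) \<and> (\<forall>d\<in>G-T. hi d v) then ee (lf v) else 0)"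
  for T and v :: "int ^ 'n"
 have "has_value (S T) x ((\<Sum>h\<in>box G N. ee (lf h) * x h) / (\<Prod>d\<in>T. 1 - ee (lf d) * x d))"
  if "finite T" "T \<subseteq> G" for T
  using that
 proof (induction T rule: finite_induct)
  case empty
  have supp: "{v. S {} v ~= 0} = box G N"
  by (auto simp: S_def box_def lo_def hi_def split: if_splits)
  have "fin_supp (S {})" using finite_box[OF G] by (simp add: fin_supp_def supp)
  moreover have "evs (S {}) x = (\<Sum>h\<in>box G N. ee (lf h) * x h)"
  unfolding evs_def supp
  by (intro sum.cong refl) (auto simp: S_def box_def lo_def hi_def split: if_splits)
  ultimately show ?case using has_value_finite[OF x, of "S {}"] by simp
 next
  case (insert d T)
  have dG: "d \<in> G" and TG: "T \<subseteq> G" using insert by auto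
  have IH: "has_value (S T) x ((\<Sum>h\<in>box G N. ee (lf h) * x h) / (\<Prod>d\<in>T. 1 - ee (lf d) * x d))"
  using insert TG by simp
  have rec: "S (insert d T) v - ee (lf d) * S (insert d T) (v - d) = S T v" for v
  proof -
  have rd: "rvec d \<in> span (rvec ` G)" using dG by (intro span_base) auto
  have sp: "rvec (v - d) \<in> span (rvec ` G) \<longleftrightarrow> rvec v \<in> span (rvec ` G)"
  using rd span_add[of "rvec (v - d)" "rvec ` G" "rvec d"] span_diff[of "rvec v" "rvec ` G" "rvec d"]
  by (auto simp: rvec_diff)
  show ?thesis
  proof (cases "rvec v \<in> span (rvec ` G)")
  case True
  have co: "co G e (rvec (v - d)) = co G e (rvec v) - (if e = d then 1 else 0)" if "e \<in> G" for e
  using G True rd dG that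
  by (simp add: co_def rvec_diff lin_indep_def real_vector.representation_diff real_vector.representation_basis)
  have lo': "lo e (v - d) \<longleftrightarrow> lo e v" "hi e (v - d) \<longleftrightarrow> hi e v" if "e \<in> G" "e ~= d" for e
  using co[OF that(1)] that by (simp_all add: lo_def hi_def)
  \<comment> \<open>Translation by d lowers only the coordinate at d, and by exactly one, so the
    lower bound for v - d is the negation of the upper bound for v.\<close>
  have key: "(lo d v \<and> \<not> lo d (v - d)) \<longleftrightarrow> (lo d v \<and> hi d v)" "lo d (v - d) ==> lo d v"
  using co[OF dG] by (auto simp: lo_def hi_def split: if_splits)
  have "ee (lf d) * ee (lf (v - d)) = ee (lf v)" by (simp add: ell_diff flip: ee_add)
  hence *: "ee (lf d) * S (insert d T) (v - d) =
  (if (\<forall>e\<in>G. lo e (v - d)) \<and> (\<forall>e\<in>G-insert d T. hi e (v - d)) then ee (lf v) else 0)"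
  unfolding S_def using sp True by (simp only: simp_thms if_True if_False mult_zero_right if_distrib[of "(*) _"])
  have A: "(\<forall>e\<in>G. lo e u) \<longleftrightarrow> lo d u \<and> (\<forall>e\<in>G-{d}. lo e u)" for u using dG by auto
  have B: "(\<forall>e\<in>G-insert d T. hi e (v - d)) \<longleftrightarrow> (\<forall>e\<in>G-insert d T. hi e v)" using lo'(2) by auto
  have C: "(\<forall>e\<in>G-{d}. lo e (v - d)) \<longleftrightarrow> (\<forall>e\<in>G-{d}. lo e v)" using lo'(1) by auto
  have D: "(\<forall>e\<in>G-T. hi e v) \<longleftrightarrow> hi d v \<and> (\<forall>e\<in>G-insert d T. hi e v)" using dG insert(2) by auto
  define R where "R \<longleftrightarrow> (\<forall>e\<in>G-{d}. lo e v)"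
  define U where "U \<longleftrightarrow> (\<forall>e\<in>G-insert d T. hi e v)"
  have "S (insert d T) v = (if lo d v \<and> R \<and> U then ee (lf v) else 0)"
  unfolding S_def A R_def U_def using True by (simp only: simp_thms conj_assoc)
  moreover have "S T v = (if lo d v \<and> R \<and> hi d v \<and> U then ee (lf v) else 0)"
  unfolding S_def A D R_def U_def using True by (simp only: simp_thms conj_assoc)
  moreover have "ee (lf d) * S (insert d T) (v - d) = (if lo d (v - d) \<and> R \<and> U then ee (lf v) else 0)"
  unfolding * A B C R_def U_def by (simp only: simp_thms conj_assoc)
  ultimately show ?thesis using key by (cases "lo d v"; cases "lo d (v - d)"; cases R; cases U; cases "hi d v") simp_all
  next
  case False
  thus ?thesis using sp by (simp add: S_def)
  qed
  qed
  have "has_value (S (insert d T)) x ((\<Sum>h\<in>box G N. ee (lf h) * x h) / (\<Prod>d\<in>T. 1 - ee (lf d) * x d) / (1 - ee (lf d) * x d))"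
  using ne[OF dG] by (intro has_value_geometric[OF x IH rec]) (auto simp: lf_def)
  thus ?case using insert by (simp add: field_simps)
 qed
 from this[OF fG order_refl] have
  "has_value (S G) x ((\<Sum>h\<in>box G N. ee (lf h) * x h) / (\<Prod>d\<in>G. 1 - ee (lf d) * x d))" .
 moreover have "S G = (%v. if rvec v \<in> half_cone G N then ee (lf v) else 0)"
  by (simp add: S_def half_cone_def lo_def fun_eq_iff)
 ultimately show ?thesis by simp
qed

lemma box_subset_pos_cone:
 assumes "lin_indep G" "h \<in> box G N"
 shows "rvec h \<in> pos_cone G"
proof -
 have "0 <= co G d (rvec h)" if "d \<in> G" for d
  using assms(2) that by (cases "d \<in> N") (force simp: box_def)+
 moreover have "rvec h \<in> span (rvec ` G)" using assms(2) by (simp add: box_def)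
 ultimately show ?thesis using pos_cone_iff[OF assms(1) order_refl, of "rvec h"] by simp
qed

lemma charac_powi: "q ~= 0 ==> charac (%v. q powi pairing m v)"
 by (simp add: charac_def pairing_add_right power_int_add)

definition cone_value :: "(int ^ 'n => complex) => (int ^ 'n) set => (int ^ 'n) set => (int ^ 'n => complex) => complex" where
 "cone_value dg G N x = (\<Sum>h\<in>box G N. ee (dg h) * x h) / (\<Prod>d\<in>G. 1 - ee (dg d) * x d)"

lemma has_value_cone_value:
 fixes dg :: "int ^ 'n => complex" and G :: "(int ^ 'n) set"
 assumes G: "lin_indep G" and x: "charac x" and ne: "!!d. d \<in> G ==> ee (dg d) * x d ~= 1"
  and lin: "\<exists>c :: complex ^ 'n. \<forall>v\<in>lattice_points (pos_cone G). dg v = (\<Sum>i\<in>UNIV. c $ i * of_int (v $ i))"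
 shows "has_value (%v. if rvec v \<in> half_cone G N then ee (dg v) else 0) x (cone_value dg G N x)"
proof -
 obtain c :: "complex ^ 'n" where c: "!!v. rvec v \<in> pos_cone G ==> dg v = (\<Sum>i\<in>UNIV. c $ i * of_int (v $ i))"
  using lin by (auto simp: lattice_points_def)
 have dG: "dg d = (\<Sum>i\<in>UNIV. c $ i * of_int (d $ i))" if "d \<in> G" for d
  by (rule c[OF rvec_in_pos_cone[OF that]])
 have bG: "dg h = (\<Sum>i\<in>UNIV. c $ i * of_int (h $ i))" if "h \<in> box G N" for h
  by (rule c[OF box_subset_pos_cone[OF G that]])
 have hG: "(if rvec v \<in> half_cone G N then ee (dg v) else 0) =
  (if rvec v \<in> half_cone G N then ee (\<Sum>i\<in>UNIV. c $ i * of_int (v $ i)) else 0)" for v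
  using c[of v] half_cone_subset[OF G, of N] by auto
 have "cone_value dg G N x = (\<Sum>h\<in>box G N. ee (\<Sum>i\<in>UNIV. c $ i * of_int (h $ i)) * x h) / (\<Prod>d\<in>G. 1 - ee (\<Sum>i\<in>UNIV. c $ i * of_int (d $ i)) * x d)"
  unfolding cone_value_def using bG dG by (intro arg_cong2[where f = "(/)"] sum.cong prod.cong) auto
 moreover have "has_value (%v. if rvec v \<in> half_cone G N then ee (\<Sum>i\<in>UNIV. c $ i * of_int (v $ i)) else 0) x
  ((\<Sum>h\<in>box G N. ee (\<Sum>i\<in>UNIV. c $ i * of_int (h $ i)) * x h) / (\<Prod>d\<in>G. 1 - ee (\<Sum>i\<in>UNIV. c $ i * of_int (d $ i)) * x d))"
 proof (rule has_value_half_cone[OF G x])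
  fix d assume "d \<in> G"
  thus "ee (\<Sum>i\<in>UNIV. c $ i * of_int (d $ i)) * x d ~= 1" using ne[of d] dG[of d] by simp
 qed
 ultimately show ?thesis by (simp only: hG)
qed

section \<open>The terms of the toric form as sums over maximal cones\<close>

text \<open>By the Euler relation the alternating sum of the cone series is the series of e^(2 pi i
  deg) over all of N. The cones have disappeared from it.\<close>

lemma toric_form_term_value:
 fixes Fn :: "(real ^ 'n) set set"
 assumes fan: "complete_fan Fn" "simplicial_fan Fn" and lin: "linear_on_cones Fn dg" and q: "q ~= 0"
  and ne: "!!d. d \<in> ray_generators Fn ==> ee (dg d) * q powi pairing m d ~= 1"
 shows "has_value (%v. ee (dg v)) (%v. q powi pairing m v) (toric_form_term Fn dg q m)"
proof -
 have isf: "is_fan Fn" using fan by (simp add: complete_fan_def)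
 note G = simplicial_fan_gens[OF isf fan(2)]
 interpret simplicial_complex_fan "gens Fn ` Fn" by (rule fan_complex[OF fan])
 let ?x = "%v. q powi pairing m v"
 have x: "charac ?x" by (rule charac_powi[OF q])
 have finFn: "finite Fn" using isf by (simp add: is_fan_def)
 let ?S = "%C v. if rvec v \<in> C then ee (dg v) else 0"
 have val: "has_value (?S C) ?x (cone_value dg (gens Fn C) {} ?x)" if C: "C \<in> Fn" for C
 proof -
  have "half_cone (gens Fn C) {} = C"
  using G(2)[OF C] pos_cone_iff[OF G(1)[OF C] order_refl] by (auto simp: half_cone_def)
  moreover have "has_value (%v. if rvec v \<in> half_cone (gens Fn C) {} then ee (dg v) else 0) ?x (cone_value dg (gens Fn C) {} ?x)"
  proof (rule has_value_cone_value[OF G(1)[OF C] x])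
  show "ee (dg d) * ?x d ~= 1" if "d \<in> gens Fn C" for d using ne that by (simp add: gens_def)
  show "\<exists>c :: complex ^ 'n. \<forall>v\<in>lattice_points (pos_cone (gens Fn C)). dg v = (\<Sum>i\<in>UNIV. c $ i * of_int (v $ i))"
  using lin C unfolding linear_on_cones_def G(2)[OF C, symmetric] by (rule bspec)
  qed
  ultimately show ?thesis by simp
 qed
 have cf: "cone_function dg C q m = cone_value dg (gens Fn C) {} ?x" if C: "C \<in> Fn" for C
  unfolding cone_function_def ee_def[symmetric] lattice_points_def mem_Collect_eq
  by (rule rational_value_eqI[OF x val[OF C]])
 have "has_value (%v. \<Sum>C\<in>Fn. (-1) ^ (CARD('n) - dim C) * ?S C v) ?x
  (\<Sum>C\<in>Fn. (-1) ^ (CARD('n) - dim C) * cone_value dg (gens Fn C) {} ?x)"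
 proof (rule has_value_sum[OF x finFn])
  fix C assume "C \<in> Fn"
  show "has_value (%v. (-1) ^ (CARD('n) - dim C) * ?S C v) ?x ((-1) ^ (CARD('n) - dim C) * cone_value dg (gens Fn C) {} ?x)"
  by (rule has_value_cmul[OF val[OF \<open>C \<in> Fn\<close>]])
 qed
 also have "(%v. \<Sum>C\<in>Fn. (-1) ^ (CARD('n) - dim C) * ?S C v) = (%v. ee (dg v))"
 proof
  fix v
  have "(\<Sum>T\<in>gens Fn ` Fn. (-1) ^ (CARD('n) - card T) * (if rvec v \<in> pos_cone T then 1 else (0::complex)))
  = (\<Sum>C\<in>Fn. (-1) ^ (CARD('n) - card (gens Fn C)) * (if rvec v \<in> pos_cone (gens Fn C) then 1 else 0))"
  using bij_betw_gens[OF isf fan(2)] by (intro sum.reindex_cong[of "gens Fn" Fn]) (auto simp: bij_betw_def)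
  also have "... = (\<Sum>C\<in>Fn. (-1) ^ (CARD('n) - dim C) * (if rvec v \<in> C then 1 else 0))"
  proof (intro sum.cong refl)
  fix C assume C: "C \<in> Fn"
  show "(-1) ^ (CARD('n) - card (gens Fn C)) * (if rvec v \<in> pos_cone (gens Fn C) then 1 else 0) =
  (-1) ^ (CARD('n) - dim C) * (if rvec v \<in> C then 1 else (0::complex))"
  using dim_pos_cone[OF G(1)[OF C]] G(2)[OF C] by simp
  qed
  finally have 1: "(\<Sum>C\<in>Fn. (-1) ^ (CARD('n) - dim C) * (if rvec v \<in> C then 1 else (0::complex))) = 1"
  using euler_relation[of "rvec v", where 'b = complex] by simp
  have "(\<Sum>C\<in>Fn. (-1) ^ (CARD('n) - dim C) * ?S C v) =
  (\<Sum>C\<in>Fn. (-1) ^ (CARD('n) - dim C) * (if rvec v \<in> C then 1 else (0::complex))) * ee (dg v)"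
  unfolding sum_distrib_right by (intro sum.cong) auto
  thus "(\<Sum>C\<in>Fn. (-1) ^ (CARD('n) - dim C) * ?S C v) = ee (dg v)" using 1 by simp
 qed
 also have "(\<Sum>C\<in>Fn. (-1) ^ (CARD('n) - dim C) * cone_value dg (gens Fn C) {} ?x) = toric_form_term Fn dg q m"
  unfolding toric_form_term_def using cf by (intro sum.cong) auto
 finally show ?thesis .
qed

text \<open>The half-open maximal cones partition N, so they give a second expression for the value
  of the same series. It holds for every generic v, with different box points.\<close>

lemma toric_form_term_eq:
 fixes Fn :: "(real ^ 'n) set set"
 assumes fan: "complete_fan Fn" "simplicial_fan Fn" and lin: "linear_on_cones Fn dg" and q: "q ~= 0"
  and ne: "!!d. d \<in> ray_generators Fn ==> ee (dg d) * q powi pairing m d ~= 1"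
  and v: "simplicial_complex_fan.generic (gens Fn ` Fn) v"
 shows "toric_form_term Fn dg q m =
  (\<Sum>G\<in>simplicial_complex_fan.facets (gens Fn ` Fn). cone_value dg G {d\<in>G. co G d v < 0} (%v. q powi pairing m v))"
proof -
 have isf: "is_fan Fn" using fan by (simp add: complete_fan_def)
 note G = simplicial_fan_gens[OF isf fan(2)]
 interpret simplicial_complex_fan "gens Fn ` Fn" by (rule fan_complex[OF fan])
 let ?x = "%v. q powi pairing m v" and ?N = "%G. {d\<in>G. co G d v < 0}"
 have x: "charac ?x" by (rule charac_powi[OF q])
 have half: "half_cone G (?N G) = half G v" if "G \<in> facets" for G
  using generic_co[OF v that] facetsD(5)[OF that]
  by (auto simp: half_cone_def half_def)
 have "has_value (%w. \<Sum>G\<in>facets. if rvec w \<in> half_cone G (?N G) then ee (dg w) else 0) ?x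
  (\<Sum>G\<in>facets. cone_value dg G (?N G) ?x)"
 proof (rule has_value_sum[OF x finite_facets], rule has_value_cone_value[OF _ x])
  fix G assume GF: "G \<in> facets"
  show "lin_indep G" by (rule facetsD(2)[OF GF])
  then obtain C where C: "C \<in> Fn" "G = gens Fn C" using facetsD(1)[OF GF] by (elim imageE)
  show "ee (dg d) * ?x d ~= 1" if "d \<in> G" for d using ne that C by (simp add: gens_def)
  show "\<exists>c :: complex ^ 'n. \<forall>v\<in>lattice_points (pos_cone G). dg v = (\<Sum>i\<in>UNIV. c $ i * of_int (v $ i))"
  using lin C(1) unfolding linear_on_cones_def C(2) G(2)[OF C(1), symmetric] by (rule bspec)
 qed
 also have "(%w. \<Sum>G\<in>facets. if rvec w \<in> half_cone G (?N G) then ee (dg w) else 0) = (%w. ee (dg w))"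
 proof
  fix w
  obtain G where GF: "G \<in> facets" "rvec w \<in> half G v" and u: "!!H. H \<in> facets ==> rvec w \<in> half H v ==> H = G"
  using half_unique[OF v, of "rvec w"] by blast
  have "(\<Sum>H\<in>facets. if rvec w \<in> half_cone H (?N H) then ee (dg w) else 0) = (\<Sum>H\<in>facets. if H = G then ee (dg w) else 0)"
  proof (intro sum.cong refl)
  fix H assume H: "H \<in> facets"
  hence "rvec w \<in> half_cone H (?N H) \<longleftrightarrow> H = G" using u GF half by blast
  thus "(if rvec w \<in> half_cone H (?N H) then ee (dg w) else 0) = (if H = G then ee (dg w) else 0)" by (simp only:)
  qed
  thus "(\<Sum>H\<in>facets. if rvec w \<in> half_cone H (?N H) then ee (dg w) else 0) = ee (dg w)"
  using finite_facets GF(1) by simp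
 qed
 finally show ?thesis using has_value_unique[OF x] toric_form_term_value[OF fan lin q ne] by blast
qed

lemma linear_on_cones_refinement:
 assumes "refinement_of Fn' Fn" "linear_on_cones Fn dg"
 shows "linear_on_cones Fn' dg"
 unfolding linear_on_cones_def
proof
 fix C' assume "C' \<in> Fn'"
 then obtain C where C: "C \<in> Fn" "C' \<subseteq> C" using assms(1) by (auto simp: refinement_of_def)
 then obtain c :: "complex ^ 'a" where "\<forall>v\<in>lattice_points C. dg v = (\<Sum>i\<in>UNIV. c $ i * of_int (v $ i))"
  using assms(2) unfolding linear_on_cones_def by blast
 with C(2) show "\<exists>c :: complex ^ 'a. \<forall>v\<in>lattice_points C'. dg v = (\<Sum>i\<in>UNIV. c $ i * of_int (v $ i))"
  by (auto simp: lattice_points_def intro!: exI[of _ c])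
qed

text \<open>Both terms are the value of one series over N, which knows the degree function but no
  fan.\<close>

lemma toric_form_term_refinement:
 fixes Fn Fn' :: "(real ^ 'n) set set"
 assumes fan: "complete_fan Fn" "simplicial_fan Fn" and fan': "complete_fan Fn'" "simplicial_fan Fn'"
  and ref: "refinement_of Fn' Fn" and lin: "linear_on_cones Fn dg" and q: "q ~= 0"
  and ne: "!!d. d \<in> ray_generators Fn ==> ee (dg d) * q powi pairing m d ~= 1"
  and ne': "!!d. d \<in> ray_generators Fn' ==> ee (dg d) * q powi pairing m d ~= 1"
 shows "toric_form_term Fn dg q m = toric_form_term Fn' dg q m"
 using has_value_unique[OF charac_powi[OF q]]
  toric_form_term_value[OF fan lin q ne] toric_form_term_value[OF fan' linear_on_cones_refinement[OF ref lin] q ne']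
 by blast

section \<open>Dominated convergence and summability over lattices\<close>

lemma infsum_dominated_convergence:
 fixes f :: "'x => 'a => 'c :: banach"
 assumes g: "g summable_on A" and dom: "\<forall>\<^sub>F x in F. \<forall>m\<in>A. norm (f x m) <= g m"
  and lim: "!!m. m \<in> A ==> ((%x. f x m) \<longlongrightarrow> l m) F" and F: "F ~= bot"
 shows "l summable_on A" "((%x. infsum (f x) A) \<longlongrightarrow> infsum l A) F"
proof -
 have nl: "norm (l m) <= g m" if "m \<in> A" for m
 proof (rule tendsto_upperbound[OF tendsto_norm[OF lim[OF that]] _ F])
  show "\<forall>\<^sub>F x in F. norm (f x m) <= g m" using dom by eventually_elim (use that in auto)
 qed
 have sub: "h summable_on B" if "B \<subseteq> A" "!!m. m \<in> A ==> norm (h m) <= g m" for h :: "'a => 'c" and B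
 proof (rule abs_summable_summable)
  show "h abs_summable_on B"
  by (rule summable_on_comparison_test[OF summable_on_subset_banach[OF g that(1)]]) (use that in auto)
 qed
 show ls: "l summable_on A" by (rule sub[OF order_refl nl])
 show "((%x. infsum (f x) A) \<longlongrightarrow> infsum l A) F"
 proof (rule tendstoI)
  fix e :: real assume e: "e > 0"
  \<comment> \<open>Outside the finite set A0 the majorant sums to at most e/4, which controls the
    tails of all \<open>f x\<close> and of the limit together.\<close>
  obtain A0 where A0: "finite A0" "A0 \<subseteq> A" "dist (sum g A0) (infsum g A) <= e / 4"
  using has_sum_finite_approximation[OF has_sum_infsum[OF g], of "e / 4"] e by auto
  have split: "infsum h A = sum h A0 + infsum h (A - A0)" if "h summable_on A" for h :: "'a => 'd :: banach"
  using infsum_Diff[OF that _ A0(2)] A0(1) by simp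
  have gA0: "infsum g (A - A0) <= e / 4"
  using A0(3) split[OF g] by (simp add: dist_real_def)
  have tail: "norm (infsum h (A - A0)) <= e / 4" if "!!m. m \<in> A ==> norm (h m) <= g m" for h :: "'a => 'c"
  proof -
  have gs: "g summable_on (A - A0)" using g by (rule summable_on_subset_banach) auto
  have hs: "h abs_summable_on (A - A0)"
  by (rule summable_on_comparison_test[OF gs]) (use that in auto)
  have "norm (infsum h (A - A0)) <= infsum (%x. norm (h x)) (A - A0)" by (rule norm_infsum_bound[OF hs])
  also have "... <= infsum g (A - A0)" by (rule infsum_mono[OF hs gs]) (use that in auto)
  finally show ?thesis using gA0 by linarith
  qed
  have "((%x. sum (f x) A0) \<longlongrightarrow> sum l A0) F"
  using A0(2) lim by (intro tendsto_sum) auto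
  hence "\<forall>\<^sub>F x in F. dist (sum (f x) A0) (sum l A0) < e / 4" using e by (intro tendstoD) auto
  with dom show "\<forall>\<^sub>F x in F. dist (infsum (f x) A) (infsum l A) < e"
  proof eventually_elim
  case (elim x)
  have fs: "f x summable_on A" using elim(1) by (intro sub) auto
  have "dist (infsum (f x) A) (infsum l A) =
  norm ((sum (f x) A0 - sum l A0) + infsum (f x) (A - A0) - infsum l (A - A0))"
  unfolding split[OF fs] split[OF ls] dist_norm by (simp add: algebra_simps)
  also have "... <= norm (sum (f x) A0 - sum l A0) + norm (infsum (f x) (A - A0)) + norm (infsum l (A - A0))"
  by (meson norm_triangle_ineq norm_triangle_ineq4 add_mono order_trans order_refl)
  also have "... < e"
  using elim(2) tail[of "f x"] elim(1) tail[OF nl] e by (simp add: dist_norm)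
  finally show ?case .
  qed
 qed
qed

lemma summable_on_PiE_prod:
 fixes f :: "'a => 'b => real"
 assumes A: "finite A" and f: "!!x. x \<in> A ==> f x summable_on B x" and nn: "!!x y. 0 <= f x y"
 shows "(%g. \<Prod>x\<in>A. f x (g x)) summable_on PiE A B"
proof (rule nonneg_bdd_above_summable_on)
 show "0 <= (\<Prod>x\<in>A. f x (g x))" for g using nn by (intro prod_nonneg) auto
 show "bdd_above (sum (%g. \<Prod>x\<in>A. f x (g x)) ` {F. F \<subseteq> PiE A B \<and> finite F})"
 proof (rule bdd_aboveI2, clarify)
  fix F assume F: "F \<subseteq> PiE A B" "finite F"
  let ?P = "%x. (%g. g x) ` F"
  have "F \<subseteq> PiE A ?P" using F(1) by (auto simp: PiE_def Pi_def)
  hence "(\<Sum>g\<in>F. \<Prod>x\<in>A. f x (g x)) <= (\<Sum>g\<in>PiE A ?P. \<Prod>x\<in>A. f x (g x))"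
  using A F(2) nn by (intro sum_mono2 finite_PiE prod_nonneg) auto
  also have "... = (\<Prod>x\<in>A. \<Sum>y\<in>?P x. f x y)" using A F(2) by (intro prod_sum_PiE[symmetric]) auto
  also have "... <= (\<Prod>x\<in>A. infsum (f x) (B x))"
  proof (rule prod_mono, rule conjI)
  fix x assume x: "x \<in> A"
  show "0 <= (\<Sum>y\<in>?P x. f x y)" using nn by (intro sum_nonneg) auto
  show "(\<Sum>y\<in>?P x. f x y) <= infsum (f x) (B x)"
  using F x nn by (intro finite_sum_le_infsum f) (auto simp: PiE_def Pi_def)
  qed
  finally show "(\<Sum>g\<in>F. \<Prod>x\<in>A. f x (g x)) <= (\<Prod>x\<in>A. infsum (f x) (B x))" .
 qed
qed

lemma summable_on_finite_sum:
 fixes f :: "'i => 'a => 'b :: topological_comm_monoid_add"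
 assumes "finite I" "!!i. i \<in> I ==> f i summable_on A"
 shows "(%x. \<Sum>i\<in>I. f i x) summable_on A"
 using assms by (induction I rule: finite_induct) (auto intro: summable_on_add)

lemma UNIV_int_split: "(UNIV :: int set) = range int \<union> range (%n. - int (Suc n))" "range int \<inter> range (%n. - int (Suc n)) = {}"
proof -
 show "range int \<inter> range (%n. - int (Suc n)) = {}" by auto
 show "(UNIV :: int set) = range int \<union> range (%n. - int (Suc n))"
 proof -
  have "k \<in> range int \<union> range (%n. - int (Suc n))" for k
  by (cases k rule: int_cases) auto
  thus ?thesis by blast
 qed
qed

lemma summable_on_int_split:
 fixes f :: "int => 'a :: banach"
 shows "f summable_on UNIV \<longleftrightarrow> (%n. f (int n)) summable_on UNIV \<and> (%n. f (- int (Suc n))) summable_on UNIV"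
proof -
 have 1: "f summable_on range int \<longleftrightarrow> (%n. f (int n)) summable_on UNIV"
  by (subst summable_on_reindex) (auto simp: o_def)
 have 2: "f summable_on range (%n. - int (Suc n)) \<longleftrightarrow> (%n. f (- int (Suc n))) summable_on UNIV"
  by (subst summable_on_reindex) (auto simp: o_def inj_on_def)
 have "f summable_on UNIV \<longleftrightarrow> f summable_on range int \<and> f summable_on range (%n. - int (Suc n))"
 proof
  assume f: "f summable_on UNIV"
  show "f summable_on range int \<and> f summable_on range (%n. - int (Suc n))"
  by (intro conjI summable_on_subset_banach[OF f] subset_UNIV)
 next
  assume "f summable_on range int \<and> f summable_on range (%n. - int (Suc n))"
  hence "f summable_on (range int \<union> range (%n. - int (Suc n)))"
  using UNIV_int_split(2) by (intro summable_on_Un_disjoint) blast+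
  thus "f summable_on UNIV" by (simp only: UNIV_int_split(1)[symmetric])
 qed
 thus ?thesis by (simp only: 1 2)
qed

lemma summable_on_exp_abs_int:
 assumes "\<beta> > 0"
 shows "(%k::int. exp (- \<beta> * \<bar>real_of_int k\<bar>)) summable_on UNIV"
proof -
 have s: "(%n::nat. exp (- \<beta> * real n)) summable_on UNIV"
 proof (rule norm_summable_imp_summable_on)
  have "(%n::nat. norm (exp (- \<beta> * real n))) = (%n. exp (- \<beta>) ^ n)"
  by (auto simp: exp_of_nat_mult[symmetric] mult.commute)
  thus "summable (%n::nat. norm (exp (- \<beta> * real n)))"
  using assms by (simp add: summable_geometric)
 qed
 hence "(%n. exp (- \<beta> * real (Suc n))) summable_on UNIV"
  using summable_on_cmult_right[OF s, of "exp (- \<beta>)"] by (simp add: algebra_simps exp_add[symmetric])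
 with s show ?thesis by (subst summable_on_int_split) (auto simp: add.commute)
qed

section \<open>Decay of the terms and majorants uniform in the degree\<close>

text \<open>Distance of a from the powers of q, normalised by the size of a q^k: the reciprocal of 1
  - a q^k stays bounded for k >= 0 and decays like |q|^|k| for k < 0.\<close>

definition sep :: "complex => complex => real => bool" where
 "sep q a c \<longleftrightarrow> (\<forall>k::int. c * max 1 (norm q powi k) <= norm (1 - a * q powi k))"

text \<open>Three regimes. For k > 0 the bound |a q| <= 1/2 keeps a q^k away from 1, for k < 0 the
  bound 2|q| <= |a| gives |a q^k| >= 2, and k = 0 is the hypothesis on 1 - a.\<close>

lemma sepI:
 assumes q: "q ~= 0" "norm q < 1" "norm a * norm q <= 1/2" "2 * norm q <= norm a" "\<eta> <= norm (1 - a)"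
  and c: "c <= 1/2" "c <= norm a / 2" "c <= \<eta>" "0 <= c"
 shows "sep q a c"
 unfolding sep_def
proof
 fix k :: int
 consider "k = 0" | "k > 0" | "k < 0" by linarith
 thus "c * max 1 (norm q powi k) <= norm (1 - a * q powi k)"
 proof cases
  case 1 thus ?thesis using assms by simp
 next
  case 2
  then obtain n where k: "k = int (Suc n)" by (metis zero_less_imp_eq_int gr0_conv_Suc)
  have "norm q ^ n <= 1" using q by (simp add: power_le_one)
  hence le: "norm q ^ Suc n <= norm q" using q by (simp add: mult_left_le)
  have "norm (a * q powi k) = norm a * norm q ^ Suc n" unfolding k norm_mult power_int_of_nat norm_power ..
  also have "... <= norm a * norm q" using le by (intro mult_left_mono) auto
  finally have "norm (a * q powi k) <= norm a * norm q" .
  hence "1/2 <= norm (1 - a * q powi k)" using norm_triangle_ineq2[of 1 "a * q powi k"] q(3) by simp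
  moreover have "norm q powi k <= 1" unfolding k power_int_of_nat using le q by linarith
  hence "max 1 (norm q powi k) = 1" by simp
  ultimately show ?thesis using c by simp
 next
  case 3
  define n where "n = nat (- k) - 1"
  have k: "k = - int (Suc n)" using 3 by (simp add: n_def)
  have qp: "norm q > 0" using q by simp
  have "norm q ^ n <= 1" using q by (simp add: power_le_one)
  have "2 * norm q ^ Suc n <= norm a"
  using q(4) mult_left_mono[OF \<open>norm q ^ n <= 1\<close>, of "2 * norm q"] by simp
  hence ge: "2 <= norm (a * q powi k)"
  unfolding k norm_mult power_int_minus power_int_of_nat norm_inverse norm_power
  using qp by (simp add: field_simps del: power_Suc)
  have "1 <= norm q powi k"
  unfolding k power_int_minus power_int_of_nat
  using qp power_le_one[of "norm q" "Suc n"] q(2) by (simp add: one_le_inverse_iff del: power_Suc)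
  hence "c * max 1 (norm q powi k) = c * norm q powi k" by simp
  also have "... <= norm a / 2 * norm q powi k" using c(2) qp by (intro mult_right_mono) auto
  also have "... = norm (a * q powi k) / 2" by (simp add: norm_mult norm_power_int)
  also have "... <= norm (a * q powi k) - 1" using ge by simp
  also have "... <= norm (1 - a * q powi k)"
  using norm_triangle_ineq3[of "a * q powi k" 1] by (simp add: norm_minus_commute)
  finally show ?thesis .
 qed
qed

lemma sep_nonzero: "sep q a c ==> c > 0 ==> a * q powi k ~= 1"
proof
 assume s: "sep q a c" "c > 0" "a * q powi k = 1"
 hence "c * max 1 (norm q powi k) <= 0" unfolding sep_def by (metis diff_self norm_zero)
 moreover have "0 < c * max 1 (norm q powi k)" using s(2) by (intro mult_pos_pos) auto
 ultimately show False by linarith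
qed

text \<open>Here w is the weight and l the coordinate of a box point. The decay rate is w + l L
  towards +infinity and (1 - l) L - w towards -infinity, where L = -ln |q| and the denominator
  supplies the 1.\<close>

lemma sep_term_bound:
 assumes q: "q ~= 0" "norm q < 1" and s: "sep q a c" and c: "c > 0"
  and b: "\<beta> <= w + l * - ln (norm q)" "\<beta> <= (1 - l) * - ln (norm q) - w"
 shows "exp (- w * k) * (norm q powr (l * k)) / norm (1 - a * q powi k) <= exp (- \<beta> * \<bar>real_of_int k\<bar>) / c"
proof -
 define L where "L = - ln (norm q)"
 have Q: "norm q powr x = exp (- L * x)" for x using q by (simp add: powr_def L_def mult.commute)
 have Qi: "norm q powi k = exp (- L * k)"
  using q Q[of "real_of_int k"] by (simp add: powr_real_of_int')
 have le: "exp (- w * k) * norm q powr (l * k) <= exp (- \<beta> * \<bar>real_of_int k\<bar>) * max 1 (norm q powi k)"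
 proof (cases "k \<ge> 0")
  case True
  have "exp (- w * k) * norm q powr (l * k) = exp (- (w + l * L) * k)"
  unfolding Q by (simp add: exp_add[symmetric] algebra_simps)
  also have "... <= exp (- \<beta> * \<bar>real_of_int k\<bar>)"
  proof -
  have "\<beta> * k <= (w + l * L) * k" using True b(1) by (intro mult_right_mono) (auto simp: L_def)
  thus ?thesis using True by (simp add: algebra_simps)
  qed
  also have "... <= exp (- \<beta> * \<bar>real_of_int k\<bar>) * max 1 (norm q powi k)" by simp
  finally show ?thesis .
 next
  case False
  have "exp (- w * k) * norm q powr (l * k) = exp (((1 - l) * L - w) * k) * exp (- L * k)"
  unfolding Q by (simp add: exp_add[symmetric] algebra_simps)
  also have "... <= exp (- \<beta> * \<bar>real_of_int k\<bar>) * exp (- L * k)"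
  proof -
  have "((1 - l) * L - w) * k <= \<beta> * k" using False b(2) by (intro mult_right_mono_neg) (auto simp: L_def)
  thus ?thesis using False by (simp add: algebra_simps)
  qed
  also have "... <= exp (- \<beta> * \<bar>real_of_int k\<bar>) * max 1 (norm q powi k)" by (simp add: Qi)
  finally show ?thesis .
 qed
 have pos: "0 < c * max 1 (norm q powi k)" using c by (intro mult_pos_pos) auto
 have "exp (- w * k) * (norm q powr (l * k)) / norm (1 - a * q powi k) <=
  exp (- \<beta> * \<bar>real_of_int k\<bar>) * max 1 (norm q powi k) / (c * max 1 (norm q powi k))"
  using le s pos by (intro frac_le) (auto simp: sep_def)
 also have "... = exp (- \<beta> * \<bar>real_of_int k\<bar>) / c" by simp
 finally show ?thesis .
qed

lemma finite_positive_bound: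
 fixes S :: "real set"
 assumes "finite S" "!!x. x \<in> S ==> x > 0"
 obtains b where "b > 0" "!!x. x \<in> S ==> b <= x"
proof
 show "Min (insert 1 S) > 0" using assms by (subst Min_gr_iff) auto
 show "Min (insert 1 S) <= x" if "x \<in> S" for x using assms that by (intro Min_le) auto
qed

context simplicial_complex_fan
begin

lemma pairing_inj:
 assumes "G \<in> facets" "!!d. d \<in> G ==> pairing m d = pairing m' d"
 shows "m = m'"
proof -
 have "rvec (m - m') \<bullet> x = 0" for x
 proof -
  have "rvec (m - m') \<bullet> x = (\<Sum>d\<in>G. co G d x * (rvec (m - m') \<bullet> rvec d))"
  by (subst facets_expand[OF assms(1), of x]) (simp add: inner_sum_right)
  also have "... = 0"
  using assms(2) by (intro sum.neutral) (auto simp: pairing_inner[symmetric] pairing_diff_left)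
  finally show ?thesis .
 qed
 hence "rvec (m - m') = 0" by (metis inner_eq_zero_iff)
 thus ?thesis by (metis eq_iff_diff_eq_0 rvec_0 rvec_inject)
qed

text \<open>A vector m is determined by its pairings with G, so the sum over M is part of a sum over
  all integer functions on G, where the product factorises.\<close>

lemma summable_pairing_prod:
 fixes f :: "int ^ 'n => int => real"
 assumes G: "G \<in> facets" and f: "!!d. d \<in> G ==> f d summable_on UNIV" and nn: "!!d k. 0 <= f d k"
 shows "(%m. \<Prod>d\<in>G. f d (pairing m d)) summable_on UNIV"
proof -
 let ?h = "%m. \<lambda>d\<in>G. pairing m d"
 have inj: "inj ?h"
 proof (rule injI)
  fix m m' assume "?h m = ?h m'"
  thus "m = m'" using pairing_inj[OF G, of m m'] by (metis restrict_apply')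
 qed
 have "(%g. \<Prod>d\<in>G. f d (g d)) summable_on PiE G (%_. UNIV)"
  using facetsD(3)[OF G] f nn by (intro summable_on_PiE_prod) auto
 hence "(%g. \<Prod>d\<in>G. f d (g d)) summable_on range ?h"
  by (rule summable_on_subset_banach) auto
 hence "((%g. \<Prod>d\<in>G. f d (g d)) \<circ> ?h) summable_on UNIV" using summable_on_reindex[OF inj] by blast
 moreover have "(%g. \<Prod>d\<in>G. f d (g d)) \<circ> ?h = (%m. \<Prod>d\<in>G. f d (pairing m d))" by (auto simp: o_def)
 ultimately show ?thesis by simp
qed

lemma inner_expand:
 assumes "G \<in> facets"
 shows "rvec m \<bullet> x = (\<Sum>d\<in>G. co G d x * pairing m d)"
 by (subst facets_expand[OF assms, of x]) (simp add: inner_sum_right pairing_inner)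

definition negs :: "(int ^ 'n) set => real ^ 'n => (int ^ 'n) set" where
 "negs G v = {d\<in>G. co G d v < 0}"

definition facet_sum :: "(int ^ 'n => complex) => complex => real ^ 'n => int ^ 'n => complex" where
 "facet_sum dg q v m = (\<Sum>G\<in>facets. cone_value dg G (negs G v) (%w. q powi pairing m w))"

text \<open>This is where the half-open box matters. A coordinate can be 0 only if v is positive
  there, and 1 only if v is negative there, so a small t > 0 makes both rates positive in every
  direction; finitely many conditions then allow a common \<open>\<beta>\<close>.\<close>

lemma weight_exists:
 assumes v: "generic v" and L: "L > 0"
 obtains t \<beta> where "t > 0" "\<beta> > 0"
  "!!G d h. G \<in> facets ==> d \<in> G ==> h \<in> box G (negs G v) ==>
  \<beta> <= t * co G d v + co G d (rvec h) * L \<and> \<beta> <= (1 - co G d (rvec h)) * L - t * co G d v"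
proof -
 let ?I = "SIGMA G:facets. G \<times> box G (negs G v)"
 let ?a = "%t (G, d, h). t * co G d v + co G d (rvec h) * L"
 let ?b = "%t (G, d, h). (1 - co G d (rvec h)) * L - t * co G d v"
 have finI: "finite ?I" using finite_facets facetsD(2,3) finite_box by (intro finite_SigmaI finite_cartesian_product) auto
 have "\<forall>\<^sub>F t in at_right (0::real). \<forall>i\<in>?I. ?a t i > 0 \<and> ?b t i > 0"
 proof (subst eventually_ball_finite_distrib[OF finI], rule ballI)
  fix i assume "i \<in> ?I"
  then obtain G d h where i: "i = (G, d, h)" and G: "G \<in> facets" and d: "d \<in> G" and h: "h \<in> box G (negs G v)"
  by (cases i) auto
  have t0: "\<forall>\<^sub>F t in at_right (0::real). t > 0" by (simp add: eventually_at_right_less)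
  have la: "((%t. t * co G d v + co G d (rvec h) * L) \<longlongrightarrow> co G d (rvec h) * L) (at_right 0)"
  by (rule tendsto_eq_rhs, (rule tendsto_intros)+) simp
  have lb: "((%t. (1 - co G d (rvec h)) * L - t * co G d v) \<longlongrightarrow> (1 - co G d (rvec h)) * L) (at_right 0)"
  by (rule tendsto_eq_rhs, (rule tendsto_intros)+) simp
  have "\<forall>\<^sub>F t in at_right (0::real). t * co G d v + co G d (rvec h) * L > 0 \<and> (1 - co G d (rvec h)) * L - t * co G d v > 0"
  proof (cases "co G d v < 0")
  case True
  hence l: "0 < co G d (rvec h)" "co G d (rvec h) <= 1" using h d by (auto simp: box_def negs_def)
  from l(1) L have "\<forall>\<^sub>F t in at_right (0::real). t * co G d v + co G d (rvec h) * L > 0"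
  by (intro order_tendstoD(1)[OF la]) auto
  with t0 show ?thesis
  proof eventually_elim
  case (elim t)
  have "t * co G d v < 0" using elim True by (simp add: mult_pos_neg)
  moreover have "(1 - co G d (rvec h)) * L \<ge> 0" using l L by simp
  ultimately show ?case using elim by linarith
  qed
  next
  case False
  hence p: "co G d v > 0" using generic_co[OF v G d] by linarith
  have l: "0 <= co G d (rvec h)" "co G d (rvec h) < 1" using h d False by (auto simp: box_def negs_def)
  from l(2) L have "\<forall>\<^sub>F t in at_right (0::real). (1 - co G d (rvec h)) * L - t * co G d v > 0"
  by (intro order_tendstoD(1)[OF lb]) auto
  with t0 show ?thesis
  proof eventually_elim
  case (elim t)
  have "t * co G d v > 0" using elim p by simp
  moreover have "co G d (rvec h) * L \<ge> 0" using l L by simp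
  ultimately show ?case using elim by linarith
  qed
  qed
  thus "\<forall>\<^sub>F t in at_right (0::real). ?a t i > 0 \<and> ?b t i > 0" by (simp add: i)
 qed
 hence "\<forall>\<^sub>F t in at_right (0::real). t > 0 \<and> (\<forall>i\<in>?I. ?a t i > 0 \<and> ?b t i > 0)"
  by (intro eventually_conj) (simp_all add: eventually_at_right_less)
 then obtain t where t: "t > 0" "\<forall>i\<in>?I. ?a t i > 0 \<and> ?b t i > 0"
  using eventually_happens'[OF trivial_limit_at_right_real] by blast
 obtain \<beta> where \<beta>: "\<beta> > 0" "!!x. x \<in> ?a t ` ?I \<union> ?b t ` ?I ==> \<beta> <= x"
  by (rule finite_positive_bound[of "?a t ` ?I \<union> ?b t ` ?I"]) (use finI t(2) in auto)
 show ?thesis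
 proof (rule that[OF t(1) \<beta>(1)])
  fix G d h assume i: "G \<in> facets" "d \<in> G" "h \<in> box G (negs G v)"
  hence "(G, d, h) \<in> ?I" by auto
  hence "?a t (G, d, h) \<in> ?a t ` ?I" "?b t (G, d, h) \<in> ?b t ` ?I" by blast+
  hence "\<beta> <= ?a t (G, d, h)" "\<beta> <= ?b t (G, d, h)" using \<beta>(2) by blast+
  thus "\<beta> <= t * co G d v + co G d (rvec h) * L \<and> \<beta> <= (1 - co G d (rvec h)) * L - t * co G d v" by simp
 qed
qed

text \<open>Each cone is bounded by a product of two-sided exponentials in the pairings with its
  generators. The weight t and the majorant g are chosen before the degree function and depend on it
  only through c and B.\<close>

lemma facet_sum_bound:
 assumes v: "generic v" and q: "q ~= 0" "norm q < 1" and c: "c > 0"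
 shows "\<exists>t>0. \<exists>g. g summable_on UNIV \<and>
  (\<forall>dg m. (\<forall>d\<in>\<Union>K. sep q (ee (dg d)) c) --> (\<forall>G\<in>facets. \<forall>h\<in>box G (negs G v). norm (ee (dg h)) <= B) -->
  norm (facet_sum dg q v m) * exp (- t * (rvec m \<bullet> v)) <= g m)"
proof -
 have L: "- ln (norm q) > 0" using q by simp
 obtain t \<beta> where t: "t > 0" "\<beta> > 0" and b: "!!G d h. G \<in> facets ==> d \<in> G ==> h \<in> box G (negs G v) ==>
  \<beta> <= t * co G d v + co G d (rvec h) * - ln (norm q) \<and> \<beta> <= (1 - co G d (rvec h)) * - ln (norm q) - t * co G d v"
  using weight_exists[OF v L] by metis
 define g where "g m = (\<Sum>G\<in>facets. \<Sum>h\<in>box G (negs G v). B * (\<Prod>d\<in>G. exp (- \<beta> * \<bar>real_of_int (pairing m d)\<bar>) / c))" for m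
 have "g summable_on UNIV"
  unfolding g_def
 proof (intro summable_on_finite_sum)
  show "finite facets" by (rule finite_facets)
  fix G assume G: "G \<in> facets"
  show "finite (box G (negs G v))" by (rule finite_box[OF facetsD(2)[OF G]])
  have "(%k::int. exp (- \<beta> * \<bar>real_of_int k\<bar>) * (1 / c)) summable_on UNIV"
  by (intro summable_on_cmult_left summable_on_exp_abs_int t(2))
  hence "(%m. \<Prod>d\<in>G. exp (- \<beta> * \<bar>real_of_int (pairing m d)\<bar>) / c) summable_on UNIV"
  using c by (intro summable_pairing_prod[OF G, of "%_ k. exp (- \<beta> * \<bar>real_of_int k\<bar>) / c"]) auto
  thus "(%m. B * (\<Prod>d\<in>G. exp (- \<beta> * \<bar>real_of_int (pairing m d)\<bar>) / c)) summable_on UNIV"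
  by (rule summable_on_cmult_right)
 qed
 moreover have "norm (facet_sum dg q v m) * exp (- t * (rvec m \<bullet> v)) <= g m"
  if s: "\<forall>d\<in>\<Union>K. sep q (ee (dg d)) c" and bd: "\<forall>G\<in>facets. \<forall>h\<in>box G (negs G v). norm (ee (dg h)) <= B" for dg m
 proof -
  have "norm (facet_sum dg q v m) * exp (- t * (rvec m \<bullet> v)) <=
  (\<Sum>G\<in>facets. norm (cone_value dg G (negs G v) (%w. q powi pairing m w)) * exp (- t * (rvec m \<bullet> v)))"
  unfolding facet_sum_def sum_distrib_right[symmetric] by (intro mult_right_mono norm_sum) auto
  also have "... <= g m"
  unfolding g_def
  proof (intro sum_mono)
  fix G assume G: "G \<in> facets"
  let ?D = "\<Prod>d\<in>G. 1 - ee (dg d) * q powi pairing m d"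
  have "norm (cone_value dg G (negs G v) (%w. q powi pairing m w)) <=
  (\<Sum>h\<in>box G (negs G v). norm (ee (dg h) * q powi pairing m h)) / norm ?D"
  unfolding cone_value_def norm_divide by (intro divide_right_mono norm_sum) auto
  hence "norm (cone_value dg G (negs G v) (%w. q powi pairing m w)) * exp (- t * (rvec m \<bullet> v)) <=
  (\<Sum>h\<in>box G (negs G v). norm (ee (dg h) * q powi pairing m h)) / norm ?D * exp (- t * (rvec m \<bullet> v))"
  by (intro mult_right_mono) auto
  also have "... = (\<Sum>h\<in>box G (negs G v). norm (ee (dg h)) * (norm (q powi pairing m h) * exp (- t * (rvec m \<bullet> v)) / norm ?D))"
  unfolding sum_divide_distrib sum_distrib_right norm_mult by (intro sum.cong refl) (simp add: field_simps)
  also have "... <= (\<Sum>h\<in>box G (negs G v). B * (\<Prod>d\<in>G. exp (- \<beta> * \<bar>real_of_int (pairing m d)\<bar>) / c))"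
  proof (intro sum_mono mult_mono)
  fix h assume h: "h \<in> box G (negs G v)"
  show "norm (ee (dg h)) <= B" using bd G h by blast
  thus "0 <= B" using norm_ge_zero order_trans by blast
  have "norm (q powi pairing m h) = norm q powr (rvec m \<bullet> rvec h)"
  using q by (simp add: norm_power_int powr_real_of_int' flip: pairing_inner)
  also have "... = (\<Prod>d\<in>G. norm q powr (co G d (rvec h) * pairing m d))"
  unfolding inner_expand[OF G] using facetsD(3)[OF G] q by (simp add: powr_sum)
  finally have 1: "norm (q powi pairing m h) = (\<Prod>d\<in>G. norm q powr (co G d (rvec h) * pairing m d))" .
  have 2: "exp (- t * (rvec m \<bullet> v)) = (\<Prod>d\<in>G. exp (- (t * co G d v) * pairing m d))"
  unfolding inner_expand[OF G] using facetsD(3)[OF G]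
  by (simp add: exp_sum[symmetric] sum_distrib_left sum_negf mult.assoc)
  have "norm (q powi pairing m h) * exp (- t * (rvec m \<bullet> v)) / norm ?D =
  (\<Prod>d\<in>G. exp (- (t * co G d v) * pairing m d) * norm q powr (co G d (rvec h) * pairing m d) / norm (1 - ee (dg d) * q powi pairing m d))"
  unfolding 1 2 by (simp add: prod_norm[symmetric] prod.distrib prod_dividef mult.commute)
  also have "... <= (\<Prod>d\<in>G. exp (- \<beta> * \<bar>real_of_int (pairing m d)\<bar>) / c)"
  proof (intro prod_mono conjI)
  fix d assume d: "d \<in> G"
  have "d \<in> \<Union>K" using facetsD(1)[OF G] d by blast
  hence "sep q (ee (dg d)) c" using s by blast
  thus "exp (- (t * co G d v) * pairing m d) * norm q powr (co G d (rvec h) * pairing m d) / norm (1 - ee (dg d) * q powi pairing m d)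
  <= exp (- \<beta> * \<bar>real_of_int (pairing m d)\<bar>) / c"
  using b[OF G d h] by (intro sep_term_bound[OF q _ c]) auto
  qed auto
  finally show "norm (q powi pairing m h) * exp (- t * (rvec m \<bullet> v)) / norm ?D <= (\<Prod>d\<in>G. exp (- \<beta> * \<bar>real_of_int (pairing m d)\<bar>) / c)" .
  qed (auto intro!: divide_nonneg_nonneg mult_nonneg_nonneg)
  finally show "norm (cone_value dg G (negs G v) (%w. q powi pairing m w)) * exp (- t * (rvec m \<bullet> v)) <=
  (\<Sum>h\<in>box G (negs G v). B * (\<Prod>d\<in>G. exp (- \<beta> * \<bar>real_of_int (pairing m d)\<bar>) / c))" .
  qed
  finally show ?thesis .
 qed
 ultimately show ?thesis using t(1) by blast
qed

end

lemma exp_weight_le: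
 fixes x :: real
 assumes "0 <= s" "s <= t" "0 <= t'"
 shows "exp (- s * x) <= exp (- t * x) + exp (t' * x)"
proof (cases "x \<ge> 0")
 case True
 hence "exp (- s * x) <= 1" "1 <= exp (t' * x)" using assms by auto
 thus ?thesis using exp_ge_zero[of "- t * x"] by linarith
next
 case False
 hence "exp (- s * x) <= exp (- t * x)" using assms by (simp add: mult_right_mono_neg)
 thus ?thesis using exp_ge_zero[of "t' * x"] by linarith
qed

text \<open>One majorant for all degree functions with the same separation constant and the same
  bound on H, and for all weights in [0, t]. This uniformity serves both limits, the one in the
  weight and the one in the perturbation of the degree.\<close>

abbreviation bounded_by where
 "bounded_by Fn q c v H B t g \<equiv> g summable_on UNIV \<and>
  (\<forall>dg m s. linear_on_cones Fn dg --> (\<forall>d\<in>ray_generators Fn. sep q (ee (dg d)) c) -->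
  (\<forall>h\<in>H. norm (ee (dg h)) <= B) --> 0 <= s --> s <= t -->
  norm (toric_form_term Fn dg q m) * exp (- s * (rvec m \<bullet> v)) <= g m)"

text \<open>The same term is a facet sum for v and for -v. The first bounds it with weight exp(-t
  m.v), the second with exp(t' m.v), and every weight in [0, t], in particular 0, is at most the sum
  of the two. H collects the box points for both directions.\<close>

lemma toric_form_bound:
 fixes Fn :: "(real ^ 'n) set set"
 assumes fan: "complete_fan Fn" "simplicial_fan Fn" and v: "simplicial_complex_fan.generic (gens Fn ` Fn) v"
  and q: "q ~= 0" "norm q < 1" and c: "c > 0"
 shows "\<exists>H. finite H \<and> (\<forall>B. \<exists>t>0. \<exists>g. bounded_by Fn q c v H B t g)"
proof -
 interpret simplicial_complex_fan "gens Fn ` Fn" by (rule fan_complex[OF fan])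
 let ?K = "gens Fn ` Fn"
 have K: "\<Union>?K \<subseteq> ray_generators Fn" by (auto simp: gens_def)
 define H where "H = (\<Union>G\<in>facets. box G (negs G v) \<union> box G (negs G (- v)))"
 have finH: "finite H" unfolding H_def using finite_facets facetsD(2) finite_box by auto
 have main: "\<exists>t>0. \<exists>g. bounded_by Fn q c v H B t g" for B
 proof -
 obtain t g where t: "t > 0" "g summable_on UNIV" and 1: "\<forall>dg m. (\<forall>d\<in>\<Union>?K. sep q (ee (dg d)) c) -->
  (\<forall>G\<in>facets. \<forall>h\<in>box G (negs G v). norm (ee (dg h)) <= B) -->
  norm (facet_sum dg q v m) * exp (- t * (rvec m \<bullet> v)) <= g m"
  using facet_sum_bound[OF v q c, of B] by blast
 obtain t' g' where t': "t' > 0" "g' summable_on UNIV" and 2: "\<forall>dg m. (\<forall>d\<in>\<Union>?K. sep q (ee (dg d)) c) -->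
  (\<forall>G\<in>facets. \<forall>h\<in>box G (negs G (- v)). norm (ee (dg h)) <= B) -->
  norm (facet_sum dg q (- v) m) * exp (- t' * (rvec m \<bullet> (- v))) <= g' m"
  using facet_sum_bound[OF generic_uminus[OF v] q c, of B] by blast
 show ?thesis
 proof (intro exI[of _ t] exI[of _ "%m. g m + g' m"] conjI allI impI)
  show "t > 0" by fact
  show "(%m. g m + g' m) summable_on UNIV" using t t' by (intro summable_on_add)
  fix dg m and s :: real assume lin: "linear_on_cones Fn dg" and sp: "\<forall>d\<in>ray_generators Fn. sep q (ee (dg d)) c"
  and bd: "\<forall>h\<in>H. norm (ee (dg h)) <= B" and s: "0 <= s" "s <= t"
  have ne: "ee (dg d) * q powi pairing m d ~= 1" if "d \<in> ray_generators Fn" for d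
  by (rule sep_nonzero[OF sp[rule_format, OF that] c])
  have e1: "toric_form_term Fn dg q m = facet_sum dg q v m"
  using toric_form_term_eq[OF fan lin q(1) ne v] by (simp add: facet_sum_def negs_def)
  have e2: "toric_form_term Fn dg q m = facet_sum dg q (- v) m"
  using toric_form_term_eq[OF fan lin q(1) ne generic_uminus[OF v]] by (simp add: facet_sum_def negs_def)
  let ?n = "norm (toric_form_term Fn dg q m)" and ?x = "rvec m \<bullet> v"
  have spK: "\<forall>d\<in>\<Union>?K. sep q (ee (dg d)) c" using sp K by blast
  have b1: "?n * exp (- t * ?x) <= g m"
  unfolding e1 by (rule 1[rule_format, OF spK[rule_format]]) (auto intro!: bd[rule_format] simp: H_def)
  have "norm (facet_sum dg q (- v) m) * exp (- t' * (rvec m \<bullet> (- v))) <= g' m"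
  by (rule 2[rule_format, OF spK[rule_format]]) (auto intro!: bd[rule_format] simp: H_def)
  hence b2: "?n * exp (t' * ?x) <= g' m" unfolding e2 by simp
  have "?n * exp (- s * ?x) <= ?n * (exp (- t * ?x) + exp (t' * ?x))"
  using exp_weight_le[of s t t' ?x] s t' by (intro mult_left_mono) auto
  also have "... <= g m + g' m" using b1 b2 by (simp add: distrib_left)
  finally show "?n * exp (- s * ?x) <= g m + g' m" .
 qed
 qed
 show ?thesis using finH main by blast
qed

section \<open>The theta function and the Kronecker series\<close>

no_notation Infinite_Set_Sum.abs_summable_on (infix "abs'_summable'_on" 50)

abbreviation dtheta where "dtheta \<tau> \<equiv> deriv (%w. theta w \<tau>) 0"

lemma holomorphic_infsum:
 fixes f :: "'a => complex => complex"
 assumes hol: "!!n. f n holomorphic_on UNIV"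
  and bd: "!!R. \<exists>M. M summable_on A \<and> (\<forall>n\<in>A. \<forall>z. norm z <= R --> norm (f n z) <= M n)"
 shows "(%z. \<Sum>\<^sub>\<infinity>n\<in>A. f n z) holomorphic_on UNIV"
proof -
 have "(%z. \<Sum>\<^sub>\<infinity>n\<in>A. f n z) field_differentiable at z" for z
 proof -
  define R where "R = norm z + 1"
  obtain M where M: "M summable_on A" "!!n w. n \<in> A ==> norm w <= R ==> norm (f n w) <= M n"
  using bd[of R] by blast
  have ul: "uniform_limit (cball 0 R) (%X y. \<Sum>x\<in>X. f x y) (%y. \<Sum>\<^sub>\<infinity>x\<in>A. f x y) (finite_subsets_at_top A)"
  by (rule Weierstrass_m_test_general[OF _ M(1)]) (use M(2) in auto)
  have "(%y. \<Sum>\<^sub>\<infinity>x\<in>A. f x y) holomorphic_on ball 0 R"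
  proof (rule holomorphic_uniform_limit[OF _ ul])
  have "(%y. \<Sum>x\<in>X. f x y) holomorphic_on S" for X S
  using hol holomorphic_on_subset by (intro holomorphic_on_sum) blast
  thus "\<forall>\<^sub>F X in finite_subsets_at_top A. continuous_on (cball 0 R) (%y. \<Sum>x\<in>X. f x y) \<and>
  (%y. \<Sum>x\<in>X. f x y) holomorphic_on ball 0 R"
  by (intro always_eventually allI conjI holomorphic_on_imp_continuous_on)
  qed auto
  moreover have "z \<in> ball 0 R" by (simp add: R_def)
  ultimately show ?thesis by (intro holomorphic_on_imp_differentiable_at) auto
 qed
 thus ?thesis by (simp add: holomorphic_on_def)
qed

lemma summable_on_product:
 fixes f :: "'a => complex" and g :: "'b => complex"
 assumes f: "f abs_summable_on A" and g: "g abs_summable_on B"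
 shows "(%(x, y). f x * g y) summable_on (A \<times> B)"
proof (rule abs_summable_summable)
 have "(%p. norm (f (fst p)) * norm (g (snd p))) summable_on A \<times> B"
 proof (rule summable_on_SigmaI)
  fix x assume "x \<in> A"
  show "((%y. norm (f (fst (x, y))) * norm (g (snd (x, y)))) has_sum norm (f x) * infsum (%y. norm (g y)) B) B"
  using has_sum_cmult_right[OF has_sum_infsum[OF g], of "norm (f x)"] by simp
 next
  show "(%x. norm (f x) * infsum (%y. norm (g y)) B) summable_on A" by (rule summable_on_cmult_left[OF f])
 qed auto
 thus "(%(x, y). f x * g y) abs_summable_on (A \<times> B)"
  by (simp add: case_prod_unfold norm_mult)
qed

definition tc :: "complex => int => complex" where
 "tc \<tau> n = (-1) powi n * exp (of_real pi * \<i> * \<tau> * (of_int n + 1 / 2)\<^sup>2)"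

lemma theta_tc: "theta z \<tau> = 1 / \<i> * (\<Sum>\<^sub>\<infinity>n. tc \<tau> n * exp (of_real pi * \<i> * z * (2 * of_int n + 1)))"
 by (simp add: theta_def tc_def)

lemma norm_tc: "norm (tc \<tau> n) = exp (- pi * Im \<tau> * (real_of_int n + 1/2)\<^sup>2)"
proof -
 have "(of_int n + 1 / 2)\<^sup>2 = complex_of_real ((real_of_int n + 1/2)\<^sup>2)" by simp
 hence "norm (exp (of_real pi * \<i> * \<tau> * (of_int n + 1 / 2)\<^sup>2)) = exp (- pi * Im \<tau> * (real_of_int n + 1/2)\<^sup>2)"
  by (simp only: norm_exp_eq_Re) simp
 thus ?thesis by (simp add: tc_def norm_mult norm_power_int)
qed

lemma norm_theta_exp: "norm (exp (of_real pi * \<i> * z * (2 * of_int n + 1))) = exp (- pi * Im z * (2 * real_of_int n + 1))"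
proof -
 have "2 * of_int n + 1 = complex_of_real (2 * real_of_int n + 1)" by simp
 thus ?thesis by (simp only: norm_exp_eq_Re) simp
qed

text \<open>Completing the square in |n + 1/2| absorbs the linear growth from Im z and one further
  |n + 1/2|, which is left over as exponential decay.\<close>

lemma theta_term_bound:
 assumes \<tau>: "Im \<tau> > 0" and z: "\<bar>Im z\<bar> <= R"
 shows "norm (tc \<tau> n * exp (of_real pi * \<i> * z * (2 * of_int n + 1))) <=
  exp ((2 * pi * R + 1)\<^sup>2 / (4 * pi * Im \<tau>) + 1/2) * exp (- 1 * \<bar>real_of_int n\<bar>)"
proof -
 define x where "x = real_of_int n + 1/2"
 define y where "y = Im \<tau>"
 have y: "y > 0" using \<tau> by (simp add: y_def)
 define C where "C = (2 * pi * R + 1)\<^sup>2 / (4 * pi * y)"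
 have "0 <= pi * y * (\<bar>x\<bar> - (2 * pi * R + 1) / (2 * pi * y))\<^sup>2" using y by simp
 also have "... = pi * y * x\<^sup>2 - (2 * pi * R + 1) * \<bar>x\<bar> + C"
  using y by (simp add: C_def power2_diff field_simps power2_eq_square)
 finally have 1: "- pi * y * x\<^sup>2 + 2 * pi * R * \<bar>x\<bar> <= C - \<bar>x\<bar>" by (simp add: algebra_simps)
 have "- (pi * Im z * (2 * x)) <= \<bar>pi * Im z * (2 * x)\<bar>" by linarith
 also have "... = 2 * pi * (\<bar>Im z\<bar> * \<bar>x\<bar>)" by (simp add: abs_mult)
 also have "... <= 2 * pi * (R * \<bar>x\<bar>)" using z by (intro mult_left_mono mult_right_mono) auto
 finally have 2: "- pi * Im z * (2 * x) <= 2 * pi * R * \<bar>x\<bar>" by simp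
 have 3: "- \<bar>x\<bar> <= 1/2 - \<bar>real_of_int n\<bar>" by (simp add: x_def)
 have "norm (tc \<tau> n * exp (of_real pi * \<i> * z * (2 * of_int n + 1))) = exp (- pi * y * x\<^sup>2 + - pi * Im z * (2 * x))"
  by (simp add: norm_mult norm_tc norm_theta_exp x_def y_def exp_add[symmetric] del: norm_exp_eq_Re)
 also have "... <= exp (C + 1/2 + - \<bar>real_of_int n\<bar>)"
  by (subst exp_le_cancel_iff) (use 1 2 3 in linarith)
 finally show ?thesis by (simp only: exp_add C_def y_def mult_minus1 mult_minus_left mult_1)
qed

lemma theta_abs_summable:
 assumes "Im \<tau> > 0"
 shows "(%n. tc \<tau> n * exp (of_real pi * \<i> * z * (2 * of_int n + 1))) abs_summable_on UNIV"
 by (rule summable_on_comparison_test[OF summable_on_cmult_right[OF summable_on_exp_abs_int[of 1]]])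
  (use theta_term_bound[OF assms order_refl] in auto)

lemma holomorphic_theta:
 assumes "Im \<tau> > 0"
 shows "(%z. theta z \<tau>) holomorphic_on UNIV"
proof -
 have "(%z. \<Sum>\<^sub>\<infinity>n. tc \<tau> n * exp (of_real pi * \<i> * z * (2 * of_int n + 1))) holomorphic_on UNIV"
 proof (rule holomorphic_infsum)
  show "(%z. tc \<tau> n * exp (of_real pi * \<i> * z * (2 * of_int n + 1))) holomorphic_on UNIV" for n
  by (intro holomorphic_intros)
  fix R :: real
  show "\<exists>M. M summable_on (UNIV :: int set) \<and> (\<forall>n\<in>UNIV. \<forall>z. norm z <= R -->
  norm (tc \<tau> n * exp (of_real pi * \<i> * z * (2 * of_int n + 1))) <= M n)"
  proof (intro exI conjI ballI allI impI)
  show "(%n::int. exp ((2 * pi * R + 1)\<^sup>2 / (4 * pi * Im \<tau>) + 1/2) * exp (- 1 * \<bar>real_of_int n\<bar>)) summable_on UNIV"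
  by (intro summable_on_cmult_right summable_on_exp_abs_int) simp
  fix n :: int and z :: complex assume "norm z <= R"
  hence "\<bar>Im z\<bar> <= R" using abs_Im_le_cmod[of z] by linarith
  thus "norm (tc \<tau> n * exp (of_real pi * \<i> * z * (2 * of_int n + 1))) <=
  exp ((2 * pi * R + 1)\<^sup>2 / (4 * pi * Im \<tau>) + 1/2) * exp (- 1 * \<bar>real_of_int n\<bar>)"
  by (rule theta_term_bound[OF assms])
  qed
 qed
 thus ?thesis unfolding theta_tc by (intro holomorphic_intros)
qed

lemma tc_reflect: "tc \<tau> (- 1 - n) = - tc \<tau> n"
proof -
 have "(-1 :: complex) powi (- 1 - n) = - ((-1) powi n)"
 proof -
  have sq: "(-1 :: complex) powi n * (-1) powi n = 1" by (simp flip: power_int_mult_distrib)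
  hence "inverse ((-1 :: complex) powi n) = (-1) powi n" by (rule inverse_unique)
  moreover have "(-1 :: complex) powi (- 1 - n) = - inverse ((-1) powi n)"
  by (simp add: power_int_diff power_int_minus divide_inverse)
  ultimately show ?thesis by simp
 qed
 moreover have "(of_int (- 1 - n) + 1 / 2)\<^sup>2 = (of_int n + 1 / 2 :: complex)\<^sup>2"
  by (simp add: power2_eq_square algebra_simps)
 ultimately show ?thesis by (simp add: tc_def)
qed

lemma infsum_tc: "infsum (tc \<tau>) UNIV = 0"
proof -
 have b: "bij (%n::int. - 1 - n)" by (rule involuntory_imp_bij) simp
 have "infsum (tc \<tau>) UNIV = infsum (%n. tc \<tau> (- 1 - n)) UNIV"
  using infsum_reindex_bij_betw[OF b, of "tc \<tau>"] by simp
 also have "... = - infsum (tc \<tau>) UNIV" by (simp add: tc_reflect infsum_uminus)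
 finally show ?thesis by simp
qed

lemma theta_zero: "theta 0 \<tau> = 0"
 by (simp add: theta_tc infsum_tc)

lemma tc_Suc: "tc \<tau> (n + 1) = - (tc \<tau> n * ee \<tau> powi (n + 1))"
proof -
 have ep: "ee \<tau> powi (n + 1) = exp (of_int (n + 1) * (2 * of_real pi * \<i> * \<tau>))"
  by (simp only: ee_def exp_power_int)
 have "(of_int (n + 1) + 1 / 2)\<^sup>2 = (of_int n + 1 / 2 :: complex)\<^sup>2 + 2 * of_int (n + 1)"
  by (simp add: power2_eq_square algebra_simps)
 hence "exp (of_real pi * \<i> * \<tau> * (of_int (n + 1) + 1 / 2)\<^sup>2) =
  exp (of_real pi * \<i> * \<tau> * (of_int n + 1 / 2)\<^sup>2) * ee \<tau> powi (n + 1)"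
  unfolding ep exp_add[symmetric] by (simp add: algebra_simps)
 thus ?thesis by (simp add: tc_def power_int_add_1)
qed

lemma ee_powi: "ee z powi n = ee (of_int n * z)"
 by (simp add: ee_def exp_power_int algebra_simps)

lemma tc_nonzero [simp]: "tc \<tau> n ~= 0" by (simp add: tc_def)

text \<open>The Kronecker series. For w < 0 the sum with numerator 1 would diverge at +infinity;
  replacing 1/(1 - a q^k) by a q^k/(1 - a q^k) subtracts 1 from each coefficient and gives the other
  branch of the same function. The two numerators are those of the half-open cones.\<close>

definition kron :: "complex => complex => real => complex" where
 "kron q a w = (\<Sum>\<^sub>\<infinity>k::int. of_real (exp (- w * real_of_int k)) * (if w > 0 then 1 else a * q powi k) / (1 - a * q powi k))"

lemma kron_abs_summable:
 assumes q: "q ~= 0" "norm q < 1" and s: "sep q a c" "c > 0" and w: "w ~= 0" "\<bar>w\<bar> < - ln (norm q)"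
 shows "(%k::int. of_real (exp (- w * real_of_int k)) * (if w > 0 then 1 else a * q powi k) / (1 - a * q powi k)) abs_summable_on UNIV"
proof -
 define \<beta> where "\<beta> = min \<bar>w\<bar> (- ln (norm q) - \<bar>w\<bar>)"
 have \<beta>: "\<beta> > 0" using w by (simp add: \<beta>_def)
 define A where "A = max 1 (norm a)"
 have S: "(%k::int. A * (exp (- \<beta> * \<bar>real_of_int k\<bar>) / c)) summable_on UNIV"
  using summable_on_cmult_right[OF summable_on_exp_abs_int[OF \<beta>], of "A / c"] by simp
 show ?thesis
 proof (rule summable_on_comparison_test[OF S])
  fix k :: int
  define l where "l = (if w > 0 then 0 else 1 :: real)"
  have n: "norm (if w > 0 then 1 else a * q powi k) <= A * norm q powr (l * k)"
  proof (cases "w > 0")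
  case True thus ?thesis using q by (simp add: l_def A_def)
  next
  case False
  have "norm (q powi k) = norm q powr k" using q by (simp add: norm_power_int powr_real_of_int')
  thus ?thesis using False by (simp add: l_def A_def norm_mult mult_right_mono)
  qed
  have "norm (of_real (exp (- w * k)) * (if w > 0 then 1 else a * q powi k) / (1 - a * q powi k)) <=
  exp (- w * k) * (A * norm q powr (l * k)) / norm (1 - a * q powi k)"
  using n by (auto simp: norm_mult norm_divide intro!: divide_right_mono mult_left_mono)
  also have "... = A * (exp (- w * k) * (norm q powr (l * k)) / norm (1 - a * q powi k))" by simp
  also have "... <= A * (exp (- \<beta> * \<bar>real_of_int k\<bar>) / c)"
  using w by (intro mult_left_mono sep_term_bound[OF q s]) (auto simp: l_def \<beta>_def A_def)
  finally show "norm (of_real (exp (- w * k)) * (if w > 0 then 1 else a * q powi k) / (1 - a * q powi k)) <=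
  A * (exp (- \<beta> * \<bar>real_of_int k\<bar>) / c)" .
 qed auto
qed

text \<open>Kronecker's identity up to a factor independent of w. In the product with the theta
  series the terms are collected by j = n - k; then w enters only through exp(w (j + 1/2)), and the
  coefficient of this obeys the same one-step recursion as the coefficient in theta(z -
  \<open>\<alpha>\<close>).\<close>

lemma kron_theta_product:
 assumes \<tau>: "Im \<tau> > 0" and s: "sep (ee \<tau>) (ee \<alpha>) c" "c > 0" and q1: "norm (ee \<tau>) < 1"
 shows "\<exists>\<kappa>. \<forall>w::real. w ~= 0 --> \<bar>w\<bar> < - ln (norm (ee \<tau>)) -->
  kron (ee \<tau>) (ee \<alpha>) w * theta (- \<i> * w / (2 * pi)) \<tau> = \<kappa> * theta (- \<i> * w / (2 * pi) - \<alpha>) \<tau>"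
proof -
 define q where "q = ee \<tau>"
 define a where "a = ee \<alpha>"
 have q: "q ~= 0" "norm q < 1" using q1 by (auto simp: q_def)
 have a: "a ~= 0" by (simp add: a_def)
 note s = s[folded q_def a_def]
 have ne: "1 - a * q powi k ~= 0" for k using sep_nonzero[OF s, of k] by auto
 define B where "B k = 1 / (1 - a * q powi k)" for k
 have aB: "a * q powi k * B k = B k - 1" for k using ne[of k] by (simp add: B_def field_simps)
 have Bb: "norm (B k) <= 1 / c" for k
 proof -
  have "c * 1 <= c * max 1 (norm q powi k)" using s(2) by (intro mult_left_mono) auto
  also have "... <= norm (1 - a * q powi k)" using s(1) by (simp add: sep_def)
  finally show ?thesis using s(2) by (simp add: B_def norm_divide frac_le)
 qed
 have tcs: "tc \<tau> abs_summable_on UNIV" using theta_abs_summable[OF \<tau>, of 0] by simp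
 have bij: "bij (%k::int. k + j)" for j by (rule o_bij[of "%k. k - j"]) auto
 have tcj: "(%k. tc \<tau> (k + j)) abs_summable_on UNIV" for j
  using tcs summable_on_reindex_bij_betw[OF bij, of "%k. norm (tc \<tau> k)" j] by simp
 have tcj0: "infsum (%k. tc \<tau> (k + j)) UNIV = 0" for j
  using infsum_reindex_bij_betw[OF bij, of "tc \<tau>" j] infsum_tc by simp
 have Btc: "(%k. B k * tc \<tau> (k + j)) abs_summable_on UNIV" for j
 proof (rule summable_on_comparison_test[OF summable_on_cmult_right[OF tcj[of j], of "1 / c"]])
  show "norm (B k * tc \<tau> (k + j)) <= 1 / c * norm (tc \<tau> (k + j))" for k
  unfolding norm_mult by (intro mult_right_mono Bb norm_ge_zero)
 qed auto
 define A where "A j = (\<Sum>\<^sub>\<infinity>k. B k * tc \<tau> (k + j))" for j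
 \<comment> \<open>The numerators 1 and a q^k of the two branches differ by a shifted theta series
   at 0, whose sum is 0. Hence the coefficients, and with them the constant, are the same for both
   signs of w.\<close>
 have A': "(\<Sum>\<^sub>\<infinity>k. a * q powi k * B k * tc \<tau> (k + j)) = A j" for j
 proof -
  have t0: "((%k. tc \<tau> (k + j)) has_sum 0) UNIV"
  using has_sum_infsum[OF abs_summable_summable[OF tcj[of j]]] unfolding tcj0 .
  have "((%k. B k * tc \<tau> (k + j)) has_sum A j) UNIV"
  unfolding A_def by (rule has_sum_infsum[OF abs_summable_summable[OF Btc]])
  from has_sum_add[OF this has_sum_cmult_right[OF t0, of "- 1"]]
  have "((%k. B k * tc \<tau> (k + j) + (- 1) * tc \<tau> (k + j)) has_sum (A j + (- 1) * 0)) UNIV" .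
  moreover have "B k * tc \<tau> (k + j) + (- 1) * tc \<tau> (k + j) = a * q powi k * B k * tc \<tau> (k + j)" for k
  unfolding aB by (simp add: algebra_simps)
  ultimately show ?thesis by (simp add: infsumI)
 qed
 \<comment> \<open>The step from j to j + 1 multiplies the summand by -q^(j+1) q^k, which exchanges
   the two numerators.\<close>
 have Arec: "a * A (j + 1) = - (q powi (j + 1) * A j)" for j
 proof -
  have "A (j + 1) = (\<Sum>\<^sub>\<infinity>k. - (q powi (j + 1) / a) * (a * q powi k * B k * tc \<tau> (k + j)))"
  unfolding A_def
  proof (rule infsum_cong)
  fix k
  have "tc \<tau> (k + (j + 1)) = - (tc \<tau> (k + j) * (q powi (j + 1) * q powi k))"
  using tc_Suc[of \<tau> "k + j"] q(1) by (simp add: q_def[symmetric] add.assoc power_int_add[symmetric] add_ac)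
  thus "B k * tc \<tau> (k + (j + 1)) = - (q powi (j + 1) / a) * (a * q powi k * B k * tc \<tau> (k + j))"
  using a by simp
  qed
  also have "... = - (q powi (j + 1) / a) * A j" by (subst infsum_cmult_right') (simp add: A')
  finally show ?thesis using a by simp
 qed
 define U where "U j = tc \<tau> j * a powi (- j)" for j
 have Urec: "a * U (j + 1) = - (q powi (j + 1) * U j)" for j
 proof -
  have "- (j + 1) = - j - 1" by simp
  hence "a powi (- (j + 1)) = a powi (- j) / a"
  using a by (simp only: power_int_diff power_int_1_right simp_thms)
  hence "a * U (j + 1) = tc \<tau> (j + 1) * a powi (- j)" using a by (simp only: U_def) simp
  also have "tc \<tau> (j + 1) = - (tc \<tau> j * q powi (j + 1))" by (simp only: tc_Suc q_def)
  finally show ?thesis by (simp only: U_def) simp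
 qed
 have AU: "A j * U 0 = A 0 * U j" for j
 proof (induction j rule: int_induct[of _ 0])
  case base show ?case by simp
 next
  case (step1 i)
  have "a * (A (i + 1) * U 0) = - (q powi (i + 1) * (A i * U 0))" using Arec[of i] by (simp add: mult.assoc[symmetric])
  also have "... = A 0 * - (q powi (i + 1) * U i)" using step1 by simp
  also have "... = a * (A 0 * U (i + 1))" unfolding Urec[symmetric] by simp
  finally show ?case using a by simp
 next
  case (step2 i)
  have a1: "a * A i = - (q powi i * A (i - 1))" using Arec[of "i - 1"] by simp
  have u1: "a * U i = - (q powi i * U (i - 1))" using Urec[of "i - 1"] by simp
  have "q powi i * (A (i - 1) * U 0) = - (a * A i) * U 0" unfolding a1 by simp
  also have "... = - (a * (A 0 * U i))" using step2 by simp
  also have "... = A 0 * - (a * U i)" by simp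
  also have "... = q powi i * (A 0 * U (i - 1))" unfolding u1 by simp
  finally show ?case using q by simp
 qed
 have U0: "U 0 ~= 0" by (simp add: U_def)
 \<comment> \<open>The factor \<open>ee (\<alpha> / 2)\<close> makes up for the half-integral
   exponents of theta.\<close>
 define \<kappa> where "\<kappa> = A 0 / U 0 * ee (\<alpha> / 2)"
 show ?thesis
 proof (intro exI[of _ \<kappa>] allI impI)
  fix w :: real assume w: "w ~= 0" "\<bar>w\<bar> < - ln (norm (ee \<tau>))"
  \<comment> \<open>Chosen such that 2 pi i z = w.\<close>
  define z where "z = - \<i> * w / (2 * pi)"
  define b where "b k = of_real (exp (- w * real_of_int k)) * (if w > 0 then 1 else a * q powi k) / (1 - a * q powi k)" for k :: int
  define t where "t n = tc \<tau> n * exp (of_real pi * \<i> * z * (2 * of_int n + 1))" for n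
  have bs: "b abs_summable_on UNIV"
  unfolding b_def by (rule kron_abs_summable[OF q s w[folded q_def]])
  have t': "t = (%n. tc \<tau> n * exp (of_real pi * \<i> * z * (2 * of_int n + 1)))"
  by (simp add: t_def fun_eq_iff)
  have ts: "t abs_summable_on UNIV" unfolding t_def by (rule theta_abs_summable[OF \<tau>])
  have ez: "exp (of_real pi * \<i> * z * (2 * of_int n + 1)) = of_real (exp (w * (real_of_int n + 1/2)))" for n :: int
  by (simp add: z_def exp_of_real[symmetric] field_simps)
  have bt: "b k * t (k + j) = of_real (exp (w * (real_of_int j + 1/2))) * ((if w > 0 then 1 else a * q powi k) * B k * tc \<tau> (k + j))" for k j
  proof -
  have "of_real (exp (- w * real_of_int k)) * of_real (exp (w * (real_of_int (k + j) + 1/2))) = complex_of_real (exp (w * (real_of_int j + 1/2)))"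
  unfolding of_real_mult[symmetric] exp_add[symmetric] by (simp add: algebra_simps)
  hence "(of_real (exp (- w * real_of_int k)) * x) * (y * of_real (exp (w * (real_of_int (k + j) + 1/2)))) = complex_of_real (exp (w * (real_of_int j + 1/2))) * (x * y)" for x y
  by (metis mult.assoc mult.commute)
  note e = this
  have "b k * t (k + j) = (of_real (exp (- w * real_of_int k)) * ((if w > 0 then 1 else a * q powi k) * B k)) *
  (tc \<tau> (k + j) * of_real (exp (w * (real_of_int (k + j) + 1/2))))"
  unfolding b_def t_def ez B_def by (simp only: divide_inverse mult_1_left mult_ac)
  thus ?thesis by (simp only: e)
  qed
  have inner: "(\<Sum>\<^sub>\<infinity>k. b k * t (k + j)) = of_real (exp (w * (real_of_int j + 1/2))) * A j" for j
  proof -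
  have "(\<Sum>\<^sub>\<infinity>k. (if w > 0 then 1 else a * q powi k) * B k * tc \<tau> (k + j)) = A j"
  using A'[of j] by (cases "w > 0") (simp_all add: A_def)
  thus ?thesis unfolding bt by (subst infsum_cmult_right') simp
  qed
  have prod: "(%(k, n). b k * t n) summable_on UNIV \<times> UNIV" by (rule summable_on_product[OF bs ts])
  have bij2: "bij_betw (%(k, j). (k, k + j)) (UNIV \<times> UNIV) (UNIV \<times> UNIV :: (int \<times> int) set)"
  by (rule bij_betw_byWitness[of _ "%(k, n). (k, n - k)"]) auto
  have prod2: "(%(k, j). b k * t (k + j)) summable_on UNIV \<times> UNIV"
  using prod summable_on_reindex_bij_betw[OF bij2, of "%(k, n). b k * t n"] by (simp add: case_prod_unfold)
  have "kron q a w * infsum t UNIV = (\<Sum>\<^sub>\<infinity>k. b k * infsum t UNIV)"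
  unfolding kron_def b_def[symmetric] by (simp add: infsum_cmult_left')
  also have "... = (\<Sum>\<^sub>\<infinity>k. \<Sum>\<^sub>\<infinity>n. b k * t n)" by (simp add: infsum_cmult_right')
  also have "... = (\<Sum>\<^sub>\<infinity>k. \<Sum>\<^sub>\<infinity>j. b k * t (k + j))"
  proof (rule infsum_cong)
  fix k
  have "bij (%j::int. k + j)" by (rule o_bij[of "%j. j - k"]) auto
  from infsum_reindex_bij_betw[OF this, of "%n. b k * t n"]
  show "(\<Sum>\<^sub>\<infinity>n. b k * t n) = (\<Sum>\<^sub>\<infinity>j. b k * t (k + j))" by simp
  qed
  also have "... = (\<Sum>\<^sub>\<infinity>j. \<Sum>\<^sub>\<infinity>k. b k * t (k + j))" by (rule infsum_swap_banach[OF prod2])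
  also have "... = (\<Sum>\<^sub>\<infinity>j. of_real (exp (w * (real_of_int j + 1/2))) * A j)" by (simp only: inner)
  also have "... = (\<Sum>\<^sub>\<infinity>j. (A 0 / U 0 * ee (\<alpha> / 2)) * (tc \<tau> j * exp (of_real pi * \<i> * (z - \<alpha>) * (2 * of_int j + 1))))"
  proof (rule infsum_cong)
  fix j
  have "A j = A 0 / U 0 * U j" using AU[of j] U0 by (simp add: field_simps)
  moreover have "exp (of_real pi * \<i> * (z - \<alpha>) * (2 * of_int j + 1)) =
  of_real (exp (w * (real_of_int j + 1/2))) * (ee (- \<alpha> / 2) * a powi (- j))"
  unfolding ez[symmetric] a_def ee_powi unfolding ee_def exp_add[symmetric] by (simp add: algebra_simps)
  moreover have "ee (\<alpha> / 2) * ee (- \<alpha> / 2) = 1" by (simp flip: ee_add)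
  ultimately show "of_real (exp (w * (real_of_int j + 1/2))) * A j =
  (A 0 / U 0 * ee (\<alpha> / 2)) * (tc \<tau> j * exp (of_real pi * \<i> * (z - \<alpha>) * (2 * of_int j + 1)))"
  by (simp add: U_def)
  qed
  also have "... = \<kappa> * (\<Sum>\<^sub>\<infinity>j. tc \<tau> j * exp (of_real pi * \<i> * (z - \<alpha>) * (2 * of_int j + 1)))"
  by (subst infsum_cmult_right') (simp add: \<kappa>_def)
  finally have "kron q a w * infsum t UNIV = \<kappa> * (\<Sum>\<^sub>\<infinity>j. tc \<tau> j * exp (of_real pi * \<i> * (z - \<alpha>) * (2 * of_int j + 1)))" .
  thus "kron (ee \<tau>) (ee \<alpha>) w * theta (- \<i> * w / (2 * pi)) \<tau> = \<kappa> * theta (- \<i> * w / (2 * pi) - \<alpha>) \<tau>"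
  unfolding theta_tc z_def[symmetric] q_def[symmetric] a_def[symmetric] t'[symmetric] by simp
 qed
qed

lemma theta_deriv:
 assumes "Im \<tau> > 0"
 shows "((%z. theta z \<tau>) has_field_derivative dtheta \<tau>) (at 0)"
 using holomorphic_theta[OF assms] by (intro holomorphic_derivI[of _ UNIV]) auto

lemma continuous_theta:
 assumes "Im \<tau> > 0" "(f \<longlongrightarrow> z) F"
 shows "((%x. theta (f x) \<tau>) \<longlongrightarrow> theta z \<tau>) F"
proof -
 have "isCont (%z. theta z \<tau>) z"
  using holomorphic_theta[OF assms(1)] holomorphic_on_imp_continuous_on continuous_on_eq_continuous_at open_UNIV by blast
 thus ?thesis using assms(2) by (rule isCont_tendsto_compose)
qed

lemma theta_quotient_limit:
 assumes "Im \<tau> > 0"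
 shows "((%w::real. theta (- \<i> * w / (2 * pi)) \<tau> / w) \<longlongrightarrow> dtheta \<tau> / (2 * pi * \<i>)) (at 0)"
proof -
 let ?z = "%w::real. - \<i> * w / (2 * pi)"
 have "((%z. theta z \<tau> / z) \<longlongrightarrow> dtheta \<tau>) (at 0)"
  using theta_deriv[OF assms] by (simp add: has_field_derivative_iff theta_zero)
 moreover have "filterlim ?z (at 0) (at 0)"
 proof (rule filterlim_atI)
  show "(?z \<longlongrightarrow> 0) (at 0)" by (rule tendsto_eq_rhs, (rule tendsto_intros)+) auto
  show "\<forall>\<^sub>F w in at 0. ?z w ~= 0" by (auto simp: eventually_at_filter)
 qed
 ultimately have "((%w. theta (?z w) \<tau> / ?z w) \<longlongrightarrow> dtheta \<tau>) (at 0)"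
  by (rule filterlim_compose)
 hence "((%w. theta (?z w) \<tau> / ?z w * (- \<i> / (2 * pi))) \<longlongrightarrow> dtheta \<tau> * (- \<i> / (2 * pi))) (at 0)"
  by (rule tendsto_mult_right)
 hence "((%w. theta (?z w) \<tau> / w) \<longlongrightarrow> dtheta \<tau> * (- \<i> / (2 * pi))) (at 0)"
  by (rule Lim_transform_eventually) (auto simp: eventually_at_filter field_simps)
 moreover have "x * (- \<i> / (2 * pi)) = x / (2 * pi * \<i>)" for x :: complex
 proof -
  have "x * (- \<i> / (2 * pi)) * (2 * pi * \<i>) = x" by simp
  thus ?thesis by (subst nonzero_eq_divide_eq) (simp_all only:, simp)
 qed
 ultimately show ?thesis by simp
qed

text \<open>For w > 0 this is the sum over k >= -h, for w < 0 minus the sum over k < -h. Both give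
  the same closed form, which makes it usable in all maximal cones alike.\<close>

lemma geometric_int_has_sum:
 fixes w :: real and h :: int
 assumes "w ~= 0"
 defines "f \<equiv> %k::int. complex_of_real (exp (- w * real_of_int k)) * ((if k \<ge> - h then 1 else 0) - (if w > 0 then 0 else 1))"
 shows "(f has_sum of_real (exp (w * h) / (1 - exp (- w)))) UNIV" "(%k. norm (f k)) summable_on UNIV"
proof -
 define x where "x = exp (- \<bar>w\<bar>)"
 have x: "0 < x" "x < 1" using assms(1) by (auto simp: x_def)
 have nat: "((%n::nat. complex_of_real x ^ n) has_sum 1 / (1 - of_real x)) UNIV"
  by (rule norm_summable_imp_has_sum) (use x in \<open>auto simp: norm_power summable_geometric intro!: geometric_sums\<close>)
 have natn: "(%n::nat. norm (complex_of_real x ^ n)) summable_on UNIV"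
  by (rule norm_summable_imp_summable_on) (use x in \<open>auto simp: norm_power summable_geometric\<close>)
 have xp: "complex_of_real x ^ n = of_real (exp (- \<bar>w\<bar> * real n))" for n
  by (simp add: x_def exp_of_nat_mult[symmetric] mult.commute flip: of_real_power)
 \<comment> \<open>Enumerates the support of f outwards from its end, in either direction, so that
   both cases become one geometric series in x.\<close>
 define e where "e = (%n::nat. if w > 0 then int n - h else - h - 1 - int n)"
 have inj: "inj e" by (auto simp: e_def inj_on_def)
 define C where "C = complex_of_real (if w > 0 then exp (w * h) else - exp (w * h) * exp w)"
 have fe: "f (e n) = C * of_real x ^ n" for n
  unfolding xp using assms(1)
  by (auto simp: f_def e_def C_def exp_add[symmetric] algebra_simps simp flip: of_real_mult)
 have out: "f k = 0" if "k \<notin> range e" for k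
 proof (cases "w > 0")
  case True
  have "\<not> k \<ge> - h"
  proof
  assume "k \<ge> - h"
  hence "k = e (nat (k + h))" using True by (simp add: e_def)
  thus False using that by blast
  qed
  thus ?thesis using True by (simp add: f_def)
 next
  case False
  have "k \<ge> - h"
  proof (rule ccontr)
  assume "\<not> k \<ge> - h"
  hence "k = e (nat (- h - 1 - k))" using False by (simp add: e_def)
  thus False using that by blast
  qed
  thus ?thesis using False by (simp add: f_def)
 qed
 have "((%n. C * of_real x ^ n) has_sum C * (1 / (1 - of_real x))) UNIV" by (rule has_sum_cmult_right[OF nat])
 hence "(f has_sum C * (1 / (1 - of_real x))) (range e)"
  by (subst has_sum_reindex[OF inj]) (simp add: o_def fe)
 hence "(f has_sum C * (1 / (1 - of_real x))) UNIV"
  by (rule has_sum_cong_neutral[THEN iffD1, rotated -1]) (use out in auto)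
 moreover have "C * (1 / (1 - of_real x)) = of_real (exp (w * h) / (1 - exp (- w)))"
 proof (cases "w > 0")
  case True thus ?thesis by (simp add: C_def x_def)
 next
  case False
  have "1 - exp w ~= 0" using assms(1) by simp
  moreover have "1 - exp (- w) ~= 0" using assms(1) by simp
  moreover have "exp w * exp (- w) = 1" by (simp flip: exp_add)
  ultimately have "- exp (w * h) * exp w * (1 / (1 - exp w)) = exp (w * h) / (1 - exp (- w))" by (simp add: field_simps)
  moreover have "C * (1 / (1 - of_real x)) = of_real (- exp (w * h) * exp w * (1 / (1 - exp w)))"
  using False by (simp add: C_def x_def)
  ultimately show ?thesis by (simp only:)
 qed
 ultimately show "(f has_sum of_real (exp (w * h) / (1 - exp (- w)))) UNIV" by simp
 have "(%n. norm (C * of_real x ^ n)) summable_on UNIV" unfolding norm_mult by (rule summable_on_cmult_right[OF natn])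
 hence "(%k. norm (f k)) summable_on range e"
  by (subst summable_on_reindex[OF inj]) (simp add: o_def fe)
 thus "(%k. norm (f k)) summable_on UNIV"
  by (rule summable_on_cong_neutral[THEN iffD1, rotated -1]) (use out in auto)
qed

text \<open>Comparison as w -> 0+. The Kronecker series is 1/(1 - exp(-w)) plus a bounded remainder,
  and theta vanishes at 0 with derivative \<open>dtheta \<tau>\<close>.\<close>

lemma kron_theta_constant:
 assumes \<tau>: "Im \<tau> > 0" and s: "sep (ee \<tau>) (ee \<alpha>) c" "c > 0" and q1: "norm (ee \<tau>) < 1"
  and \<kappa>: "!!w::real. w ~= 0 ==> \<bar>w\<bar> < - ln (norm (ee \<tau>)) ==>
  kron (ee \<tau>) (ee \<alpha>) w * theta (- \<i> * w / (2 * pi)) \<tau> = \<kappa> * theta (- \<i> * w / (2 * pi) - \<alpha>) \<tau>"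
 shows "\<kappa> * theta (- \<alpha>) \<tau> = dtheta \<tau> / (2 * pi * \<i>)"
proof -
 define q where "q = ee \<tau>"
 define a where "a = ee \<alpha>"
 define L where "L = - ln (norm q)"
 have q: "q ~= 0" "norm q < 1" using q1 by (auto simp: q_def)
 have L: "L > 0" using q by (simp add: L_def)
 note s = s[folded q_def a_def]
 let ?z = "%w::real. - \<i> * w / (2 * pi)"
 have ne: "1 - a * q powi k ~= 0" for k using sep_nonzero[OF s, of k] by auto
 \<comment> \<open>The geometric series over k >= 0 carries the pole; what remains decays like
   |q|^|k| on both sides.\<close>
 define R where "R k = 1 / (1 - a * q powi k) - (if k \<ge> 0 then 1 else 0)" for k
 define C where "C = max 1 (norm a) / c"
 have C0: "C \<ge> 0" using s by (simp add: C_def)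
 have Rb: "norm (R k) <= C * exp (- L * \<bar>real_of_int k\<bar>)" for k
 proof (cases "k \<ge> 0")
  case True
  have "R k = a * q powi k / (1 - a * q powi k)" using ne[of k] True by (simp add: R_def field_simps)
  hence "norm (R k) = norm a * norm q powr k / norm (1 - a * q powi k)"
  using q by (simp add: norm_divide norm_mult norm_power_int powr_real_of_int')
  also have "... <= max 1 (norm a) * norm q powr k / c"
  proof (intro frac_le mult_right_mono)
  have "c * 1 <= c * max 1 (norm q powi k)" using s(2) by (intro mult_left_mono) auto
  also have "... <= norm (1 - a * q powi k)" using s(1) by (simp add: sep_def)
  finally show "c <= norm (1 - a * q powi k)" by simp
  qed (use s in auto)
  also have "norm q powr k = exp (- L * \<bar>real_of_int k\<bar>)" using q True by (simp add: powr_def L_def)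
  finally show ?thesis by (simp add: C_def)
 next
  case False
  have "c * norm q powi k <= c * max 1 (norm q powi k)" using s(2) by (intro mult_left_mono) auto
  also have "... <= norm (1 - a * q powi k)" using s(1) by (simp add: sep_def)
  finally have le: "c * norm q powi k <= norm (1 - a * q powi k)" .
  have pos: "0 < c * norm q powi k" using s(2) q by simp
  have "norm (R k) = 1 / norm (1 - a * q powi k)" using False by (simp add: R_def norm_divide)
  also have "... <= 1 / (c * norm q powi k)" using le pos by (intro frac_le) auto
  also have "norm q powi k = exp (L * \<bar>real_of_int k\<bar>)" using q False
  by (simp add: powr_real_of_int'[symmetric] powr_def L_def)
  also have "1 / (c * exp (L * \<bar>real_of_int k\<bar>)) = 1 / c * exp (- L * \<bar>real_of_int k\<bar>)"
  by (simp add: exp_minus field_simps)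
  also have "... <= C * exp (- L * \<bar>real_of_int k\<bar>)" using s(2) by (intro mult_right_mono) (auto simp: C_def divide_right_mono)
  finally show ?thesis .
 qed
 define S where "S = (\<Sum>\<^sub>\<infinity>k::int. C * exp (- (L / 2) * \<bar>real_of_int k\<bar>))"
 define rem where "rem w = (\<Sum>\<^sub>\<infinity>k::int. of_real (exp (- w * real_of_int k)) * R k)" for w :: real
 have Ssum: "(%k::int. C * exp (- (L / 2) * \<bar>real_of_int k\<bar>)) summable_on UNIV"
  using L by (intro summable_on_cmult_right summable_on_exp_abs_int) auto
 have dom: "norm (of_real (exp (- w * real_of_int k)) * R k) <= C * exp (- (L / 2) * \<bar>real_of_int k\<bar>)"
  if w: "0 < w" "w < L / 2" for w k
 proof -
  have "exp (- w * real_of_int k) <= exp (L / 2 * \<bar>real_of_int k\<bar>)"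
  proof -
  have "- w * real_of_int k <= w * \<bar>real_of_int k\<bar>" using w by (simp add: abs_if)
  also have "... <= L / 2 * \<bar>real_of_int k\<bar>" using w by (intro mult_right_mono) auto
  finally show ?thesis by simp
  qed
  hence "norm (of_real (exp (- w * real_of_int k)) * R k) <= exp (L / 2 * \<bar>real_of_int k\<bar>) * (C * exp (- L * \<bar>real_of_int k\<bar>))"
  unfolding norm_mult using Rb[of k] by (intro mult_mono) auto
  also have "... = C * exp (L / 2 * \<bar>real_of_int k\<bar> + - L * \<bar>real_of_int k\<bar>)" by (simp only: exp_add mult_ac)
  also have "L / 2 * \<bar>real_of_int k\<bar> + - L * \<bar>real_of_int k\<bar> = - (L / 2) * \<bar>real_of_int k\<bar>" by (simp add: field_simps)
  finally show ?thesis .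
 qed
 have remsum: "(%k::int. norm (of_real (exp (- w * real_of_int k)) * R k)) summable_on UNIV" if w: "0 < w" "w < L / 2" for w
  by (rule summable_on_comparison_test[OF Ssum dom[OF w]]) auto
 have remb: "norm (rem w) <= S" if w: "0 < w" "w < L / 2" for w
  unfolding rem_def S_def
  by (rule order_trans[OF norm_infsum_bound[OF remsum[OF w]] infsum_mono[OF remsum[OF w] Ssum dom[OF w]]])
 have geo: "((%k::int. complex_of_real (exp (- w * real_of_int k)) * (if k \<ge> 0 then 1 else 0)) has_sum of_real (1 / (1 - exp (- w)))) UNIV"
  if w: "0 < w" for w :: real
  using geometric_int_has_sum(1)[of w 0] w by simp
 have kr: "kron q a w = of_real (1 / (1 - exp (- w))) + rem w" if w: "0 < w" "w < L / 2" for w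
 proof -
  have "((%k::int. of_real (exp (- w * real_of_int k)) * (if k \<ge> 0 then 1 else 0) + of_real (exp (- w * real_of_int k)) * R k)
  has_sum (of_real (1 / (1 - exp (- w))) + rem w)) UNIV"
  unfolding rem_def by (rule has_sum_add[OF geo[OF w(1)] has_sum_infsum[OF abs_summable_summable[OF remsum[OF w]]]])
  moreover have "of_real (exp (- w * real_of_int k)) * (if k \<ge> 0 then 1 else 0) + of_real (exp (- w * real_of_int k)) * R k
  = of_real (exp (- w * real_of_int k)) * (if w > 0 then 1 else a * q powi k) / (1 - a * q powi k)" for k
  using w(1) by (simp add: R_def algebra_simps)
  ultimately show ?thesis unfolding kron_def by (simp add: infsumI)
 qed
 have ev: "\<forall>\<^sub>F w in at_right (0::real). 0 < w \<and> w < L / 2"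
  using L by (auto simp: eventually_at_right_field intro: exI[of _ "L / 2"])
 have tq: "((%w::real. theta (?z w) \<tau> / w) \<longlongrightarrow> dtheta \<tau> / (2 * pi * \<i>)) (at_right 0)"
  using theta_quotient_limit[OF \<tau>] by (rule tendsto_within_subset) auto
 have zl: "(?z \<longlongrightarrow> 0) (at_right 0)" by (rule tendsto_eq_rhs, (rule tendsto_intros)+) auto
 have t0: "((%w::real. theta (?z w) \<tau>) \<longlongrightarrow> 0) (at_right 0)"
  using continuous_theta[OF \<tau> zl] by (simp add: theta_zero)
 have r0: "((%w. rem w * theta (?z w) \<tau>) \<longlongrightarrow> 0) (at_right 0)"
 proof (rule Lim_null_comparison)
  show "\<forall>\<^sub>F w in at_right 0. norm (rem w * theta (?z w) \<tau>) <= S * norm (theta (?z w) \<tau>)"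
  using ev by eventually_elim (auto simp: norm_mult intro!: mult_right_mono remb)
  show "((%w. S * norm (theta (?z w) \<tau>)) \<longlongrightarrow> 0) (at_right 0)"
  using tendsto_mult_right_zero[OF tendsto_norm_zero[OF t0]] by simp
 qed
 have we: "((%w::real. w / (1 - exp (- w))) \<longlongrightarrow> 1) (at_right 0)" by real_asymp
 have "((%w. of_real (w / (1 - exp (- w))) * (theta (?z w) \<tau> / w) + rem w * theta (?z w) \<tau>) \<longlongrightarrow>
  of_real 1 * (dtheta \<tau> / (2 * pi * \<i>)) + 0) (at_right 0)"
  by (intro tendsto_add tendsto_mult tendsto_of_real we tq r0)
 moreover have "\<forall>\<^sub>F w in at_right 0. of_real (w / (1 - exp (- w))) * (theta (?z w) \<tau> / w) + rem w * theta (?z w) \<tau> =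
  \<kappa> * theta (?z w - \<alpha>) \<tau>"
  using ev
 proof eventually_elim
  case (elim w)
  have "of_real (w / (1 - exp (- w))) * (theta (?z w) \<tau> / w) = of_real (1 / (1 - exp (- w))) * theta (?z w) \<tau>"
  using elim by simp
  hence "of_real (w / (1 - exp (- w))) * (theta (?z w) \<tau> / w) + rem w * theta (?z w) \<tau> = kron q a w * theta (?z w) \<tau>"
  using kr[of w] elim by (simp only: distrib_right)
  also have "... = \<kappa> * theta (?z w - \<alpha>) \<tau>"
  unfolding q_def a_def by (rule \<kappa>) (use elim L in \<open>auto simp: L_def q_def\<close>)
  finally show ?case .
 qed
 ultimately have "((%w. \<kappa> * theta (?z w - \<alpha>) \<tau>) \<longlongrightarrow> of_real 1 * (dtheta \<tau> / (2 * pi * \<i>)) + 0) (at_right 0)"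
  by (rule Lim_transform_eventually)
 moreover have "((%w. \<kappa> * theta (?z w - \<alpha>) \<tau>) \<longlongrightarrow> \<kappa> * theta (0 - \<alpha>) \<tau>) (at_right 0)"
  by (intro tendsto_mult_left continuous_theta[OF \<tau>] tendsto_diff zl tendsto_const)
 ultimately have "\<kappa> * theta (0 - \<alpha>) \<tau> = of_real 1 * (dtheta \<tau> / (2 * pi * \<i>)) + 0"
  using tendsto_unique trivial_limit_at_right_real by blast
 thus ?thesis by simp
qed

text \<open>For small q the terms n = 0 and n = -1 dominate; together they are a multiple of sin(pi
  z), with derivative 2 pi |tc 0| at 0 in absolute value. The rest is at most 2 |tc 0| on the unit
  disc, hence so is its derivative at 0 by Cauchy's inequality. The bound exp(-30) is what makes
  this crude estimate work.\<close>

lemma theta_deriv_nonzero: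
 assumes \<tau>: "Im \<tau> > 0" and q: "norm (ee \<tau>) < exp (- 30)"
 shows "dtheta \<tau> ~= 0"
proof -
 define y where "y = pi * Im \<tau>"
 have "norm (ee \<tau>) = exp (- 2 * y)" by (simp add: ee_def y_def)
 with q have y: "y > 15" by simp
 define f where "f n z = tc \<tau> n * exp (of_real pi * \<i> * z * (2 * of_int n + 1))" for n and z
 \<comment> \<open>The index n and its mirror image -1 - n give the same m, so off the two leading
   terms each m >= 1 occurs twice, and (n + 1/2)^2 = 1/4 + m (m + 1).\<close>
 define m where "m n = (if n \<ge> 0 then n else - 1 - n)" for n :: int
 define A where "A = UNIV - {0, - 1 :: int}"
 have fb: "norm (f n z) <= norm (tc \<tau> 0) * exp (- 18 * m n)" if n: "n \<in> A" and z: "norm z <= 1" for n z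
 proof -
  have m1: "real_of_int (m n) \<ge> 1" using n by (auto simp: A_def m_def)
  have e: "(real_of_int n + 1/2)\<^sup>2 = (1/2)\<^sup>2 + m n * (m n + 1)"
  by (auto simp: m_def power2_eq_square algebra_simps)
  have a: "\<bar>2 * real_of_int n + 1\<bar> = 2 * m n + 1" by (auto simp: m_def)
  have "\<bar>Im z\<bar> <= 1" using z abs_Im_le_cmod[of z] by linarith
  hence "- pi * Im z * (2 * real_of_int n + 1) <= pi * 1 * \<bar>2 * real_of_int n + 1\<bar>"
  proof -
  have "- pi * Im z * (2 * real_of_int n + 1) <= \<bar>pi * Im z * (2 * real_of_int n + 1)\<bar>" by linarith
  also have "... = pi * \<bar>Im z\<bar> * \<bar>2 * real_of_int n + 1\<bar>" by (simp add: abs_mult)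
  also have "... <= pi * 1 * \<bar>2 * real_of_int n + 1\<bar>" using \<open>\<bar>Im z\<bar> <= 1\<close> by (intro mult_right_mono mult_left_mono) auto
  finally show ?thesis .
  qed
  also have "... = pi * (2 * m n + 1)" by (simp add: a)
  also have "... <= 4 * real_of_int (2 * m n + 1)" using pi_less_4 m1 by (intro mult_right_mono) auto
  also have "... <= 12 * m n" using m1 by simp
  finally have 1: "- pi * Im z * (2 * real_of_int n + 1) <= 12 * m n" .
  \<comment> \<open>The Gaussian contributes at least 30 m and the factor in z at most 12 m, because
    pi < 4 and 2 m + 1 <= 3 m; the difference is the exponent 18.\<close>
  have "15 * (real_of_int (m n) * 2) <= y * (m n * (m n + 1))" using y m1 by (intro mult_mono) auto
  hence 2: "- pi * Im \<tau> * (m n * (m n + 1)) <= - 30 * m n" by (simp add: y_def)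
  have "norm (f n z) = exp (- pi * Im \<tau> * (1/2)\<^sup>2 + (- pi * Im \<tau> * (m n * (m n + 1)) + - pi * Im z * (2 * real_of_int n + 1)))"
  unfolding f_def norm_mult norm_tc norm_theta_exp exp_add[symmetric] e by (simp add: algebra_simps)
  also have "... <= exp (- pi * Im \<tau> * (1/2)\<^sup>2 + - 18 * m n)"
  by (subst exp_le_cancel_iff) (use 1 2 in linarith)
  also have "... = norm (tc \<tau> 0) * exp (- 18 * m n)" by (simp only: exp_add norm_tc) simp
  finally show ?thesis .
 qed
 define x :: real where "x = exp (- 18)"
 have x: "0 < x" "x <= 1/2"
 proof -
  have "(2::real) <= 1 + 18" by simp
  also have "... <= exp 18" by (rule exp_ge_add_one_self)
  finally show "x <= 1/2" by (simp add: x_def exp_minus field_simps)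
 qed (simp add: x_def)
 have nat: "((%k::nat. x ^ Suc k) has_sum x / (1 - x)) UNIV"
 proof (rule norm_summable_imp_has_sum)
  show "summable (%k. norm (x ^ Suc k))" using x by (simp add: norm_power norm_mult summable_geometric summable_mult)
  show "(%k. x ^ Suc k) sums (x / (1 - x))" using sums_mult[OF geometric_sums[of x], of x] x by simp
 qed
 have ex: "exp (real_of_int (- 18 * int (Suc k))) = x ^ Suc k" for k
 proof -
  have "real_of_int (- 18 * int (Suc k)) = real (Suc k) * (- 18)" by simp
  thus ?thesis by (simp only: x_def exp_of_nat_mult)
 qed
 have mk: "m (int (Suc k)) = int (Suc k)" "m (- 1 - int (Suc k)) = int (Suc k)" for k by (auto simp: m_def)
 have "((%n. exp (- 18 * m n)) \<circ> (%k. int (Suc k))) = (%k. x ^ Suc k)"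
  by (rule ext) (simp only: o_def mk ex)
 hence s1: "((%n. exp (- 18 * m n)) has_sum x / (1 - x)) (range (%k. int (Suc k)))"
  using nat by (subst has_sum_reindex) (simp_all only: inj_on_def of_nat_eq_iff nat.inject, simp)
 have inj2: "inj (%k. - 1 - int (Suc k))" by (simp add: inj_on_def)
 have "((%n. exp (- 18 * m n)) \<circ> (%k. - 1 - int (Suc k))) = (%k. x ^ Suc k)"
  by (rule ext) (simp only: o_def mk ex)
 hence s2: "((%n. exp (- 18 * m n)) has_sum x / (1 - x)) (range (%k. - 1 - int (Suc k)))"
  using nat by (subst has_sum_reindex[OF inj2]) (simp only:)
 have "range (%k. int (Suc k)) \<inter> range (%k. - 1 - int (Suc k)) = {}" by auto
 from has_sum_Un_disjoint[OF s1 s2 this] have "((%n. exp (- 18 * m n)) has_sum x / (1 - x) + x / (1 - x)) (range (%k. int (Suc k)) \<union> range (%k. - 1 - int (Suc k)))" .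
 moreover have "n \<in> range (%k. int (Suc k)) \<union> range (%k. - 1 - int (Suc k)) \<longleftrightarrow> n \<in> A" for n
 proof -
  consider "n > 0" | "n = 0" | "n = - 1" | "n < - 1" by linarith
  thus ?thesis
  proof cases
  case 1
  hence "n = int (Suc (nat n - 1))" by simp
  hence "n \<in> range (%k. int (Suc k))" by (rule range_eqI)
  thus ?thesis using 1 by (simp add: A_def)
  next
  case 4
  hence "n = - 1 - int (Suc (nat (- 1 - n) - 1))" by simp
  hence "n \<in> range (%k. - 1 - int (Suc k))" by (rule range_eqI)
  thus ?thesis using 4 by (simp add: A_def)
  qed (auto simp: A_def)
 qed
 hence "range (%k. int (Suc k)) \<union> range (%k. - 1 - int (Suc k)) = A" by blast
 ultimately have Asum: "((%n. exp (- 18 * m n)) has_sum x / (1 - x) + x / (1 - x)) A" by simp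
 have xx: "x / (1 - x) <= 1" using x by (simp add: field_simps)
 define g where "g z = (\<Sum>\<^sub>\<infinity>n\<in>A. f n z)" for z
 have fsum: "(%n. norm (f n z)) summable_on UNIV" for z unfolding f_def by (rule theta_abs_summable[OF \<tau>])
 have gb: "norm (g z) <= norm (tc \<tau> 0) * 2" if z: "norm z <= 1" for z
 proof -
  have fA: "(%n. norm (f n z)) summable_on A" using fsum by (rule summable_on_subset_banach) simp
  have mA: "(%n. norm (tc \<tau> 0) * exp (- 18 * m n)) summable_on A"
  using Asum by (intro summable_on_cmult_right) (rule has_sum_imp_summable)
  have "norm (g z) <= (\<Sum>\<^sub>\<infinity>n\<in>A. norm (f n z))" unfolding g_def by (rule norm_infsum_bound[OF fA])
  also have "... <= (\<Sum>\<^sub>\<infinity>n\<in>A. norm (tc \<tau> 0) * exp (- 18 * m n))" by (rule infsum_mono[OF fA mA fb[OF _ z]])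
  also have "... = norm (tc \<tau> 0) * (x / (1 - x) + x / (1 - x))" using infsumI[OF Asum] by (simp add: infsum_cmult_right')
  also have "... <= norm (tc \<tau> 0) * 2" using xx by (intro mult_left_mono) auto
  finally show ?thesis .
 qed
 have \<theta>g: "\<i> * theta z \<tau> = g z + tc \<tau> 0 * (2 * \<i> * sin (of_real pi * z))" for z
 proof -
  have "\<i> * theta z \<tau> = infsum (%n. f n z) UNIV" by (simp add: theta_tc f_def)
  also have "... = g z + sum (%n. f n z) {0, - 1}"
  using infsum_Diff[OF abs_summable_summable[OF fsum[of z]], of "{0, -1}"] by (simp add: g_def A_def)
  also have "sum (%n. f n z) {0, - 1} = tc \<tau> 0 * (2 * \<i> * sin (of_real pi * z))"
  proof -
  have "2 * \<i> * sin (of_real pi * z) = exp (\<i> * (of_real pi * z)) - exp (- (\<i> * (of_real pi * z)))"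
  by (simp add: sin_exp_eq)
  moreover have "sum (%n. f n z) {0, - 1} = tc \<tau> 0 * exp (\<i> * (of_real pi * z)) + - tc \<tau> 0 * exp (- (\<i> * (of_real pi * z)))"
  using tc_reflect[of \<tau> 0] by (simp add: f_def mult_ac)
  ultimately show ?thesis by (simp add: right_diff_distrib)
  qed
  finally show ?thesis .
 qed
 have gtheta: "g = (%z. \<i> * theta z \<tau> - tc \<tau> 0 * (2 * \<i> * sin (of_real pi * z)))" using \<theta>g by (auto simp: fun_eq_iff)
 have gh: "g holomorphic_on UNIV"
  unfolding gtheta by (intro holomorphic_intros holomorphic_theta \<tau>)
 have "norm ((deriv ^^ 1) g 0) <= fact 1 * (norm (tc \<tau> 0) * 2) / 1 ^ 1"
  by (rule Cauchy_inequality[OF holomorphic_on_subset[OF gh] continuous_on_subset[OF holomorphic_on_imp_continuous_on[OF gh]]])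
  (use gb in auto)
 hence gd: "norm (deriv g 0) <= norm (tc \<tau> 0) * 2" by simp
 have "(g has_field_derivative (\<i> * dtheta \<tau> - tc \<tau> 0 * (2 * \<i> * of_real pi))) (at 0)"
  unfolding gtheta by (rule derivative_eq_intros theta_deriv[OF \<tau>] refl)+ simp
 hence dg: "deriv g 0 = \<i> * dtheta \<tau> - tc \<tau> 0 * (2 * \<i> * of_real pi)" by (rule DERIV_imp_deriv)
 show ?thesis
 proof
  assume "dtheta \<tau> = 0"
  hence "norm (deriv g 0) = norm (tc \<tau> 0) * (2 * pi)" by (simp add: dg norm_mult)
  hence "norm (tc \<tau> 0) * (2 * pi) <= norm (tc \<tau> 0) * 2" using gd by simp
  hence "2 * pi <= 2" using tc_nonzero[of \<tau> 0] by (simp del: tc_nonzero)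
  thus False using pi_gt3 by simp
 qed
qed

text \<open>Numerator and denominator both have a simple zero at 0 with equal leading coefficients,
  so the quotient extends by the value 1, and \<open>remove_sings\<close> yields the same function
  near 0.\<close>

lemma theta_factor_expansion:
 assumes \<tau>: "Im \<tau> > 0" and d: "dtheta \<tau> ~= 0" and \<alpha>: "theta (- \<alpha>) \<tau> ~= 0"
 defines "g \<equiv> %z. if z = 0 then 1 else (z * theta (z - \<alpha>) \<tau> * dtheta \<tau>) / (theta z \<tau> * theta (- \<alpha>) \<tau>)"
 shows "g has_fps_expansion theta_factor \<tau> \<alpha>"
proof -
 define D where "D = dtheta \<tau>"
 let ?\<theta> = "%z. theta z \<tau>"
 have an: "(%z. theta (z - b) \<tau>) analytic_on {0}" for b
 proof -
  have "(?\<theta> \<circ> (%z. z - b)) holomorphic_on UNIV"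
  by (rule holomorphic_on_compose) (auto intro!: holomorphic_intros holomorphic_on_subset[OF holomorphic_theta[OF \<tau>]])
  thus ?thesis by (auto simp: o_def analytic_on_holomorphic)
 qed
 have fps: "(%z. theta (z - b) \<tau>) has_fps_expansion fps_expansion (%z. theta (z - b) \<tau>) 0" for b
  by (rule analytic_at_imp_has_fps_expansion_0[OF an])
 define T where "T = fps_expansion ?\<theta> 0"
 define Ta where "Ta = fps_expansion (%z. theta (z - \<alpha>) \<tau>) 0"
 have T: "?\<theta> has_fps_expansion T" using fps[of 0] by (simp add: T_def)
 have T0: "fps_nth T 0 = 0" by (simp add: T_def fps_expansion_def theta_zero)
 have T1: "fps_nth T 1 = D" by (simp add: T_def fps_expansion_def D_def)
 have sT: "subdegree T = 1" using T0 T1 d by (intro subdegreeI) (auto simp: D_def)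
 define F where "F = fps_X * Ta * fps_const D"
 define G where "G = T * fps_const (theta (- \<alpha>) \<tau>)"
 have F: "(%z. z * theta (z - \<alpha>) \<tau> * D) has_fps_expansion F"
  unfolding F_def Ta_def by (intro fps_expansion_intros fps)
 have G: "(%z. theta z \<tau> * theta (- \<alpha>) \<tau>) has_fps_expansion G"
  unfolding G_def by (intro fps_expansion_intros T)
 have G0: "G ~= 0" using sT \<alpha> by (auto simp: G_def)
 have sG: "subdegree G = 1" using T0 T1 d \<alpha> by (intro subdegreeI) (auto simp: G_def D_def)
 have F0: "fps_nth F 0 = 0" by (simp add: F_def mult.assoc)
 have Ta0: "fps_nth Ta 0 = theta (- \<alpha>) \<tau>" by (simp add: Ta_def fps_expansion_def)
 have F1: "fps_nth F 1 = theta (- \<alpha>) \<tau> * D" by (simp add: F_def mult.assoc Ta0)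
 have G1: "fps_nth G 1 = D * theta (- \<alpha>) \<tau>" using T1 by (simp add: G_def)
 have Fne: "F ~= 0" using F1 d \<alpha> by (auto simp: D_def)
 have sF: "subdegree F = 1" using F0 F1 d \<alpha> by (intro subdegreeI) (auto simp: D_def)
 have gx: "g has_fps_expansion F / G"
 proof -
  have "(%z. if z = 0 then fps_nth F (subdegree G) / fps_nth G (subdegree G) else z * theta (z - \<alpha>) \<tau> * D / (theta z \<tau> * theta (- \<alpha>) \<tau>))
  has_fps_expansion F / G"
  by (rule has_fps_expansion_divide[OF F G _ G0 refl]) (simp add: sF sG)
  moreover have "fps_nth F (subdegree G) / fps_nth G (subdegree G) = 1" using sG F1 G1 d \<alpha> by (simp add: D_def)
  ultimately show ?thesis by (simp only: g_def D_def[symmetric])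
 qed
 define f where "f = (%z. z * theta (z - \<alpha>) \<tau> * D / (theta z \<tau> * theta (- \<alpha>) \<tau>))"
 have gcont: "isCont g 0" using has_fps_expansion_imp_continuous[OF gx, of UNIV] by simp
 have fg: "f z = g z" if "z ~= 0" for z using that by (simp add: f_def g_def D_def)
 have "g \<midarrow>0\<rightarrow> 1" using gcont by (simp add: isCont_def g_def)
 hence f1: "f \<midarrow>0\<rightarrow> 1" by (rule Lim_transform_eventually) (auto simp: eventually_at_filter fg)
 have "g analytic_on {0}" using gx by (rule has_fps_expansion_imp_analytic_0)
 then obtain e where e: "e > 0" "g holomorphic_on ball 0 e" by (auto simp: analytic_on_def)
 have rs: "remove_sings f z = g z" if "z \<in> ball 0 e" for z
 proof (cases "z = 0")
  case True
  thus ?thesis using remove_sings_eqI[OF f1] by (simp add: g_def)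
 next
  case False
  have "g holomorphic_on (ball 0 e - {0})" using e(2) by (rule holomorphic_on_subset) auto
  hence "f holomorphic_on (ball 0 e - {0})" by (rule holomorphic_transform) (auto simp: fg)
  hence "f analytic_on {z}"
  using False that by (subst analytic_at) (intro exI[of _ "ball 0 e - {0}"], auto)
  thus ?thesis using fg[OF False] by simp
 qed
 have "eventually (%z. remove_sings f z = g z) (nhds 0)"
  using e(1) rs by (intro eventually_nhds_in_open[THEN eventually_mono, of "ball 0 e"]) auto
 hence "remove_sings f has_fps_expansion F / G" using gx by (subst has_fps_expansion_cong[OF _ refl])
 note rf = this
 have "fps_expansion (remove_sings f) 0 = F / G"
  by (rule fps_expansion_unique_complex[OF analytic_at_imp_has_fps_expansion_0[OF has_fps_expansion_imp_analytic_0[OF rf]] rf])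
 hence "theta_factor \<tau> \<alpha> = F / G" by (simp add: theta_factor_def f_def D_def)
 with gx show ?thesis by simp
qed

lemma kron_factor:
 assumes \<tau>: "Im \<tau> > 0" and q: "norm (ee \<tau>) < exp (- 30)" and s: "sep (ee \<tau>) (ee \<alpha>) c" "c > 0"
 shows "\<exists>g. g has_fps_expansion theta_factor \<tau> \<alpha> \<and> g 0 = 1 \<and>
  (\<forall>\<^sub>F w::real in at 0. kron (ee \<tau>) (ee \<alpha>) w = g (- \<i> * w / (2 * pi)) / w)"
proof -
 have "exp (- 30 :: real) < 1" by simp
 with q have q1: "norm (ee \<tau>) < 1" by (rule less_trans)
 have d: "dtheta \<tau> ~= 0" by (rule theta_deriv_nonzero[OF \<tau> q])
 obtain \<kappa> where \<kappa>: "!!w::real. w ~= 0 ==> \<bar>w\<bar> < - ln (norm (ee \<tau>)) ==>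
  kron (ee \<tau>) (ee \<alpha>) w * theta (- \<i> * w / (2 * pi)) \<tau> = \<kappa> * theta (- \<i> * w / (2 * pi) - \<alpha>) \<tau>"
  using kron_theta_product[OF \<tau> s q1] by blast
 have \<kappa>c: "\<kappa> * theta (- \<alpha>) \<tau> = dtheta \<tau> / (2 * pi * \<i>)"
  by (rule kron_theta_constant[OF \<tau> s q1 \<kappa>])
 \<comment> \<open>The formula for the constant also shows that the denominator of the theta
   quotient is not 0.\<close>
 hence \<alpha>: "theta (- \<alpha>) \<tau> ~= 0" using d by auto
 define g where "g = (%z. if z = 0 then 1 else (z * theta (z - \<alpha>) \<tau> * dtheta \<tau>) / (theta z \<tau> * theta (- \<alpha>) \<tau>))"
 have "g has_fps_expansion theta_factor \<tau> \<alpha>" unfolding g_def by (rule theta_factor_expansion[OF \<tau> d \<alpha>])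
 moreover have "g 0 = 1" by (simp add: g_def)
 moreover have "\<forall>\<^sub>F w::real in at 0. kron (ee \<tau>) (ee \<alpha>) w = g (- \<i> * w / (2 * pi)) / w"
 proof -
  have "- ln (norm (ee \<tau>)) > 0" using q1 by simp
  hence e1: "\<forall>\<^sub>F w::real in at 0. \<bar>w\<bar> < - ln (norm (ee \<tau>))"
  unfolding eventually_at by (intro exI[of _ "- ln (norm (ee \<tau>))"]) (auto simp: dist_real_def)
  have e2: "\<forall>\<^sub>F w::real in at 0. w ~= 0" by (auto simp: eventually_at_filter)
  have "dtheta \<tau> / (2 * pi * \<i>) ~= 0" using d by simp
  hence e3: "\<forall>\<^sub>F w::real in at 0. theta (- \<i> * w / (2 * pi)) \<tau> / w ~= 0"
  by (rule tendsto_imp_eventually_ne[OF theta_quotient_limit[OF \<tau>]])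
  show ?thesis using e1 e2 e3
  proof eventually_elim
  case (elim w)
  let ?z = "- \<i> * w / (2 * pi) :: complex"
  have z: "?z ~= 0" using elim by simp
  have t: "theta ?z \<tau> ~= 0" using elim by auto
  have "kron (ee \<tau>) (ee \<alpha>) w = \<kappa> * theta (?z - \<alpha>) \<tau> / theta ?z \<tau>" using \<kappa>[of w] elim t by (simp add: field_simps)
  also have "\<kappa> = dtheta \<tau> / (2 * pi * \<i>) / theta (- \<alpha>) \<tau>" using \<kappa>c \<alpha> by (simp add: field_simps)
  also have "dtheta \<tau> / (2 * pi * \<i>) / theta (- \<alpha>) \<tau> * theta (?z - \<alpha>) \<tau> / theta ?z \<tau> = g ?z / w"
  proof -
  have "g ?z / w = (?z / w) * theta (?z - \<alpha>) \<tau> * dtheta \<tau> / (theta ?z \<tau> * theta (- \<alpha>) \<tau>)"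
  using z by (simp only: g_def if_False divide_inverse mult_ac)
  also have "?z / w = 1 / (2 * pi * \<i>)" using elim by (simp add: field_simps)
  finally show ?thesis by (simp only: divide_inverse mult_1_left inverse_mult_distrib mult_ac)
  qed
  finally show ?case .
  qed
 qed
 ultimately show ?thesis by blast
qed

section \<open>Coefficients of products of power series, expanded over words\<close>

text \<open>The degree k part of the product over \<open>ds\<close> of the series with coefficients
  \<open>c d\<close>, with a monomial kept as the word in which each letter is repeated by its
  exponent, and J applied to words. J need not be multiplicative or symmetric, so the scheme covers
  cup products of cochains as well as localization sums.\<close>

primrec wexp :: "('a => nat => complex) => 'a list => nat => ('a list => complex) => complex" where
 "wexp c [] k J = (if k = 0 then J [] else 0)"
| "wexp c (d # ds) k J = (\<Sum>j\<le>k. c d j * wexp c ds (k - j) (%w. J (replicate j d @ w)))"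

lemma wexp_cong:
 assumes "!!w. length w = k ==> set w \<subseteq> set ds ==> J w = J' w"
 shows "wexp c ds k J = wexp c ds k J'"
 using assms
proof (induction ds arbitrary: k J J')
 case (Cons d ds)
 have "wexp c ds (k - j) (%w. J (replicate j d @ w)) = wexp c ds (k - j) (%w. J' (replicate j d @ w))" if "j <= k" for j
  by (intro Cons.IH Cons.prems) (use that in auto)
 thus ?case by simp
qed auto

lemma wexp_sum: "wexp c ds k (%w. \<Sum>i\<in>A. J i w) = (\<Sum>i\<in>A. wexp c ds k (J i))"
proof (induction ds arbitrary: k J)
 case (Cons d ds)
 have "wexp c (d # ds) k (%w. \<Sum>i\<in>A. J i w) = (\<Sum>j\<le>k. \<Sum>i\<in>A. c d j * wexp c ds (k - j) (%w. J i (replicate j d @ w)))"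
  by (simp add: Cons.IH sum_distrib_left)
 also have "... = (\<Sum>i\<in>A. wexp c (d # ds) k (J i))" by (subst sum.swap) simp
 finally show ?case .
qed auto

lemma wexp_prod:
 "wexp c ds k (%w. C * prod_list (map z w)) = C * fps_nth (\<Prod>d\<leftarrow>ds. Abs_fps (%j. c d j * z d ^ j)) k"
proof (induction ds arbitrary: k C)
 case (Cons d ds)
 have "wexp c (d # ds) k (%w. C * prod_list (map z w)) =
  (\<Sum>j\<le>k. c d j * wexp c ds (k - j) (%w. (C * z d ^ j) * prod_list (map z w)))"
  by (simp add: prod_list_replicate mult_ac)
 also have "... = C * (\<Sum>j\<le>k. (c d j * z d ^ j) * fps_nth (\<Prod>d\<leftarrow>ds. Abs_fps (%j. c d j * z d ^ j)) (k - j))"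
  unfolding Cons.IH by (simp add: sum_distrib_left mult_ac)
 finally show ?case by (simp add: fps_mult_nth atMost_atLeast0)
qed auto

lemma has_sum_finite_sum:
 fixes f :: "'i => 'a => complex"
 assumes "finite I" "!!i. i \<in> I ==> (f i has_sum S i) A"
 shows "((%x. \<Sum>i\<in>I. f i x) has_sum (\<Sum>i\<in>I. S i)) A"
 using assms by (induction I rule: finite_induct) (auto intro: has_sum_add)

section \<open>Localization numbers of a nonsingular fan\<close>

locale nonsingular_complex = simplicial_complex_fan K for K :: "(int ^ 'n) set set" +
 assumes dual: "G \<in> K ==> \<exists>e. \<forall>d\<in>G. \<forall>d'\<in>G. pairing (e d) d' = (if d = d' then 1 else 0)"
begin

text \<open>Dual vectors realise every integer function on G, so a sum over M of a product over G
  factorises completely.\<close>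

lemma pairing_bij:
 assumes G: "G \<in> facets"
 shows "bij_betw (%m. \<lambda>d\<in>G. pairing m d) UNIV (PiE G (%_. UNIV))"
 unfolding bij_betw_def
proof
 show "inj (%m. \<lambda>d\<in>G. pairing m d)"
 proof (rule injI)
  fix m m' assume "(\<lambda>d\<in>G. pairing m d) = (\<lambda>d\<in>G. pairing m' d)"
  thus "m = m'" using pairing_inj[OF G, of m m'] by (metis restrict_apply')
 qed
 obtain e where e: "\<forall>d\<in>G. \<forall>d'\<in>G. pairing (e d) d' = (if d = d' then 1 else 0)" using dual[OF facetsD(1)[OF G]] by blast
 show "range (%m. \<lambda>d\<in>G. pairing m d) = PiE G (%_. UNIV)"
 proof
  show "PiE G (%_. UNIV) \<subseteq> range (%m. \<lambda>d\<in>G. pairing m d)"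
  proof
  fix k assume k: "k \<in> PiE G (%_. UNIV :: int set)"
  have "pairing (\<Sum>d\<in>G. k d *s e d) d' = k d'" if "d' \<in> G" for d'
  proof -
  have "pairing (\<Sum>d\<in>G. k d *s e d) d' = (\<Sum>d\<in>G. if d = d' then k d else 0)"
  unfolding pairing_sum_left pairing_smult_left using e that by (intro sum.cong) auto
  thus ?thesis using that facetsD(3)[OF G] by simp
  qed
  hence "(\<lambda>d\<in>G. pairing (\<Sum>d\<in>G. k d *s e d) d) = (\<lambda>d\<in>G. k d)" by (intro restrict_ext) auto
  also have "(\<lambda>d\<in>G. k d) = k" using k by (simp add: PiE_restrict)
  finally have eq: "(\<lambda>d\<in>G. pairing (\<Sum>d\<in>G. k d *s e d) d) = k" .
  show "k \<in> range (%m. \<lambda>d\<in>G. pairing m d)" using eq by (intro image_eqI[of _ _ "\<Sum>d\<in>G. k d *s e d"]) auto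
  qed
 qed auto
qed

lemma facet_prod_sum:
 fixes f :: "int ^ 'n => int => complex"
 assumes G: "G \<in> facets" and f: "!!d. d \<in> G ==> (%k. norm (f d k)) summable_on UNIV"
 shows "(%m. norm (\<Prod>d\<in>G. f d (pairing m d))) summable_on UNIV"
  "infsum (%m. \<Prod>d\<in>G. f d (pairing m d)) UNIV = (\<Prod>d\<in>G. infsum (f d) UNIV)"
proof -
 show "(%m. norm (\<Prod>d\<in>G. f d (pairing m d))) summable_on UNIV"
  unfolding prod_norm[symmetric] by (rule summable_pairing_prod[OF G f]) auto
 have "infsum (%g. \<Prod>d\<in>G. f d (g d)) (PiE G (%_. UNIV)) = (\<Prod>d\<in>G. infsum (f d) UNIV)"
  by (rule infsum_prod_PiE_abs[OF facetsD(3)[OF G] f])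
 thus "infsum (%m. \<Prod>d\<in>G. f d (pairing m d)) UNIV = (\<Prod>d\<in>G. infsum (f d) UNIV)"
  using infsum_reindex_bij_betw[OF pairing_bij[OF G], of "%g. \<Prod>d\<in>G. f d (g d)"] by simp
qed

text \<open>The Bott residue sum for a word of divisors: maximal cones are the fixed points,
  \<open>co G d v\<close> is the restriction of the divisor d to the fixed point G, and the
  denominator is the Euler class of the tangent space.\<close>

definition Lw :: "real ^ 'n => (int ^ 'n) list => real" where
 "Lw v w = (\<Sum>G\<in>facets. (\<Prod>d\<leftarrow>w. co G d v) / (\<Prod>d\<in>G. co G d v))"

definition rays :: "(int ^ 'n) set" where "rays = \<Union>K"

lemma finite_rays: "finite rays"
 using fin finite_K_mem by (auto simp: rays_def)

lemma facets_rays: "G \<in> facets ==> G \<subseteq> rays"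
 using facetsD(1) by (auto simp: rays_def)

lemma inner_rays:
 assumes "G \<in> facets"
 shows "(\<Sum>d\<in>rays. pairing n d * co G d v) = rvec n \<bullet> v"
proof -
 have "(\<Sum>d\<in>rays. pairing n d * co G d v) = (\<Sum>d\<in>G. pairing n d * co G d v)"
  using finite_rays facets_rays[OF assms] co_outside[OF assms] by (intro sum.mono_neutral_right) auto
 thus ?thesis by (simp add: inner_expand[OF assms] mult.commute)
qed

text \<open>The equivariant form of the linear relation. The error term carries a word shorter by
  one letter, which \<open>Lw_short\<close> removes when the long word has r letters.\<close>

lemma Lw_linear: "(\<Sum>d\<in>rays. pairing n d * Lw v (u @ d # u')) = (rvec n \<bullet> v) * Lw v (u @ u')"
proof -
 have "(\<Sum>d\<in>rays. pairing n d * Lw v (u @ d # u')) =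
  (\<Sum>G\<in>facets. \<Sum>d\<in>rays. pairing n d * co G d v * ((\<Prod>d\<leftarrow>u @ u'. co G d v) / (\<Prod>d\<in>G. co G d v)))"
  unfolding Lw_def sum_distrib_left by (subst sum.swap) (simp add: algebra_simps)
 also have "... = (\<Sum>G\<in>facets. (rvec n \<bullet> v) * ((\<Prod>d\<leftarrow>u @ u'. co G d v) / (\<Prod>d\<in>G. co G d v)))"
  unfolding sum_distrib_right[symmetric] by (intro sum.cong refl) (simp add: inner_rays)
 finally show ?thesis by (simp add: Lw_def sum_distrib_left)
qed

lemma Lw_notin:
 assumes "!!G. G \<in> facets ==> \<not> set w \<subseteq> G"
 shows "Lw v w = 0"
 unfolding Lw_def
proof (intro sum.neutral ballI)
 fix G assume G: "G \<in> facets"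
 then obtain d where "d \<in> set w" "d \<notin> G" using assms by blast
 hence "0 \<in> set (map (%d. co G d v) w)" using co_outside[OF G, of d v] by force
 hence "(\<Prod>d\<leftarrow>w. co G d v) = 0" by (rule prod_list_zero_iff[THEN iffD2])
 thus "(\<Prod>d\<leftarrow>w. co G d v) / (\<Prod>d\<in>G. co G d v) = 0" by simp
qed

lemma Lw_facet:
 assumes v: "generic v" and w: "distinct w" "set w \<in> facets"
 shows "Lw v w = 1"
proof -
 have z: "(\<Prod>d\<leftarrow>w. co G d v) / (\<Prod>d\<in>G. co G d v) = (if G = set w then 1 else 0)" if G: "G \<in> facets" for G
 proof (cases "G = set w")
  case True
  have "(\<Prod>d\<leftarrow>w. co G d v) = (\<Prod>d\<in>G. co G d v)" using w(1) True by (simp add: prod.distinct_set_conv_list)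
  moreover have "(\<Prod>d\<in>G. co G d v) ~= 0" using generic_co[OF v G] facetsD(3)[OF G] by simp
  ultimately show ?thesis using True by simp
 next
  case False
  have "\<not> set w \<subseteq> G"
  proof
  assume "set w \<subseteq> G"
  hence "set w = G" using facetsD(3,4)[OF G] facetsD(4)[OF w(2)] by (intro card_subset_eq) auto
  thus False using False by simp
  qed
  then obtain d where "d \<in> set w" "d \<notin> G" by blast
  hence "0 \<in> set (map (%d. co G d v) w)" using co_outside[OF G, of d v] by force
  hence "(\<Prod>d\<leftarrow>w. co G d v) = 0" by (rule prod_list_zero_iff[THEN iffD2])
  thus ?thesis using False by simp
 qed
 show ?thesis unfolding Lw_def using w(2) finite_facets by (simp add: z)
qed

text \<open>The multiplicative counterpart of \<open>Lw\<close>: 1 - exp(-t x) replaces x, and h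
  twists by a combination of divisors. A single summand may have a pole at t = 0.\<close>

definition Bh :: "real ^ 'n => (int ^ 'n) list => (int ^ 'n => int) => real => real" where
 "Bh v w h t = (\<Sum>G\<in>facets. (\<Prod>d\<leftarrow>w. 1 - exp (- t * co G d v)) * (\<Prod>d\<in>rays. exp (t * co G d v * h d)) / (\<Prod>d\<in>G. 1 - exp (- t * co G d v)))"

text \<open>The sum of the rational expressions is a weighted sum over M of integers T m that do not
  depend on v. It converges absolutely at t = 1 for v and for -v; these two sums dominate every t in
  (0, 1], so the poles of the single cones must cancel.\<close>

lemma Bh_Nil_bounded:
 assumes v: "generic v"
 shows "\<exists>C. \<forall>t. 0 < t \<and> t <= 1 --> \<bar>Bh v [] h t\<bar> <= C"
proof -
 define \<phi> where "\<phi> m d = (if pairing m d \<ge> - h d then 1 else (0::complex))" for m d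
 \<comment> \<open>By \<open>alternating_prod_sum\<close> these numbers split over the maximal cones
   into products of one-sided indicator functions, for any generic direction.\<close>
 define T where "T m = (\<Sum>T\<in>K. (-1) ^ (CARD('n) - card T) * (\<Prod>d\<in>T. \<phi> m d))" for m
 have key: "(%m. norm (of_real (exp (- t * (rvec m \<bullet> v))) * T m)) summable_on UNIV \<and>
  infsum (%m. of_real (exp (- t * (rvec m \<bullet> v))) * T m) UNIV = of_real (\<Sum>G\<in>facets. \<Prod>d\<in>G. exp (t * co G d v * h d) / (1 - exp (- (t * co G d v))))"
  if t: "0 < t" and v: "generic v" for t v
 proof -
  define f where "f G d = (%k::int. complex_of_real (exp (- (t * co G d v) * real_of_int k)) * ((if k \<ge> - h d then 1 else 0) - (if t * co G d v > 0 then 0 else 1)))" for G d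
  have TG: "of_real (exp (- t * (rvec m \<bullet> v))) * T m = (\<Sum>G\<in>facets. \<Prod>d\<in>G. f G d (pairing m d))" for m
  proof -
  have "of_real (exp (- t * (rvec m \<bullet> v))) * T m = (\<Sum>G\<in>facets. of_real (exp (- t * (rvec m \<bullet> v))) * (\<Prod>d\<in>G. if co G d v > 0 then \<phi> m d else \<phi> m d - 1))"
  unfolding T_def alternating_prod_sum[OF v] sum_distrib_left ..
  also have "... = (\<Sum>G\<in>facets. \<Prod>d\<in>G. f G d (pairing m d))"
  proof (intro sum.cong refl)
  fix G assume G: "G \<in> facets"
  have "complex_of_real (exp (- t * (rvec m \<bullet> v))) = (\<Prod>d\<in>G. of_real (exp (- (t * co G d v) * pairing m d)))"
  unfolding inner_expand[OF G] using facetsD(3)[OF G]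
  by (simp add: exp_sum[symmetric] sum_distrib_left sum_negf mult.assoc flip: of_real_prod)
  hence "of_real (exp (- t * (rvec m \<bullet> v))) * (\<Prod>d\<in>G. if co G d v > 0 then \<phi> m d else \<phi> m d - 1) =
  (\<Prod>d\<in>G. of_real (exp (- (t * co G d v) * pairing m d)) * (if co G d v > 0 then \<phi> m d else \<phi> m d - 1))"
  by (simp only: prod.distrib)
  also have "... = (\<Prod>d\<in>G. f G d (pairing m d))"
  using t by (intro prod.cong refl) (simp add: f_def \<phi>_def zero_less_mult_iff)
  finally show "of_real (exp (- t * (rvec m \<bullet> v))) * (\<Prod>d\<in>G. if co G d v > 0 then \<phi> m d else \<phi> m d - 1) = (\<Prod>d\<in>G. f G d (pairing m d))" .
  qed
  finally show ?thesis .
  qed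
  have fs: "(f G d has_sum of_real (exp (t * co G d v * h d) / (1 - exp (- (t * co G d v))))) UNIV" "(%k. norm (f G d k)) summable_on UNIV"
  if "G \<in> facets" "d \<in> G" for G d
  using geometric_int_has_sum[of "t * co G d v" "h d"] generic_co[OF v that] t by (simp_all add: f_def)
  have s: "(%m. norm (\<Prod>d\<in>G. f G d (pairing m d))) summable_on UNIV" if "G \<in> facets" for G
  using facet_prod_sum(1)[OF that fs(2)[OF that]] .
  have "(%m. norm (\<Sum>G\<in>facets. \<Prod>d\<in>G. f G d (pairing m d))) summable_on UNIV"
  by (rule summable_on_comparison_test[OF summable_on_finite_sum[OF finite_facets s]]) (auto intro: norm_sum)
  moreover have "((%m. \<Sum>G\<in>facets. \<Prod>d\<in>G. f G d (pairing m d)) has_sum (\<Sum>G\<in>facets. \<Prod>d\<in>G. infsum (f G d) UNIV)) UNIV"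
  proof (rule has_sum_finite_sum[OF finite_facets])
  fix G assume G: "G \<in> facets"
  have "infsum (%m. \<Prod>d\<in>G. f G d (pairing m d)) UNIV = (\<Prod>d\<in>G. infsum (f G d) UNIV)"
  by (rule facet_prod_sum(2)[OF G fs(2)[OF G]])
  thus "((%m. \<Prod>d\<in>G. f G d (pairing m d)) has_sum (\<Prod>d\<in>G. infsum (f G d) UNIV)) UNIV"
  using has_sum_infsum[OF abs_summable_summable[OF s[OF G]]] by simp
  qed
  moreover have "(\<Sum>G\<in>facets. \<Prod>d\<in>G. infsum (f G d) UNIV) = of_real (\<Sum>G\<in>facets. \<Prod>d\<in>G. exp (t * co G d v * h d) / (1 - exp (- (t * co G d v))))"
  unfolding of_real_sum of_real_prod using infsumI[OF fs(1)] by (intro sum.cong prod.cong refl) simp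
  ultimately show ?thesis unfolding TG by (simp add: infsumI)
 qed
 define N where "N m = norm (of_real (exp (- 1 * (rvec m \<bullet> v))) * T m) + norm (of_real (exp (- 1 * (rvec m \<bullet> (- v)))) * T m)" for m
 have Ns: "N summable_on UNIV"
  unfolding N_def using key[OF _ v, of 1] key[OF _ generic_uminus[OF v], of 1] by (intro summable_on_add) auto
 have "\<bar>Bh v [] h t\<bar> <= infsum N UNIV" if t: "0 < t" "t <= 1" for t
 proof -
  have "Bh v [] h t = (\<Sum>G\<in>facets. \<Prod>d\<in>G. exp (t * co G d v * h d) / (1 - exp (- (t * co G d v))))"
  unfolding Bh_def
  proof (intro sum.cong refl)
  fix G assume G: "G \<in> facets"
  have "(\<Prod>d\<in>rays. exp (t * co G d v * h d)) = (\<Prod>d\<in>G. exp (t * co G d v * h d))"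
  using finite_rays facets_rays[OF G] co_outside[OF G] by (intro prod.mono_neutral_right) auto
  thus "(\<Prod>d\<leftarrow>[]. 1 - exp (- t * co G d v)) * (\<Prod>d\<in>rays. exp (t * co G d v * h d)) / (\<Prod>d\<in>G. 1 - exp (- t * co G d v)) =
  (\<Prod>d\<in>G. exp (t * co G d v * h d) / (1 - exp (- (t * co G d v))))"
  by (simp add: prod_dividef)
  qed
  hence eq: "complex_of_real (Bh v [] h t) = infsum (%m. of_real (exp (- t * (rvec m \<bullet> v))) * T m) UNIV"
  using key[OF t(1) v] by simp
  have as: "(%m. norm (of_real (exp (- t * (rvec m \<bullet> v))) * T m)) summable_on UNIV" using key[OF t(1) v] by simp
  have "\<bar>Bh v [] h t\<bar> = norm (complex_of_real (Bh v [] h t))" by simp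
  also have "... <= infsum (%m. norm (of_real (exp (- t * (rvec m \<bullet> v))) * T m)) UNIV"
  unfolding eq by (rule norm_infsum_bound[OF as])
  also have "... <= infsum N UNIV"
  proof (rule infsum_mono[OF as Ns])
  fix m
  have "norm (of_real (exp (- t * (rvec m \<bullet> v))) * T m) <= (exp (- 1 * (rvec m \<bullet> v)) + exp (1 * (rvec m \<bullet> v))) * norm (T m)"
  unfolding norm_mult using exp_weight_le[of t 1 1 "rvec m \<bullet> v"] t by (intro mult_right_mono) auto
  thus "norm (of_real (exp (- t * (rvec m \<bullet> v))) * T m) <= N m" by (simp add: N_def norm_mult distrib_right)
  qed
  finally show ?thesis .
 qed
 thus ?thesis by blast
qed

text \<open>A further letter d splits the sum into a difference of two sums, the second with h
  lowered by 1 at d. This is the reason for carrying h.\<close>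

lemma Bh_bounded:
 assumes v: "generic v" and w: "set w \<subseteq> rays"
 shows "\<exists>C. \<forall>t. 0 < t \<and> t <= 1 --> \<bar>Bh v w h t\<bar> <= C"
 using w
proof (induction w arbitrary: h)
 case Nil
 show ?case by (rule Bh_Nil_bounded[OF v])
next
 case (Cons d w)
 have rec: "Bh v (d # w) h t = Bh v w h t - Bh v w (h(d := h d - 1)) t" for t
 proof -
  have "(\<Prod>e\<in>rays. exp (t * co G e v * (h(d := h d - 1)) e)) = exp (- t * co G d v) * (\<Prod>e\<in>rays. exp (t * co G e v * h e))" for G
  proof -
  have dr: "d \<in> rays" using Cons.prems by simp
  have "(\<Prod>e\<in>rays. exp (t * co G e v * (h(d := h d - 1)) e)) = exp (t * co G d v * (h d - 1)) * (\<Prod>e\<in>rays - {d}. exp (t * co G e v * (h(d := h d - 1)) e))"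
  by (subst prod.remove[OF finite_rays dr]) simp
  also have "(\<Prod>e\<in>rays - {d}. exp (t * co G e v * (h(d := h d - 1)) e)) = (\<Prod>e\<in>rays - {d}. exp (t * co G e v * h e))"
  by (intro prod.cong) auto
  also have "exp (t * co G d v * (h d - 1)) = exp (- t * co G d v) * exp (t * co G d v * h d)"
  by (simp add: exp_add[symmetric] algebra_simps)
  finally show ?thesis by (simp add: prod.remove[OF finite_rays dr] mult.assoc)
  qed
  hence "(\<Prod>e\<leftarrow>d # w. 1 - exp (- t * co G e v)) * (\<Prod>e\<in>rays. exp (t * co G e v * h e)) / X =
  (\<Prod>e\<leftarrow>w. 1 - exp (- t * co G e v)) * (\<Prod>e\<in>rays. exp (t * co G e v * h e)) / X -
  (\<Prod>e\<leftarrow>w. 1 - exp (- t * co G e v)) * (\<Prod>e\<in>rays. exp (t * co G e v * (h(d := h d - 1)) e)) / X" for G X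
  by (simp add: diff_divide_distrib[symmetric] algebra_simps)
  thus ?thesis unfolding Bh_def by (simp only: sum_subtractf)
 qed
 have sub: "set w \<subseteq> rays" using Cons.prems by simp
 obtain C where C: "\<forall>t. 0 < t \<and> t <= 1 --> \<bar>Bh v w h t\<bar> <= C" using Cons.IH[OF sub, of h] by blast
 obtain C' where C': "\<forall>t. 0 < t \<and> t <= 1 --> \<bar>Bh v w (h(d := h d - 1)) t\<bar> <= C'" using Cons.IH[OF sub, of "h(d := h d - 1)"] by blast
 have "\<bar>Bh v (d # w) h t\<bar> <= C + C'" if "0 < t" "t <= 1" for t
  unfolding rec using C[rule_format, of t] C'[rule_format, of t] that by linarith
 thus ?case by blast
qed

text \<open>\<open>Lw v w\<close> is the limit of \<open>Bh\<close> times t to the power r minus the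
  length of w. The first factor is bounded and the exponent is positive. This is the cancellation of
  the pole parts.\<close>

lemma Lw_short:
 assumes v: "generic v" and w: "set w \<subseteq> rays" "length w < CARD('n)"
 shows "Lw v w = 0"
proof -
 let ?B = "Bh v w (%_. 0)" and ?s = "CARD('n) - length w"
 obtain C where C: "!!t. 0 < t ==> t <= 1 ==> \<bar>?B t\<bar> <= C" using Bh_bounded[OF v w(1), of "%_. 0"] by blast
 have ev: "\<forall>\<^sub>F t in at_right (0::real). 0 < t \<and> t <= 1"
  by (auto simp: eventually_at_right_field intro: exI[of _ 1])
 have l1: "((%t. (1 - exp (- t * x)) / t) \<longlongrightarrow> x) (at_right 0)" for x :: real by real_asymp
 have "((%t. \<Sum>G\<in>facets. (\<Prod>d\<leftarrow>w. (1 - exp (- t * co G d v)) / t) / (\<Prod>d\<in>G. (1 - exp (- t * co G d v)) / t)) \<longlongrightarrow> Lw v w) (at_right 0)"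
  unfolding Lw_def
 proof (intro tendsto_sum tendsto_divide tendsto_prod l1)
  show "((%t::real. \<Prod>d\<leftarrow>w. (1 - exp (- t * co G d v)) / t) \<longlongrightarrow> (\<Prod>d\<leftarrow>w. co G d v)) (at_right 0)" for G
  proof (induction w)
  case (Cons a w)
  from tendsto_mult[OF l1[of "co G a v"] Cons.IH] show ?case by (simp only: list.map prod_list.Cons)
  qed simp
  show "(\<Prod>d\<in>G. co G d v) ~= 0" if "G \<in> facets" for G
  using generic_co[OF v that] facetsD(3)[OF that] by simp
 qed
 moreover have "((%t. \<Sum>G\<in>facets. (\<Prod>d\<leftarrow>w. (1 - exp (- t * co G d v)) / t) / (\<Prod>d\<in>G. (1 - exp (- t * co G d v)) / t)) \<longlongrightarrow> 0) (at_right 0)"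
 proof (rule Lim_null_comparison)
  show "\<forall>\<^sub>F t in at_right 0. norm (\<Sum>G\<in>facets. (\<Prod>d\<leftarrow>w. (1 - exp (- t * co G d v)) / t) / (\<Prod>d\<in>G. (1 - exp (- t * co G d v)) / t)) <= C * t ^ ?s"
  using ev
  proof eventually_elim
  case (elim t)
  have pl: "(\<Prod>d\<leftarrow>u. (1 - exp (- t * co G d v)) / t) = (\<Prod>d\<leftarrow>u. 1 - exp (- t * co G d v)) / t ^ length u" for G u
  by (induction u) auto
  have "(\<Sum>G\<in>facets. (\<Prod>d\<leftarrow>w. (1 - exp (- t * co G d v)) / t) / (\<Prod>d\<in>G. (1 - exp (- t * co G d v)) / t)) = ?B t * t ^ ?s"
  unfolding Bh_def sum_distrib_right
  proof (intro sum.cong refl)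
  fix G assume G: "G \<in> facets"
  have "(\<Prod>d\<in>G. (1 - exp (- t * co G d v)) / t) = (\<Prod>d\<in>G. 1 - exp (- t * co G d v)) / t ^ CARD('n)"
  using facetsD(4)[OF G] by (simp add: prod_dividef)
  moreover have "t ^ CARD('n) = t ^ length w * t ^ ?s" using w(2) by (simp flip: power_add)
  ultimately show "(\<Prod>d\<leftarrow>w. (1 - exp (- t * co G d v)) / t) / (\<Prod>d\<in>G. (1 - exp (- t * co G d v)) / t) =
  (\<Prod>d\<leftarrow>w. 1 - exp (- t * co G d v)) * (\<Prod>d\<in>rays. exp (t * co G d v * of_int 0)) / (\<Prod>d\<in>G. 1 - exp (- t * co G d v)) * t ^ ?s"
  unfolding pl using elim by simp
  qed
  thus ?case using C[of t] elim by (simp add: abs_mult mult_right_mono)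
  qed
  have "((%t::real. C * t ^ ?s) \<longlongrightarrow> C * 0 ^ ?s) (at_right 0)" by (intro tendsto_intros)
  moreover have "C * 0 ^ ?s = 0" using w(2) by (simp add: power_0_left)
  ultimately show "((%t::real. C * t ^ ?s) \<longlongrightarrow> 0) (at_right 0)" by (simp only:)
 qed
 ultimately show ?thesis using tendsto_unique trivial_limit_at_right_real by blast
qed

text \<open>Induction on the number of letters missing from a full set. A repeated letter is
  exchanged, by the linear relation for its dual vector, for letters outside the word, so every new
  word has more distinct letters. Relations are available at each position because J is not assumed
  symmetric; \<open>Lw\<close> satisfies the same rules.\<close>

theorem intersection_numbers_unique:
 assumes v: "generic v"
  and A1: "!!n u u'. set u \<subseteq> rays ==> set u' \<subseteq> rays ==> length u + length u' + 1 = CARD('n) ==>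
  (\<Sum>d\<in>rays. of_int (pairing n d) * J (u @ d # u')) = (0::complex)"
  and A2: "!!w. set w \<subseteq> rays ==> length w = CARD('n) ==> set w \<notin> K ==> J w = 0"
  and A3: "!!w. set w \<in> K ==> length w = CARD('n) ==> distinct w ==> J w = 1"
  and w: "set w \<subseteq> rays" "length w = CARD('n)"
 shows "J w = of_real (Lw v w)"
 using w
proof (induction "CARD('n) - card (set w)" arbitrary: w rule: less_induct)
 case less
 show ?case
 proof (cases "set w \<in> K")
  case False
  hence "\<not> set w \<subseteq> G" if "G \<in> facets" for G using down facetsD(1)[OF that] by blast
  thus ?thesis using A2[OF less.prems False] Lw_notin[of w v] by simp
 next
  case True
  show ?thesis
  proof (cases "distinct w")
  case dw: True
  hence "set w \<in> facets" using True less.prems by (simp add: facets_def distinct_card)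
  thus ?thesis using A3[OF True less.prems(2) dw] Lw_facet[OF v dw] by simp
  next
  case False
  then obtain u d u' u'' where "w = u @ [d] @ u' @ [d] @ u''" using not_distinct_decomp by blast
  hence wu: "w = u @ d # (u' @ d # u'')" by simp
  \<comment> \<open>One occurrence of d stays in U, so exchanging the other one does not lose a
    letter of w.\<close>
  define U where "U = u' @ d # u''"
  have w: "w = u @ d # U" using wu by (simp add: U_def)
  have setw: "set w = set (u @ U)" by (auto simp: w U_def)
  obtain e where e: "\<forall>x\<in>set w. \<forall>x'\<in>set w. pairing (e x) x' = (if x = x' then 1 else 0)" using dual[OF True] by blast
  have dw: "d \<in> set w" by (simp add: w)
  have dr: "d \<in> rays" using dw less.prems by blast
  have sub: "set u \<subseteq> rays" "set U \<subseteq> rays" using less.prems by (auto simp: w)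
  have len: "length u + length U + 1 = CARD('n)" using less.prems by (simp add: w)
  have IH: "J (u @ x # U) = of_real (Lw v (u @ x # U))" if x: "x \<in> rays - set w" for x
  proof (rule less.hyps)
  have "set (u @ x # U) = insert x (set w)" using setw by auto
  hence "card (set (u @ x # U)) = Suc (card (set w))" using x by simp
  moreover have "card (set (u @ x # U)) <= CARD('n)" using card_length[of "u @ x # U"] len by simp
  ultimately show "CARD('n) - card (set (u @ x # U)) < CARD('n) - card (set w)" by simp
  show "set (u @ x # U) \<subseteq> rays" "length (u @ x # U) = CARD('n)" using x sub len by auto
  qed
  \<comment> \<open>The dual vector pairs to 1 with d and to 0 with the other letters of w, so in
    the relation only d itself and rays outside w survive.\<close>
  let ?n = "e d"
  have coef: "pairing ?n x = (if x = d then 1 else 0)" if "x \<in> set w" for x using e dw that by auto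
  have split: "(\<Sum>x\<in>rays. of_int (pairing ?n x) * F x) = F d + (\<Sum>x\<in>rays - set w. of_int (pairing ?n x) * F x)" for F :: "int ^ 'n => complex"
  proof -
  have "(\<Sum>x\<in>rays. of_int (pairing ?n x) * F x) = (\<Sum>x\<in>rays - set w. of_int (pairing ?n x) * F x) + (\<Sum>x\<in>set w. of_int (pairing ?n x) * F x)"
  by (rule sum.subset_diff[OF less.prems(1) finite_rays])
  also have "(\<Sum>x\<in>set w. of_int (pairing ?n x) * F x) = (\<Sum>x\<in>set w. if x = d then F x else 0)"
  using coef by (intro sum.cong) auto
  also have "... = F d" using dw by simp
  finally show ?thesis by simp
  qed
  have "J w = - (\<Sum>x\<in>rays - set w. of_int (pairing ?n x) * J (u @ x # U))"
  using A1[OF sub len, of ?n] split[of "%x. J (u @ x # U)"] by (simp add: w eq_neg_iff_add_eq_0)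
  also have "... = - (\<Sum>x\<in>rays - set w. of_int (pairing ?n x) * of_real (Lw v (u @ x # U)))"
  using IH by simp
  also have "... = of_real (Lw v w)"
  proof -
  have "Lw v (u @ U) = 0" using sub len by (intro Lw_short[OF v]) auto
  hence "(\<Sum>x\<in>rays. pairing ?n x * Lw v (u @ x # U)) = 0" using Lw_linear[of ?n v u U] by simp
  hence "(\<Sum>x\<in>rays. of_int (pairing ?n x) * complex_of_real (Lw v (u @ x # U))) = 0"
  by (metis (no_types, lifting) of_real_0 of_real_mult of_real_of_int_eq of_real_sum sum.cong)
  thus ?thesis using split[of "%x. complex_of_real (Lw v (u @ x # U))"] by (simp add: w neg_eq_iff_add_eq_0 add.commute)
  qed
  finally show ?thesis .
  qed
 qed
qed

end

section \<open>The toric form of a nonsingular fan\<close>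

lemma nonsingular_fan_complex:
 fixes Fn :: "(real ^ 'n) set set"
 assumes fan: "complete_fan Fn" and ns: "nonsingular_fan Fn"
 shows "nonsingular_complex (gens Fn ` Fn)"
proof -
 have isf: "is_fan Fn" using fan by (simp add: complete_fan_def)
 interpret simplicial_complex_fan "gens Fn ` Fn"
  by (rule fan_complex[OF fan nonsingular_imp_simplicial[OF isf ns]])
 show ?thesis
 proof
  fix G assume "G \<in> gens Fn ` Fn"
  then obtain C where C: "C \<in> Fn" "G = gens Fn C" by blast
  obtain B where B: "lattice_basis B" "G \<subseteq> B" using nonsingular_fan_gens(1)[OF isf ns C(1)] C(2) by blast
  show "\<exists>e. \<forall>d\<in>G. \<forall>d'\<in>G. pairing (e d) d' = (if d = d' then 1 else 0)"
  using lattice_basis_dual[OF B(1)] B(2) by (meson subsetD)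
 qed
qed

lemma ray_generators_gens:
 fixes Fn :: "(real ^ 'n) set set"
 shows "\<Union>(gens Fn ` Fn) = ray_generators Fn"
proof
 show "ray_generators Fn \<subseteq> \<Union>(gens Fn ` Fn)"
 proof
  fix d assume d: "d \<in> ray_generators Fn"
  hence "convex_cone hull {rvec d} \<in> Fn" by (simp add: ray_generators_def)
  moreover have "d \<in> gens Fn (convex_cone hull {rvec d})" using d by (simp add: gens_def hull_inc)
  ultimately show "d \<in> \<Union>(gens Fn ` Fn)" by blast
 qed
qed (auto simp: gens_def)

lemma finite_ray_generators:
 fixes Fn :: "(real ^ 'n) set set"
 assumes "complete_fan Fn" "simplicial_fan Fn"
 shows "finite (ray_generators Fn)"
proof -
 interpret simplicial_complex_fan "gens Fn ` Fn" by (rule fan_complex[OF assms])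
 show ?thesis using fin finite_K_mem unfolding ray_generators_gens[symmetric] by blast
qed

context nonsingular_complex
begin

lemma co_rvec_int:
 assumes G: "G \<in> facets" and d: "d \<in> G"
 shows "\<exists>k::int. co G d (rvec h) = of_int k"
proof -
 obtain e where e: "\<forall>d\<in>G. \<forall>d'\<in>G. pairing (e d) d' = (if d = d' then 1 else 0)" using dual[OF facetsD(1)[OF G]] by blast
 have "real_of_int (pairing (e d) h) = rvec (e d) \<bullet> rvec h" by (rule pairing_inner)
 also have "... = (\<Sum>d'\<in>G. co G d' (rvec h) * pairing (e d) d')" by (rule inner_expand[OF G])
 also have "... = (\<Sum>d'\<in>G. if d = d' then co G d' (rvec h) else 0)" using e d by (intro sum.cong) auto
 also have "... = co G d (rvec h)" using d facetsD(3)[OF G] by simp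
 finally have "co G d (rvec h) = real_of_int (pairing (e d) h)" by (rule sym)
 thus ?thesis by (rule exI)
qed

text \<open>Coordinates of lattice points are integers here, so each interval [0,1) or (0,1] admits
  a single value.\<close>

lemma box_facet:
 assumes G: "G \<in> facets" and N: "N \<subseteq> G"
 shows "box G N = {\<Sum>d\<in>N. d}"
proof -
 have finN: "finite N" using N facetsD(3)[OF G] finite_subset by blast
 have eq: "(\<Sum>d\<in>G. (if d \<in> N then 1 else 0) *\<^sub>R rvec d) = rvec (\<Sum>d\<in>N. d)"
 proof -
  have "(\<Sum>d\<in>G. (if d \<in> N then 1 else 0) *\<^sub>R rvec d) = (\<Sum>d\<in>N. (if d \<in> N then 1 else 0) *\<^sub>R rvec d)"
  using N facetsD(3)[OF G] by (intro sum.mono_neutral_right) auto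
  thus ?thesis by (simp add: rvec_sum)
 qed
 have "h = (\<Sum>d\<in>N. d)" if h: "h \<in> box G N" for h
 proof -
  have "co G d (rvec h) = (if d \<in> N then 1 else 0)" if d: "d \<in> G" for d
  proof -
  obtain k where k: "co G d (rvec h) = real_of_int k" using co_rvec_int[OF G d] by blast
  have "if d \<in> N then 0 < real_of_int k \<and> real_of_int k <= 1 else 0 <= real_of_int k \<and> real_of_int k < 1"
  using h d k[symmetric] by (auto simp: box_def)
  thus ?thesis unfolding k by (auto split: if_splits)
  qed
  hence "rvec h = (\<Sum>d\<in>G. (if d \<in> N then 1 else 0) *\<^sub>R rvec d)"
  by (subst facets_expand[OF G]) (intro sum.cong refl, simp)
  hence "rvec h = rvec (\<Sum>d\<in>N. d)" unfolding eq .
  thus ?thesis by simp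
 qed
 moreover have "(\<Sum>d\<in>N. d) \<in> box G N"
 proof -
  have "co G d (rvec (\<Sum>d\<in>N. d)) = (if d \<in> N then 1 else 0)" if "d \<in> G" for d
  unfolding eq[symmetric] using co_sum[OF facetsD(2)[OF G] that] .
  thus ?thesis using facetsD(5)[OF G] by (simp add: box_def)
 qed
 ultimately show ?thesis by blast
qed

end

lemma ee_sum: "ee (\<Sum>d\<in>N. f d) = (\<Prod>d\<in>N. ee (f d))"
 by (induction N rule: infinite_finite_induct) (auto simp: ee_add)

lemma powi_sum: "q ~= 0 ==> (q :: complex) powi (\<Sum>d\<in>N. f d) = (\<Prod>d\<in>N. q powi f d)"
 by (induction N rule: infinite_finite_induct) (auto simp: power_int_add)

lemma cone_value_nonsingular:
 fixes Fn :: "(real ^ 'n) set set"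
 assumes fan: "complete_fan Fn" and ns: "nonsingular_fan Fn" and lin: "linear_on_cones Fn dg" and q: "q ~= 0"
  and G: "G \<in> simplicial_complex_fan.facets (gens Fn ` Fn)" and N: "N \<subseteq> G"
 shows "cone_value dg G N (%v. q powi pairing m v) =
  (\<Prod>d\<in>G. (if d \<in> N then ee (dg d) * q powi pairing m d else 1) / (1 - ee (dg d) * q powi pairing m d))"
proof -
 have isf: "is_fan Fn" using fan by (simp add: complete_fan_def)
 interpret nonsingular_complex "gens Fn ` Fn" by (rule nonsingular_fan_complex[OF fan ns])
 have finG: "finite G" by (rule facetsD(3)[OF G])
 obtain C where C: "C \<in> Fn" "G = gens Fn C" using facetsD(1)[OF G] by blast
 have CG: "C = pos_cone G" using nonsingular_fan_gens(3)[OF isf ns C(1)] C(2) by blast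
 obtain c :: "complex ^ 'n" where c: "\<forall>v\<in>lattice_points C. dg v = (\<Sum>i\<in>UNIV. c $ i * of_int (v $ i))"
  using lin C(1) unfolding linear_on_cones_def by blast
 have dgd: "dg d = (\<Sum>i\<in>UNIV. c $ i * of_int (d $ i))" if "d \<in> G" for d
  using c rvec_in_pos_cone[OF that] unfolding CG by (simp add: lattice_points_def)
 have finN: "finite N" using finG N finite_subset by blast
 have "rvec (\<Sum>d\<in>N. d) \<in> C"
  unfolding CG rvec_sum by (rule convex_cone_sum[OF convex_cone_pos_cone]) (use N rvec_in_pos_cone in blast)
 hence "dg (\<Sum>d\<in>N. d) = (\<Sum>i\<in>UNIV. c $ i * of_int ((\<Sum>d\<in>N. d) $ i))" using c by (simp add: lattice_points_def)
 also have "... = (\<Sum>d\<in>N. \<Sum>i\<in>UNIV. c $ i * of_int (d $ i))"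
  by (subst sum.swap) (simp add: sum_distrib_left)
 also have "... = (\<Sum>d\<in>N. dg d)" using dgd N by (intro sum.cong) auto
 finally have dgN: "dg (\<Sum>d\<in>N. d) = (\<Sum>d\<in>N. dg d)" .
 have "ee (dg (\<Sum>d\<in>N. d)) * q powi pairing m (\<Sum>d\<in>N. d) = (\<Prod>d\<in>N. ee (dg d) * q powi pairing m d)"
  unfolding dgN pairing_sum_right ee_sum powi_sum[OF q] by (simp add: prod.distrib)
 also have "... = (\<Prod>d\<in>G. if d \<in> N then ee (dg d) * q powi pairing m d else 1)"
  using finG N by (simp add: prod.If_cases Int_absorb1)
 finally show ?thesis unfolding cone_value_def box_facet[OF G N] by (simp add: prod_dividef)
qed

lemma wexp_Lw:
 fixes Fn :: "(real ^ 'n) set set"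
 assumes K: "nonsingular_complex K"
 shows "wexp c ds k (%w. of_real (nonsingular_complex.Lw K v w)) =
  fps_nth (\<Sum>G\<in>simplicial_complex_fan.facets K. fps_const (of_real (1 / (\<Prod>d\<in>G. co G d v))) *
  (\<Prod>d\<leftarrow>ds. Abs_fps (%j. c d j * of_real (co G d v) ^ j))) k"
proof -
 interpret nonsingular_complex K by (rule K)
 have pl: "complex_of_real (\<Prod>d\<leftarrow>w. co G d v) = (\<Prod>d\<leftarrow>w. of_real (co G d v))" for G w
  by (induction w) auto
 have "(%w. complex_of_real (Lw v w)) = (%w. \<Sum>G\<in>facets. of_real (1 / (\<Prod>d\<in>G. co G d v)) * (\<Prod>d\<leftarrow>w. of_real (co G d v)))"
  unfolding Lw_def of_real_sum by (intro ext sum.cong refl) (simp add: pl)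
 thus ?thesis by (simp only: wexp_sum wexp_prod fps_sum_nth fps_mult_left_const_nth)
qed

lemma has_fps_expansion_prod_list:
 assumes "!!d. d \<in> set ds ==> g d has_fps_expansion F d"
 shows "(%z::complex. \<Prod>d\<leftarrow>ds. g d z) has_fps_expansion (\<Prod>d\<leftarrow>ds. F d)"
 using assms by (induction ds) (auto intro!: fps_expansion_intros)

lemma has_fps_expansion_scale:
 fixes g :: "complex => complex"
 assumes "g has_fps_expansion F"
 shows "(%z. g (x * z)) has_fps_expansion Abs_fps (%j. fps_nth F j * x ^ j)"
proof -
 have "(%z. x * z) has_fps_expansion fps_const x * fps_X"
  by (rule has_fps_expansion_cmult_left) (rule has_fps_expansion_fps_X)
 moreover have "fps_nth (fps_const x * fps_X) 0 = 0" by simp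
 ultimately have "(g \<circ> (%z. x * z)) has_fps_expansion fps_compose F (fps_const x * fps_X)"
  by (rule has_fps_expansion_compose[OF assms])
 hence "(%z. g (x * z)) has_fps_expansion Abs_fps (%j. x ^ j * fps_nth F j)"
  unfolding fps_compose_linear o_def .
 thus ?thesis by (subst mult.commute)
qed

lemma has_fps_expansion_quotient_limit:
 fixes h :: "complex => complex"
 assumes h: "h has_fps_expansion F" and z: "!!k. k < r ==> fps_nth F k = 0"
 shows "((%s. h s / s ^ r) \<longlongrightarrow> fps_nth F r) (at 0)"
proof (cases "F = 0")
 case True
 have "eventually (%s. h s = eval_fps F s) (nhds 0)" using h by (simp add: has_fps_expansion_def eq_commute)
 hence "eventually (%s. h s / s ^ r = fps_nth F r) (at 0)"
  unfolding eventually_at_filter by eventually_elim (simp add: True)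
 thus ?thesis by (rule tendsto_eventually)
next
 case False
 have "r <= subdegree F" using z False by (meson not_le nth_subdegree_nonzero)
 from has_fps_expansion_shift[OF h this refl]
 have "((%x. if x = 0 then fps_nth F r else h x / x ^ r) \<longlongrightarrow> fps_nth (fps_shift r F) 0) (nhds 0)"
  by (rule has_fps_expansion_imp_tendsto_0)
 hence "((%x. if x = 0 then fps_nth F r else h x / x ^ r) \<longlongrightarrow> fps_nth F r) (at 0)"
  by (auto intro: tendsto_mono[OF at_within_le_nhds])
 thus ?thesis
  by (rule Lim_transform_eventually) (auto simp: eventually_at_filter)
qed

text \<open>With the weight exp(-s m.v) the sum over M factorises in every maximal cone into
  Kronecker series at s times the coordinates of v. Near 0 these are theta quotients divided by
  their argument, so the sum is h(z)/s^r for a power series h in z = -i s/(2 pi). Its coefficients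
  below r vanish, and s -> 0+ extracts the coefficient of degree r.\<close>

theorem toric_form_nonsingular:
 fixes Fn :: "(real ^ 'n) set set"
 assumes fan: "complete_fan Fn" and ns: "nonsingular_fan Fn" and lin: "linear_on_cones Fn dg"
  and \<tau>: "Im \<tau> > 0" and q: "norm (ee \<tau>) < exp (- 30)"
  and c: "c > 0" and sp: "\<forall>d\<in>ray_generators Fn. sep (ee \<tau>) (ee (dg d)) c"
  and v: "simplicial_complex_fan.generic (gens Fn ` Fn) v"
  and ds: "distinct ds" "set ds = ray_generators Fn"
 shows "toric_form Fn dg (ee \<tau>) =
  wexp (%d. fps_nth (theta_factor \<tau> (dg d))) ds CARD('n) (%w. of_real (nonsingular_complex.Lw (gens Fn ` Fn) v w))
  / (2 * of_real pi * \<i>) ^ CARD('n)"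
proof -
 have isf: "is_fan Fn" using fan by (simp add: complete_fan_def)
 have simp_fan: "simplicial_fan Fn" by (rule nonsingular_imp_simplicial[OF isf ns])
 interpret nonsingular_complex "gens Fn ` Fn" by (rule nonsingular_fan_complex[OF fan ns])
 define Q where "Q = ee \<tau>"
 have Q0: "Q ~= 0" by (simp add: Q_def)
 have Q1: "norm Q < 1" using q by (simp add: Q_def) (smt (verit) exp_le_one_iff)
 have raysG: "d \<in> ray_generators Fn" if "G \<in> facets" "d \<in> G" for G d
  using facetsD(1)[OF that(1)] that(2) by (auto simp: gens_def)
 have spG: "sep Q (ee (dg d)) c" if "G \<in> facets" "d \<in> G" for G d
  using sp raysG[OF that] by (simp add: Q_def)
 have ne: "ee (dg d) * Q powi pairing m d ~= 1" if "d \<in> ray_generators Fn" for d m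
  using sep_nonzero[OF sp[rule_format, OF that] c] by (simp add: Q_def)
 let ?T = "toric_form_term Fn dg Q"
 obtain H where H: "finite H" and Hb: "\<forall>B. \<exists>t>0. \<exists>g. bounded_by Fn Q c v H B t g"
  using toric_form_bound[OF fan simp_fan v Q0 Q1 c] by blast
 define B where "B = (\<Sum>h\<in>H. norm (ee (dg h)))"
 have hB: "\<forall>h\<in>H. norm (ee (dg h)) <= B" unfolding B_def using H by (auto intro: member_le_sum)
 obtain t0 g0 where t0: "t0 > 0" and g0: "g0 summable_on UNIV" and bound: "\<forall>dg m s. linear_on_cones Fn dg --> (\<forall>d\<in>ray_generators Fn. sep Q (ee (dg d)) c) -->
  (\<forall>h\<in>H. norm (ee (dg h)) <= B) --> 0 <= s --> s <= t0 -->
  norm (toric_form_term Fn dg Q m) * exp (- s * (rvec m \<bullet> v)) <= g0 m"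
  using spec[OF Hb, of B] by blast
 have dom: "norm (of_real (exp (- s * (rvec m \<bullet> v))) * ?T m) <= g0 m" if "0 <= s" "s <= t0" for s m
  using bound[rule_format, OF lin _ _ that, of m] sp hB by (simp add: norm_mult mult.commute Q_def)
 \<comment> \<open>The weighted sum is all that can be computed termwise; the majorant for weights
   down to 0 brings back the original sum.\<close>
 have lim1: "((%s. infsum (%m. of_real (exp (- s * (rvec m \<bullet> v))) * ?T m) UNIV) \<longlongrightarrow> infsum ?T UNIV) (at_right 0)"
 proof (rule infsum_dominated_convergence(2)[OF g0])
  show "\<forall>\<^sub>F s in at_right (0::real). \<forall>m\<in>UNIV. norm (of_real (exp (- s * (rvec m \<bullet> v))) * ?T m) <= g0 m"
  using t0 dom by (auto simp: eventually_at_right_field intro!: exI[of _ t0])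
  have "((%s. complex_of_real (exp (- s * (rvec m \<bullet> v))) * ?T m) \<longlongrightarrow> of_real (exp (- 0 * (rvec m \<bullet> v))) * ?T m) (at_right 0)" for m
  by (intro tendsto_intros)
  thus "((%s. complex_of_real (exp (- s * (rvec m \<bullet> v))) * ?T m) \<longlongrightarrow> ?T m) (at_right 0)" for m by simp
 qed simp
 define kf where "kf a w = (%k::int. complex_of_real (exp (- w * real_of_int k)) * (if w > 0 then 1 else a * Q powi k) / (1 - a * Q powi k))" for a and w :: real
 have termE: "of_real (exp (- s * (rvec m \<bullet> v))) * ?T m = (\<Sum>G\<in>facets. \<Prod>d\<in>G. kf (ee (dg d)) (s * co G d v) (pairing m d))"
  if s: "s > 0" for s m
 proof -
  have tf: "?T m = (\<Sum>G\<in>facets. cone_value dg G {d\<in>G. co G d v < 0} (%w. Q powi pairing m w))"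
  by (rule toric_form_term_eq[OF fan simp_fan lin Q0 ne v])
  have "of_real (exp (- s * (rvec m \<bullet> v))) * ?T m = (\<Sum>G\<in>facets. of_real (exp (- s * (rvec m \<bullet> v))) * cone_value dg G {d\<in>G. co G d v < 0} (%w. Q powi pairing m w))"
  unfolding tf by (rule sum_distrib_left)
  also have "... = (\<Sum>G\<in>facets. \<Prod>d\<in>G. kf (ee (dg d)) (s * co G d v) (pairing m d))"
  proof (intro sum.cong refl)
  fix G assume G: "G \<in> facets"
  have "complex_of_real (exp (- s * (rvec m \<bullet> v))) = (\<Prod>d\<in>G. of_real (exp (- (s * co G d v) * pairing m d)))"
  unfolding inner_expand[OF G] using facetsD(3)[OF G]
  by (simp add: exp_sum[symmetric] sum_distrib_left sum_negf mult.assoc flip: of_real_prod)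
  moreover have "cone_value dg G {d\<in>G. co G d v < 0} (%w. Q powi pairing m w) =
  (\<Prod>d\<in>G. (if d \<in> {d\<in>G. co G d v < 0} then ee (dg d) * Q powi pairing m d else 1) / (1 - ee (dg d) * Q powi pairing m d))"
  by (rule cone_value_nonsingular[OF fan ns lin Q0 G]) auto
  ultimately have "of_real (exp (- s * (rvec m \<bullet> v))) * cone_value dg G {d\<in>G. co G d v < 0} (%w. Q powi pairing m w) =
  (\<Prod>d\<in>G. of_real (exp (- (s * co G d v) * pairing m d)) *
  ((if d \<in> {d\<in>G. co G d v < 0} then ee (dg d) * Q powi pairing m d else 1) / (1 - ee (dg d) * Q powi pairing m d)))"
  by (simp only: prod.distrib)
  also have "... = (\<Prod>d\<in>G. kf (ee (dg d)) (s * co G d v) (pairing m d))"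
  proof (intro prod.cong refl)
  fix d assume d: "d \<in> G"
  \<comment> \<open>The generators dropped from the half-open cone are those where the argument of
    the Kronecker series is negative, so the numerators of the cone and of the series agree.\<close>
  have "(d \<in> {d\<in>G. co G d v < 0}) = (\<not> s * co G d v > 0)"
  using d s generic_co[OF v G d] by (auto simp: zero_less_mult_iff)
  thus "of_real (exp (- (s * co G d v) * pairing m d)) *
  ((if d \<in> {d\<in>G. co G d v < 0} then ee (dg d) * Q powi pairing m d else 1) / (1 - ee (dg d) * Q powi pairing m d)) =
  kf (ee (dg d)) (s * co G d v) (pairing m d)" by (simp add: kf_def)
  qed
  finally show "of_real (exp (- s * (rvec m \<bullet> v))) * cone_value dg G {d\<in>G. co G d v < 0} (%w. Q powi pairing m w) =
  (\<Prod>d\<in>G. kf (ee (dg d)) (s * co G d v) (pairing m d))" .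
  qed
  finally show ?thesis .
 qed
 \<comment> \<open>A bound for all coordinates of v; for s below -ln |q| / M every argument lies in
   the convergence strip of the Kronecker series.\<close>
 define M where "M = 1 + (\<Sum>G\<in>facets. \<Sum>d\<in>G. \<bar>co G d v\<bar>)"
 have Mpos: "M > 0" unfolding M_def by (intro add_pos_nonneg sum_nonneg) auto
 have Mb: "\<bar>co G d v\<bar> < M" if "G \<in> facets" "d \<in> G" for G d
 proof -
  have "\<bar>co G d v\<bar> <= (\<Sum>d\<in>G. \<bar>co G d v\<bar>)" using that facetsD(3) by (intro member_le_sum) auto
  also have "... <= (\<Sum>G\<in>facets. \<Sum>d\<in>G. \<bar>co G d v\<bar>)" using that finite_facets
  by (intro member_le_sum[of G facets "%G. \<Sum>d\<in>G. \<bar>co G d v\<bar>"]) (auto intro: sum_nonneg)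
  finally show ?thesis by (simp add: M_def)
 qed
 have lnQ: "- ln (norm Q) > 0" using Q0 Q1 by simp
 have small: "\<forall>\<^sub>F s in at_right (0::real). 0 < s \<and> s < - ln (norm Q) / M"
 proof -
  have "0 < - ln (norm Q) / M" using lnQ Mpos by (rule divide_pos_pos)
  thus ?thesis unfolding eventually_at_right_field by blast
 qed
 have sums: "infsum (%m. of_real (exp (- s * (rvec m \<bullet> v))) * ?T m) UNIV = (\<Sum>G\<in>facets. \<Prod>d\<in>G. kron Q (ee (dg d)) (s * co G d v))"
  if s: "0 < s" "s < - ln (norm Q) / M" for s
 proof -
  have ks: "(%k. norm (kf (ee (dg d)) (s * co G d v) k)) summable_on UNIV" if "G \<in> facets" "d \<in> G" for G d
  unfolding kf_def
  proof (rule kron_abs_summable[OF Q0 Q1 spG[OF that] c])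
  show "s * co G d v ~= 0" using s generic_co[OF v that] by simp
  have "\<bar>s * co G d v\<bar> <= s * M" using s Mb[OF that] by (simp add: abs_mult)
  also have "... < - ln (norm Q)" using s Mpos by (simp add: field_simps)
  finally show "\<bar>s * co G d v\<bar> < - ln (norm Q)" .
  qed
  have "((%m. \<Sum>G\<in>facets. \<Prod>d\<in>G. kf (ee (dg d)) (s * co G d v) (pairing m d)) has_sum
  (\<Sum>G\<in>facets. \<Prod>d\<in>G. infsum (kf (ee (dg d)) (s * co G d v)) UNIV)) UNIV"
  proof (rule has_sum_finite_sum[OF finite_facets])
  fix G assume G: "G \<in> facets"
  let ?f = "%d. kf (ee (dg d)) (s * co G d v)"
  have 1: "(%m. norm (\<Prod>d\<in>G. ?f d (pairing m d))) summable_on UNIV"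
  by (rule facet_prod_sum(1)[OF G, of ?f]) (rule ks[OF G])
  have 2: "infsum (%m. \<Prod>d\<in>G. ?f d (pairing m d)) UNIV = (\<Prod>d\<in>G. infsum (?f d) UNIV)"
  by (rule facet_prod_sum(2)[OF G, of ?f]) (rule ks[OF G])
  show "((%m. \<Prod>d\<in>G. ?f d (pairing m d)) has_sum (\<Prod>d\<in>G. infsum (?f d) UNIV)) UNIV"
  using has_sum_infsum[OF abs_summable_summable[OF 1]] unfolding 2 .
  qed
  hence "infsum (%m. \<Sum>G\<in>facets. \<Prod>d\<in>G. kf (ee (dg d)) (s * co G d v) (pairing m d)) UNIV =
  (\<Sum>G\<in>facets. \<Prod>d\<in>G. infsum (kf (ee (dg d)) (s * co G d v)) UNIV)" by (rule infsumI)
  thus ?thesis unfolding termE[OF s(1)] by (simp only: kf_def kron_def)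
 qed
 define P where "P d g \<longleftrightarrow> g has_fps_expansion theta_factor \<tau> (dg d) \<and> g 0 = 1 \<and>
  (\<forall>\<^sub>F w::real in at 0. kron Q (ee (dg d)) w = g (- \<i> * w / (2 * pi)) / w)" for d and g :: "complex => complex"
 have "\<forall>d\<in>ray_generators Fn. \<exists>g. P d g"
  using kron_factor[OF \<tau> q] sp c unfolding P_def Q_def by blast
 then obtain g where g: "\<forall>d\<in>ray_generators Fn. P d (g d)" by metis
 have gF: "g d has_fps_expansion theta_factor \<tau> (dg d)" "g d 0 = 1"
  "\<forall>\<^sub>F w::real in at 0. kron Q (ee (dg d)) w = g d (- \<i> * w / (2 * pi)) / w"
  if "d \<in> ray_generators Fn" for d
  using g that unfolding P_def by blast+
 define h where "h z = (\<Sum>G\<in>facets. of_real (1 / (\<Prod>d\<in>G. co G d v)) * (\<Prod>d\<leftarrow>ds. g d (of_real (co G d v) * z)))" for z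
 define F where "F = (\<Sum>G\<in>facets. fps_const (of_real (1 / (\<Prod>d\<in>G. co G d v))) *
  (\<Prod>d\<leftarrow>ds. Abs_fps (%j. fps_nth (theta_factor \<tau> (dg d)) j * complex_of_real (co G d v) ^ j)))"
 have hF: "h has_fps_expansion F"
  unfolding h_def F_def
  by (intro has_fps_expansion_sum has_fps_expansion_cmult_left has_fps_expansion_prod_list has_fps_expansion_scale gF(1))
  (simp add: ds)
 have Fw: "fps_nth F k = wexp (%d. fps_nth (theta_factor \<tau> (dg d))) ds k (%w. of_real (Lw v w))" for k
  unfolding F_def by (rule wexp_Lw[symmetric]) unfold_locales
 have raysR: "rays = ray_generators Fn" by (simp add: rays_def ray_generators_gens)
 \<comment> \<open>Each coefficient is an expansion over words of length k with values
   \<open>Lw\<close>, which vanish for k < r.\<close>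
 have F0: "fps_nth F k = 0" if k: "k < CARD('n)" for k
 proof -
  have "wexp (%d. fps_nth (theta_factor \<tau> (dg d))) ds k (%w. of_real (Lw v w)) = wexp (%d. fps_nth (theta_factor \<tau> (dg d))) ds k (%w. 0)"
  by (rule wexp_cong) (use Lw_short[OF v] k ds raysR in simp)
  also have "(%w. 0) = (%w :: (int ^ 'n) list. \<Sum>i\<in>({}::nat set). 0::complex)" by simp
  finally show ?thesis unfolding Fw wexp_sum by simp
 qed
 have lim2: "((%z. h z / z ^ CARD('n)) \<longlongrightarrow> fps_nth F CARD('n)) (at 0)"
  by (rule has_fps_expansion_quotient_limit[OF hF F0])
 have fl: "filterlim (%s::real. - \<i> * of_real s / (2 * pi)) (at (0::complex)) (at_right 0)"
  unfolding filterlim_at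
 proof
  have "((%s::real. - \<i> * of_real s / (2 * pi)) \<longlongrightarrow> - \<i> * of_real 0 / (2 * pi)) (at_right 0)"
  by (intro tendsto_intros) auto
  thus "((%s::real. - \<i> * of_real s / (2 * pi)) \<longlongrightarrow> 0) (at_right 0)" by simp
  show "\<forall>\<^sub>F s in at_right 0. - \<i> * complex_of_real s / (2 * pi) \<in> UNIV \<and> - \<i> * complex_of_real s / (2 * pi) ~= 0"
  by (auto simp: eventually_at_right_field intro: exI[of _ 1])
 qed
 have lim3: "((%s. (- \<i> / (2 * pi)) ^ CARD('n) * (h (- \<i> * of_real s / (2 * pi)) / (- \<i> * of_real s / (2 * pi)) ^ CARD('n))) \<longlongrightarrow>
  (- \<i> / (2 * pi)) ^ CARD('n) * fps_nth F CARD('n)) (at_right 0)"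
  by (intro tendsto_mult tendsto_const filterlim_compose[OF lim2 fl])
 have kf_ev: "\<forall>\<^sub>F s in at_right 0. \<forall>G\<in>facets. \<forall>d\<in>G. kron Q (ee (dg d)) (s * co G d v) = g d (- \<i> * (s * co G d v) / (2 * pi)) / (s * co G d v)"
 proof (intro eventually_ball_finite finite_facets ballI facetsD(3))
  fix G d assume G: "G \<in> facets" "d \<in> G"
  have nz: "co G d v ~= 0" by (rule generic_co[OF v G])
  have "filterlim (%s. s * co G d v) (at 0) (at_right 0)"
  unfolding filterlim_at
  proof
  have "((%s. s * co G d v) \<longlongrightarrow> 0 * co G d v) (at_right 0)" by (intro tendsto_intros)
  thus "((%s. s * co G d v) \<longlongrightarrow> 0) (at_right 0)" by simp
  show "\<forall>\<^sub>F s in at_right 0. s * co G d v \<in> UNIV \<and> s * co G d v ~= 0"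
  using nz by (auto simp: eventually_at_right_field intro: exI[of _ 1])
  qed
  from eventually_compose_filterlim[OF gF(3)[OF raysG[OF G]] this]
  show "\<forall>\<^sub>F s in at_right 0. kron Q (ee (dg d)) (s * co G d v) = g d (- \<i> * (s * co G d v) / (2 * pi)) / (s * co G d v)" .
 qed
 have "\<forall>\<^sub>F s in at_right 0. infsum (%m. of_real (exp (- s * (rvec m \<bullet> v))) * ?T m) UNIV =
  (- \<i> / (2 * pi)) ^ CARD('n) * (h (- \<i> * of_real s / (2 * pi)) / (- \<i> * of_real s / (2 * pi)) ^ CARD('n))"
  using small kf_ev
 proof eventually_elim
  case (elim s)
  let ?z = "- \<i> * of_real s / (2 * pi)"
  have s: "0 < s" using elim by simp
  have prod: "(\<Prod>d\<in>G. kron Q (ee (dg d)) (s * co G d v)) =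
  of_real (1 / (\<Prod>d\<in>G. co G d v)) * (\<Prod>d\<leftarrow>ds. g d (of_real (co G d v) * ?z)) / of_real s ^ CARD('n)"
  if G: "G \<in> facets" for G
  proof -
  have "(\<Prod>d\<in>G. kron Q (ee (dg d)) (s * co G d v)) = (\<Prod>d\<in>G. g d (of_real (co G d v) * ?z) / (of_real s * of_real (co G d v)))"
  proof (intro prod.cong refl)
  fix d assume d: "d \<in> G"
  have e: "- \<i> * (s * co G d v) / (2 * pi) = of_real (co G d v) * ?z" by simp
  have "kron Q (ee (dg d)) (s * co G d v) = g d (- \<i> * (s * co G d v) / (2 * pi)) / (s * co G d v)"
  using elim G d by blast
  hence "kron Q (ee (dg d)) (s * co G d v) = g d (of_real (co G d v) * ?z) / (s * co G d v)" unfolding e .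
  thus "kron Q (ee (dg d)) (s * co G d v) = g d (of_real (co G d v) * ?z) / (of_real s * of_real (co G d v))"
  by simp
  qed
  also have "... = (\<Prod>d\<in>G. g d (of_real (co G d v) * ?z)) / (of_real s ^ CARD('n) * of_real (\<Prod>d\<in>G. co G d v))"
  using facetsD(4)[OF G] by (simp add: prod_dividef prod.distrib)
  \<comment> \<open>The product may run over all rays, because outside G the coordinate is 0 and
    \<open>g d 0 = 1\<close>. After this all cones share one expansion scheme.\<close>
  also have "(\<Prod>d\<in>G. g d (of_real (co G d v) * ?z)) = (\<Prod>d\<in>set ds. g d (of_real (co G d v) * ?z))"
  using raysG[OF G] co_outside[OF G] gF(2) ds finite_ray_generators[OF fan simp_fan] by (intro prod.mono_neutral_left) auto
  also have "... = (\<Prod>d\<leftarrow>ds. g d (of_real (co G d v) * ?z))" by (rule prod.distinct_set_conv_list[OF ds(1)])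
  finally show ?thesis by simp
  qed
  have "infsum (%m. of_real (exp (- s * (rvec m \<bullet> v))) * ?T m) UNIV = h ?z / of_real s ^ CARD('n)"
  unfolding sums[OF s conjunct2[OF elim(1)]] h_def sum_divide_distrib
  by (rule sum.cong[OF refl prod])
  also have "... = (- \<i> / (2 * pi)) ^ CARD('n) * (h ?z / ?z ^ CARD('n))"
  proof -
  have zs: "?z ^ CARD('n) = (- \<i> / (2 * pi)) ^ CARD('n) * of_real s ^ CARD('n)" by (simp flip: power_mult_distrib)
  have nz: "(- \<i> / (2 * pi)) ^ CARD('n) ~= (0::complex)" by simp
  have gq: "X / y = x * (X / (x * y))" if "x ~= 0" for X x y :: complex using that by simp
  show ?thesis unfolding zs by (rule gq[OF nz])
  qed
  finally show ?case .
 qed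
 hence "((%s. infsum (%m. of_real (exp (- s * (rvec m \<bullet> v))) * ?T m) UNIV) \<longlongrightarrow> (- \<i> / (2 * pi)) ^ CARD('n) * fps_nth F CARD('n)) (at_right 0)"
  using lim3 by (rule tendsto_cong[THEN iffD2])
 hence "infsum ?T UNIV = (- \<i> / (2 * pi)) ^ CARD('n) * fps_nth F CARD('n)"
  using lim1 tendsto_unique trivial_limit_at_right_real by blast
 moreover have "- \<i> / (2 * pi) = 1 / (2 * of_real pi * \<i>)" by (simp add: field_simps)
 ultimately show ?thesis by (simp add: toric_form_def Q_def Fw power_divide power_mult_distrib)
qed

section \<open>Perturbation of the degree and passage to the refinement\<close>

lemma tendsto_ee [tendsto_intros]: "(f \<longlongrightarrow> a) F ==> ((%x. ee (f x)) \<longlongrightarrow> ee a) F"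
 unfolding ee_def by (intro tendsto_intros)

text \<open>In the unit disc the affine function is bounded and meets only finitely many integers,
  each at one point; these points do not accumulate at 0.\<close>

lemma eventually_affine_not_Ints:
 fixes a b :: complex
 assumes "b ~= 0"
 shows "\<forall>\<^sub>F \<epsilon> in at 0. a + \<epsilon> * b \<notin> \<int>"
proof -
 define S where "S = {\<epsilon>. a + \<epsilon> * b \<in> \<int> \<and> norm \<epsilon> <= 1}"
 have "S \<subseteq> (%n. (of_int n - a) / b) ` {- \<lceil>norm a + norm b\<rceil>..\<lceil>norm a + norm b\<rceil>}"
 proof
  fix \<epsilon> assume "\<epsilon> \<in> S"
  then obtain n where n: "a + \<epsilon> * b = of_int n" and e: "norm \<epsilon> <= 1" by (auto simp: S_def Ints_def)
  have "\<bar>real_of_int n\<bar> = norm (a + \<epsilon> * b)" unfolding n by simp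
  also have "... <= norm a + norm \<epsilon> * norm b" by (metis norm_mult norm_triangle_ineq)
  also have "... <= norm a + 1 * norm b" using e by (intro add_left_mono mult_right_mono) auto
  finally have "\<bar>real_of_int n\<bar> <= norm a + norm b" by simp
  hence "n \<in> {- \<lceil>norm a + norm b\<rceil>..\<lceil>norm a + norm b\<rceil>}" by simp linarith
  moreover have "\<epsilon> = (of_int n - a) / b" using n assms by (simp add: field_simps flip: n)
  ultimately show "\<epsilon> \<in> (%n. (of_int n - a) / b) ` {- \<lceil>norm a + norm b\<rceil>..\<lceil>norm a + norm b\<rceil>}" by blast
 qed
 hence "finite S" using finite_surj by blast
 hence "\<forall>\<^sub>F \<epsilon> in at 0. \<epsilon> \<notin> S" using islimpt_finite islimpt_iff_eventually by blast
 moreover have "\<forall>\<^sub>F \<epsilon> in at (0::complex). norm \<epsilon> < 1"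
  by (auto simp: eventually_at intro: exI[of _ 1])
 ultimately show ?thesis by eventually_elim (auto simp: S_def)
qed

lemma linear_on_cones_add:
 assumes "linear_on_cones Fn dg" "linear_on_cones Fn dg1"
 shows "linear_on_cones Fn (%d. dg d + \<epsilon> * dg1 d)"
 unfolding linear_on_cones_def
proof
 fix C assume "C \<in> Fn"
 then obtain c c1 where "\<forall>v\<in>lattice_points C. dg v = (\<Sum>i\<in>UNIV. c $ i * of_int (v $ i))"
  "\<forall>v\<in>lattice_points C. dg1 v = (\<Sum>i\<in>UNIV. c1 $ i * of_int (v $ i))"
  using assms unfolding linear_on_cones_def by meson
 hence "\<forall>v\<in>lattice_points C. dg v + \<epsilon> * dg1 v = (\<Sum>i\<in>UNIV. (c + \<epsilon> *s c1) $ i * of_int (v $ i))"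
  by (simp add: sum.distrib sum_distrib_left algebra_simps)
 thus "\<exists>c. \<forall>v\<in>lattice_points C. dg v + \<epsilon> * dg1 v = (\<Sum>i\<in>UNIV. c $ i * of_int (v $ i))" by blast
qed

text \<open>On the rays of Fn the degree is not integral, so one separation constant works for all
  small \<open>\<epsilon>\<close> and dominated convergence applies. On the rays of Fn' separation
  holds only for \<open>\<epsilon>\<close> other than 0, with a constant depending on it; this
  suffices to identify the two forms for each such \<open>\<epsilon>\<close>.\<close>

theorem toric_form_perturbation:
 fixes Fn Fn' :: "(real ^ 'n) set set"
 assumes fan: "complete_fan Fn" "simplicial_fan Fn" and fan': "complete_fan Fn'" "simplicial_fan Fn'"
  and ref: "refinement_of Fn' Fn" and lin: "linear_on_cones Fn dg" "linear_on_cones Fn dg1"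
  and ni: "\<forall>d\<in>ray_generators Fn. dg d \<notin> \<int>" and n0: "\<forall>d\<in>ray_generators Fn'. dg1 d ~= 0"
 shows "\<exists>\<delta>>0. \<delta> <= exp (- 30) \<and> (\<forall>\<tau>. norm (ee \<tau>) < \<delta> -->
  toric_form_term Fn dg (ee \<tau>) summable_on UNIV \<and>
  (\<forall>\<^sub>F \<epsilon> in at 0. \<exists>c>0. \<forall>d\<in>ray_generators Fn'. sep (ee \<tau>) (ee (dg d + \<epsilon> * dg1 d)) c) \<and>
  ((%\<epsilon>. toric_form Fn' (%d. dg d + \<epsilon> * dg1 d) (ee \<tau>)) \<longlongrightarrow> toric_form Fn dg (ee \<tau>)) (at 0))"
proof -
 interpret simplicial_complex_fan "gens Fn ` Fn" by (rule fan_complex[OF fan])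
 let ?R = "ray_generators Fn" and ?R' = "ray_generators Fn'"
 have finR: "finite ?R" "finite ?R'" using finite_ray_generators fan fan' by auto
 have finRR: "finite (?R \<union> ?R')" using finR by simp
 define a where "a \<epsilon> d = ee (dg d + \<epsilon> * dg1 d)" for \<epsilon> d
 have a0: "a 0 d = ee (dg d)" for d by (simp add: a_def)
 have alim: "((%\<epsilon>. a \<epsilon> d) \<longlongrightarrow> ee (dg d)) (at 0)" for d
 proof -
  have "((%\<epsilon>. a \<epsilon> d) \<longlongrightarrow> ee (dg d + 0 * dg1 d)) (at 0)" unfolding a_def by (intro tendsto_intros)
  thus ?thesis by simp
 qed
 have nlim: "((%\<epsilon>. norm (a \<epsilon> d)) \<longlongrightarrow> norm (ee (dg d))) (at 0)" for d by (intro tendsto_norm alim)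
 have nlim1: "((%\<epsilon>. norm (1 - a \<epsilon> d)) \<longlongrightarrow> norm (1 - ee (dg d))) (at 0)" for d
  by (intro tendsto_intros alim)
 have evn: "\<forall>\<^sub>F \<epsilon> in at 0. \<forall>d\<in>?R \<union> ?R'. norm (ee (dg d)) / 2 < norm (a \<epsilon> d) \<and> norm (a \<epsilon> d) < 2 * norm (ee (dg d))"
 proof (intro eventually_ball_finite finRR ballI eventually_conj)
  fix d
  show "\<forall>\<^sub>F \<epsilon> in at 0. norm (ee (dg d)) / 2 < norm (a \<epsilon> d)" by (rule order_tendstoD(1)[OF nlim]) simp
  show "\<forall>\<^sub>F \<epsilon> in at 0. norm (a \<epsilon> d) < 2 * norm (ee (dg d))" by (rule order_tendstoD(2)[OF nlim]) simp
 qed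
 have ev1: "\<forall>\<^sub>F \<epsilon> in at 0. \<forall>d\<in>?R. norm (1 - ee (dg d)) / 2 < norm (1 - a \<epsilon> d)"
 proof (intro eventually_ball_finite finR ballI)
  fix d assume "d \<in> ?R"
  hence "ee (dg d) ~= 1" using ni ee_eq_1 by blast
  hence "norm (1 - ee (dg d)) / 2 < norm (1 - ee (dg d))" by simp
  thus "\<forall>\<^sub>F \<epsilon> in at 0. norm (1 - ee (dg d)) / 2 < norm (1 - a \<epsilon> d)" using order_tendstoD(1)[OF nlim1] by blast
 qed
 \<comment> \<open>The threshold for |q|. The factors 1/4 are the 1/2 demanded by
   \<open>sepI\<close> with another factor 2 for the variation of the perturbed values; exp(-30) is
   inherited from \<open>theta_deriv_nonzero\<close>.\<close>
 obtain b where b: "b > 0" "!!x. x \<in> (%d. norm (ee (dg d)) / 4) ` (?R \<union> ?R') \<union> (%d. 1 / (4 * norm (ee (dg d)))) ` (?R \<union> ?R') \<union> {exp (- 30)} ==> b <= x"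
  by (rule finite_positive_bound[of "(%d. norm (ee (dg d)) / 4) ` (?R \<union> ?R') \<union> (%d. 1 / (4 * norm (ee (dg d)))) ` (?R \<union> ?R') \<union> {exp (- 30)}"])
  (use finRR in auto)
 have b1: "b <= norm (ee (dg d)) / 4" "b <= 1 / (4 * norm (ee (dg d)))" if "d \<in> ?R \<union> ?R'" for d using b(2) that by blast+
 have b30: "b <= exp (- 30)" using b(2) by blast
 have "toric_form_term Fn dg (ee \<tau>) summable_on UNIV \<and>
  (\<forall>\<^sub>F \<epsilon> in at 0. \<exists>c>0. \<forall>d\<in>?R'. sep (ee \<tau>) (ee (dg d + \<epsilon> * dg1 d)) c) \<and>
  ((%\<epsilon>. toric_form Fn' (%d. dg d + \<epsilon> * dg1 d) (ee \<tau>)) \<longlongrightarrow> toric_form Fn dg (ee \<tau>)) (at 0)"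
  if q: "norm (ee \<tau>) < b" for \<tau>
 proof -
  define Q where "Q = ee \<tau>"
  have Q0: "Q ~= 0" by (simp add: Q_def)
  have Q1: "norm Q < 1" using q b30 by (simp add: Q_def) (smt (verit) exp_le_one_iff)
  have qb: "norm (ee (dg d)) * norm Q <= 1/4" "4 * norm Q <= norm (ee (dg d))" if "d \<in> ?R \<union> ?R'" for d
  proof -
  have "norm (ee (dg d)) * norm Q <= norm (ee (dg d)) * b" using q by (intro mult_left_mono) (auto simp: Q_def)
  also have "... <= norm (ee (dg d)) * (1 / (4 * norm (ee (dg d))))" using b1(2)[OF that] by (intro mult_left_mono) auto
  finally show "norm (ee (dg d)) * norm Q <= 1/4" by simp
  show "4 * norm Q <= norm (ee (dg d))" using b1(1)[OF that] q by (simp add: Q_def)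
  qed
  have evq: "\<forall>\<^sub>F \<epsilon> in at 0. \<forall>d\<in>?R \<union> ?R'. norm (a \<epsilon> d) * norm Q <= 1/2 \<and> 2 * norm Q <= norm (a \<epsilon> d)"
  using evn
  proof eventually_elim
  case (elim \<epsilon>)
  show ?case
  proof
  fix d assume d: "d \<in> ?R \<union> ?R'"
  have "norm (a \<epsilon> d) * norm Q <= 2 * norm (ee (dg d)) * norm Q"
  using elim[rule_format, OF d] by (intro mult_right_mono) auto
  thus "norm (a \<epsilon> d) * norm Q <= 1/2 \<and> 2 * norm Q <= norm (a \<epsilon> d)"
  using qb[OF d] elim[rule_format, OF d] by auto
  qed
  qed
  obtain c where c: "c > 0" "!!x. x \<in> (%d. norm (ee (dg d)) / 4) ` ?R \<union> (%d. norm (1 - ee (dg d)) / 2) ` ?R \<union> {1/2} ==> c <= x"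
  by (rule finite_positive_bound[of "(%d. norm (ee (dg d)) / 4) ` ?R \<union> (%d. norm (1 - ee (dg d)) / 2) ` ?R \<union> {1/2}"])
  (use finR ni ee_eq_1 in auto)
  have c1: "c <= norm (ee (dg d)) / 4" "c <= norm (1 - ee (dg d)) / 2" if "d \<in> ?R" for d using c(2) that by blast+
  have c2: "c <= 1/2" using c(2) by blast
  have sep0: "sep Q (ee (dg d)) c" if d: "d \<in> ?R" for d
  by (rule sepI[OF Q0 Q1, where \<eta> = c]) (use qb[of d] c1[OF d] c2 c(1) d norm_ge_zero[of Q] in auto)
  have seps: "\<forall>\<^sub>F \<epsilon> in at 0. \<forall>d\<in>?R. sep Q (a \<epsilon> d) c"
  using evq evn ev1
  proof eventually_elim
  case (elim \<epsilon>)
  show ?case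
  proof
  fix d assume d: "d \<in> ?R"
  show "sep Q (a \<epsilon> d) c"
  by (rule sepI[OF Q0 Q1, where \<eta> = c])
  (use elim(1)[rule_format, of d] elim(2)[rule_format, of d] elim(3)[rule_format, of d] c1[OF d] c2 c(1) d in auto)
  qed
  qed
  have evni: "\<forall>\<^sub>F \<epsilon> in at 0. \<forall>d\<in>?R'. dg d + \<epsilon> * dg1 d \<notin> \<int>"
  by (intro eventually_ball_finite finR ballI eventually_affine_not_Ints) (use n0 in auto)
  \<comment> \<open>Here the constant is chosen after \<open>\<epsilon>\<close>, since a ray of Fn'
    may have integral degree at \<open>\<epsilon>\<close> = 0.\<close>
  have seps': "\<forall>\<^sub>F \<epsilon> in at 0. \<exists>c>0. \<forall>d\<in>?R'. sep Q (a \<epsilon> d) c"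
  using evq evni
  proof eventually_elim
  case (elim \<epsilon>)
  have an: "a \<epsilon> d ~= 1" if "d \<in> ?R'" for d using elim(2) that ee_eq_1 unfolding a_def by blast
  have a00: "a \<epsilon> d ~= 0" for d by (simp add: a_def)
  obtain e where e: "e > 0" "!!x. x \<in> (%d. norm (a \<epsilon> d) / 2) ` ?R' \<union> (%d. norm (1 - a \<epsilon> d)) ` ?R' \<union> {1/2} ==> e <= x"
  by (rule finite_positive_bound[of "(%d. norm (a \<epsilon> d) / 2) ` ?R' \<union> (%d. norm (1 - a \<epsilon> d)) ` ?R' \<union> {1/2}"])
  (use finR an a00 in auto)
  have "sep Q (a \<epsilon> d) e" if d: "d \<in> ?R'" for d
  proof (rule sepI[OF Q0 Q1, where \<eta> = e])
  show "e <= norm (1 - a \<epsilon> d)" "e <= 1/2" "e <= norm (a \<epsilon> d) / 2" using e(2) d by blast+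
  qed (use elim(1) d e(1) in auto)
  thus ?case using e(1) by blast
  qed
  obtain v where v: "generic v" using generic_exists by blast
  obtain H where H: "finite H" and Hb: "\<forall>B. \<exists>t>0. \<exists>g. bounded_by Fn Q c v H B t g"
  using toric_form_bound[OF fan v Q0 Q1 c(1)] by blast
  \<comment> \<open>The added 1 leaves room for the perturbed values at the finitely many box
    points.\<close>
  define B where "B = (\<Sum>h\<in>H. norm (ee (dg h)) + 1)"
  have hB: "norm (ee (dg h)) + 1 <= B" if "h \<in> H" for h
  unfolding B_def by (rule member_le_sum[of h H "%h. norm (ee (dg h)) + 1"]) (use H that in auto)
  obtain t0 g0 where t0: "t0 > 0" and g0: "g0 summable_on UNIV" and bound: "\<forall>dg m s. linear_on_cones Fn dg --> (\<forall>d\<in>ray_generators Fn. sep Q (ee (dg d)) c) -->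
  (\<forall>h\<in>H. norm (ee (dg h)) <= B) --> 0 <= s --> s <= t0 -->
  norm (toric_form_term Fn dg Q m) * exp (- s * (rvec m \<bullet> v)) <= g0 m"
  using spec[OF Hb, of B] by blast
  have evB: "\<forall>\<^sub>F \<epsilon> in at 0. \<forall>h\<in>H. norm (a \<epsilon> h) <= B"
  proof (intro eventually_ball_finite H ballI)
  fix h assume h: "h \<in> H"
  have "norm (ee (dg h)) < B" using hB[OF h] by linarith
  thus "\<forall>\<^sub>F \<epsilon> in at 0. norm (a \<epsilon> h) <= B"
  by (rule eventually_mono[OF order_tendstoD(2)[OF nlim]]) simp_all
  qed
  let ?T = "%\<epsilon>. toric_form_term Fn (%d. dg d + \<epsilon> * dg1 d) Q"
  have linE: "linear_on_cones Fn (%d. dg d + \<epsilon> * dg1 d)" for \<epsilon> by (rule linear_on_cones_add[OF lin])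
  have dom: "\<forall>\<^sub>F \<epsilon> in at 0. \<forall>m\<in>UNIV. norm (?T \<epsilon> m) <= g0 m"
  using seps evB
  proof eventually_elim
  case (elim \<epsilon>)
  have "norm (?T \<epsilon> m) * exp (- 0 * (rvec m \<bullet> v)) <= g0 m" for m
  by (rule bound[rule_format, OF linE]) (use elim t0 in \<open>auto simp: a_def\<close>)
  thus ?case by simp
  qed
  have lim: "((%\<epsilon>. ?T \<epsilon> m) \<longlongrightarrow> toric_form_term Fn dg Q m) (at 0)" for m
  proof -
  let ?V = "%f. \<Sum>G\<in>facets. cone_value f G {d\<in>G. co G d v < 0} (%w. Q powi pairing m w)"
  have ne: "ee (dg d) * Q powi pairing m d ~= 1" if "d \<in> ?R" for d by (rule sep_nonzero[OF sep0[OF that] c(1)])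
  have e0: "toric_form_term Fn dg Q m = ?V dg"
  by (rule toric_form_term_eq[OF fan lin(1) Q0 ne v])
  have "\<forall>\<^sub>F \<epsilon> in at 0. ?T \<epsilon> m = ?V (%d. dg d + \<epsilon> * dg1 d)"
  using seps
  proof eventually_elim
  case (elim \<epsilon>)
  show ?case
  proof (rule toric_form_term_eq[OF fan linE Q0 _ v])
  fix d assume "d \<in> ?R"
  thus "ee (dg d + \<epsilon> * dg1 d) * Q powi pairing m d ~= 1"
  using elim sep_nonzero c(1) unfolding a_def by blast
  qed
  qed
  moreover have "((%\<epsilon>. ?V (%d. dg d + \<epsilon> * dg1 d)) \<longlongrightarrow> ?V dg) (at 0)"
  unfolding cone_value_def a_def[symmetric]
  proof (intro tendsto_intros alim)
  fix G assume G: "G \<in> facets"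
  have "1 - ee (dg d) * Q powi pairing m d ~= 0" if "d \<in> G" for d
  using ne[of d] facetsD(1)[OF G] that by (auto simp: gens_def)
  thus "(\<Prod>d\<in>G. 1 - ee (dg d) * Q powi pairing m d) ~= 0" using facetsD(3)[OF G] by simp
  qed
  ultimately show ?thesis unfolding e0 by (rule tendsto_cong[THEN iffD2])
  qed
  have res: "toric_form_term Fn dg Q summable_on UNIV"
  "((%\<epsilon>. infsum (?T \<epsilon>) UNIV) \<longlongrightarrow> infsum (toric_form_term Fn dg Q) UNIV) (at 0)"
  using infsum_dominated_convergence[OF g0 dom lim] by auto
  have "\<forall>\<^sub>F \<epsilon> in at 0. toric_form Fn' (%d. dg d + \<epsilon> * dg1 d) Q = infsum (?T \<epsilon>) UNIV"
  using seps seps'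
  proof eventually_elim
  case (elim \<epsilon>)
  then obtain c' where c': "c' > 0" "\<forall>d\<in>?R'. sep Q (a \<epsilon> d) c'" by blast
  have "?T \<epsilon> m = toric_form_term Fn' (%d. dg d + \<epsilon> * dg1 d) Q m" for m
  proof (rule toric_form_term_refinement[OF fan fan' ref linE Q0])
  show "ee (dg d + \<epsilon> * dg1 d) * Q powi pairing m d ~= 1" if "d \<in> ?R" for d
  using elim(1) that sep_nonzero c(1) unfolding a_def by blast
  show "ee (dg d + \<epsilon> * dg1 d) * Q powi pairing m d ~= 1" if "d \<in> ?R'" for d
  using c' that sep_nonzero unfolding a_def by blast
  qed
  hence "?T \<epsilon> = toric_form_term Fn' (%d. dg d + \<epsilon> * dg1 d) Q" by (rule ext)
  thus ?case by (simp only: toric_form_def)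
  qed
  hence "((%\<epsilon>. toric_form Fn' (%d. dg d + \<epsilon> * dg1 d) Q) \<longlongrightarrow> toric_form Fn dg Q) (at 0)"
  using res(2) unfolding toric_form_def[of Fn] by (rule tendsto_cong[THEN iffD2])
  thus ?thesis using res(1) seps' unfolding Q_def a_def by blast
 qed
 thus ?thesis using b(1) b30 by blast
qed

section \<open>Cochains, cup products and their evaluation on cycles\<close>

lemma eval_chain_superset:
 assumes "finite A" "Poly_Mapping.keys c \<subseteq> A"
 shows "eval_chain \<phi> c = (\<Sum>s\<in>A. of_int (Poly_Mapping.lookup c s) * \<phi> s)"
 unfolding eval_chain_def using assms by (intro sum.mono_neutral_left) (auto simp: in_keys_iff)

lemma eval_chain_0 [simp]: "eval_chain \<phi> 0 = 0"
 by (simp add: eval_chain_def)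

lemma eval_chain_frag_of [simp]: "eval_chain \<phi> (frag_of s) = \<phi> s"
 by (simp add: eval_chain_def)

lemma eval_chain_diff: "eval_chain \<phi> (a - b) = eval_chain \<phi> a - eval_chain \<phi> b"
proof -
 let ?A = "Poly_Mapping.keys a \<union> Poly_Mapping.keys b"
 have k: "Poly_Mapping.keys (a - b) \<subseteq> ?A" by (rule keys_diff)
 have "eval_chain \<phi> (a - b) = (\<Sum>s\<in>?A. of_int (Poly_Mapping.lookup a s) * \<phi> s) - (\<Sum>s\<in>?A. of_int (Poly_Mapping.lookup b s) * \<phi> s)"
  by (subst eval_chain_superset[OF _ k]) (simp_all add: lookup_minus left_diff_distrib sum_subtractf)
 also have "... = eval_chain \<phi> a - eval_chain \<phi> b"
  by (simp add: eval_chain_superset[of ?A a] eval_chain_superset[of ?A b])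
 finally show ?thesis .
qed

lemma eval_chain_minus: "eval_chain \<phi> (- a) = - eval_chain \<phi> a"
 using eval_chain_diff[of \<phi> 0 a] by simp

lemma eval_chain_add: "eval_chain \<phi> (a + b) = eval_chain \<phi> a + eval_chain \<phi> b"
 using eval_chain_diff[of \<phi> a "- b"] by (simp add: eval_chain_minus)

lemma eval_chain_sum: "eval_chain \<phi> (\<Sum>i\<in>I. f i) = (\<Sum>i\<in>I. eval_chain \<phi> (f i))"
 by (induction I rule: infinite_finite_induct) (auto simp: eval_chain_add)

lemma eval_chain_cmul: "eval_chain \<phi> (frag_cmul k a) = of_int k * eval_chain \<phi> a"
proof -
 have "eval_chain \<phi> (frag_cmul k a) = (\<Sum>s\<in>Poly_Mapping.keys a. of_int (Poly_Mapping.lookup (frag_cmul k a) s) * \<phi> s)"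
  by (rule eval_chain_superset) (auto simp: keys_cmul)
 thus ?thesis by (simp add: eval_chain_def sum_distrib_left mult.assoc)
qed

lemma eval_chain_cong: "(!!s. s \<in> Poly_Mapping.keys c ==> \<phi> s = \<psi> s) ==> eval_chain \<phi> c = eval_chain \<psi> c"
 by (simp add: eval_chain_def)

lemma eval_chain_zero: "(!!s. s \<in> Poly_Mapping.keys c ==> \<phi> s = 0) ==> eval_chain \<phi> c = 0"
 by (simp add: eval_chain_def)

lemma eval_chain_diff_left: "eval_chain (%s. \<phi> s - \<psi> s) c = eval_chain \<phi> c - eval_chain \<psi> c"
 by (simp add: eval_chain_def right_diff_distrib sum_subtractf)

lemma coboundary_sum: "coboundary p \<phi> s = (\<Sum>k\<le>Suc p. (-1) ^ k * \<phi> (singular_face (Suc p) k s))"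
 unfolding coboundary_def chain_boundary_of by (simp add: eval_chain_sum eval_chain_cmul del: sum.atMost_Suc)

lemma coboundary_add: "coboundary p (%s. \<phi> s + \<psi> s) s = coboundary p \<phi> s + coboundary p \<psi> s"
 unfolding coboundary_sum by (simp only: distrib_left sum.distrib)

lemma coboundary_diff: "coboundary p (%s. \<phi> s - \<psi> s) s = coboundary p \<phi> s - coboundary p \<psi> s"
 unfolding coboundary_sum by (simp only: right_diff_distrib sum_subtractf)

lemma coboundary_linear: "coboundary p (%s. \<Sum>i\<in>I. a i * \<phi> i s) s = (\<Sum>i\<in>I. a i * coboundary p (\<phi> i) s)"
 unfolding coboundary_sum sum_distrib_left by (subst sum.swap) (simp only: mult.left_commute)

lemma eval_chain_coboundary: "eval_chain (coboundary p \<phi>) c = eval_chain \<phi> (chain_boundary (Suc p) c)"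
 using subset_UNIV
 by (induction c rule: frag_induction) (simp_all add: coboundary_def eval_chain_diff chain_boundary_diff)

lemma cocycle_eval_boundary:
 assumes "cocycle p X \<phi>" "singular_chain (Suc p) X c"
 shows "eval_chain \<phi> (chain_boundary (Suc p) c) = 0"
 unfolding eval_chain_coboundary[symmetric]
 by (rule eval_chain_zero) (use assms in \<open>auto simp: cocycle_def singular_chain_def\<close>)

lemma coboundary_coboundary:
 assumes "singular_simplex (Suc (Suc p)) X s"
 shows "coboundary (Suc p) (coboundary p \<phi>) s = 0"
proof -
 have "chain_boundary (Suc p) (chain_boundary (Suc (Suc p)) (frag_of s)) = 0"
  using chain_boundary_boundary_alt[of "Suc p" X "frag_of s"] assms by (simp add: singular_chain_of)
 thus ?thesis unfolding coboundary_def[of "Suc p"] eval_chain_coboundary by simp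
qed

definition shift :: "nat => (nat => real) => nat => real" where
 "shift p x i = (if i < p then 0 else x (i - p))"

lemma back_face_shift: "back_face p k s = restrict (%x. s (shift p x)) (standard_simplex k)"
 by (simp add: back_face_def shift_def[abs_def])

lemma shift_simplex:
 assumes "x \<in> standard_simplex q"
 shows "shift p x \<in> standard_simplex (p + q)"
proof -
 have "(\<Sum>i\<le>p + q. shift p x i) = (\<Sum>i\<in>(%j. j + p) ` {..q}. shift p x i)"
 proof (rule sum.mono_neutral_right)
  show "\<forall>i\<in>{..p + q} - (%j. j + p) ` {..q}. shift p x i = 0"
  proof
  fix i assume i: "i \<in> {..p + q} - (%j. j + p) ` {..q}"
  have "i < p"
  proof (rule ccontr)
  assume "\<not> i < p"
  hence "i = (i - p) + p" "i - p <= q" using i by auto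
  hence "i \<in> (%j. j + p) ` {..q}" by blast
  thus False using i by blast
  qed
  thus "shift p x i = 0" by (simp add: shift_def)
  qed
 qed auto
 also have "... = (\<Sum>j\<le>q. x j)" by (subst sum.reindex) (auto simp: shift_def)
 finally show ?thesis using assms by (auto simp: standard_simplex_def shift_def)
qed

lemma continuous_map_powertop_component:
 "continuous_map (subtopology (powertop_real UNIV) S) euclideanreal (%x. x i)"
 by (intro continuous_map_from_subtopology continuous_map_product_projection) auto

lemma continuous_map_simplexI:
 assumes "!!i. continuous_map (subtopology (powertop_real UNIV) S) euclideanreal (%x. f x i)"
  and "!!x. x \<in> S ==> f x \<in> T"
 shows "continuous_map (subtopology (powertop_real UNIV) S) (subtopology (powertop_real UNIV) T) f"
 unfolding continuous_map_in_subtopology using assms by (auto simp: continuous_map_componentwise_UNIV)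

lemma singular_simplex_front_face:
 assumes "singular_simplex n X s" "p <= n"
 shows "singular_simplex p X (front_face p s)"
proof -
 have sub: "standard_simplex p \<subseteq> standard_simplex n" by (rule standard_simplex_mono[OF assms(2)])
 have "continuous_map (subtopology (powertop_real UNIV) (standard_simplex p)) X s"
  using assms(1) sub unfolding singular_simplex_def by (meson continuous_map_from_subtopology_mono)
 thus ?thesis unfolding singular_simplex_def front_face_def
  by (auto intro: continuous_map_eq)
qed

lemma singular_simplex_back_face:
 assumes "singular_simplex (p + q) X s"
 shows "singular_simplex q X (back_face p q s)"
proof -
 have "continuous_map (subtopology (powertop_real UNIV) (standard_simplex q)) (subtopology (powertop_real UNIV) (standard_simplex (p + q))) (shift p)"
 proof (rule continuous_map_simplexI)
  show "continuous_map (subtopology (powertop_real UNIV) (standard_simplex q)) euclideanreal (%x. shift p x i)" for i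
  unfolding shift_def by (cases "i < p") (auto intro: continuous_map_powertop_component)
 qed (rule shift_simplex)
 hence "continuous_map (subtopology (powertop_real UNIV) (standard_simplex q)) X (s \<circ> shift p)"
  using assms unfolding singular_simplex_def by (blast intro: continuous_map_compose)
 thus ?thesis unfolding singular_simplex_def back_face_shift
  by (auto intro: continuous_map_eq)
qed

lemma front_front: "p <= q ==> front_face p (front_face q s) = front_face p s"
 using standard_simplex_mono[of p q] by (auto simp: front_face_def fun_eq_iff)

lemma back_front: "back_face p q (front_face (p + q) s) = back_face p q s"
 using shift_simplex[of _ q p] by (auto simp: front_face_def back_face_shift fun_eq_iff)

lemma front_back: "front_face q (back_face p (q + r) s) = back_face p q s"
 using standard_simplex_mono[of q "q + r"] by (auto simp: front_face_def back_face_shift fun_eq_iff)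

lemma back_back: "back_face p r (back_face p' (p + r) s) = back_face (p' + p) r s"
proof -
 have "shift p' (shift p x) = shift (p' + p) x" for x by (auto simp: shift_def fun_eq_iff)
 thus ?thesis using shift_simplex[of _ r p] by (intro ext) (simp add: back_face_shift restrict_def)
qed

lemma front_singular_face_le:
 assumes "k <= Suc p"
 shows "front_face p (singular_face (Suc (p + q)) k s) = singular_face (Suc p) k (front_face (Suc p) s)"
proof (rule ext)
 fix x
 have "simplical_face k x \<in> standard_simplex (Suc p)" if "x \<in> standard_simplex p"
  using simplical_face_in_standard_simplex[of "Suc p" k x] that assms by simp
 moreover have "standard_simplex p \<subseteq> standard_simplex (p + q)" by (rule standard_simplex_mono) simp
 ultimately show "front_face p (singular_face (Suc (p + q)) k s) x = singular_face (Suc p) k (front_face (Suc p) s) x"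
  by (auto simp: front_face_def singular_face_def)
qed

lemma front_singular_face_gt:
 assumes "p < k"
 shows "front_face p (singular_face (Suc (p + q)) k s) = front_face p s"
proof (rule ext)
 fix x
 have "simplical_face k x = x" if "x \<in> standard_simplex p"
  using that assms by (auto simp: simplical_face_def standard_simplex_def fun_eq_iff)
 moreover have "standard_simplex p \<subseteq> standard_simplex (p + q)" by (rule standard_simplex_mono) simp
 ultimately show "front_face p (singular_face (Suc (p + q)) k s) x = front_face p s x"
  by (auto simp: front_face_def singular_face_def)
qed

lemma back_singular_face_le:
 assumes "k <= p"
 shows "back_face p q (singular_face (Suc (p + q)) k s) = back_face (Suc p) q s"
proof (rule ext)
 fix x
 have "simplical_face k (shift p x) = shift (Suc p) x"
  using assms by (auto simp: simplical_face_def shift_def fun_eq_iff)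
 thus "back_face p q (singular_face (Suc (p + q)) k s) x = back_face (Suc p) q s x"
  using shift_simplex[of x q p] by (auto simp: back_face_shift singular_face_def)
qed

lemma back_singular_face_gt:
 assumes "p < k" "k <= Suc (p + q)"
 shows "back_face p q (singular_face (Suc (p + q)) k s) = singular_face (Suc q) (k - p) (back_face p (Suc q) s)"
proof (rule ext)
 fix x
 have "simplical_face k (shift p x) = shift p (simplical_face (k - p) x)"
 proof
  fix i
  show "simplical_face k (shift p x) i = shift p (simplical_face (k - p) x) i"
  using assms by (cases "i < p"; cases "i < k"; cases "i = k") (auto simp: simplical_face_def shift_def diff_right_commute)
 qed
 moreover have "simplical_face (k - p) x \<in> standard_simplex (Suc q)" if "x \<in> standard_simplex q"
  using simplical_face_in_standard_simplex[of "Suc q" "k - p" x] that assms by simp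
 ultimately show "back_face p q (singular_face (Suc (p + q)) k s) x = singular_face (Suc q) (k - p) (back_face p (Suc q) s) x"
  using shift_simplex[of x q p] by (auto simp: back_face_shift singular_face_def)
qed

definition cupc :: "nat => nat => 'a cochain => 'a cochain => 'a cochain" where
 "cupc p q \<phi> \<psi> s = \<phi> (front_face p s) * \<psi> (back_face p q s)"

text \<open>Faces up to p act on the front part and later ones on the back part. The two
  coboundaries on the right contain one extra face each, at the common vertex; these are the same
  term with opposite signs.\<close>

lemma coboundary_cupc:
 "coboundary (p + q) (cupc p q \<phi> \<psi>) s =
  coboundary p \<phi> (front_face (Suc p) s) * \<psi> (back_face (Suc p) q s) +
  (-1) ^ p * (\<phi> (front_face p s) * coboundary q \<psi> (back_face p (Suc q) s))"
proof -
 define n where "n = Suc (p + q)"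
 define F where "F k = (-1) ^ k * cupc p q \<phi> \<psi> (singular_face n k s)" for k
 let ?X = "\<psi> (back_face (Suc p) q s)" and ?Y = "\<phi> (front_face p s)"
 have "{..n} = {..p} \<union> {Suc p..n}" by (auto simp: n_def)
 hence "coboundary (p + q) (cupc p q \<phi> \<psi>) s = (\<Sum>k\<le>p. F k) + (\<Sum>k\<in>{Suc p..n}. F k)"
  unfolding coboundary_sum n_def[symmetric] F_def by (simp add: sum.union_disjoint)
 also have "(\<Sum>k\<le>p. F k) = (\<Sum>k\<le>p. (-1) ^ k * \<phi> (singular_face (Suc p) k (front_face (Suc p) s)) * ?X)"
  unfolding F_def cupc_def n_def by (intro sum.cong refl) (simp add: front_singular_face_le back_singular_face_le)
 also have "... = (coboundary p \<phi> (front_face (Suc p) s) - (-1) ^ Suc p * ?Y) * ?X"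
 proof -
  have "singular_face (Suc p) (Suc p) (front_face (Suc p) s) = front_face p s"
  using front_singular_face_le[of "Suc p" p q s] front_singular_face_gt[of p "Suc p" q s] by simp
  thus ?thesis unfolding coboundary_sum by (simp add: sum_distrib_right sum_distrib_left algebra_simps)
 qed
 also have "(\<Sum>k\<in>{Suc p..n}. F k) = (\<Sum>j\<in>{1..Suc q}. F (j + p))"
  by (rule sum.reindex_bij_witness[of _ "%j. j + p" "%k. k - p"]) (auto simp: n_def)
 also have "... = (\<Sum>j\<in>{1..Suc q}. (-1) ^ p * (?Y * ((-1) ^ j * \<psi> (singular_face (Suc q) j (back_face p (Suc q) s)))))"
  unfolding F_def cupc_def n_def
  by (intro sum.cong refl) (auto simp: front_singular_face_gt back_singular_face_gt power_add)
 also have "... = (-1) ^ p * (?Y * (\<Sum>j\<in>{1..Suc q}. (-1) ^ j * \<psi> (singular_face (Suc q) j (back_face p (Suc q) s))))"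
  by (simp only: sum_distrib_left)
 also have "(\<Sum>j\<in>{1..Suc q}. (-1) ^ j * \<psi> (singular_face (Suc q) j (back_face p (Suc q) s))) = coboundary q \<psi> (back_face p (Suc q) s) - ?X"
 proof -
  have "singular_face (Suc q) 0 (back_face p (Suc q) s) = back_face (Suc p) q s"
  proof (rule ext)
  fix x
  have "shift p (simplical_face 0 x) = shift (Suc p) x"
  by (auto simp: simplical_face_def shift_def fun_eq_iff Suc_diff_le)
  moreover have "simplical_face 0 x \<in> standard_simplex (Suc q)" if "x \<in> standard_simplex q"
  using simplical_face_in_standard_simplex[of "Suc q" 0 x] that by simp
  ultimately show "singular_face (Suc q) 0 (back_face p (Suc q) s) x = back_face (Suc p) q s x"
  by (auto simp: back_face_shift singular_face_def)
  qed
  moreover have "{..Suc q} = insert 0 {1..Suc q}" by auto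
  ultimately show ?thesis unfolding coboundary_sum by simp
 qed
 finally show ?thesis by (simp add: algebra_simps)
qed

text \<open>Iterated cup product of cochains of degree two. It multiplies the values on consecutive
  triangles of the simplex and depends on the order of the letters.\<close>

primrec wc :: "'a cochain list => 'a cochain" where
 "wc [] s = 1"
| "wc (c # cs) s = c (front_face 2 s) * wc cs (back_face 2 (2 * length cs) s)"

lemma wc_Cons_cupc: "wc (c # cs) = cupc 2 (2 * length cs) c (wc cs)"
 by (simp add: cupc_def fun_eq_iff)

lemma wc_restrict: "wc cs (front_face (2 * length cs) s) = wc cs s"
proof (cases cs)
 case (Cons c cs')
 have "front_face 2 (front_face (2 * length cs) s) = front_face 2 s" by (rule front_front) (simp add: Cons)
 moreover have "back_face 2 (2 * length cs') (front_face (2 * length cs) s) = back_face 2 (2 * length cs') s"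
  using back_front[of 2 "2 * length cs'" s] by (simp add: Cons)
 ultimately show ?thesis by (simp add: Cons)
qed simp

lemma wc_append:
 "wc (u @ w) s = wc u (front_face (2 * length u) s) * wc w (back_face (2 * length u) (2 * length w) s)"
proof (induction u arbitrary: s)
 case Nil
 have "back_face 0 (2 * length w) s = front_face (2 * length w) s"
  by (simp add: back_face_shift shift_def[abs_def] front_face_def)
 thus ?case by (simp add: wc_restrict)
next
 case (Cons c u)
 let ?a = "2 * length u" and ?b = "2 * length w"
 have "front_face 2 (front_face (2 + ?a) s) = front_face 2 s" by (rule front_front) simp
 moreover have "back_face 2 ?a (front_face (2 + ?a) s) = front_face ?a (back_face 2 (?a + ?b) s)"
  by (simp only: back_front front_back)
 moreover have "back_face ?a ?b (back_face 2 (?a + ?b) s) = back_face (2 + ?a) ?b s" by (rule back_back)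
 ultimately show ?case using Cons.IH[of "back_face 2 (?a + ?b) s"] by (simp add: mult.assoc)
qed

lemma cup_in_degree_two:
 "cup (in_degree 2 \<phi>) \<Psi> n s = (if 2 <= n then \<phi> (front_face 2 s) * \<Psi> (n - 2) (back_face 2 (n - 2) s) else 0)"
proof -
 have "cup (in_degree 2 \<phi>) \<Psi> n s = (\<Sum>p\<le>n. if p = 2 then \<phi> (front_face 2 s) * \<Psi> (n - 2) (back_face 2 (n - 2) s) else 0)"
  unfolding cup_def in_degree_def by (intro sum.cong refl) auto
 thus ?thesis by simp
qed

lemma cup_power_in_degree_two:
 "cup_power (in_degree 2 \<phi>) k n s = (if n = 2 * k then wc (replicate k \<phi>) s else 0)"
proof (induction k arbitrary: n s)
 case (Suc k)
 show ?case
 proof (cases "2 <= n")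
  case True
  hence "n - 2 = 2 * k \<longleftrightarrow> n = 2 * Suc k" by auto
  thus ?thesis using True by (auto simp: cup_in_degree_two Suc.IH)
 qed (auto simp: cup_in_degree_two)
qed (simp add: cup_one_def in_degree_def)

lemma fps_at_in_degree_two:
 "fps_at g (in_degree 2 \<phi>) n s = (if even n then fps_nth g (n div 2) * wc (replicate (n div 2) \<phi>) s else 0)"
proof (cases "even n")
 case True
 then obtain j where n: "n = 2 * j" by blast
 have "fps_at g (in_degree 2 \<phi>) n s = (\<Sum>k\<le>n. if k = j then fps_nth g j * wc (replicate j \<phi>) s else 0)"
  unfolding fps_at_def cup_power_in_degree_two n by (intro sum.cong refl) auto
 thus ?thesis by (simp add: n)
next
 case False
 hence "n ~= 2 * k" for k by auto
 thus ?thesis using False by (simp add: fps_at_def cup_power_in_degree_two)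
qed

text \<open>A series in a cochain of degree two lives in even degrees. Splitting the simplex at 2j
  leaves j copies of the letter d in front, which is the recursion of \<open>wexp\<close>.\<close>

lemma cup_prod_wexp:
 "cup_prod (map (%d. fps_at (g d) (in_degree 2 (\<phi> d))) ds) (2 * k) s = wexp (%d. fps_nth (g d)) ds k (%w. wc (map \<phi> w) s)"
proof (induction ds arbitrary: k s)
 case Nil
 show ?case by (simp add: cup_prod_def cup_one_def in_degree_def)
next
 case (Cons d ds)
 let ?P = "cup_prod (map (%d. fps_at (g d) (in_degree 2 (\<phi> d))) ds)"
 define T where "T p = fps_at (g d) (in_degree 2 (\<phi> d)) p (front_face p s) * ?P (2 * k - p) (back_face p (2 * k - p) s)" for p
 have "cup_prod (map (%d. fps_at (g d) (in_degree 2 (\<phi> d))) (d # ds)) (2 * k) s = (\<Sum>p\<le>2 * k. T p)"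
  by (simp add: cup_prod_def cup_def T_def)
 also have "... = (\<Sum>p\<in>(%j. 2 * j) ` {..k}. T p)"
 proof (rule sum.mono_neutral_right)
  show "\<forall>p\<in>{..2 * k} - (%j. 2 * j) ` {..k}. T p = 0"
  proof
  fix p assume p: "p \<in> {..2 * k} - (%j. 2 * j) ` {..k}"
  have "odd p"
  proof
  assume "even p"
  then obtain j where "p = 2 * j" by blast
  thus False using p by auto
  qed
  thus "T p = 0" by (simp add: T_def fps_at_in_degree_two)
  qed
 qed auto
 also have "... = (\<Sum>j\<le>k. T (2 * j))" by (subst sum.reindex) (auto simp: inj_on_def)
 also have "... = wexp (%d. fps_nth (g d)) (d # ds) k (%w. wc (map \<phi> w) s)"
  unfolding wexp.simps
 proof (intro sum.cong refl)
  fix j assume "j \<in> {..k}"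
  hence e: "2 * k - 2 * j = 2 * (k - j)" by simp
  have J: "wexp (%d. fps_nth (g d)) ds (k - j) (%w. wc (map \<phi> (replicate j d @ w)) s) =
  wexp (%d. fps_nth (g d)) ds (k - j) (%w. \<Sum>i\<in>{()}. wc (replicate j (\<phi> d)) (front_face (2 * j) s) * wc (map \<phi> w) (back_face (2 * j) (2 * (k - j)) s))"
  by (rule wexp_cong) (simp add: wc_append)
  have scale: "wexp c ds k (%w. a * J w) = a * wexp c ds k J" for a c k and J :: "_ => complex"
  by (induction ds arbitrary: k J) (auto simp: sum_distrib_left mult.left_commute)
  show "T (2 * j) = fps_nth (g d) j * wexp (%d. fps_nth (g d)) ds (k - j) (%w. wc (map \<phi> (replicate j d @ w)) s)"
  unfolding T_def e Cons.IH J by (simp add: fps_at_in_degree_two scale)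
 qed
 finally show ?case .
qed

lemma wexp_cmul: "wexp c ds k (%w. a * J w) = a * wexp c ds k J"
 by (induction ds arbitrary: k J) (auto simp: sum_distrib_left mult.left_commute)

lemma wc_scale: "wc (map (%d s. \<phi> d s / x) w) s = wc (map \<phi> w) s / x ^ length w"
 by (induction w arbitrary: s) auto

lemma eval_cup_prod:
 "eval_chain (cup_prod (map (%d. fps_at (g d) (in_degree 2 (%s. \<phi> d s / x))) ds) (2 * k)) \<mu> =
 wexp (%d. fps_nth (g d)) ds k (%w. eval_chain (wc (map \<phi> w)) \<mu>) / x ^ k"
proof -
 have "cup_prod (map (%d. fps_at (g d) (in_degree 2 (%s. \<phi> d s / x))) ds) (2 * k) s =
  (1 / x ^ k) * wexp (%d. fps_nth (g d)) ds k (%w. wc (map \<phi> w) s)" for s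
  unfolding cup_prod_wexp wexp_cmul[symmetric] by (rule wexp_cong) (simp add: wc_scale)
 hence "eval_chain (cup_prod (map (%d. fps_at (g d) (in_degree 2 (%s. \<phi> d s / x))) ds) (2 * k)) \<mu> =
  (1 / x ^ k) * (\<Sum>s\<in>Poly_Mapping.keys \<mu>. of_int (Poly_Mapping.lookup \<mu> s) * wexp (%d. fps_nth (g d)) ds k (%w. wc (map \<phi> w) s))"
  by (simp add: eval_chain_def sum_distrib_left mult.left_commute)
 also have "... = (1 / x ^ k) * wexp (%d. fps_nth (g d)) ds k (%w. eval_chain (wc (map \<phi> w)) \<mu>)"
  by (simp add: eval_chain_def wexp_sum wexp_cmul)
 finally show ?thesis by simp
qed

lemma cocycle_wc:
 assumes "!!c. c \<in> set cs ==> cocycle 2 X c"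
 shows "cocycle (2 * length cs) X (wc cs)"
 using assms
proof (induction cs)
 case Nil
 show ?case by (simp add: cocycle_def coboundary_sum)
next
 case (Cons c cs)
 show ?case unfolding cocycle_def
 proof (intro allI impI)
  fix s assume s: "singular_simplex (Suc (2 * length (c # cs))) X s"
  let ?m = "2 * length cs"
  have f: "singular_simplex (Suc 2) X (front_face (Suc 2) s)" by (rule singular_simplex_front_face[OF s]) simp
  have b: "singular_simplex (Suc ?m) X (back_face 2 (Suc ?m) s)" by (rule singular_simplex_back_face) (use s in simp)
  have "coboundary 2 c (front_face (Suc 2) s) = 0" using Cons.prems[of c] f by (simp add: cocycle_def)
  moreover have "coboundary ?m (wc cs) (back_face 2 (Suc ?m) s) = 0" using Cons b by (simp add: cocycle_def)
  ultimately have "coboundary (2 + ?m) (wc (c # cs)) s = 0" unfolding wc_Cons_cupc coboundary_cupc by simp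
  thus "coboundary (2 * length (c # cs)) (wc (c # cs)) s = 0" by simp
 qed
qed

definition cohomologous :: "'a topology => 'a cochain => 'a cochain => bool" where
 "cohomologous X c c' \<longleftrightarrow> (\<exists>e. \<forall>s. singular_simplex 2 X s --> c s - c' s = coboundary 1 e s)"

lemma cohomologous_refl: "cohomologous X c c"
 unfolding cohomologous_def by (rule exI[of _ "%_. 0"]) (simp add: coboundary_sum)

lemma cohomologous_coboundary: "cohomologous X c (%s. c s - coboundary 1 e s)"
 unfolding cohomologous_def by (rule exI[of _ e]) simp

lemma cocycle_minus_coboundary:
 assumes "cocycle 2 X c"
 shows "cocycle 2 X (%s. c s - coboundary 1 e s)"
 unfolding cocycle_def coboundary_diff
proof (intro allI impI)
 fix s assume s: "singular_simplex (Suc 2) X s"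
 have "coboundary 2 (coboundary 1 e) s = 0" using coboundary_coboundary[of 1 X s e] s by (simp add: numeral_2_eq_2)
 thus "coboundary 2 c s - coboundary 2 (coboundary 1 e) s = 0" using assms s by (simp add: cocycle_def)
qed

text \<open>With W, W' for the products of the remaining letters, c W - c' W' = (c - c') W + c' (W -
  W'). The first summand is the coboundary of e W since W is closed, the second that of c' Q since
  c' is closed of even degree.\<close>

lemma wc_cohomologous:
 assumes "list_all2 (cohomologous X) cs cs'" "!!c. c \<in> set cs ==> cocycle 2 X c" "!!c. c \<in> set cs' ==> cocycle 2 X c"
 shows "\<exists>Q. \<forall>s. singular_simplex (2 * length cs) X s --> wc cs s - wc cs' s = coboundary (2 * length cs - 1) Q s"
 using assms
proof (induction rule: list_all2_induct)
 case Nil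
 show ?case by (rule exI[of _ "%_. 0"]) (simp add: coboundary_sum)
next
 case (Cons c cs c' cs')
 have len: "length cs' = length cs" using Cons.hyps(2) by (simp add: list_all2_lengthD)
 let ?m = "2 * length cs"
 obtain e where e: "\<forall>s. singular_simplex 2 X s --> c s - c' s = coboundary 1 e s"
  using Cons.hyps(1) unfolding cohomologous_def by blast
 obtain Q where Q: "\<forall>s. singular_simplex ?m X s --> wc cs s - wc cs' s = coboundary (?m - 1) Q s"
  using Cons.IH Cons.prems by auto
 have cyc: "cocycle ?m X (wc cs)" by (rule cocycle_wc) (use Cons.prems in auto)
 \<comment> \<open>For the empty tail the degree ?m - 1 makes no sense, and there W - W' =
   0.\<close>
 define Q' where "Q' = (%s. cupc 1 ?m e (wc cs) s + (if ?m = 0 then 0 else cupc 2 (?m - 1) c' Q s))"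
 have "wc (c # cs) s - wc (c' # cs') s = coboundary (Suc ?m) Q' s" if s: "singular_simplex (2 + ?m) X s" for s
 proof -
  have f2: "singular_simplex 2 X (front_face 2 s)" by (rule singular_simplex_front_face[OF s]) simp
  have b2: "singular_simplex ?m X (back_face 2 ?m s)" by (rule singular_simplex_back_face[OF s])
  have b1: "singular_simplex (Suc ?m) X (back_face 1 (Suc ?m) s)" by (rule singular_simplex_back_face) (use s in simp)
  have z1: "coboundary ?m (wc cs) (back_face 1 (Suc ?m) s) = 0" using cyc b1 by (simp add: cocycle_def)
  have d1: "coboundary (1 + ?m) (cupc 1 ?m e (wc cs)) s = (c (front_face 2 s) - c' (front_face 2 s)) * wc cs (back_face 2 ?m s)"
  unfolding coboundary_cupc z1 using e f2 by (simp add: numeral_2_eq_2)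
  have d2: "coboundary (Suc ?m) (%s. if ?m = 0 then 0 else cupc 2 (?m - 1) c' Q s) s =
  c' (front_face 2 s) * (wc cs (back_face 2 ?m s) - wc cs' (back_face 2 ?m s))"
  proof (cases "?m = 0")
  case True
  thus ?thesis using len by (simp add: coboundary_sum)
  next
  case False
  have "singular_simplex (Suc 2) X (front_face (Suc 2) s)" by (rule singular_simplex_front_face[OF s]) (use False in linarith)
  hence z: "coboundary 2 c' (front_face (Suc 2) s) = 0" using Cons.prems(2)[of c'] by (simp add: cocycle_def)
  have "coboundary (2 + (?m - 1)) (cupc 2 (?m - 1) c' Q) s = c' (front_face 2 s) * coboundary (?m - 1) Q (back_face 2 ?m s)"
  unfolding coboundary_cupc z using False by simp
  moreover have "2 + (?m - 1) = Suc ?m" using False by simp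
  ultimately show ?thesis using Q b2 False by simp
  qed
  have "coboundary (Suc ?m) Q' s = (c (front_face 2 s) - c' (front_face 2 s)) * wc cs (back_face 2 ?m s) +
  c' (front_face 2 s) * (wc cs (back_face 2 ?m s) - wc cs' (back_face 2 ?m s))"
  unfolding Q'_def coboundary_add d2 using d1 by simp
  thus ?thesis using len by (simp add: algebra_simps)
 qed
 thus ?case by (intro exI[of _ Q']) simp
qed

lemma eval_wc_cohomologous:
 assumes "list_all2 (cohomologous X) cs cs'" "!!c. c \<in> set cs ==> cocycle 2 X c" "!!c. c \<in> set cs' ==> cocycle 2 X c"
  and \<mu>: "singular_relcycle (2 * length cs) X {} \<mu>"
 shows "eval_chain (wc cs) \<mu> = eval_chain (wc cs') \<mu>"
proof -
 obtain Q where Q: "\<forall>s. singular_simplex (2 * length cs) X s --> wc cs s - wc cs' s = coboundary (2 * length cs - 1) Q s"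
  using wc_cohomologous[OF assms(1-3)] by blast
 have \<mu>': "singular_chain (2 * length cs) X \<mu>" "chain_boundary (2 * length cs) \<mu> = 0" using \<mu> by (auto simp: singular_cycle)
 show ?thesis
 proof (cases "cs = []")
  case True
  thus ?thesis using assms(1) by simp
 next
  case False
  hence S: "Suc (2 * length cs - 1) = 2 * length cs" by (cases cs) auto
  have "eval_chain (wc cs) \<mu> - eval_chain (wc cs') \<mu> = eval_chain (coboundary (2 * length cs - 1) Q) \<mu>"
  unfolding eval_chain_diff_left[symmetric] by (rule eval_chain_cong) (use Q \<mu>'(1) in \<open>auto simp: singular_chain_def\<close>)
  also have "... = 0" unfolding eval_chain_coboundary S \<mu>'(2) by simp
  finally show ?thesis by simp
 qed
qed

text \<open>Front and back faces of a simplex in Y stay in Y, so each factor is only evaluated on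
  triangles in Y.\<close>

lemma wc_vanish:
 assumes "singular_simplex (2 * length cs) Y s" "c \<in> set cs" "!!t. singular_simplex 2 Y t ==> c t = 0"
 shows "wc cs s = 0"
 using assms(1,2)
proof (induction cs arbitrary: s)
 case (Cons a cs)
 have "singular_simplex 2 Y (front_face 2 s)" by (rule singular_simplex_front_face[OF Cons.prems(1)]) simp
 moreover have "singular_simplex (2 * length cs) Y (back_face 2 (2 * length cs) s)"
  by (rule singular_simplex_back_face) (use Cons.prems(1) in simp)
 ultimately show ?case using Cons.IH Cons.prems(2) assms(3) by auto
qed simp

section \<open>Localizing the evaluation by barycentric subdivision\<close>

text \<open>The cochain vanishes only on simplices inside a single member of the cover; sufficiently
  fine subdivision produces nothing but such simplices.\<close>

lemma small_chain_eval_zero: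
 assumes ch: "singular_chain n X \<rho>" and op: "!!V. V \<in> \<U> ==> openin X V" and cov: "topspace X \<subseteq> \<Union>\<U>"
  and van: "!!V s. V \<in> \<U> ==> singular_simplex n (subtopology X V) s ==> \<Phi> s = 0"
 shows "\<exists>m. eval_chain \<Phi> ((singular_subdivision n ^^ m) \<rho>) = 0"
proof -
 obtain m where m: "!!k f. m <= k ==> f \<in> Poly_Mapping.keys ((singular_subdivision n ^^ k) \<rho>) ==> \<exists>V\<in>\<U>. f \<in> standard_simplex n \<rightarrow> V"
  using sufficient_iterated_singular_subdivision_exists[OF op cov ch] by blast
 have sc: "singular_chain n X ((singular_subdivision n ^^ k) \<rho>)" for k
  by (induction k) (auto simp: ch singular_chain_singular_subdivision)
 have "eval_chain \<Phi> ((singular_subdivision n ^^ m) \<rho>) = 0"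
 proof (rule eval_chain_zero)
  fix f assume f: "f \<in> Poly_Mapping.keys ((singular_subdivision n ^^ m) \<rho>)"
  then obtain V where V: "V \<in> \<U>" "f \<in> standard_simplex n \<rightarrow> V" using m by blast
  have "singular_simplex n X f" using sc[of m] f by (auto simp: singular_chain_def)
  hence "singular_simplex n (subtopology X V) f" using V(2) by (auto simp: singular_simplex_subtopology)
  thus "\<Phi> f = 0" by (rule van[OF V(1)])
 qed
 thus ?thesis by blast
qed

text \<open>The chain homotopy between subdivision and the identity leaves a boundary, on which a
  cocycle is 0, and the homotopy applied to the boundary of \<open>\<kappa>\<close>. By naturality
  the latter stays, piece by piece, in the sets \<open>V i\<close> where \<open>\<Phi>\<close>
  vanishes.\<close>

lemma eval_iterated_subdivision:
 assumes cyc: "cocycle n X \<Phi>" and n: "n > 0" and \<kappa>: "singular_chain n X \<kappa>"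
  and bd: "chain_boundary n \<kappa> = (\<Sum>i\<in>I. \<rho> i)"
  and \<rho>: "!!i. i \<in> I ==> singular_chain (n - 1) (subtopology X (V i)) (\<rho> i)"
  and van: "!!i s. i \<in> I ==> singular_simplex n (subtopology X (V i)) s ==> \<Phi> s = 0"
 shows "eval_chain \<Phi> ((singular_subdivision n ^^ m) \<kappa>) = eval_chain \<Phi> \<kappa>"
proof -
 obtain h where h: "!!p. h p 0 = (0 :: 'a chain)" "!!p c1 c2. h p (c1-c2) = h p c1 - h p c2"
  "!!p X c. singular_chain p X c ==> singular_chain (Suc p) X (h p c)"
  "!!p X c. singular_chain p X c
  ==> chain_boundary (Suc p) (h p c) + h (p - Suc 0) (chain_boundary p c)
  = (singular_subdivision p ^^ m) c - c"
  using chain_homotopic_iterated_singular_subdivision[of m] by blast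
 have hadd: "h p (a + b) = h p a + h p b" for p a b
  using h(2)[of p a "- b"] h(2)[of p 0 b] h(1) by simp
 have hsum: "h p (\<Sum>i\<in>I. \<rho> i) = (\<Sum>i\<in>I. h p (\<rho> i))" for p
  by (induction I rule: infinite_finite_induct) (auto simp: h(1) hadd)
 have "eval_chain \<Phi> ((singular_subdivision n ^^ m) \<kappa>) - eval_chain \<Phi> \<kappa> =
  eval_chain \<Phi> (chain_boundary (Suc n) (h n \<kappa>)) + (\<Sum>i\<in>I. eval_chain \<Phi> (h (n - Suc 0) (\<rho> i)))"
  unfolding eval_chain_diff[symmetric] h(4)[OF \<kappa>, symmetric] bd hsum by (simp add: eval_chain_add eval_chain_sum)
 moreover have "eval_chain \<Phi> (chain_boundary (Suc n) (h n \<kappa>)) = 0"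
  by (rule cocycle_eval_boundary[OF cyc h(3)[OF \<kappa>]])
 moreover have "eval_chain \<Phi> (h (n - Suc 0) (\<rho> i)) = 0" if i: "i \<in> I" for i
 proof (rule eval_chain_zero)
  fix s assume s: "s \<in> Poly_Mapping.keys (h (n - Suc 0) (\<rho> i))"
  have "singular_chain (Suc (n - Suc 0)) (subtopology X (V i)) (h (n - Suc 0) (\<rho> i))"
  by (rule h(3)) (use \<rho>[OF i] in simp)
  hence "singular_simplex n (subtopology X (V i)) s" using s n by (auto simp: singular_chain_def)
  thus "\<Phi> s = 0" by (rule van[OF i])
 qed
 ultimately show ?thesis by simp
qed

lemma eval_cycle_subdivision:
 assumes "cocycle n X \<Phi>" "n > 0" "singular_chain n X \<kappa>" "chain_boundary n \<kappa> = 0"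
 shows "eval_chain \<Phi> ((singular_subdivision n ^^ m) \<kappa>) = eval_chain \<Phi> \<kappa>"
 by (rule eval_iterated_subdivision[OF assms(1-3), where I = "{}::nat set" and \<rho> = "%_. 0" and V = "%_. {}"]) (use assms(4) in auto)

text \<open>A global number from local data: \<open>\<mu> - \<kappa>\<close> is a boundary up to a
  chain in the union of the cover. After subdivision that chain contributes 0, and subdivision
  changes neither the value on \<open>\<mu>\<close> nor the value on \<open>\<kappa>\<close>,
  although \<open>\<kappa>\<close> need not be a cycle.\<close>

lemma cocycle_eval_local:
 assumes cyc: "cocycle n X \<Phi>" and n: "n > 0" and \<mu>: "singular_relcycle n X {} \<mu>"
  and op: "!!V. V \<in> \<U> ==> openin X V"
  and van: "!!V s. V \<in> \<U> ==> singular_simplex n (subtopology X V) s ==> \<Phi> s = 0"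
  and hom: "homologous_rel n X (\<Union>\<U>) \<mu> \<kappa>" and \<kappa>: "singular_chain n X \<kappa>"
  and bd: "chain_boundary n \<kappa> = (\<Sum>i\<in>I. \<rho> i)"
  and \<rho>: "!!i. i \<in> I ==> singular_chain (n - 1) (subtopology X (V i)) (\<rho> i)"
  and van': "!!i s. i \<in> I ==> singular_simplex n (subtopology X (V i)) s ==> \<Phi> s = 0"
 shows "eval_chain \<Phi> \<mu> = eval_chain \<Phi> \<kappa>"
proof -
 have \<mu>': "singular_chain n X \<mu>" "chain_boundary n \<mu> = 0" using \<mu> by (auto simp: singular_cycle)
 obtain \<eta> \<sigma> where \<eta>: "singular_chain (Suc n) X \<eta>" and \<sigma>: "singular_chain n (subtopology X (\<Union>\<U>)) \<sigma>"
  and eq: "chain_boundary (Suc n) \<eta> = (\<mu> - \<kappa>) + \<sigma>"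
  using hom unfolding homologous_rel_def singular_relboundary_alt by blast
 have opU: "openin X (\<Union>\<U>)" using op by blast
 obtain m where m: "eval_chain \<Phi> ((singular_subdivision n ^^ m) \<sigma>) = 0"
 proof -
  have "\<exists>m. eval_chain \<Phi> ((singular_subdivision n ^^ m) \<sigma>) = 0"
  proof (rule small_chain_eval_zero[OF \<sigma>, of \<U>])
  show "openin (subtopology X (\<Union>\<U>)) V" if "V \<in> \<U>" for V
  using op[OF that] that by (metis Sup_upper inf.absorb_iff2 openin_subtopology_Int2)
  show "topspace (subtopology X (\<Union>\<U>)) \<subseteq> \<Union>\<U>" by simp
  show "\<Phi> s = 0" if "V \<in> \<U>" "singular_simplex n (subtopology (subtopology X (\<Union>\<U>)) V) s" for V s
  by (rule van[OF that(1)]) (use that(2) in \<open>simp add: singular_simplex_subtopology\<close>)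
  qed
  thus ?thesis using that by blast
 qed
 let ?S = "singular_subdivision n ^^ m"
 have \<eta>': "singular_chain n X (chain_boundary (Suc n) \<eta>)" "chain_boundary n (chain_boundary (Suc n) \<eta>) = 0"
  using singular_chain_boundary_alt[OF \<eta>] chain_boundary_boundary_alt[OF \<eta>] by auto
 have "\<sigma> = chain_boundary (Suc n) \<eta> - (\<mu> - \<kappa>)" using eq by simp
 hence "?S \<sigma> = ?S (chain_boundary (Suc n) \<eta>) - (?S \<mu> - ?S \<kappa>)" by (simp add: singular_subdivision_power_diff)
 hence "0 = eval_chain \<Phi> (?S (chain_boundary (Suc n) \<eta>)) - (eval_chain \<Phi> (?S \<mu>) - eval_chain \<Phi> (?S \<kappa>))"
  using m by (simp add: eval_chain_diff)
 moreover have "eval_chain \<Phi> (?S (chain_boundary (Suc n) \<eta>)) = 0"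
  using eval_cycle_subdivision[OF cyc n \<eta>'] cocycle_eval_boundary[OF cyc \<eta>] by simp
 moreover have "eval_chain \<Phi> (?S \<mu>) = eval_chain \<Phi> \<mu>" by (rule eval_cycle_subdivision[OF cyc n \<mu>'])
 moreover have "eval_chain \<Phi> (?S \<kappa>) = eval_chain \<Phi> \<kappa>" by (rule eval_iterated_subdivision[OF cyc n \<kappa> bd \<rho> van'])
 ultimately show ?thesis by simp
qed

lemma cocycle_eval_vanish:
 assumes cyc: "cocycle n X \<Phi>" and n: "n > 0" and \<mu>: "singular_relcycle n X {} \<mu>"
  and op: "!!V. V \<in> \<U> ==> openin X V" and cov: "topspace X \<subseteq> \<Union>\<U>"
  and van: "!!V s. V \<in> \<U> ==> singular_simplex n (subtopology X V) s ==> \<Phi> s = 0"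
 shows "eval_chain \<Phi> \<mu> = 0"
proof -
 have \<mu>': "singular_chain n X \<mu>" "chain_boundary n \<mu> = 0" using \<mu> by (auto simp: singular_cycle)
 have "\<exists>m. eval_chain \<Phi> ((singular_subdivision n ^^ m) \<mu>) = 0"
  by (rule small_chain_eval_zero[OF \<mu>'(1), of \<U>]) (use op cov van in auto)
 then obtain m where "eval_chain \<Phi> ((singular_subdivision n ^^ m) \<mu>) = 0" by blast
 thus ?thesis using eval_cycle_subdivision[OF cyc n \<mu>'] by simp
qed

section \<open>Winding numbers along singular simplices\<close>

abbreviation wn where "wn \<gamma> \<equiv> winding_number \<gamma> 0"

lemma exp_lift:
 fixes \<gamma> :: "real => complex"
 assumes "path \<gamma>" "!!t. t \<in> {0..1} ==> \<gamma> t ~= 0"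
 shows "\<exists>p. path p \<and> (\<forall>t\<in>{0..1}. \<gamma> t = exp (p t))"
proof -
 have "contractible {0..1::real}" by (intro convex_imp_contractible convex_closed_interval)
 from continuous_logarithm_on_contractible[OF _ this, of \<gamma>] assms show ?thesis
  unfolding path_def by metis
qed

lemma winding_number_lift:
 assumes "path p" "!!t. t \<in> {0..1} ==> \<gamma> t = exp (p t)"
 shows "wn \<gamma> = (p 1 - p 0) / (2 * of_real pi * \<i>)"
proof -
 have "wn \<gamma> = wn (exp \<circ> p)"
  by (rule winding_number_cong) (use assms(2) in simp)
 thus ?thesis using winding_number_compose_exp[OF assms(1)] by (simp add: pathfinish_def pathstart_def)
qed

text \<open>Continuous logarithms of the factors combine linearly to one of the product, and the
  winding number is the increment of a logarithm over 2 pi i; the paths need not be closed.\<close>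

lemma winding_number_prod_powi:
 fixes n :: "'a => int"
 assumes R: "finite R" and \<gamma>: "!!d. d \<in> R ==> path (\<gamma> d)" "!!d t. d \<in> R ==> t \<in> {0..1} ==> \<gamma> d t ~= 0"
 shows "wn (%t. \<Prod>d\<in>R. \<gamma> d t powi n d) = (\<Sum>d\<in>R. of_int (n d) * wn (\<gamma> d))"
proof -
 have "\<forall>d\<in>R. \<exists>p. path p \<and> (\<forall>t\<in>{0..1}. \<gamma> d t = exp (p t))" using exp_lift \<gamma> by metis
 then obtain p where p: "\<forall>d\<in>R. path (p d) \<and> (\<forall>t\<in>{0..1}. \<gamma> d t = exp (p d t))" by metis
 have "wn (%t. \<Prod>d\<in>R. \<gamma> d t powi n d) =
  ((\<Sum>d\<in>R. of_int (n d) * p d 1) - (\<Sum>d\<in>R. of_int (n d) * p d 0)) / (2 * of_real pi * \<i>)"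
 proof (rule winding_number_lift[of "%t. \<Sum>d\<in>R. of_int (n d) * p d t"])
  show "path (%t. \<Sum>d\<in>R. of_int (n d) * p d t)"
  using p unfolding path_def by (intro continuous_intros) auto
  fix t :: real assume t: "t \<in> {0..1}"
  have "(\<Prod>d\<in>R. \<gamma> d t powi n d) = (\<Prod>d\<in>R. exp (of_int (n d) * p d t))"
  using p t by (intro prod.cong refl) (auto simp: exp_power_int)
  thus "(\<Prod>d\<in>R. \<gamma> d t powi n d) = exp (\<Sum>d\<in>R. of_int (n d) * p d t)" by (simp add: exp_sum[OF R])
 qed
 also have "... = (\<Sum>d\<in>R. of_int (n d) * ((p d 1 - p d 0) / (2 * of_real pi * \<i>)))"
  by (simp add: sum_subtractf[symmetric] sum_divide_distrib right_diff_distrib)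
 also have "... = (\<Sum>d\<in>R. of_int (n d) * wn (\<gamma> d))"
 proof (intro sum.cong refl)
  fix d assume "d \<in> R"
  hence "wn (\<gamma> d) = (p d 1 - p d 0) / (2 * of_real pi * \<i>)"
  using p by (intro winding_number_lift) auto
  thus "of_int (n d) * ((p d 1 - p d 0) / (2 * of_real pi * \<i>)) = of_int (n d) * wn (\<gamma> d)" by simp
 qed
 finally show ?thesis .
qed

lemma winding_number_mult:
 assumes "path \<gamma>" "path \<gamma>'" "!!t. t \<in> {0..1} ==> \<gamma> t ~= 0" "!!t. t \<in> {0..1} ==> \<gamma>' t ~= 0"
 shows "wn (%t. \<gamma> t * \<gamma>' t) = wn \<gamma> + wn \<gamma>'"
 using winding_number_prod_powi[of "UNIV :: bool set" "%b. if b then \<gamma> else \<gamma>'" "%_. 1"] assms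
 by (simp add: UNIV_bool mult.commute add.commute split: if_splits)

definition edge_point :: "real => nat => real" where
 "edge_point t i = (if i = 0 then 1 - t else if i = 1 then t else 0)"

lemma simplex_path_edge_point: "simplex_path s t = s (edge_point t)"
 by (simp add: simplex_path_def edge_point_def[abs_def])

lemma edge_point_simplex: "t \<in> {0..1} ==> edge_point t \<in> standard_simplex 1"
 by (auto simp: standard_simplex_def edge_point_def)

lemma simplex_path_in:
 assumes "singular_simplex 1 (subtopology X U) s" "t \<in> {0..1}"
 shows "simplex_path s t \<in> U" "simplex_path s t \<in> topspace X"
 using assms edge_point_simplex[OF assms(2)] unfolding simplex_path_edge_point
 by (auto simp: singular_simplex_def continuous_map_def Pi_iff)

lemma path_simplex_path:
 assumes s: "singular_simplex 1 X s" and F: "continuous_map X euclidean (F :: _ => complex)"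
 shows "path (F \<circ> simplex_path s)"
proof -
 have "continuous_map (top_of_set {0..1}) (subtopology (powertop_real UNIV) (standard_simplex 1)) edge_point"
  unfolding continuous_map_in_subtopology continuous_map_componentwise_UNIV
 proof (intro conjI allI)
  fix i
  have "continuous_on {0..1} (%t. edge_point t i)"
  unfolding edge_point_def by (cases "i = 0"; cases "i = 1") (auto intro!: continuous_intros)
  thus "continuous_map (top_of_set {0..1}) euclideanreal (%t. edge_point t i)" by simp
 qed (use edge_point_simplex in auto)
 hence "continuous_map (top_of_set {0..1}) euclidean (F \<circ> (s \<circ> edge_point))"
  using s F unfolding singular_simplex_def by (blast intro: continuous_map_compose)
 thus ?thesis by (simp add: path_def o_def simplex_path_edge_point)
qed

text \<open>On the contractible triangle F has a continuous logarithm. The value on each edge is the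
  difference of the logarithm at its ends, and the alternating sum telescopes.\<close>

lemma winding_number_coboundary:
 assumes s: "singular_simplex 2 X s" and F: "continuous_map X euclidean (F :: _ => complex)"
  and nz: "!!p. p \<in> topspace X ==> F p ~= 0"
 shows "coboundary 1 (%t. wn (F \<circ> simplex_path t)) s = 0"
proof -
 define S where "S = {z::real \<times> real. 0 <= fst z \<and> 0 <= snd z \<and> fst z + snd z <= 1}"
 \<comment> \<open>Parametrises the standard 2-simplex by a planar triangle, on which continuity and
   logarithms are available.\<close>
 define T :: "real \<times> real => nat => real" where
  "T z i = (if i = 0 then 1 - fst z - snd z else if i = 1 then fst z else if i = 2 then snd z else 0)" for z i
 have TS: "T z \<in> standard_simplex 2" if "z \<in> S" for z
  using that by (auto simp: standard_simplex_def T_def S_def numeral_2_eq_2)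
 have "continuous_map (top_of_set S) (subtopology (powertop_real UNIV) (standard_simplex 2)) T"
  unfolding continuous_map_in_subtopology continuous_map_componentwise_UNIV
 proof (intro conjI allI)
  fix i
  have "continuous_on S (%z. T z i)"
  unfolding T_def by (cases "i = 0"; cases "i = 1"; cases "i = 2") (auto intro!: continuous_intros)
  thus "continuous_map (top_of_set S) euclideanreal (%z. T z i)" by simp
 qed (use TS in auto)
 hence "continuous_map (top_of_set S) euclidean (F \<circ> (s \<circ> T))"
  using s F unfolding singular_simplex_def by (blast intro: continuous_map_compose)
 hence cont: "continuous_on S (F \<circ> (s \<circ> T))" by simp
 have "convex S"
 proof -
  have "S = {z. 0 <= inner (1, 0) z} \<inter> {z. 0 <= inner (0, 1) z} \<inter> {z. inner (1, 1) z <= 1}"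
  by (auto simp: S_def inner_prod_def)
  thus ?thesis by (simp only:) (intro convex_Int convex_halfspace_le convex_halfspace_ge[unfolded mem_Collect_eq])
 qed
 hence contr: "contractible S" by (rule convex_imp_contractible)
 have nzS: "(F \<circ> (s \<circ> T)) z ~= 0" if "z \<in> S" for z
  using TS[OF that] s by (auto simp: singular_simplex_def continuous_map_def Pi_iff intro!: nz)
 obtain l where l: "continuous_on S l" "!!z. z \<in> S ==> (F \<circ> (s \<circ> T)) z = exp (l z)"
  using continuous_logarithm_on_contractible[OF cont contr nzS] by blast
 have face: "wn (F \<circ> simplex_path (singular_face (Suc 1) k s)) = (l (g 1) - l (g 0)) / (2 * of_real pi * \<i>)"
  if g: "continuous_on {0..1} g" "!!t. t \<in> {0..1} ==> g t \<in> S" "!!t. simplical_face k (edge_point t) = T (g t)" for k and g :: "real => real \<times> real"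
 proof (rule winding_number_lift[of "%t. l (g t)"])
  show "path (%t. l (g t))" unfolding path_def
  by (rule continuous_on_compose2[OF l(1) g(1)]) (use g(2) in auto)
  fix t :: real assume t: "t \<in> {0..1}"
  have "simplex_path (singular_face (Suc 1) k s) t = s (T (g t))"
  using edge_point_simplex[OF t] by (simp add: simplex_path_edge_point singular_face_def g(3))
  thus "(F \<circ> simplex_path (singular_face (Suc 1) k s)) t = exp (l (g t))" using l(2)[OF g(2)[OF t]] by simp
 qed
 have f0: "wn (F \<circ> simplex_path (singular_face (Suc 1) 0 s)) = (l (0, 1) - l (1, 0)) / (2 * of_real pi * \<i>)"
  by (subst face[of "%t. (1 - t, t)"]) (auto intro!: continuous_intros simp: S_def T_def simplical_face_def edge_point_def fun_eq_iff)
 have f1: "wn (F \<circ> simplex_path (singular_face (Suc 1) 1 s)) = (l (0, 1) - l (0, 0)) / (2 * of_real pi * \<i>)"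
  by (subst face[of "%t. (0, t)"]) (auto intro!: continuous_intros simp: S_def T_def simplical_face_def edge_point_def fun_eq_iff)
 have f2: "wn (F \<circ> simplex_path (singular_face (Suc 1) 2 s)) = (l (1, 0) - l (0, 0)) / (2 * of_real pi * \<i>)"
  by (subst face[of "%t. (t, 0)"]) (auto intro!: continuous_intros simp: S_def T_def simplical_face_def edge_point_def fun_eq_iff)
 have "{..Suc 1} = {0, 1, 2::nat}" by auto
 thus ?thesis unfolding coboundary_sum using f0 f1 f2 by (simp add: diff_divide_distrib)
qed

text \<open>A trivialisation of the line bundle over V makes its class a coboundary there. The
  functions F i without zeros are the trivialisation in the charts, and the differences of
  \<open>b i\<close> and the winding numbers of F i glue to one cochain e.\<close>

lemma chern_correction:
 fixes F :: "'i => 'a => complex"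
 assumes compat: "!!i j s. i \<in> I ==> j \<in> I ==> singular_simplex 1 (subtopology X (U i \<inter> U j \<inter> V)) s ==>
  b i s - b j s = wn (F i \<circ> simplex_path s) - wn (F j \<circ> simplex_path s)"
  and F: "!!i. i \<in> I ==> continuous_map (subtopology X (U i \<inter> V)) euclidean (F i)"
  and nz: "!!i p. i \<in> I ==> p \<in> topspace X ==> p \<in> U i \<inter> V ==> F i p ~= 0"
  and c: "!!i s. i \<in> I ==> singular_simplex 2 (subtopology X (U i)) s ==> c s = coboundary 1 (b i) s"
 shows "\<exists>e. (\<forall>i\<in>I. \<forall>s. singular_simplex 1 (subtopology X (U i \<inter> V)) s --> b i s - e s = wn (F i \<circ> simplex_path s)) \<and>
  (\<forall>i\<in>I. \<forall>s. singular_simplex 2 (subtopology X (U i \<inter> V)) s --> c s - coboundary 1 e s = 0)"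
proof -
 define P where "P s i \<longleftrightarrow> i \<in> I \<and> singular_simplex 1 (subtopology X (U i \<inter> V)) s" for s i
 \<comment> \<open>The chosen chart is immaterial by \<open>compat\<close>; the value on a simplex
   that lies in no chart is arbitrary.\<close>
 define e where "e s = (let i = (SOME i. P s i) in b i s - wn (F i \<circ> simplex_path s))" for s
 have e: "b i s - e s = wn (F i \<circ> simplex_path s)" if "P s i" for i s
 proof -
  define j where "j = (SOME i. P s i)"
  have j: "P s j" unfolding j_def by (rule someI[of "P s", OF that])
  have "singular_simplex 1 (subtopology X (U i \<inter> U j \<inter> V)) s"
  using that j by (auto simp: P_def singular_simplex_subtopology)
  hence "b i s - b j s = wn (F i \<circ> simplex_path s) - wn (F j \<circ> simplex_path s)"
  using that j compat by (simp add: P_def)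
  thus ?thesis by (simp add: e_def Let_def flip: j_def) (simp add: algebra_simps)
 qed
 have "c s - coboundary 1 e s = 0" if i: "i \<in> I" and s: "singular_simplex 2 (subtopology X (U i \<inter> V)) s" for i s
 proof -
  have "singular_simplex 2 (subtopology X (U i)) s" using s by (auto simp: singular_simplex_subtopology)
  hence "c s - coboundary 1 e s = coboundary 1 (%s. b i s - e s) s"
  unfolding coboundary_diff using c[OF i] by simp
  also have "... = coboundary 1 (%t. wn (F i \<circ> simplex_path t)) s"
  unfolding coboundary_sum
  proof (intro sum.cong refl arg_cong2[where f = "(*)"])
  fix k assume k: "k \<in> {..Suc 1}"
  have "singular_simplex (Suc 1 - Suc 0) (subtopology X (U i \<inter> V)) (singular_face (Suc 1) k s)"
  by (rule singular_simplex_singular_face) (use s k in \<open>auto simp: numeral_2_eq_2\<close>)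
  thus "b i (singular_face (Suc 1) k s) - e (singular_face (Suc 1) k s) = wn (F i \<circ> simplex_path (singular_face (Suc 1) k s))"
  by (intro e) (simp add: P_def i)
  qed
  also have "... = 0" by (rule winding_number_coboundary[OF s F[OF i]]) (use nz i in auto)
  finally show ?thesis .
 qed
 thus ?thesis using e by (intro exI[of _ e]) (simp add: P_def)
qed

lemma continuous_map_euclidean_iff:
 "continuous_map Y euclidean f \<longleftrightarrow> (\<forall>y\<in>topspace Y. (f \<longlongrightarrow> f y) (atin Y y))"
 by (simp add: continuous_map_atin)

section \<open>Points, characters and charts of a nonsingular toric variety\<close>

locale nonsingular_toric =
 fixes Fn :: "(real ^ 'n) set set"
 assumes fan: "complete_fan Fn" and ns: "nonsingular_fan Fn"
begin

lemma isf: "is_fan Fn" using fan by (simp add: complete_fan_def)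

lemma simpl: "simplicial_fan Fn" by (rule nonsingular_imp_simplicial[OF isf ns])

sublocale nc: nonsingular_complex "gens Fn ` Fn" by (rule nonsingular_fan_complex[OF fan ns])

abbreviation G :: "(real ^ 'n) set => (int ^ 'n) set" where "G \<equiv> gens Fn"
abbreviation S :: "(real ^ 'n) set => (int ^ 'n) set" where "S \<equiv> dual_semigroup"
abbreviation A :: "(real ^ 'n) set => (int ^ 'n => complex) set" where "A C \<equiv> topspace (affine_toric C)"

lemma A_iff: "x \<in> A C \<longleftrightarrow> x \<in> extensional (S C) \<and> x 0 = 1 \<and> (\<forall>m\<in>S C. \<forall>m'\<in>S C. x (m + m') = x m * x m')"
 by (auto simp: affine_toric_def PiE_def)

lemma cone_eq: "C \<in> Fn ==> C = pos_cone (G C)"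
 by (rule nonsingular_fan_gens(3)[OF isf ns])

lemma finite_gens: "C \<in> Fn ==> finite (G C)"
 using nonsingular_fan_gens(2)[OF isf ns] by (simp add: lin_indep_def)

lemma mem_S:
 assumes "C \<in> Fn"
 shows "m \<in> S C \<longleftrightarrow> (\<forall>d\<in>G C. 0 <= pairing m d)"
proof
 assume m: "m \<in> S C"
 show "\<forall>d\<in>G C. 0 <= pairing m d"
 proof
  fix d assume "d \<in> G C"
  hence "0 <= rvec m \<bullet> rvec d" using m by (auto simp: dual_semigroup_def gens_def)
  thus "0 <= pairing m d" unfolding pairing_inner[symmetric] by simp
 qed
next
 assume m: "\<forall>d\<in>G C. 0 <= pairing m d"
 show "m \<in> S C" unfolding dual_semigroup_def
 proof (intro CollectI ballI)
  fix y assume "y \<in> C"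
  hence "y \<in> pos_cone (G C)" by (rule equalityD1[OF cone_eq[OF assms], THEN subsetD])
  then obtain c where c: "\<forall>d\<in>G C. 0 <= c d" "y = (\<Sum>d\<in>G C. c d *\<^sub>R rvec d)"
  unfolding pos_cone_explicit[OF finite_gens[OF assms]] by blast
  have "rvec m \<bullet> y = (\<Sum>d\<in>G C. c d * real_of_int (pairing m d))"
  unfolding c(2) by (simp add: inner_sum_right pairing_inner)
  thus "0 <= rvec m \<bullet> y" using c(1) m by (simp add: sum_nonneg)
 qed
qed

lemma S_0 [simp]: "0 \<in> S C"
 by (simp add: dual_semigroup_def)

lemma S_add: "m \<in> S C ==> m' \<in> S C ==> m + m' \<in> S C"
 by (auto simp: dual_semigroup_def rvec_add inner_add_left)

lemma S_mono: "C0 \<subseteq> C ==> S C \<subseteq> S C0"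
 by (auto simp: dual_semigroup_def)

lemma A_mult: "x \<in> A C ==> m \<in> S C ==> m' \<in> S C ==> x (m + m') = x m * x m'"
 by (simp add: A_iff)

lemma A_arb: "x \<in> A C ==> m \<notin> S C ==> x m = undefined"
 by (simp add: A_iff extensional_def)

lemma A_0: "x \<in> A C ==> x 0 = 1"
 by (simp add: A_iff)

lemma A_restrict:
 assumes "y \<in> A C0" "C0 \<subseteq> C"
 shows "restrict y (S C) \<in> A C"
 using assms S_mono[OF assms(2)] by (auto simp: A_iff S_add subset_iff)

lemma face_cone:
 assumes "C \<in> Fn" "T \<subseteq> G C"
 shows "pos_cone T \<in> Fn" "G (pos_cone T) = T" "pos_cone T \<subseteq> C"
 using gens_pos_cone[OF isf simpl assms] cone_eq[OF assms(1)] pos_cone_mono[OF assms(2)] by auto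

lemma inter_cone:
 assumes "C \<in> Fn" "C' \<in> Fn"
 shows "C \<inter> C' \<in> Fn" "G (C \<inter> C') = G C \<inter> G C'"
proof -
 have "0 \<in> C \<inter> C'" using cone_eq[OF assms(1)] cone_eq[OF assms(2)] zero_in_pos_cone by blast
 thus "C \<inter> C' \<in> Fn" by (intro fan_face[OF isf assms(1) fan_inter[OF isf assms]]) auto
qed (auto simp: gens_def)

definition dv :: "(real ^ 'n) set => int ^ 'n => int ^ 'n" where
 "dv C = (SOME e. \<forall>d\<in>G C. \<forall>d'\<in>G C. pairing (e d) d' = (if d = d' then 1 else 0))"

lemma dv: "C \<in> Fn ==> d \<in> G C ==> d' \<in> G C ==> pairing (dv C d) d' = (if d = d' then 1 else 0)"
 using someI_ex[OF nc.dual[of "G C"]] unfolding dv_def by blast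

lemma dv_S: "C \<in> Fn ==> d \<in> G C ==> dv C d \<in> S C"
 by (simp add: mem_S dv)

text \<open>The rays of C whose coordinate function is zero at x, that is, the invariant divisors of
  the chart through this point.\<close>

definition Tz :: "(real ^ 'n) set => (int ^ 'n => complex) => (int ^ 'n) set" where
 "Tz C x = {d \<in> G C. x (dv C d) = 0}"

definition den :: "(real ^ 'n) set => (int ^ 'n => complex) => int ^ 'n => int ^ 'n => bool" where
 "den C x m u \<longleftrightarrow> u \<in> S C \<and> x u ~= 0 \<and> m + u \<in> S C"

text \<open>Extends the homomorphism x to characters outside S C by writing m as the fraction of m +
  u and u with x u not 0. By \<open>loc_eq\<close> the choice of u does not matter.\<close>

definition loc :: "(real ^ 'n) set => (int ^ 'n => complex) => int ^ 'n => complex" where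
 "loc C x m = (let u = SOME u. den C x m u in x (m + u) / x u)"

lemma loc_eq:
 assumes x: "x \<in> A C" and u: "den C x m u"
 shows "loc C x m = x (m + u) / x u"
proof -
 define v where "v = (SOME u. den C x m u)"
 have v: "den C x m v" unfolding v_def by (rule someI[of "den C x m", OF u])
 have "x (m + u) * x v = x (m + u + v)" using A_mult[OF x] u v by (simp add: den_def)
 also have "m + u + v = (m + v) + u" by simp
 also have "x ... = x (m + v) * x u" using A_mult[OF x, of "m + v" u] u v by (simp add: den_def)
 finally have "x (m + v) / x v = x (m + u) / x u" using u v by (simp add: den_def field_simps)
 thus ?thesis by (simp add: loc_def Let_def flip: v_def)
qed

lemma nonzero_smult:
 assumes x: "x \<in> A C" and a: "a \<in> S C" "x a ~= 0"
 shows "int k *s a \<in> S C \<and> x (int k *s a) ~= 0"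
proof (induction k)
 case 0
 have "(0::int) *s a = 0" by (simp add: vec_eq_iff)
 thus ?case using A_0[OF x] by simp
next
 case (Suc k)
 have "int (Suc k) *s a = int k *s a + a" by (simp add: vec_eq_iff algebra_simps)
 thus ?case using Suc a A_mult[OF x] S_add by simp
qed

lemma nonzero_sum:
 assumes x: "x \<in> A C" and D: "finite D" "!!d. d \<in> D ==> a d \<in> S C \<and> x (a d) ~= 0"
 shows "(\<Sum>d\<in>D. a d) \<in> S C \<and> x (\<Sum>d\<in>D. a d) ~= 0"
 using D by (induction D rule: finite_induct) (auto simp: A_0[OF x] A_mult[OF x] S_add)

text \<open>A large multiple of the sum of the dual vectors of D lifts m into the semigroup. The
  successor keeps its pairing positive on all of D, so that u vanishes wherever a coordinate from D
  does.\<close>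

lemma shift_exists:
 assumes C: "C \<in> Fn" and D: "D \<subseteq> G C" and m: "!!d. d \<in> G C - D ==> 0 <= pairing m d"
 obtains k u where "u = (\<Sum>d\<in>D. int (Suc k) *s dv C d)" "u \<in> S C" "m + u \<in> S C"
  "!!d. d \<in> G C ==> pairing u d = (if d \<in> D then int (Suc k) else 0)"
proof -
 have finD: "finite D" using finite_gens[OF C] D finite_subset by blast
 define k where "k = (\<Sum>d\<in>D. nat \<bar>pairing m d\<bar>)"
 define u where "u = (\<Sum>d\<in>D. int (Suc k) *s dv C d)"
 have pu: "pairing u d = (if d \<in> D then int (Suc k) else 0)" if "d \<in> G C" for d
 proof -
  have "pairing u d = (\<Sum>e\<in>D. if e = d then int (Suc k) else 0)"
  unfolding u_def pairing_sum_left pairing_smult_left using dv[OF C] D that by (intro sum.cong) auto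
  thus ?thesis using finD by simp
 qed
 have "0 <= pairing (m + u) d" if d: "d \<in> G C" for d
 proof (cases "d \<in> D")
  case True
  hence "nat \<bar>pairing m d\<bar> <= k" unfolding k_def using finD by (intro member_le_sum) auto
  thus ?thesis using True pu[OF d] by (simp add: pairing_add_left)
 next
  case False
  thus ?thesis using m d pu[OF d] by (simp add: pairing_add_left)
 qed
 thus ?thesis using that[OF u_def] pu by (simp add: mem_S[OF C])
qed

lemma nonzero_shift:
 assumes C: "C \<in> Fn" and x: "x \<in> A C" and D: "D \<subseteq> G C" "!!d. d \<in> D ==> x (dv C d) ~= 0"
 shows "x (\<Sum>d\<in>D. int k *s dv C d) ~= 0"
 using nonzero_sum[OF x finite_subset[OF D(1) finite_gens[OF C]], of "%d. int k *s dv C d"] D dv_S[OF C] nonzero_smult[OF x] by blast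

lemma den_exists:
 assumes C: "C \<in> Fn" and x: "x \<in> A C" and D: "D \<subseteq> G C" "!!d. d \<in> D ==> x (dv C d) ~= 0"
  and m: "!!d. d \<in> G C - D ==> 0 <= pairing m d"
 shows "\<exists>u. den C x m u"
proof -
 obtain k u where u: "u = (\<Sum>d\<in>D. int (Suc k) *s dv C d)" "u \<in> S C" "m + u \<in> S C" using shift_exists[OF C D(1) m] by blast
 have "x u ~= 0" unfolding u(1) by (rule nonzero_shift[OF C x D])
 thus ?thesis using u by (auto simp: den_def)
qed

lemma A_zero:
 assumes C: "C \<in> Fn" and x: "x \<in> A C" and d: "d \<in> Tz C x" and u: "u \<in> S C" "0 < pairing u d"
 shows "x u = 0"
proof -
 have dG: "d \<in> G C" using d by (simp add: Tz_def)
 have "u - dv C d \<in> S C" using u dv[OF C dG] by (auto simp: mem_S[OF C] pairing_diff_left)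
 hence "x (dv C d + (u - dv C d)) = x (dv C d) * x (u - dv C d)" by (rule A_mult[OF x dv_S[OF C dG]])
 thus ?thesis using d by (simp add: Tz_def)
qed

text \<open>The point x read in the chart of the smallest face, the one generated by the rays whose
  coordinates vanish at x; the other coordinates are inverted.\<close>

definition wz :: "(real ^ 'n) set => (int ^ 'n => complex) => int ^ 'n => complex" where
 "wz C x = restrict (loc C x) (S (pos_cone (Tz C x)))"

text \<open>A normal form of points without reference to a chart: T is the set of rays whose
  divisors pass through the point, and w is its homomorphism on the chart of the cone of T, non-zero
  exactly on the invertible characters.\<close>

definition orb :: "(int ^ 'n) set => (int ^ 'n => complex) => bool" where
 "orb T w \<longleftrightarrow> T \<in> G ` Fn \<and> w \<in> A (pos_cone T) \<and> (\<forall>m\<in>S (pos_cone T). w m ~= 0 \<longleftrightarrow> (\<forall>d\<in>T. pairing m d = 0))"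

lemma orb_cone: "orb T w ==> pos_cone T \<in> Fn \<and> G (pos_cone T) = T"
 using face_cone unfolding orb_def by blast

lemma den_Tz:
 assumes C: "C \<in> Fn" and x: "x \<in> A C" and m: "m \<in> S (pos_cone (Tz C x))"
 shows "\<exists>u. den C x m u"
proof -
 have sub: "Tz C x \<subseteq> G C" by (auto simp: Tz_def)
 have m': "\<forall>d\<in>Tz C x. 0 <= pairing m d" using mem_S face_cone[OF C sub] m by blast
 show ?thesis by (rule den_exists[OF C x, of "G C - Tz C x"]) (use m' in \<open>auto simp: Tz_def\<close>)
qed

lemma orb_rep:
 assumes C: "C \<in> Fn" and x: "x \<in> A C"
 shows "orb (Tz C x) (wz C x)" "x = restrict (wz C x) (S C)" "Tz C x \<subseteq> G C"
proof -
 let ?T = "Tz C x"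
 show sub: "?T \<subseteq> G C" by (auto simp: Tz_def)
 note F = face_cone[OF C sub]
 have SS: "S C \<subseteq> S (pos_cone ?T)" by (rule S_mono[OF F(3)])
 have den: "\<exists>u. den C x m u" if "m \<in> S (pos_cone ?T)" for m by (rule den_Tz[OF C x that])
 have l0: "loc C x m = x m" if "m \<in> S C" for m
  using loc_eq[OF x, of m 0] A_0[OF x] that by (simp add: den_def)
 have lm: "loc C x (m + m') = loc C x m * loc C x m'" if m: "m \<in> S (pos_cone ?T)" "m' \<in> S (pos_cone ?T)" for m m'
 proof -
  obtain u u' where u: "den C x m u" "den C x m' u'" using den m by blast
  have s: "m + m' + (u + u') = (m + u) + (m' + u')" by simp
  have uu: "u + u' \<in> S C" "x (u + u') = x u * x u'" using u A_mult[OF x] S_add by (auto simp: den_def)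
  have "den C x (m + m') (u + u')" using u uu unfolding den_def s by (simp add: S_add)
  hence "loc C x (m + m') = x ((m + u) + (m' + u')) / x (u + u')" unfolding s[symmetric] by (rule loc_eq[OF x])
  also have "... = (x (m + u) * x (m' + u')) / (x u * x u')" using A_mult[OF x] u uu by (simp add: den_def)
  finally show ?thesis using loc_eq[OF x u(1)] loc_eq[OF x u(2)] by simp
 qed
 show "x = restrict (wz C x) (S C)"
 proof
  fix m show "x m = restrict (wz C x) (S C) m"
  proof (cases "m \<in> S C")
  case True
  thus ?thesis using l0[OF True] subsetD[OF SS True] by (simp add: wz_def)
  next
  case False
  thus ?thesis using A_arb[OF x False] by simp
  qed
 qed
 have A: "wz C x \<in> A (pos_cone ?T)"
  unfolding A_iff using lm l0[OF S_0] A_0[OF x] by (auto simp: wz_def S_add)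
 have "wz C x m ~= 0 \<longleftrightarrow> (\<forall>d\<in>?T. pairing m d = 0)" if m: "m \<in> S (pos_cone ?T)" for m
 proof
  assume nz: "wz C x m ~= 0"
  obtain u where u: "den C x m u" using den m by blast
  have "x (m + u) ~= 0" using nz loc_eq[OF x u] m by (auto simp: wz_def)
  moreover have "m + u \<in> S C" "u \<in> S C" "x u ~= 0" using u by (auto simp: den_def)
  ultimately have z: "\<not> 0 < pairing (m + u) d \<and> \<not> 0 < pairing u d" if "d \<in> ?T" for d
  using A_zero[OF C x that] by blast
  show "\<forall>d\<in>?T. pairing m d = 0"
  proof
  fix d assume d: "d \<in> ?T"
  have "0 <= pairing u d" "0 <= pairing (m + u) d" using u d sub by (auto simp: den_def mem_S[OF C])
  thus "pairing m d = 0" using z[OF d] by (simp add: pairing_add_left)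
  qed
 next
  assume z: "\<forall>d\<in>?T. pairing m d = 0"
  hence "- m \<in> S (pos_cone ?T)" unfolding mem_S[OF F(1)] F(2) by (simp add: pairing_minus_left)
  hence "wz C x m * wz C x (- m) = wz C x (m + - m)" by (rule A_mult[OF A m, symmetric])
  hence "wz C x m * wz C x (- m) = 1" using A_0[OF A] by simp
  thus "wz C x m ~= 0" by auto
 qed
 thus "orb ?T (wz C x)" unfolding orb_def using A F by blast
qed

text \<open>In passing from C to the face of T0 all coordinates outside T0 become invertible. Hence
  the zero coordinates of x lie in T0, and y is recovered from x by fractions.\<close>

lemma restrict_unique:
 assumes C: "C \<in> Fn" and T0: "T0 \<subseteq> G C" and y: "y \<in> A (pos_cone T0)" and x: "x = restrict y (S C)"
 shows "Tz C x \<subseteq> T0" "!!m. m \<in> S (pos_cone T0) ==> y m = wz C x m"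
proof -
 note F = face_cone[OF C T0]
 have SS: "S C \<subseteq> S (pos_cone T0)" by (rule S_mono[OF F(3)])
 have xA: "x \<in> A C" unfolding x by (rule A_restrict[OF y F(3)])
 have nz: "x (dv C d) ~= 0" if d: "d \<in> G C - T0" for d
 proof -
  have "dv C d \<in> S (pos_cone T0)" "- dv C d \<in> S (pos_cone T0)"
  unfolding mem_S[OF F(1)] F(2) using dv[OF C] d T0 by (auto simp: pairing_minus_left subset_iff)
  hence "y (dv C d) * y (- dv C d) = y (dv C d + - dv C d)" by (rule A_mult[OF y, symmetric])
  hence "y (dv C d) * y (- dv C d) = 1" using A_0[OF y] by simp
  thus ?thesis using dv_S[OF C] d by (auto simp: x)
 qed
 thus T: "Tz C x \<subseteq> T0" by (auto simp: Tz_def)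
 fix m assume m: "m \<in> S (pos_cone T0)"
 have "\<exists>u. den C x m u"
 proof (rule den_exists[OF C xA, of "G C - T0"])
  fix d assume "d \<in> G C - (G C - T0)"
  thus "0 <= pairing m d" using m unfolding mem_S[OF F(1)] F(2) by blast
 qed (use nz in auto)
 then obtain u where u: "den C x m u" by blast
 have uS: "u \<in> S C" "m + u \<in> S C" "x u ~= 0" using u by (auto simp: den_def)
 have "loc C x m = y (m + u) / y u" using loc_eq[OF xA u] uS by (simp add: x)
 moreover have "y (m + u) = y m * y u" using A_mult[OF y m] uS SS by blast
 moreover have "y u ~= 0" using uS by (simp add: x)
 moreover have "m \<in> S (pos_cone (Tz C x))" using m S_mono[OF pos_cone_mono[OF T]] by blast
 ultimately show "y m = wz C x m" by (simp add: wz_def)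
qed

text \<open>All representatives of the point with normal form (T, w), one for each cone that has T
  among its generators.\<close>

definition pt :: "(int ^ 'n) set => (int ^ 'n => complex) => 'n toric_point" where
 "pt T w = {(C', x'). C' \<in> Fn \<and> T \<subseteq> G C' \<and> x' = restrict w (S C')}"

text \<open>The gluing relation compares two charts over the intersection of their cones. That
  intersection contains the smallest face of the point, where the representative is unique, so
  related pairs are exactly the restrictions of one normal form.\<close>

lemma chart_map_eq:
 assumes C: "C \<in> Fn" and x: "x \<in> A C"
 shows "toric_chart_map Fn C x = pt (Tz C x) (wz C x)"
proof -
 let ?T = "Tz C x" and ?w = "wz C x"
 note R = orb_rep[OF C x]
 have wA: "?w \<in> A (pos_cone ?T)" using R(1) by (simp add: orb_def)
 have "(C', x') \<in> toric_chart_map Fn C x \<longleftrightarrow> (C', x') \<in> pt ?T ?w" for C' x'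
 proof
  assume "(C', x') \<in> toric_chart_map Fn C x"
  then obtain y where C': "C' \<in> Fn" and y: "y \<in> A (C \<inter> C')" "x = restrict y (S C)" "x' = restrict y (S C')"
  unfolding toric_chart_map_def toric_gluing_def by blast
  note I = inter_cone[OF C C']
  have e: "C \<inter> C' = pos_cone (G C \<inter> G C')" using cone_eq[OF I(1)] I(2) by simp
  have yA: "y \<in> A (pos_cone (G C \<inter> G C'))" using y(1) unfolding e .
  have T: "?T \<subseteq> G C \<inter> G C'" by (rule restrict_unique(1)[OF C _ yA y(2)]) simp
  have yw: "y m = ?w m" if "m \<in> S (pos_cone (G C \<inter> G C'))" for m
  by (rule restrict_unique(2)[OF C _ yA y(2) that]) simp
  have "S C' \<subseteq> S (pos_cone (G C \<inter> G C'))" unfolding e[symmetric] by (rule S_mono) simp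
  hence "x' = restrict ?w (S C')" unfolding y(3) using yw by (intro restrict_ext) blast
  thus "(C', x') \<in> pt ?T ?w" using C' T by (simp add: pt_def)
 next
  assume "(C', x') \<in> pt ?T ?w"
  hence C': "C' \<in> Fn" "?T \<subseteq> G C'" "x' = restrict ?w (S C')" by (auto simp: pt_def)
  have sub: "pos_cone ?T \<subseteq> C" "pos_cone ?T \<subseteq> C'" using face_cone(3)[OF C R(3)] face_cone(3)[OF C'(1,2)] .
  let ?y = "restrict ?w (S (C \<inter> C'))"
  have "?y \<in> A (C \<inter> C')" by (rule A_restrict[OF wA]) (use sub in blast)
  moreover have "S C \<subseteq> S (C \<inter> C')" "S C' \<subseteq> S (C \<inter> C')" by (auto intro: S_mono[THEN subsetD, rotated])
  hence "x = restrict ?y (S C)" "x' = restrict ?y (S C')"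
  using R(2) C'(3) by (auto simp: Int_absorb1)
  ultimately show "(C', x') \<in> toric_chart_map Fn C x"
  unfolding toric_chart_map_def toric_gluing_def using C C'(1) by blast
 qed
 thus ?thesis by auto
qed

lemma pt_chart:
 assumes w: "orb T w" and C: "C \<in> Fn" "T \<subseteq> G C"
 shows "restrict w (S C) \<in> A C" "toric_chart_map Fn C (restrict w (S C)) = pt T w"
proof -
 note F = face_cone[OF C]
 have wA: "w \<in> A (pos_cone T)" using w by (simp add: orb_def)
 show xA: "restrict w (S C) \<in> A C" by (rule A_restrict[OF wA F(3)])
 let ?x = "restrict w (S C)"
 have SS: "S C \<subseteq> S (pos_cone T)" by (rule S_mono[OF F(3)])
 have T: "Tz C ?x = T"
 proof -
  have "w (dv C d) = 0 \<longleftrightarrow> d \<in> T" if "d \<in> G C" for d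
  proof -
  have "dv C d \<in> S (pos_cone T)" using dv_S[OF C(1) that] SS by blast
  hence "w (dv C d) ~= 0 \<longleftrightarrow> (\<forall>e\<in>T. pairing (dv C d) e = 0)" using w by (simp add: orb_def)
  also have "... \<longleftrightarrow> d \<notin> T" using dv[OF C(1) that] C(2) by (auto simp: subset_iff)
  finally show ?thesis by blast
  qed
  thus ?thesis unfolding Tz_def using C(2) dv_S[OF C(1)] by auto
 qed
 have "wz C ?x = w"
 proof
  fix m show "wz C ?x m = w m"
  proof (cases "m \<in> S (pos_cone T)")
  case True thus ?thesis using restrict_unique(2)[OF C wA refl] by simp
  next
  case False thus ?thesis using A_arb[OF wA False] by (simp add: wz_def T)
  qed
 qed
 thus "toric_chart_map Fn C ?x = pt T w" using chart_map_eq[OF C(1) xA] T by simp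
qed

lemma pt_inj:
 assumes "orb T w" "orb T' w'" "pt T w = pt T' w'"
 shows "T = T' \<and> w = w'"
proof -
 have ext: "restrict v (S (pos_cone U)) = v" if "orb U v" for U v
  using that by (simp add: orb_def A_iff extensional_restrict)
 have sub: "U' \<subseteq> U \<and> v = restrict v' (S (pos_cone U))" if "orb U v" "orb U' v'" "pt U v = pt U' v'" for U v U' v'
 proof -
  have "(pos_cone U, v) \<in> pt U v" using orb_cone[OF that(1)] ext[OF that(1)] by (simp add: pt_def)
  hence "(pos_cone U, v) \<in> pt U' v'" using that(3) by simp
  thus ?thesis using orb_cone[OF that(1)] by (simp add: pt_def)
 qed
 have "T = T'" using sub[OF assms] sub[OF assms(2,1) assms(3)[symmetric]] by blast
 moreover have "w = restrict w' (S (pos_cone T))" using sub[OF assms] by blast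
 ultimately show ?thesis using ext[OF assms(2)] by simp
qed

abbreviation X :: "'n toric_point topology" where "X \<equiv> toric_variety Fn"

abbreviation Ch where "Ch \<equiv> toric_chart Fn"

abbreviation smp where "smp p V \<equiv> singular_simplex p (subtopology X V)"

lemma topspace_X: "topspace X = {pt T w | T w. orb T w}"
proof -
 let ?Y = "sum_topology affine_toric Fn" and ?p = "%(C, x). toric_chart_map Fn C x"
 have tsY: "topspace ?Y = {(C, x). C \<in> Fn \<and> x \<in> A C}" by auto
 have "openin X (?p ` topspace ?Y)"
  unfolding openin_toric_variety
 proof
  have "{y \<in> topspace ?Y. ?p y \<in> ?p ` topspace ?Y} = topspace ?Y" by blast
  thus "openin ?Y {y \<in> topspace ?Y. ?p y \<in> ?p ` topspace ?Y}" by (simp only: openin_topspace)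
 qed simp
 hence "?p ` topspace ?Y \<subseteq> topspace X" by (rule openin_subset)
 moreover have "topspace X \<subseteq> ?p ` topspace ?Y" using openin_topspace[of X] unfolding openin_toric_variety by blast
 ultimately have "topspace X = ?p ` topspace ?Y" by blast
 also have "... = {pt T w | T w. orb T w}"
 proof
  show "?p ` topspace ?Y \<subseteq> {pt T w | T w. orb T w}"
  unfolding tsY using chart_map_eq orb_rep(1) by fastforce
  show "{pt T w | T w. orb T w} \<subseteq> ?p ` topspace ?Y"
  proof clarify
  fix T w assume w: "orb T w"
  have c: "pos_cone T \<in> Fn" "T \<subseteq> G (pos_cone T)" using orb_cone[OF w] by auto
  show "pt T w \<in> ?p ` topspace ?Y"
  unfolding tsY using pt_chart[OF w c] c(1) by (intro image_eqI[of _ _ "(pos_cone T, restrict w (S (pos_cone T)))"]) auto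
  qed
 qed
 finally show ?thesis .
qed

definition Tp :: "'n toric_point => (int ^ 'n) set" where
 "Tp p = (THE T. \<exists>w. orb T w \<and> p = pt T w)"

text \<open>The character m as a function on the variety, independent of charts. At points where m
  is not regular the value is \<open>undefined\<close>, since homomorphisms are stored as
  extensional functions.\<close>

definition chi :: "int ^ 'n => 'n toric_point => complex" where
 "chi m p = (THE w. \<exists>T. orb T w \<and> p = pt T w) m"

lemma rep_pt:
 assumes "orb T w"
 shows "Tp (pt T w) = T" "chi m (pt T w) = w m"
proof -
 show "Tp (pt T w) = T" unfolding Tp_def using assms pt_inj by (intro the_equality) blast+
 have "(THE w'. \<exists>T'. orb T' w' \<and> pt T w = pt T' w') = w" using assms pt_inj by (intro the_equality) blast+
 thus "chi m (pt T w) = w m" by (simp add: chi_def)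
qed

lemma rep:
 assumes "p \<in> topspace X"
 shows "orb (Tp p) (%m. chi m p)" "p = pt (Tp p) (%m. chi m p)"
proof -
 obtain T w where w: "orb T w" "p = pt T w" using assms unfolding topspace_X by blast
 have "(%m. chi m p) = w" using rep_pt(2)[OF w(1)] w(2) by auto
 thus "orb (Tp p) (%m. chi m p)" "p = pt (Tp p) (%m. chi m p)" using w rep_pt(1)[OF w(1)] by auto
qed

lemma chart_map_rep:
 assumes "C \<in> Fn" "x \<in> A C"
 shows "toric_chart_map Fn C x \<in> topspace X" "Tp (toric_chart_map Fn C x) = Tz C x" "chi m (toric_chart_map Fn C x) = wz C x m"
 using orb_rep(1)[OF assms] rep_pt unfolding chart_map_eq[OF assms] topspace_X by blast+

lemma chi_chart_map:
 assumes "C \<in> Fn" "x \<in> A C" "m \<in> S C"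
 shows "chi m (toric_chart_map Fn C x) = x m"
proof -
 have "x m = restrict (wz C x) (S C) m" using orb_rep(2)[OF assms(1,2)] by (rule arg_cong)
 thus ?thesis using chart_map_rep(3)[OF assms(1,2)] assms(3) by simp
qed

lemma mem_chart:
 assumes C: "C \<in> Fn"
 shows "p \<in> Ch C \<longleftrightarrow> p \<in> topspace X \<and> Tp p \<subseteq> G C"
proof
 assume "p \<in> Ch C"
 then obtain x where x: "x \<in> A C" "p = toric_chart_map Fn C x" by (auto simp: toric_chart_def)
 thus "p \<in> topspace X \<and> Tp p \<subseteq> G C" using chart_map_rep[OF C x(1)] orb_rep(3)[OF C x(1)] by simp
next
 assume p: "p \<in> topspace X \<and> Tp p \<subseteq> G C"
 hence r: "orb (Tp p) (%m. chi m p)" "p = pt (Tp p) (%m. chi m p)" using rep by blast+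
 have "restrict (%m. chi m p) (S C) \<in> A C" "toric_chart_map Fn C (restrict (%m. chi m p) (S C)) = pt (Tp p) (%m. chi m p)"
  using pt_chart[OF r(1) C] p by blast+
 thus "p \<in> Ch C" unfolding toric_chart_def using r(2) by (metis image_eqI)
qed

lemma chart_inter:
 assumes "C \<in> Fn" "C' \<in> Fn"
 shows "Ch (C \<inter> C') = Ch C \<inter> Ch C'"
 using mem_chart[OF assms(1)] mem_chart[OF assms(2)] mem_chart[OF inter_cone(1)[OF assms]] inter_cone(2)[OF assms] by auto

lemma inj_chart_map:
 assumes C: "C \<in> Fn"
 shows "inj_on (toric_chart_map Fn C) (A C)"
proof (rule inj_onI)
 fix x y assume xy: "x \<in> A C" "y \<in> A C" "toric_chart_map Fn C x = toric_chart_map Fn C y"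
 show "x = y"
 proof
  fix m show "x m = y m"
  proof (cases "m \<in> S C")
  case True
  thus ?thesis using chi_chart_map[OF C xy(1) True] chi_chart_map[OF C xy(2) True] xy(3) by simp
  next
  case False thus ?thesis using A_arb[OF xy(1) False] A_arb[OF xy(2) False] by simp
  qed
 qed
qed

lemma coords_eq:
 assumes C: "C \<in> Fn" and p: "p \<in> Ch C" and m: "m \<in> S C"
 shows "toric_coords Fn C p m = chi m p"
proof -
 obtain x where x: "x \<in> A C" "p = toric_chart_map Fn C x" using p by (auto simp: toric_chart_def)
 have "toric_coords Fn C p = x" unfolding toric_coords_def x(2) by (rule the_inv_into_f_f[OF inj_chart_map[OF C] x(1)])
 thus ?thesis using chi_chart_map[OF C x(1) m] x(2) by simp
qed

lemma chi_mult:
 assumes "C \<in> Fn" "p \<in> Ch C" "m \<in> S C" "m' \<in> S C"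
 shows "chi (m + m') p = chi m p * chi m' p"
proof -
 have p: "p \<in> topspace X" "Tp p \<subseteq> G C" using mem_chart[OF assms(1)] assms(2) by auto
 have "(%m. chi m p) \<in> A (pos_cone (Tp p))" using rep(1)[OF p(1)] by (simp add: orb_def)
 moreover have "S C \<subseteq> S (pos_cone (Tp p))" by (rule S_mono[OF face_cone(3)[OF assms(1) p(2)]])
 ultimately show ?thesis using A_mult assms(3,4) by blast
qed

lemma chi_nonzero:
 assumes "C \<in> Fn" "p \<in> Ch C" "m \<in> S C"
 shows "chi m p ~= 0 \<longleftrightarrow> (\<forall>d\<in>Tp p. pairing m d = 0)"
proof -
 have p: "p \<in> topspace X" "Tp p \<subseteq> G C" using mem_chart[OF assms(1)] assms(2) by auto
 have "S C \<subseteq> S (pos_cone (Tp p))" by (rule S_mono[OF face_cone(3)[OF assms(1) p(2)]])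
 thus ?thesis using rep(1)[OF p(1)] assms(3) by (auto simp: orb_def)
qed

lemma continuous_map_affine: "m \<in> S C ==> continuous_map (affine_toric C) euclidean (%x. x m)"
 unfolding affine_toric_def by (intro continuous_map_from_subtopology continuous_map_product_projection)

text \<open>Openness is checked in every other chart C'. There the chart of C is the locus where one
  monomial u is not 0, and on it the character m is the quotient x (m + u) / x u of two
  coordinates.\<close>

lemma openin_chi:
 assumes C: "C \<in> Fn" and m: "m \<in> S C" and U: "open U"
 shows "openin X {p \<in> Ch C. chi m p \<in> U}"
 unfolding openin_toric_variety
proof
 let ?Y = "sum_topology affine_toric Fn" and ?p = "%(C, x). toric_chart_map Fn C x"
 have "Ch C \<subseteq> ?p ` topspace ?Y"
 proof
  fix p assume "p \<in> Ch C"
  then obtain x where "x \<in> A C" "p = toric_chart_map Fn C x" by (auto simp: toric_chart_def)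
  thus "p \<in> ?p ` topspace ?Y" using C by (intro image_eqI[of _ _ "(C, x)"]) auto
 qed
 thus "{p \<in> Ch C. chi m p \<in> U} \<subseteq> ?p ` topspace ?Y" by blast
 show "openin ?Y {y \<in> topspace ?Y. ?p y \<in> {p \<in> Ch C. chi m p \<in> U}}"
  unfolding openin_sum_topology
 proof (intro conjI ballI)
  show "{y \<in> topspace ?Y. ?p y \<in> {p \<in> Ch C. chi m p \<in> U}} \<subseteq> Sigma Fn (topspace \<circ> affine_toric)" by auto
  fix C' assume C': "C' \<in> Fn"
  \<comment> \<open>The rays of C' that are not in C; these are the coordinates that have to be
    invertible for a point of C' to lie in the chart of C.\<close>
  define D where "D = G C' - G C"
  have D: "D \<subseteq> G C'" "finite D" unfolding D_def using finite_gens[OF C'] by auto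
  have m0: "0 <= pairing m d" if "d \<in> G C' - D" for d using m that by (simp add: D_def mem_S[OF C])
  obtain k u where u_def: "u = (\<Sum>d\<in>D. int (Suc k) *s dv C' d)" and uS: "u \<in> S C'" and muS: "m + u \<in> S C'"
  and pu: "!!d. d \<in> G C' ==> pairing u d = (if d \<in> D then int (Suc k) else 0)"
  using shift_exists[OF C' D(1) m0] by blast
  have iff: "Tz C' x \<subseteq> G C \<longleftrightarrow> x u ~= 0" if x: "x \<in> A C'" for x
  proof
  assume T: "Tz C' x \<subseteq> G C"
  have "x (dv C' d) ~= 0" if "d \<in> D" for d using that T unfolding D_def Tz_def by blast
  thus "x u ~= 0" unfolding u_def by (rule nonzero_shift[OF C' x D(1)])
  next
  assume nz: "x u ~= 0"
  have "d \<in> G C" if d: "d \<in> Tz C' x" for d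
  proof (rule ccontr)
  assume "d \<notin> G C"
  hence "d \<in> D" using d by (simp add: D_def Tz_def)
  hence "0 < pairing u d" using pu D(1) by auto
  thus False using A_zero[OF C' x d uS] nz by simp
  qed
  thus "Tz C' x \<subseteq> G C" by blast
  qed
  have val: "chi m (toric_chart_map Fn C' x) = x (m + u) / x u" if x: "x \<in> A C'" "x u ~= 0" for x
  proof -
  have T: "Tz C' x \<subseteq> G C" using iff x by blast
  have "m \<in> S (pos_cone (Tz C' x))" using m S_mono[OF face_cone(3)[OF C T]] by blast
  hence "chi m (toric_chart_map Fn C' x) = loc C' x m" using chart_map_rep(3)[OF C' x(1)] by (simp add: wz_def)
  also have "... = x (m + u) / x u" by (rule loc_eq[OF x(1)]) (use uS muS x(2) in \<open>simp add: den_def\<close>)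
  finally show ?thesis .
  qed
  have "(C', x) \<in> {y \<in> topspace ?Y. ?p y \<in> {p \<in> Ch C. chi m p \<in> U}} \<longleftrightarrow>
  x \<in> A C' \<and> x u \<in> - {0} \<and> x (m + u) / x u \<in> U" for x
  proof (cases "x \<in> A C'")
  case True
  show ?thesis
  proof (cases "x u = 0")
  case u0: True
  thus ?thesis using iff[OF True] chart_map_rep(2)[OF C' True] by (simp add: mem_chart[OF C])
  next
  case False
  thus ?thesis using C' True iff[OF True] chart_map_rep(1,2)[OF C' True] val[OF True False] by (simp add: mem_chart[OF C])
  qed
  qed simp
  hence eq: "{x. (C', x) \<in> {y \<in> topspace ?Y. ?p y \<in> {p \<in> Ch C. chi m p \<in> U}}} =
  {x \<in> topspace (subtopology (affine_toric C') {x \<in> A C'. x u \<in> - {0}}). x (m + u) / x u \<in> U}" by auto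
  have op: "openin (affine_toric C') {x \<in> A C'. x u \<in> - {0}}"
  by (rule openin_continuous_map_preimage[OF continuous_map_affine[OF uS]]) auto
  have op2: "openin (subtopology (affine_toric C') {x \<in> A C'. x u \<in> - {0}})
  {x \<in> topspace (subtopology (affine_toric C') {x \<in> A C'. x u \<in> - {0}}). x (m + u) / x u \<in> U}"
  proof (rule openin_continuous_map_preimage)
  show "continuous_map (subtopology (affine_toric C') {x \<in> A C'. x u \<in> - {0}}) euclidean (%x. x (m + u) / x u)"
  proof -
  have "continuous_map (subtopology (affine_toric C') {x \<in> A C'. x u \<in> - {0}}) euclidean (%x. x u)"
  "continuous_map (subtopology (affine_toric C') {x \<in> A C'. x u \<in> - {0}}) euclidean (%x. x (m + u))"
  by (intro continuous_map_from_subtopology continuous_map_affine uS muS)+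
  thus ?thesis unfolding continuous_map_euclidean_iff by (auto intro!: tendsto_divide)
  qed
  show "openin euclidean U" using U by simp
  qed
  show "openin (affine_toric C') {x. (C', x) \<in> {y \<in> topspace ?Y. ?p y \<in> {p \<in> Ch C. chi m p \<in> U}}}"
  unfolding eq by (rule openin_trans_full[OF op2 op])
 qed
qed

lemma openin_chart:
 assumes "C \<in> Fn"
 shows "openin X (Ch C)"
 using openin_chi[OF assms S_0 open_UNIV] by simp

lemma continuous_map_chi:
 assumes "C \<in> Fn" "m \<in> S C"
 shows "continuous_map (subtopology X (Ch C)) euclidean (chi m)"
 unfolding continuous_map_def
proof (intro conjI allI impI)
 fix U :: "complex set" assume "openin euclidean U"
 hence "openin X {p \<in> Ch C. chi m p \<in> U}" by (intro openin_chi[OF assms]) simp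
 moreover have "Ch C \<subseteq> topspace X" using mem_chart[OF assms(1)] by blast
 hence "{x \<in> topspace (subtopology X (Ch C)). chi m x \<in> U} = {p \<in> Ch C. chi m p \<in> U} \<inter> Ch C" by auto
 ultimately show "openin (subtopology X (Ch C)) {x \<in> topspace (subtopology X (Ch C)). chi m x \<in> U}"
  unfolding openin_subtopology by blast
qed simp

lemma charts_cover:
 assumes "p \<in> topspace X"
 shows "\<exists>C\<in>Fn. p \<in> Ch C \<and> G C = Tp p"
proof -
 have "pos_cone (Tp p) \<in> Fn" "G (pos_cone (Tp p)) = Tp p" using orb_cone[OF rep(1)[OF assms]] by auto
 thus ?thesis using mem_chart assms by blast
qed

definition away :: "int ^ 'n => 'n toric_point set" where
 "away d = {p \<in> topspace X. d \<notin> Tp p}"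

lemma openin_away: "openin X (away d)"
proof (subst openin_subopen, intro ballI)
 fix p assume p: "p \<in> away d"
 then obtain C where C: "C \<in> Fn" "p \<in> Ch C" "G C = Tp p" using charts_cover unfolding away_def by blast
 have "Ch C \<subseteq> away d" using mem_chart[OF C(1)] C(3) p by (auto simp: away_def)
 thus "\<exists>T. openin X T \<and> p \<in> T \<and> T \<subseteq> away d" using openin_chart[OF C(1)] C(2) by blast
qed

text \<open>In the chart of C a character vanishes on the divisor exactly if it is positive on d,
  with no condition when d is not a generator of C. That these characters form a translate m + S C
  determines the pairings: compare with the dual vector of d in the first case and with 0 in the
  second.\<close>

lemma local_equation_pairing:
 assumes d: "d \<in> ray_generators Fn" and C: "C \<in> Fn" and eq: "local_equation Fn d C m" and d': "d' \<in> G C"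
 shows "pairing m d' = (if d' = d then 1 else 0)"
proof -
 define \<rho> where "\<rho> = (convex_cone hull {rvec d} :: (real ^ 'n) set)"
 have \<rho>Fn: "\<rho> \<in> Fn" using d by (simp add: ray_generators_def \<rho>_def)
 have \<rho>p: "\<rho> = pos_cone {d}" by (simp add: \<rho>_def pos_cone_def)
 have dG: "d \<in> G \<rho>" using d by (simp add: gens_def \<rho>_def hull_inc)
 have G\<rho>: "G \<rho> = {d}" using face_cone(2)[OF \<rho>Fn, of "{d}"] dG \<rho>p by simp
 define Ob where "Ob = toric_chart_map Fn \<rho> ` {x \<in> A \<rho>. \<forall>m\<in>S \<rho>. x m ~= 0 \<longleftrightarrow> pairing m d = 0}"
 have div: "toric_divisor Fn d = X closure_of Ob" by (simp add: toric_divisor_def Let_def \<rho>_def Ob_def)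
 have OT: "Tp p = {d}" "p \<in> topspace X" if p: "p \<in> Ob" for p
 proof -
  obtain x where x: "x \<in> A \<rho>" "\<forall>m\<in>S \<rho>. x m ~= 0 \<longleftrightarrow> pairing m d = 0" "p = toric_chart_map Fn \<rho> x" using p by (auto simp: Ob_def)
  have "Tz \<rho> x = {d}" unfolding Tz_def G\<rho> using x(2) dv_S[OF \<rho>Fn dG] dv[OF \<rho>Fn dG dG] by auto
  thus "Tp p = {d}" "p \<in> topspace X" using chart_map_rep[OF \<rho>Fn x(1)] x(3) by auto
 qed
 have divT: "d \<in> Tp p" if p: "p \<in> toric_divisor Fn d" for p
 proof (rule ccontr)
  assume n: "d \<notin> Tp p"
  have "p \<in> topspace X" using p unfolding div by (simp add: in_closure_of)
  hence "p \<in> away d" using n by (simp add: away_def)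
  hence "\<exists>y. y \<in> Ob \<and> y \<in> away d" using p openin_away unfolding div in_closure_of by blast
  thus False using OT by (auto simp: away_def)
 qed
 \<comment> \<open>The distinguished point of the orbit of the ray, with value 1 on characters
   orthogonal to d and 0 on the others. It shows that orthogonal characters do not vanish on the
   divisor.\<close>
 define w where "w = restrict (%m. if pairing m d = 0 then 1 else (0::complex)) (S \<rho>)"
 have wA: "w \<in> A \<rho>"
  unfolding A_iff w_def using mem_S[OF \<rho>Fn] G\<rho> by (auto simp: S_add pairing_add_left add_nonneg_eq_0_iff)
 have zeroset: "{u \<in> S C. \<forall>p \<in> Ch C \<inter> toric_divisor Fn d. toric_coords Fn C p u = 0} = {u \<in> S C. d \<in> G C --> 0 < pairing u d}"
 proof -
  have "(\<forall>p \<in> Ch C \<inter> toric_divisor Fn d. toric_coords Fn C p u = 0) \<longleftrightarrow> (d \<in> G C --> 0 < pairing u d)" if u: "u \<in> S C" for u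
  proof
  assume z: "\<forall>p \<in> Ch C \<inter> toric_divisor Fn d. toric_coords Fn C p u = 0"
  show "d \<in> G C --> 0 < pairing u d"
  proof (intro impI, rule ccontr)
  assume dC: "d \<in> G C" and n: "\<not> 0 < pairing u d"
  hence u0: "pairing u d = 0" using u mem_S[OF C] by force
  let ?p = "toric_chart_map Fn \<rho> w"
  have pO: "?p \<in> Ob" unfolding Ob_def using wA by (auto simp: w_def)
  have pd: "?p \<in> toric_divisor Fn d" unfolding div in_closure_of using pO OT by blast
  have pC: "?p \<in> Ch C" using mem_chart[OF C] OT[OF pO] dC by auto
  have u\<rho>: "u \<in> S \<rho>" using u0 mem_S[OF \<rho>Fn] G\<rho> by simp
  have "chi u ?p = 1" using chi_chart_map[OF \<rho>Fn wA u\<rho>] u\<rho> u0 by (simp add: w_def)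
  thus False using z pd pC coords_eq[OF C pC u] by auto
  qed
  next
  assume h: "d \<in> G C --> 0 < pairing u d"
  show "\<forall>p \<in> Ch C \<inter> toric_divisor Fn d. toric_coords Fn C p u = 0"
  proof
  fix p assume p: "p \<in> Ch C \<inter> toric_divisor Fn d"
  hence "d \<in> Tp p" "p \<in> Ch C" using divT by auto
  moreover have "d \<in> G C" using calculation mem_chart[OF C] by blast
  ultimately show "toric_coords Fn C p u = 0"
  using h chi_nonzero[OF C _ u, of p] coords_eq[OF C _ u, of p] by force
  qed
  qed
  thus ?thesis by blast
 qed
 have E: "{u \<in> S C. d \<in> G C --> 0 < pairing u d} = (+) m ` S C" using eq unfolding local_equation_def zeroset .
 have mS: "m \<in> {u \<in> S C. d \<in> G C --> 0 < pairing u d}" unfolding E by (rule image_eqI[of _ _ 0]) auto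
 have m0: "0 <= pairing m d'" if "d' \<in> G C" for d' using mS that by (auto simp: mem_S[OF C])
 show ?thesis
 proof (cases "d \<in> G C")
  case True
  have "dv C d \<in> {u \<in> S C. d \<in> G C --> 0 < pairing u d}" using dv_S[OF C True] dv[OF C True True] by simp
  then obtain s where s: "s \<in> S C" "dv C d = m + s" unfolding E by blast
  have "pairing m d' + pairing s d' = (if d = d' then 1 else 0)"
  using dv[OF C True d'] unfolding s(2) pairing_add_left .
  moreover have "0 <= pairing s d'" using s(1) d' by (simp add: mem_S[OF C])
  moreover have "0 <= pairing m d'" by (rule m0[OF d'])
  moreover have "0 < pairing m d" using mS True by simp
  ultimately show ?thesis by (auto split: if_splits)
 next
  case False
  have "0 \<in> {u \<in> S C. d \<in> G C --> 0 < pairing u d}" using False by simp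
  then obtain s where s: "s \<in> S C" "0 = m + s" unfolding E by blast
  have "pairing m d' + pairing s d' = 0" using s(2) by (metis pairing_0(1) pairing_add_left)
  moreover have "0 <= pairing s d'" using s(1) d' by (simp add: mem_S[OF C])
  ultimately show ?thesis using m0[OF d'] False d' by auto
 qed
qed

lemma continuous_map_chart_map:
 assumes C: "C \<in> Fn"
 shows "continuous_map (affine_toric C) X (toric_chart_map Fn C)"
 unfolding continuous_map_def
proof (intro conjI allI impI)
 show "toric_chart_map Fn C \<in> A C \<rightarrow> topspace X" using chart_map_rep(1)[OF C] by blast
 fix U assume "openin X U"
 hence "openin (affine_toric C) {x. (C, x) \<in> {y \<in> topspace (sum_topology affine_toric Fn). (%(C, x). toric_chart_map Fn C x) y \<in> U}}"
  unfolding openin_toric_variety openin_sum_topology using C by blast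
 moreover have "{x. (C, x) \<in> {y \<in> topspace (sum_topology affine_toric Fn). (%(C, x). toric_chart_map Fn C x) y \<in> U}} = {x \<in> A C. toric_chart_map Fn C x \<in> U}"
  using C by auto
 ultimately show "openin (affine_toric C) {x \<in> A C. toric_chart_map Fn C x \<in> U}" by simp
qed

end

section \<open>Divisor classes: linear relations and vanishing products\<close>

lemma wc_linear:
 "wc (us @ (%s. \<Sum>i\<in>I. a i * \<phi> i s) # vs) s = (\<Sum>i\<in>I. a i * wc (us @ \<phi> i # vs) s)"
 by (induction us arbitrary: s) (auto simp: sum_distrib_left sum_distrib_right mult_ac)

lemma eval_chain_linear: "eval_chain (%s. \<Sum>i\<in>I. a i * \<psi> i s) c = (\<Sum>i\<in>I. a i * eval_chain (\<psi> i) c)"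
proof -
 have "eval_chain (%s. \<Sum>i\<in>I. a i * \<psi> i s) c = (\<Sum>s\<in>Poly_Mapping.keys c. \<Sum>i\<in>I. a i * (of_int (Poly_Mapping.lookup c s) * \<psi> i s))"
  unfolding eval_chain_def sum_distrib_left by (intro sum.cong refl) (simp add: mult_ac)
 also have "... = (\<Sum>i\<in>I. a i * eval_chain (\<psi> i) c)"
  unfolding eval_chain_def sum_distrib_left by (rule sum.swap)
 finally show ?thesis .
qed

lemma cocycle_linear:
 assumes "!!i. i \<in> I ==> cocycle p X (\<phi> i)"
 shows "cocycle p X (%s. \<Sum>i\<in>I. a i * \<phi> i s)"
 unfolding cocycle_def coboundary_linear using assms by (auto simp: cocycle_def intro!: sum.neutral)

context nonsingular_toric
begin

lemma path_chi:
 assumes "C \<in> Fn" "m \<in> S C" "smp 1 (Ch C) s"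
 shows "path (%t. chi m (simplex_path s t))"
 using path_simplex_path[OF assms(3) continuous_map_chi[OF assms(1,2)]] by (simp add: o_def)

lemma chi_unit:
 assumes C: "C \<in> Fn" and p: "p \<in> Ch C" and m: "\<forall>d\<in>G C. pairing m d = 0"
 shows "m \<in> S C" "chi m p ~= 0"
proof -
 show mS: "m \<in> S C" using m by (simp add: mem_S[OF C])
 show "chi m p ~= 0" using chi_nonzero[OF C p mS] m mem_chart[OF C] p by blast
qed

lemma chi_0: "C \<in> Fn ==> p \<in> Ch C ==> chi 0 p = 1"
 using chi_mult[of C p 0 0] chi_unit(2)[of C p 0] by simp

lemma chi_powi:
 assumes C: "C \<in> Fn" and p: "p \<in> Ch C" and m: "\<forall>d\<in>G C. pairing m d = 0"
 shows "chi (n *s m) p = chi m p powi n"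
proof -
 have u: "k *s m \<in> S C" "chi (k *s m) p ~= 0" for k using chi_unit[OF C p, of "k *s m"] m by (auto simp: pairing_smult_left)
 have nat: "chi (int k *s m) p = chi m p ^ k" for k
 proof (induction k)
  case 0
  have "(0::int) *s m = 0" by (simp add: vec_eq_iff)
  thus ?case using chi_0[OF C p] by simp
 next
  case (Suc k)
  have e: "int (Suc k) *s m = int k *s m + m" by (simp add: vec_eq_iff algebra_simps)
  show ?case unfolding e chi_mult[OF C p u(1) chi_unit(1)[OF C p m]] using Suc by simp
 qed
 show ?thesis
 proof (cases "n \<ge> 0")
  case True
  thus ?thesis using nat[of "nat n"] by (simp add: power_int_def)
 next
  case False
  have "int (nat (- n)) *s m + n *s m = 0" using False by (simp add: vec_eq_iff)
  hence "chi (int (nat (- n)) *s m) p * chi (n *s m) p = 1" unfolding chi_mult[OF C p u(1) u(1), symmetric] using chi_0[OF C p] by simp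
  thus ?thesis using False nat[of "nat (- n)"] chi_unit(2)[OF C p m] by (simp add: power_int_def field_simps)
 qed
qed

lemma chi_sum_powi:
 assumes C: "C \<in> Fn" and p: "p \<in> Ch C" and R: "finite R" and m: "!!i. i \<in> R ==> \<forall>d\<in>G C. pairing (m i) d = 0"
 shows "chi (\<Sum>i\<in>R. n i *s m i) p = (\<Prod>i\<in>R. chi (m i) p powi n i)"
 using R m
proof (induction R rule: finite_induct)
 case empty
 thus ?case using chi_0[OF C p] by simp
next
 case (insert i R)
 have "n i *s m i \<in> S C" "(\<Sum>i\<in>R. n i *s m i) \<in> S C"
  using insert.prems by (auto simp: mem_S[OF C] pairing_sum_left pairing_smult_left)
 thus ?case using insert chi_mult[OF C p] chi_powi[OF C p] by simp
qed

lemma wn_chi_quotient: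
 assumes C: "C \<in> Fn" and s: "smp 1 (Ch C) s" and M: "M' \<in> S C" "M - M' \<in> S C"
  and nz: "\<forall>t\<in>{0..1}. chi M' (simplex_path s t) ~= 0 \<and> chi (M - M') (simplex_path s t) ~= 0"
 shows "wn (chi M \<circ> simplex_path s) = wn (chi M' \<circ> simplex_path s) + wn (%t. chi (M - M') (simplex_path s t))"
proof -
 have "wn (chi M \<circ> simplex_path s) = wn (%t. chi M' (simplex_path s t) * chi (M - M') (simplex_path s t))"
 proof (rule winding_number_cong)
  fix t :: real assume "0 <= t" "t <= 1"
  hence "simplex_path s t \<in> Ch C" using simplex_path_in(1)[OF s] by simp
  from chi_mult[OF C this M] show "(chi M \<circ> simplex_path s) t = chi M' (simplex_path s t) * chi (M - M') (simplex_path s t)" by simp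
 qed
 also have "... = wn (%t. chi M' (simplex_path s t)) + wn (%t. chi (M - M') (simplex_path s t))"
  by (rule winding_number_mult[OF path_chi[OF C M(1) s] path_chi[OF C M(2) s]]) (use nz in blast)+
 finally show ?thesis by (simp add: o_def)
qed

definition Rays :: "(int ^ 'n) set" where "Rays = ray_generators Fn"

lemma gens_Rays: "G C \<subseteq> Rays"
 by (auto simp: gens_def Rays_def)

text \<open>The data behind \<open>divisor_cocycle\<close> in the form in which they are used: the
  local equations through their pairings only, and the transition functions as globally named
  characters.\<close>

definition eqn :: "int ^ 'n => ((real ^ 'n) set => int ^ 'n) => ((real ^ 'n) set => 'n toric_point cochain) => 'n toric_point cochain => bool" where
 "eqn d m b c \<longleftrightarrow> cocycle 2 X c \<and>
  (\<forall>C\<in>Fn. \<forall>d'\<in>G C. pairing (m C) d' = (if d' = d then 1 else 0)) \<and>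
  (\<forall>C\<in>Fn. \<forall>s. smp 2 (Ch C) s --> c s = coboundary 1 (b C) s) \<and>
  (\<forall>C\<in>Fn. \<forall>C'\<in>Fn. \<forall>s. smp 1 (Ch C \<inter> Ch C') s -->
  b C s - b C' s = wn (%t. chi (m C - m C') (simplex_path s t)))"

lemma eqnD:
 assumes "eqn d m b c"
 shows "cocycle 2 X c" "!!C d'. C \<in> Fn ==> d' \<in> G C ==> pairing (m C) d' = (if d' = d then 1 else 0)"
  "!!C s. C \<in> Fn ==> smp 2 (Ch C) s ==> c s = coboundary 1 (b C) s"
  "!!C C' s. C \<in> Fn ==> C' \<in> Fn ==> smp 1 (Ch C \<inter> Ch C') s ==>
  b C s - b C' s = wn (%t. chi (m C - m C') (simplex_path s t))"
 using assms unfolding eqn_def by blast+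

lemma divisor_cocycle_eqn:
 assumes d: "d \<in> Rays" and c: "divisor_cocycle Fn d c"
 shows "\<exists>m b. eqn d m b c"
proof -
 obtain m where m: "\<forall>C\<in>Fn. local_equation Fn d C (m C)"
  and ch: "chern_cocycle X Fn (Ch) (%C C' p. toric_coords Fn (C \<inter> C') p (m C - m C')) c"
  using c unfolding divisor_cocycle_def by blast
 obtain b where b: "\<forall>C\<in>Fn. \<forall>s. smp 2 (Ch C) s --> c s = coboundary 1 (b C) s"
  "\<forall>C\<in>Fn. \<forall>C'\<in>Fn. \<forall>s. smp 1 (Ch C \<inter> Ch C') s -->
  b C s - b C' s = wn ((%p. toric_coords Fn (C \<inter> C') p (m C - m C')) \<circ> simplex_path s)"
  using ch unfolding chern_cocycle_def by blast
 have pm: "pairing (m C) d' = (if d' = d then 1 else 0)" if "C \<in> Fn" "d' \<in> G C" for C d'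
  using local_equation_pairing[of d C "m C" d'] d m that by (simp add: Rays_def)
 have w: "wn ((%p. toric_coords Fn (C \<inter> C') p (m C - m C')) \<circ> simplex_path s) =
  wn (%t. chi (m C - m C') (simplex_path s t))"
  if C: "C \<in> Fn" "C' \<in> Fn" and s: "smp 1 (Ch C \<inter> Ch C') s" for C C' s
 proof (rule winding_number_cong)
  fix t :: real assume "0 <= t" "t <= 1"
  hence "simplex_path s t \<in> Ch (C \<inter> C')" using simplex_path_in(1)[OF s, of t] unfolding chart_inter[OF C] by simp
  moreover have "m C - m C' \<in> S (C \<inter> C')"
  unfolding mem_S[OF inter_cone(1)[OF C]] inter_cone(2)[OF C] using pm C by (auto simp: pairing_diff_left)
  ultimately show "((%p. toric_coords Fn (C \<inter> C') p (m C - m C')) \<circ> simplex_path s) t = chi (m C - m C') (simplex_path s t)"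
  using coords_eq[OF inter_cone(1)[OF C]] by simp
 qed
 have "cocycle 2 X c" using ch by (simp add: chern_cocycle_def)
 hence "eqn d m b c" unfolding eqn_def using pm b w by simp
 thus ?thesis by blast
qed

text \<open>Off the divisor the local equations \<open>chi (m C)\<close> have no zeros, so they
  trivialise the line bundle there.\<close>

lemma divisor_correction:
 assumes e: "eqn d m b c"
 shows "\<exists>e. (\<forall>C\<in>Fn. \<forall>s. smp 1 (Ch C \<inter> away d) s -->
  b C s - e s = wn (chi (m C) \<circ> simplex_path s)) \<and>
  (\<forall>C\<in>Fn. \<forall>s. smp 2 (Ch C \<inter> away d) s --> c s - coboundary 1 e s = 0)"
proof (rule chern_correction[where I = Fn and U = "Ch" and F = "%C. chi (m C)"])
 have mS: "m C \<in> S C" if "C \<in> Fn" for C using eqnD(2)[OF e] that by (simp add: mem_S)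
 have nz: "chi (m C) p ~= 0" if "C \<in> Fn" "p \<in> Ch C" "p \<in> away d" for C p
 proof -
  have "Tp p \<subseteq> G C" "d \<notin> Tp p" using that mem_chart[OF that(1)] by (auto simp: away_def)
  thus ?thesis using chi_nonzero[OF that(1,2) mS[OF that(1)]] eqnD(2)[OF e that(1)] by (auto simp: subset_iff)
 qed
 show "chi (m C) p ~= 0" if "C \<in> Fn" "p \<in> topspace X" "p \<in> Ch C \<inter> away d" for C p using nz that by blast
 show "continuous_map (subtopology X (Ch C \<inter> away d)) euclidean (chi (m C))" if "C \<in> Fn" for C
  using continuous_map_chi[OF that mS[OF that]] by (rule continuous_map_from_subtopology_mono) blast
 show "c s = coboundary 1 (b C) s" if "C \<in> Fn" "smp 2 (Ch C) s" for C s
  by (rule eqnD(3)[OF e that])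
 show "b C s - b C' s = wn (chi (m C) \<circ> simplex_path s) - wn (chi (m C') \<circ> simplex_path s)"
  if C: "C \<in> Fn" "C' \<in> Fn" and s: "smp 1 (Ch C \<inter> Ch C' \<inter> away d) s" for C C' s
 proof -
  note I = inter_cone[OF C]
  have s': "smp 1 (Ch C \<inter> Ch C') s"
  using s by (auto simp: singular_simplex_subtopology)
  have sI: "smp 1 (Ch (C \<inter> C')) s" using s' unfolding chart_inter[OF C] .
  have in_t: "simplex_path s t \<in> Ch C" "simplex_path s t \<in> Ch C'" "simplex_path s t \<in> Ch (C \<inter> C')" "simplex_path s t \<in> away d"
  if "t \<in> {0..1}" for t using simplex_path_in(1)[OF s that] chart_inter[OF C] by auto
  have D0: "\<forall>d'\<in>G (C \<inter> C'). pairing (m C - m C') d' = 0"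
  unfolding I(2) using eqnD(2)[OF e] C by (auto simp: pairing_diff_left)
  have DS: "m C - m C' \<in> S (C \<inter> C')" using D0 by (simp add: mem_S[OF I(1)])
  have C'S: "m C' \<in> S (C \<inter> C')" using mS[OF C(2)] S_mono[of "C \<inter> C'" C'] by blast
  have nzt: "\<forall>t\<in>{0..1}. chi (m C') (simplex_path s t) ~= 0 \<and> chi (m C - m C') (simplex_path s t) ~= 0"
  using nz[OF C(2)] in_t chi_unit(2)[OF I(1) _ D0] by blast
  show ?thesis using wn_chi_quotient[OF I(1) sI C'S DS nzt] eqnD(4)[OF e C s'] by (simp add: o_def)
 qed
qed

lemma small_charts:
 shows "topspace X \<subseteq> \<Union>(Ch ` Fn)"
 using charts_cover by blast

definition word :: "(int ^ 'n => 'n toric_point cochain) => (int ^ 'n) list => 'n toric_point cochain" where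
 "word D w = wc (map D w)"

text \<open>The combination of divisors with coefficients <n, d> is principal. The corresponding
  product of local equations differs from the character n by units of the charts, and these
  trivialise the combined bundle everywhere; the corrected cocycle is 0 on each chart and so kills
  the cup product after subdivision.\<close>

theorem linear_relation:
 assumes D: "!!d. d \<in> Rays ==> \<exists>m b. eqn d m b (D d)"
  and u: "set u \<subseteq> Rays" "set u' \<subseteq> Rays" "length u + length u' + 1 = CARD('n)"
  and \<mu>: "singular_relcycle (2 * CARD('n)) X {} \<mu>"
 shows "(\<Sum>d\<in>Rays. of_int (pairing n d) * eval_chain (word D (u @ d # u')) \<mu>) = 0"
proof -
 have finR: "finite Rays" unfolding Rays_def by (rule finite_ray_generators[OF fan simpl])
 have "\<forall>d\<in>Rays. \<exists>m. \<exists>b. eqn d m b (D d)" using D by blast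
 then obtain m where "\<forall>d\<in>Rays. \<exists>b. eqn d (m d) b (D d)" by (rule bchoice[THEN exE])
 then obtain b where E: "\<forall>d\<in>Rays. eqn d (m d) (b d) (D d)" by (rule bchoice[THEN exE])
 have E': "eqn d (m d) (b d) (D d)" if "d \<in> Rays" for d using E that by blast
 define \<beta> where "\<beta> s = (\<Sum>d\<in>Rays. of_int (pairing n d) * D d s)" for s
 \<comment> \<open>Subtracting n divides the combined local equation by the character n. The result
   is orthogonal to all generators of C, hence invertible on the chart.\<close>
 define M where "M C = (\<Sum>d\<in>Rays. pairing n d *s m d C) - n" for C
 have M0: "\<forall>d'\<in>G C. pairing (M C) d' = 0" if C: "C \<in> Fn" for C
 proof
  fix d' assume d': "d' \<in> G C"
  have "(\<Sum>d\<in>Rays. pairing n d * pairing (m d C) d') = (\<Sum>d\<in>Rays. if d' = d then pairing n d else 0)"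
  using eqnD(2)[OF E' C d'] by (intro sum.cong) auto
  also have "... = pairing n d'" using finR gens_Rays d' by auto
  finally show "pairing (M C) d' = 0" by (simp add: M_def pairing_diff_left pairing_sum_left pairing_smult_left)
 qed
 have MS: "M C \<in> S C" if "C \<in> Fn" for C using M0[OF that] by (simp add: mem_S[OF that])
 have "\<exists>e. (\<forall>C\<in>Fn. \<forall>s. smp 1 (Ch C \<inter> UNIV) s -->
  (\<Sum>d\<in>Rays. of_int (pairing n d) * b d C s) - e s = wn (chi (M C) \<circ> simplex_path s)) \<and>
  (\<forall>C\<in>Fn. \<forall>s. smp 2 (Ch C \<inter> UNIV) s --> \<beta> s - coboundary 1 e s = 0)"
 proof (rule chern_correction[where I = Fn and U = "Ch" and F = "%C. chi (M C)" and b = "%C s. \<Sum>d\<in>Rays. of_int (pairing n d) * b d C s"])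
  show "continuous_map (subtopology X (Ch C \<inter> UNIV)) euclidean (chi (M C))" if "C \<in> Fn" for C
  using continuous_map_chi[OF that MS[OF that]] by simp
  show "chi (M C) p ~= 0" if "C \<in> Fn" "p \<in> topspace X" "p \<in> Ch C \<inter> UNIV" for C p
  by (rule chi_unit(2)[OF that(1) _ M0[OF that(1)]]) (use that in blast)
  show "\<beta> s = coboundary 1 (%s. \<Sum>d\<in>Rays. of_int (pairing n d) * b d C s) s"
  if "C \<in> Fn" "smp 2 (Ch C) s" for C s
  unfolding \<beta>_def coboundary_linear using eqnD(3)[OF E' that] by (intro sum.cong) auto
  show "(\<Sum>d\<in>Rays. of_int (pairing n d) * b d C s) - (\<Sum>d\<in>Rays. of_int (pairing n d) * b d C' s) =
  wn (chi (M C) \<circ> simplex_path s) - wn (chi (M C') \<circ> simplex_path s)"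
  if C: "C \<in> Fn" "C' \<in> Fn" and s0: "smp 1 (Ch C \<inter> Ch C' \<inter> UNIV) s" for C C' s
  proof -
  have s: "smp 1 (Ch C \<inter> Ch C') s" using s0 by simp
  note I = inter_cone[OF C]
  have sI: "smp 1 (Ch (C \<inter> C')) s" using s unfolding chart_inter[OF C] .
  have in_t: "simplex_path s t \<in> Ch (C \<inter> C')" if "t \<in> {0..1}" for t using simplex_path_in(1)[OF sI that] .
  define k where "k d = m d C - m d C'" for d
  have k0: "\<forall>d'\<in>G (C \<inter> C'). pairing (k d) d' = 0" if "d \<in> Rays" for d
  unfolding I(2) k_def using eqnD(2)[OF E'[OF that]] C by (auto simp: pairing_diff_left)
  have kS: "k d \<in> S (C \<inter> C')" if "d \<in> Rays" for d using k0[OF that] by (simp add: mem_S[OF I(1)])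
  have Mk: "M C - M C' = (\<Sum>d\<in>Rays. pairing n d *s k d)"
  unfolding M_def k_def by (simp add: sum_subtractf[symmetric] vec_eq_iff right_diff_distrib)
  have M0': "\<forall>d'\<in>G (C \<inter> C'). pairing (M C') d' = 0" "\<forall>d'\<in>G (C \<inter> C'). pairing (M C - M C') d' = 0"
  unfolding I(2) using M0 C by (auto simp: pairing_diff_left)
  have MS': "M C' \<in> S (C \<inter> C')" "M C - M C' \<in> S (C \<inter> C')" using M0' by (simp_all add: mem_S[OF I(1)])
  have nzt: "\<forall>t\<in>{0..1}. chi (M C') (simplex_path s t) ~= 0 \<and> chi (M C - M C') (simplex_path s t) ~= 0"
  using in_t chi_unit(2)[OF I(1) _ M0'(1)] chi_unit(2)[OF I(1) _ M0'(2)] by blast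
  have "wn (chi (M C) \<circ> simplex_path s) = wn (chi (M C') \<circ> simplex_path s) + wn (%t. chi (M C - M C') (simplex_path s t))"
  by (rule wn_chi_quotient[OF I(1) sI MS' nzt])
  also have "wn (%t. chi (M C - M C') (simplex_path s t)) = wn (%t. \<Prod>d\<in>Rays. chi (k d) (simplex_path s t) powi pairing n d)"
  proof (rule winding_number_cong)
  fix t :: real assume "0 <= t" "t <= 1"
  hence "simplex_path s t \<in> Ch (C \<inter> C')" using in_t by simp
  from chi_sum_powi[OF I(1) this finR k0] show "chi (M C - M C') (simplex_path s t) = (\<Prod>d\<in>Rays. chi (k d) (simplex_path s t) powi pairing n d)"
  unfolding Mk .
  qed
  also have "... = (\<Sum>d\<in>Rays. of_int (pairing n d) * wn (%t. chi (k d) (simplex_path s t)))"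
  proof (rule winding_number_prod_powi[OF finR])
  show "path (%t. chi (k d) (simplex_path s t))" if "d \<in> Rays" for d by (rule path_chi[OF I(1) kS[OF that] sI])
  show "chi (k d) (simplex_path s t) ~= 0" if "d \<in> Rays" "t \<in> {0..1}" for d t
  by (rule chi_unit(2)[OF I(1) in_t[OF that(2)] k0[OF that(1)]])
  qed
  also have "... = (\<Sum>d\<in>Rays. of_int (pairing n d) * (b d C s - b d C' s))"
  unfolding k_def using eqnD(4)[OF E' C s] by (intro sum.cong) auto
  finally show ?thesis by (simp add: o_def right_diff_distrib sum_subtractf)
  qed
 qed
 then obtain e where e: "\<forall>C\<in>Fn. \<forall>s. smp 2 (Ch C) s --> \<beta> s - coboundary 1 e s = 0"
  by auto
 let ?\<beta>' = "%s. \<beta> s - coboundary 1 e s"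
 have cD: "cocycle 2 X (D d)" if "d \<in> Rays" for d by (rule eqnD(1)[OF E'[OF that]])
 have c\<beta>: "cocycle 2 X \<beta>" unfolding \<beta>_def[abs_def] by (rule cocycle_linear) (rule cD)
 have c\<beta>': "cocycle 2 X ?\<beta>'" by (rule cocycle_minus_coboundary[OF c\<beta>])
 let ?us = "map D u" and ?vs = "map D u'"
 have len: "2 * length (?us @ ?\<beta>' # ?vs) = 2 * CARD('n)" "2 * length (?us @ \<beta> # ?vs) = 2 * CARD('n)" using u(3) by auto
 have cus: "cocycle 2 X c" if "c \<in> set ?us \<union> set ?vs" for c using that cD u(1,2) by auto
 have "(\<Sum>d\<in>Rays. of_int (pairing n d) * eval_chain (word D (u @ d # u')) \<mu>) = eval_chain (wc (?us @ \<beta> # ?vs)) \<mu>"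
 proof -
  have "wc (?us @ \<beta> # ?vs) = (%s. \<Sum>d\<in>Rays. of_int (pairing n d) * wc (?us @ D d # ?vs) s)"
  unfolding \<beta>_def[abs_def] by (rule ext) (rule wc_linear)
  thus ?thesis by (simp only: eval_chain_linear word_def map_append list.map)
 qed
 also have "... = eval_chain (wc (?us @ ?\<beta>' # ?vs)) \<mu>"
 proof (rule eval_wc_cohomologous)
  show "list_all2 (cohomologous X) (?us @ \<beta> # ?vs) (?us @ ?\<beta>' # ?vs)"
  by (intro list_all2_appendI list_all2_Cons[THEN iffD2] conjI list_all2_refl cohomologous_refl cohomologous_coboundary)
  show "singular_relcycle (2 * length (?us @ \<beta> # ?vs)) X {} \<mu>" unfolding len(2) by (rule \<mu>)
 qed (use cus c\<beta> c\<beta>' in auto)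
 also have "... = 0"
 proof (rule cocycle_eval_vanish[where \<U> = "Ch ` Fn" and X = X and n = "2 * CARD('n)"])
  show "cocycle (2 * CARD('n)) X (wc (?us @ ?\<beta>' # ?vs))"
  unfolding len(1)[symmetric] by (rule cocycle_wc) (use cus c\<beta>' in auto)
  show "0 < 2 * CARD('n)" by simp
  show "openin X V" if "V \<in> Ch ` Fn" for V using openin_chart that by blast
  show "wc (?us @ ?\<beta>' # ?vs) s = 0" if "V \<in> Ch ` Fn" "smp (2 * CARD('n)) V s" for V s
  proof (rule wc_vanish[where Y = "subtopology X V" and c = ?\<beta>'])
  show "smp (2 * length (?us @ ?\<beta>' # ?vs)) V s" unfolding len(1) by (rule that(2))
  show "?\<beta>' t = 0" if "smp 2 V t" for t
  using e that \<open>V \<in> Ch ` Fn\<close> by blast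
  qed simp
 qed (use \<mu> small_charts in auto)
 finally show ?thesis .
qed

text \<open>The normalisation that makes supports visible at the cochain level: the cocycle vanishes
  on simplices of a chart that miss the divisor.\<close>

definition tame :: "int ^ 'n => 'n toric_point cochain => bool" where
 "tame d c \<longleftrightarrow> (\<forall>C\<in>Fn. \<forall>s. smp 2 (Ch C \<inter> away d) s --> c s = 0)"

lemma word_tame_vanish:
 assumes "C \<in> Fn" "d \<in> set w" "tame d (D d)" "smp (2 * length w) (Ch C \<inter> away d) s"
 shows "word D w s = 0"
 unfolding word_def
proof (rule wc_vanish[where Y = "subtopology X (Ch C \<inter> away d)" and c = "D d"])
 show "D d t = 0" if "smp 2 (Ch C \<inter> away d) t" for t
  using assms(1,3) that by (simp add: tame_def)
qed (use assms in auto)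

lemma eval_word_cohomologous:
 assumes "!!d. d \<in> set w ==> cocycle 2 X (D d)" "!!d. d \<in> set w ==> cocycle 2 X (D' d)"
  "!!d. d \<in> set w ==> cohomologous X (D d) (D' d)" "singular_relcycle (2 * length w) X {} \<mu>"
 shows "eval_chain (word D w) \<mu> = eval_chain (word D' w) \<mu>"
 unfolding word_def
proof (rule eval_wc_cohomologous)
 show "list_all2 (cohomologous X) (map D w) (map D' w)" using assms(3) by (auto simp: list_all2_conv_all_nth)
qed (use assms in auto)

lemma tame_cohomologous:
 assumes "eqn d m b c"
 shows "\<exists>e. tame d (%s. c s - coboundary 1 e s) \<and>
  (\<forall>C\<in>Fn. \<forall>s. smp 1 (Ch C \<inter> away d) s --> b C s - e s = wn (chi (m C) \<circ> simplex_path s))"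
 using divisor_correction[OF assms] unfolding tame_def by blast

abbreviation cover_of where "cover_of w \<equiv> {Ch C \<inter> away d | C d. C \<in> Fn \<and> d \<in> set w}"

lemma openin_chart_away: "C \<in> Fn ==> openin X (Ch C \<inter> away d)"
 using openin_chart openin_away by blast

text \<open>A point on all divisors of w would have all letters of w among the generators of one
  cone. So the sets off one divisor, cut down to charts, cover the variety, and on each of them one
  factor vanishes.\<close>

theorem vanishing:
 assumes D: "!!d. d \<in> Rays ==> \<exists>m b. eqn d m b (D d)"
  and w: "set w \<subseteq> Rays" "length w = CARD('n)" "set w \<notin> G ` Fn"
  and \<mu>: "singular_relcycle (2 * CARD('n)) X {} \<mu>"
 shows "eval_chain (word D w) \<mu> = 0"
proof -
 have "\<forall>d\<in>Rays. \<exists>e. tame d (%s. D d s - coboundary 1 e s)" using D tame_cohomologous by blast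
 then obtain e where e: "\<forall>d\<in>Rays. tame d (%s. D d s - coboundary 1 (e d) s)" by (rule bchoice[THEN exE])
 define D' where "D' d s = D d s - coboundary 1 (e d) s" for d s
 have cD: "cocycle 2 X (D d)" if "d \<in> Rays" for d using D[OF that] eqnD(1) by blast
 have cD': "cocycle 2 X (D' d)" if "d \<in> Rays" for d
  unfolding D'_def[abs_def] by (rule cocycle_minus_coboundary[OF cD[OF that]])
 have "eval_chain (word D w) \<mu> = eval_chain (word D' w) \<mu>"
 proof (rule eval_word_cohomologous)
  show "cohomologous X (D d) (D' d)" for d unfolding D'_def[abs_def] by (rule cohomologous_coboundary)
 qed (use cD cD' w \<mu> in auto)
 also have "... = 0"
 proof (rule cocycle_eval_vanish[where \<U> = "cover_of w" and X = X and n = "2 * CARD('n)"])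
  have "cocycle (2 * length (map D' w)) X (wc (map D' w))" by (rule cocycle_wc) (use cD' w in auto)
  thus "cocycle (2 * CARD('n)) X (word D' w)" using w(2) by (simp add: word_def)
  show "0 < 2 * CARD('n)" by simp
  show "openin X V" if "V \<in> cover_of w" for V using openin_chart_away that by blast
  show "topspace X \<subseteq> \<Union>(cover_of w)"
  proof
  fix p assume p: "p \<in> topspace X"
  then obtain C where C: "C \<in> Fn" "p \<in> Ch C" "G C = Tp p" using charts_cover by blast
  have "\<not> set w \<subseteq> Tp p" using w(3) nc.down[of "G C" "set w"] C by auto
  then obtain d where "d \<in> set w" "d \<notin> Tp p" by blast
  thus "p \<in> \<Union>(cover_of w)" using C p unfolding away_def by blast
  qed
  show "word D' w s = 0" if V: "V \<in> cover_of w" and s: "smp (2 * CARD('n)) V s" for V s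
  proof -
  obtain C d where Cd: "C \<in> Fn" "d \<in> set w" "V = Ch C \<inter> away d" using V by blast
  have "tame d (D' d)" using e Cd(2) w(1) unfolding D'_def[abs_def] by blast
  from word_tame_vanish[of C d w D', OF Cd(1,2) this] show ?thesis using s Cd(3) w(2) by simp
  qed
 qed (rule \<mu>)
 finally show ?thesis .
qed

end

section \<open>Winding numbers around the corners of a square\<close>

lemma wc_prod: "wc cs s = (\<Prod>j<length cs. (cs ! j) (back_face (2 * j) 2 s))"
proof (induction cs arbitrary: s)
 case (Cons c cs)
 let ?m = "2 * length cs"
 have b: "back_face (2 * j) 2 (back_face 2 ?m s) = back_face (2 * Suc j) 2 s" if "j < length cs" for j
 proof
  fix x
  have "shift 2 (shift (2 * j) x) = shift (2 * Suc j) x" by (auto simp: shift_def fun_eq_iff)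
  moreover have "shift (2 * j) x \<in> standard_simplex ?m" if "x \<in> standard_simplex 2"
  using shift_simplex[OF that, of "2 * j"] standard_simplex_mono[of "2 * j + 2" ?m] \<open>j < length cs\<close> by auto
  ultimately show "back_face (2 * j) 2 (back_face 2 ?m s) x = back_face (2 * Suc j) 2 s x"
  by (simp add: back_face_shift restrict_def)
 qed
 have b0: "back_face (2 * 0) 2 s = front_face 2 s"
  by (simp add: back_face_shift shift_def[abs_def] front_face_def)
 show ?case unfolding length_Cons prod.lessThan_Suc_shift wc.simps Cons.IH b0 using b by simp
qed simp

definition seg_wn :: "complex => complex => complex" where
 "seg_wn a b = wn (linepath a b)"

text \<open>The coboundary of the winding number cochain on the triangle with vertices a, b,
  c.\<close>

definition tri_wn :: "complex => complex => complex => complex" where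
 "tri_wn a b c = seg_wn b c - seg_wn a c + seg_wn a b"

lemma seg_wn_reverse: "0 \<notin> closed_segment a b ==> seg_wn b a = - seg_wn a b"
 using winding_number_reversepath[of "linepath a b" 0] by (simp add: seg_wn_def)

lemma tri_wn_closed:
 assumes "0 \<notin> closed_segment a b" "0 \<notin> closed_segment b c" "0 \<notin> closed_segment a c"
 shows "tri_wn a b c = wn (linepath a b +++ linepath b c +++ linepath c a)"
proof -
 have ca: "0 \<notin> closed_segment c a" using assms(3) by (simp add: closed_segment_commute)
 have "wn (linepath a b +++ linepath b c +++ linepath c a) = seg_wn a b + (seg_wn b c + seg_wn c a)"
  unfolding seg_wn_def using assms ca by (simp add: winding_number_join path_image_join)
 thus ?thesis using seg_wn_reverse[OF assms(3)] by (simp add: tri_wn_def)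
qed

lemma seg_wn_refl: "a ~= 0 ==> seg_wn a a = 0"
 by (simp add: seg_wn_def)

lemma tri_wn_degenerate: "a ~= 0 ==> tri_wn a a c = 0" "c ~= 0 ==> tri_wn a c c = 0"
 by (simp_all add: tri_wn_def seg_wn_refl)

text \<open>The points are corners of a square of side K with lowest corner (-A, -B), visited
  monotonically, so the segment is a side, the rising diagonal or a point. B < A keeps the origin
  off the diagonal, 0 < B and A < K keep it off the sides.\<close>

lemma square_segment:
 fixes A B K :: real
 assumes "0 < B" "B < A" "A < K" and le: "\<alpha> <= \<alpha>'" "\<beta> <= \<beta>'" and bits: "{\<alpha>, \<alpha>', \<beta>, \<beta>'} \<subseteq> {0, 1 :: real}"
 shows "0 \<notin> closed_segment (Complex (- A + K * \<alpha>) (- B + K * \<beta>)) (Complex (- A + K * \<alpha>') (- B + K * \<beta>'))"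
proof
 assume "0 \<in> closed_segment (Complex (- A + K * \<alpha>) (- B + K * \<beta>)) (Complex (- A + K * \<alpha>') (- B + K * \<beta>'))"
 then obtain u where u: "0 <= u" "u <= 1" and e: "0 = (1 - u) *\<^sub>R Complex (- A + K * \<alpha>) (- B + K * \<beta>) + u *\<^sub>R Complex (- A + K * \<alpha>') (- B + K * \<beta>')"
  unfolding in_segment by blast
 have x: "0 = (1 - u) * (- A + K * \<alpha>) + u * (- A + K * \<alpha>')" using arg_cong[OF e, of Re] by simp
 have y: "0 = (1 - u) * (- B + K * \<beta>) + u * (- B + K * \<beta>')" using arg_cong[OF e, of Im] by simp
 have "A = K * ((1 - u) * \<alpha> + u * \<alpha>')" "B = K * ((1 - u) * \<beta> + u * \<beta>')" using x y by (simp_all add: algebra_simps)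
 moreover have "(\<alpha> = 0 \<and> \<alpha>' = 0) \<or> (\<alpha> = 0 \<and> \<alpha>' = 1) \<or> (\<alpha> = 1 \<and> \<alpha>' = 1)" using bits le by auto
 moreover have "(\<beta> = 0 \<and> \<beta>' = 0) \<or> (\<beta> = 0 \<and> \<beta>' = 1) \<or> (\<beta> = 1 \<and> \<beta>' = 1)" using bits le by auto
 ultimately show False using assms(1-3) by auto
qed

text \<open>As B < A, the origin lies below the diagonal, inside the triangle that goes right first
  and then up, which is traversed counterclockwise.\<close>

lemma tri_wn_positive:
 fixes A B K :: real
 assumes "0 < B" "B < A" "A < K"
 shows "tri_wn (Complex (- A) (- B)) (Complex (K - A) (- B)) (Complex (K - A) (K - B)) = 1"
proof -
 let ?a = "Complex (- A) (- B)" and ?b = "Complex (K - A) (- B)" and ?c = "Complex (K - A) (K - B)"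
 have seg: "0 \<notin> closed_segment ?a ?b" "0 \<notin> closed_segment ?b ?c" "0 \<notin> closed_segment ?a ?c"
  using square_segment[OF assms, of 0 1 0 0] square_segment[OF assms, of 1 1 0 1] square_segment[OF assms, of 0 1 0 1]
  by (simp_all add: algebra_simps)
 \<comment> \<open>The open triangle as an intersection of three half planes; it puts the origin
   into the interior of the convex hull.\<close>
 define T where "T = {z. - B < Im z} \<inter> {z. Re z < K - A} \<inter> {z. B - A < Re z - Im z}"
 have "open T" unfolding T_def
  by (intro open_Int open_halfspace_Im_gt open_halfspace_Re_lt open_Collect_less continuous_intros)
 moreover have "0 \<in> T" using assms by (simp add: T_def)
 moreover have "T \<subseteq> convex hull {?a, ?b, ?c}"
 proof
  fix z assume z: "z \<in> T"
  define s t where "s = (Re z + A) / K" and "t = (Im z + B) / K"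
  have K: "K > 0" using assms by simp
  have "0 <= Im z + B" "Im z + B <= Re z + A" "Re z + A <= K" using z by (auto simp: T_def)
  hence st: "0 <= t" "t <= s" "s <= 1" using K unfolding s_def t_def by (auto intro!: divide_right_mono simp: divide_le_eq)
  have "s * K = Re z + A" "t * K = Im z + B" using K by (simp_all add: s_def t_def)
  hence "z = (1 - s) *\<^sub>R ?a + (s - t) *\<^sub>R ?b + t *\<^sub>R ?c"
  by (simp add: complex_eq_iff algebra_simps)
  moreover have "0 <= 1 - s" "0 <= s - t" "0 <= t" "(1 - s) + (s - t) + t = 1" using st by auto
  ultimately show "z \<in> convex hull {?a, ?b, ?c}" unfolding convex_hull_3 by blast
 qed
 ultimately have int: "0 \<in> interior (convex hull {?a, ?b, ?c})" by (rule interiorI)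
 have "0 < Im ((?b - ?a) * cnj (?b - 0))" using assms by simp
 thus ?thesis unfolding tri_wn_closed[OF seg] winding_number_triangle[OF int] by simp
qed

text \<open>The triangle that goes up first lies on or above the diagonal, in a half plane that
  misses the origin.\<close>

lemma tri_wn_negative:
 fixes A B K :: real
 assumes "0 < B" "B < A" "A < K"
 shows "tri_wn (Complex (- A) (- B)) (Complex (- A) (K - B)) (Complex (K - A) (K - B)) = 0"
proof -
 let ?a = "Complex (- A) (- B)" and ?b = "Complex (- A) (K - B)" and ?c = "Complex (K - A) (K - B)"
 have seg: "0 \<notin> closed_segment ?a ?b" "0 \<notin> closed_segment ?b ?c" "0 \<notin> closed_segment ?a ?c"
  using square_segment[OF assms, of 0 0 0 1] square_segment[OF assms, of 0 1 1 1] square_segment[OF assms, of 0 1 0 1]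
  by (simp_all add: algebra_simps)
 define H where "H = {z. inner (Complex 1 (- 1)) z <= B - A}"
 have "convex H" unfolding H_def by (rule convex_halfspace_le)
 have in_H: "?a \<in> H" "?b \<in> H" "?c \<in> H" using assms by (simp_all add: H_def inner_complex_def)
 have sub: "closed_segment ?a ?b \<subseteq> H" "closed_segment ?b ?c \<subseteq> H" "closed_segment ?c ?a \<subseteq> H"
  using in_H \<open>convex H\<close> by (auto intro: closed_segment_subset[THEN subsetD])
 show ?thesis unfolding tri_wn_closed[OF seg]
 proof (rule winding_number_zero_outside[OF _ \<open>convex H\<close>])
  show "0 \<notin> H" using assms by (simp add: H_def)
  show "path_image (linepath ?a ?b +++ linepath ?b ?c +++ linepath ?c ?a) \<subseteq> H"
  using sub by (simp add: path_image_join)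
 qed auto
qed

lemma oriented_simplex_singular: "singular_simplex p (powertop_real UNIV) (oriented_simplex p l)"
proof -
 have "simplicial_simplex p UNIV (oriented_simplex p l)" unfolding simplicial_simplex by blast
 thus ?thesis by (simp add: simplicial_simplex_def)
qed

lemma continuous_map_Complex:
 assumes "continuous_map Y euclideanreal a" "continuous_map Y euclideanreal b"
 shows "continuous_map Y euclidean (%y. Complex (a y) (b y))"
 using assms unfolding continuous_map_euclidean_iff by (auto intro: tendsto_Complex)

section \<open>Coordinates around a torus-fixed point\<close>

locale toric_facet = nonsingular_toric Fn for Fn :: "(real ^ 'n) set set" +
 fixes w :: "(int ^ 'n) list"
 assumes dw: "distinct w" and wG: "set w \<in> gens Fn ` Fn" and lw: "length w = CARD('n)"
begin

definition C0 :: "(real ^ 'n) set" where "C0 = pos_cone (set w)"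

lemma C0: "C0 \<in> Fn" "G C0 = set w"
proof -
 obtain C where C: "C \<in> Fn" "set w = G C" using wG by blast
 have "C = C0" using cone_eq[OF C(1)] C(2) by (simp add: C0_def)
 thus "C0 \<in> Fn" "G C0 = set w" using C by auto
qed

lemma facet: "set w \<in> nc.facets"
 using wG dw lw by (simp add: nc.facets_def distinct_card)

lemma basis: "lattice_basis (set w)"
proof -
 obtain B where B: "lattice_basis B" "set w \<subseteq> B" using nonsingular_fan_gens(1)[OF isf ns C0(1)] C0(2) by auto
 have finB: "finite B" using B(1) by (simp add: lattice_basis_def)
 obtain e where "\<forall>b\<in>B. \<forall>b'\<in>B. pairing (e b) b' = (if b = b' then 1 else 0)" using lattice_basis_dual[OF B(1)] by blast
 hence "lin_indep B" using lin_indep_dual[OF finB, of e] by blast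
 hence "card B <= card (set w)" using card_le_rank dw lw by (simp add: distinct_card)
 hence "set w = B" using card_seteq[OF finB B(2)] by blast
 thus ?thesis using B(1) by simp
qed

definition xz :: "(nat => complex) => int ^ 'n => complex" where
 "xz z = restrict (%m. \<Prod>j<length w. z j ^ nat (pairing m (w ! j))) (S C0)"

abbreviation cp :: "(nat => complex) => 'n toric_point" where "cp \<equiv> coordinate_point Fn w"

lemma cp_eq: "cp z = toric_chart_map Fn C0 (xz z)"
 by (simp add: coordinate_point_def Let_def xz_def C0_def pos_cone_def)

lemma mem_S0: "m \<in> S C0 \<longleftrightarrow> (\<forall>j<length w. 0 <= pairing m (w ! j))"
 unfolding mem_S[OF C0(1)] C0(2) by (rule all_set_conv_all_nth)

lemma xz_A: "xz z \<in> A C0"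
proof -
 have "(\<Prod>j<length w. z j ^ nat (pairing (m + m') (w ! j))) =
  (\<Prod>j<length w. z j ^ nat (pairing m (w ! j))) * (\<Prod>j<length w. z j ^ nat (pairing m' (w ! j)))"
  if "m \<in> S C0" "m' \<in> S C0" for m m'
  unfolding prod.distrib[symmetric]
  using that by (intro prod.cong refl) (simp add: mem_S0 pairing_add_left nat_add_distrib power_add)
 thus ?thesis unfolding A_iff xz_def by (simp add: S_add)
qed

lemma cp_chart: "cp z \<in> Ch C0"
 unfolding cp_eq toric_chart_def using xz_A by blast

lemma cp_topspace: "cp z \<in> topspace X"
 using cp_chart mem_chart[OF C0(1)] by blast

lemma chi_cp_dual:
 assumes j: "j < length w" and m: "!!d. d \<in> set w ==> pairing m d = (if d = w ! j then 1 else 0)"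
 shows "m \<in> S C0" "xz z m = z j" "chi m (cp z) = z j"
proof -
 have p: "pairing m (w ! i) = (if i = j then 1 else 0)" if "i < length w" for i
  using m[of "w ! i"] that j dw by (simp add: nth_eq_iff_index_eq)
 show mS: "m \<in> S C0" using p by (simp add: mem_S0)
 have "(\<Prod>i<length w. z i ^ nat (pairing m (w ! i))) = (\<Prod>i<length w. if i = j then z j else 1)"
  using p by (intro prod.cong) auto
 thus x: "xz z m = z j" using mS j by (simp add: xz_def)
 thus "chi m (cp z) = z j" unfolding cp_eq using chi_chart_map[OF C0(1) xz_A mS] by simp
qed

lemma Tp_cp:
 assumes "j < length w"
 shows "w ! j \<in> Tp (cp z) \<longleftrightarrow> z j = 0"
proof -
 have "xz z (dv C0 (w ! j)) = z j"
  by (rule chi_cp_dual(2)[OF assms]) (use dv[OF C0(1)] C0(2) assms in auto)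
 thus ?thesis unfolding cp_eq chart_map_rep(2)[OF C0(1) xz_A] using assms C0(2) by (auto simp: Tz_def)
qed

lemma cp_away: "j < length w ==> z j ~= 0 ==> cp z \<in> away (w ! j)"
 using Tp_cp cp_topspace by (simp add: away_def)

definition p0 :: "'n toric_point" where "p0 = cp (%_. 0)"

lemma cp_eq_p0: "cp z = p0 ==> j < length w ==> z j = 0"
 using Tp_cp[of j z] Tp_cp[of j "%_. 0"] by (simp add: p0_def)

text \<open>A point on all divisors of w has no further rays, by rank, and its homomorphism is 1 at
  0 and 0 at all other characters of the chart. So \<open>p0\<close> is the only such point.\<close>

lemma complement_p0: "\<Union>(cover_of w) = topspace X - {p0}"
proof
 have Tp0: "set w \<subseteq> Tp p0" using Tp_cp[of _ "%_. 0"] by (auto simp: p0_def in_set_conv_nth)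
 thus "\<Union>(cover_of w) \<subseteq> topspace X - {p0}"
  by (auto simp: away_def)
 show "topspace X - {p0} \<subseteq> \<Union>(cover_of w)"
 proof
  fix p assume p: "p \<in> topspace X - {p0}"
  hence pX: "p \<in> topspace X" by blast
  have full: "Tp q = set w \<and> (\<forall>m. chi m q = (if m \<in> S C0 then if m = 0 then 1 else 0 else undefined))"
  if q: "q \<in> topspace X" "set w \<subseteq> Tp q" for q
  proof -
  have o: "orb (Tp q) (%m. chi m q)" by (rule rep(1)[OF q(1)])
  have TK: "Tp q \<in> G ` Fn" using o by (simp add: orb_def)
  hence "card (Tp q) <= CARD('n)" by (intro card_le_rank nc.indep)
  hence T: "Tp q = set w"
  using card_seteq[OF nc.finite_K_mem[OF TK] q(2)] dw lw by (simp add: distinct_card)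
  have A: "(%m. chi m q) \<in> A C0" "\<forall>m\<in>S C0. chi m q ~= 0 \<longleftrightarrow> (\<forall>d\<in>set w. pairing m d = 0)"
  using o unfolding orb_def T C0_def by blast+
  have "m = 0" if "\<forall>d\<in>set w. pairing m d = 0" for m
  by (rule nc.pairing_inj[OF facet]) (use that in simp)
  hence "chi m q = (if m \<in> S C0 then if m = 0 then 1 else 0 else undefined)" for m
  using A(2) A_0[OF A(1)] A_arb[OF A(1)] by auto
  thus ?thesis using T by blast
  qed
  have "\<not> set w \<subseteq> Tp p"
  proof
  assume s: "set w \<subseteq> Tp p"
  have "p0 \<in> topspace X" unfolding p0_def by (rule cp_topspace)
  note f0 = full[OF this Tp0] and f = full[OF pX s]
  have "(%m. chi m p) = (%m. chi m p0)" by (rule ext) (use f f0 in simp)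
  hence "p = p0" using rep(2)[OF pX] rep(2)[OF \<open>p0 \<in> topspace X\<close>] f f0 by metis
  thus False using p by blast
  qed
  then obtain d where d: "d \<in> set w" "d \<notin> Tp p" by blast
  obtain C where "C \<in> Fn" "p \<in> Ch C" using charts_cover[OF pX] by blast
  thus "p \<in> \<Union>(cover_of w)"
  using d pX unfolding away_def by blast
 qed
qed

lemma continuous_map_cp:
 assumes z: "!!j. j < length w ==> continuous_map Y euclidean (%y. z y j)"
 shows "continuous_map Y X (%y. cp (z y))"
proof -
 have comp: "continuous_map Y euclidean (%y. xz (z y) m)" if m: "m \<in> S C0" for m
 proof -
  have "continuous_map Y euclidean (%y. \<Prod>j<length w. z y j ^ nat (pairing m (w ! j)))"
  using z unfolding continuous_map_euclidean_iff by (auto intro!: tendsto_prod tendsto_power)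
  thus ?thesis using m by (simp add: xz_def)
 qed
 have ext: "xz (z y) \<in> extensional (S C0)" for y by (simp add: xz_def)
 have "continuous_map Y (product_topology (%_. euclidean) (S C0)) (%y. xz (z y))"
  unfolding continuous_map_componentwise using comp ext by (simp add: image_subset_iff Pi_iff)
 moreover have "xz (z y) 0 = 1 \<and> (\<forall>m\<in>S C0. \<forall>m'\<in>S C0. xz (z y) (m + m') = xz (z y) m * xz (z y) m')" for y
  using xz_A by (simp add: A_iff)
 ultimately have "continuous_map Y (affine_toric C0) (%y. xz (z y))"
  unfolding affine_toric_def by (intro continuous_map_into_subtopology) auto
 from continuous_map_compose[OF this continuous_map_chart_map[OF C0(1)]] show ?thesis
  by (simp add: o_def cp_eq)
qed

text \<open>Real coordinates for the chart, numbered from 1 as in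
  \<open>orientation_simplex\<close>, where index 0 is the barycentric coordinate of the base
  vertex.\<close>

definition zc :: "(nat => real) => nat => complex" where
 "zc x j = Complex (x (2 * j + 1)) (x (2 * j + 2))"

definition PP :: "(nat => real) => 'n toric_point" where "PP x = cp (zc x)"

text \<open>The affine simplex with vertices l in these real coordinates, so that faces and
  subsimplices are again given by lists of vertices.\<close>

definition sx :: "nat => (nat => nat => real) => (nat => real) => 'n toric_point" where
 "sx p l = simplex_map p PP (oriented_simplex p l)"

lemma continuous_map_PP: "continuous_map (powertop_real UNIV) X PP"
 unfolding PP_def zc_def
 by (intro continuous_map_cp continuous_map_Complex continuous_map_product_projection) auto

lemma sx_apply: "x \<in> standard_simplex p ==> sx p l x = PP (%k. \<Sum>i\<le>p. l i k * x i)"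
 by (simp add: sx_def simplex_map_def oriented_simplex_def)

lemma sx_singular: "singular_simplex p X (sx p l)"
 unfolding sx_def by (rule singular_simplex_simplex_map[OF oriented_simplex_singular continuous_map_PP])

lemma sx_singular_sub:
 assumes "!!x. x \<in> standard_simplex p ==> PP (%k. \<Sum>i\<le>p. l i k * x i) \<in> V"
 shows "smp p V (sx p l)"
 using assms sx_singular by (auto simp: singular_simplex_subtopology sx_apply)

lemma PP_chart: "PP x \<in> Ch C0"
 unfolding PP_def by (rule cp_chart)

lemma sx_chart: "smp p (Ch C0) (sx p l)"
 by (rule sx_singular_sub) (rule PP_chart)

lemma PP_away: "j < length w ==> zc x j ~= 0 ==> PP x \<in> Ch C0 \<inter> away (w ! j)"
 using cp_away cp_chart by (simp add: PP_def)

lemma singular_face_sx: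
 assumes "1 <= p" "k <= p"
 shows "singular_face p k (sx p l) = sx (p - 1) (%j. if j < k then l j else l (Suc j))"
proof -
 have "singular_face p k (sx p l) = simplex_map (p - 1) PP (singular_face p k (oriented_simplex p l))"
  unfolding sx_def singular_face_simplex_map[OF assms] by (auto simp: simplex_map_def singular_face_def fun_eq_iff)
 thus ?thesis unfolding singular_face_oriented_simplex[OF assms] sx_def .
qed

lemma back_face_sx:
 assumes "2 * j + 2 <= p"
 shows "back_face (2 * j) 2 (sx p l) = sx 2 (%i. l (2 * j + i))"
proof
 fix x
 show "back_face (2 * j) 2 (sx p l) x = sx 2 (%i. l (2 * j + i)) x"
 proof (cases "x \<in> standard_simplex 2")
  case True
  have sh: "shift (2 * j) x \<in> standard_simplex p"
  using shift_simplex[OF True, of "2 * j"] standard_simplex_mono[OF assms] by auto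
  have "(\<Sum>i\<le>p. l i k * shift (2 * j) x i) = (\<Sum>i\<le>2. l (2 * j + i) k * x i)" for k
  proof -
  have "(\<Sum>i\<le>p. l i k * shift (2 * j) x i) = (\<Sum>i\<in>(%i. 2 * j + i) ` {..2}. l i k * shift (2 * j) x i)"
  proof (rule sum.mono_neutral_right)
  show "\<forall>i\<in>{..p} - (%i. 2 * j + i) ` {..2}. l i k * shift (2 * j) x i = 0"
  proof
  fix i assume i: "i \<in> {..p} - (%i. 2 * j + i) ` {..2}"
  have "i < 2 * j \<or> 2 < i - 2 * j"
  proof (rule ccontr)
  assume "\<not> (i < 2 * j \<or> 2 < i - 2 * j)"
  hence "i = 2 * j + (i - 2 * j)" "i - 2 * j \<in> {..2}" by auto
  thus False using i by blast
  qed
  thus "l i k * shift (2 * j) x i = 0" using True by (auto simp: shift_def standard_simplex_def)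
  qed
  qed (use assms in auto)
  also have "... = (\<Sum>i\<le>2. l (2 * j + i) k * x i)" by (subst sum.reindex) (auto simp: shift_def inj_on_def)
  finally show ?thesis .
  qed
  thus ?thesis using True sh by (simp add: back_face_shift sx_apply)
 next
  case False
  thus ?thesis by (simp add: back_face_shift sx_def simplex_map_def)
 qed
qed

lemma sx_away_const:
 assumes j: "j < length w" and k: "k = 2 * j + 1 \<or> k = 2 * j + 2" and c: "!!i. i <= p ==> l i k = c" "c ~= 0"
 shows "smp p (Ch C0 \<inter> away (w ! j)) (sx p l)"
proof (rule sx_singular_sub, rule PP_away[OF j])
 fix x :: "nat => real" assume x: "x \<in> standard_simplex p"
 have "(\<Sum>i\<le>p. l i k * x i) = c * (\<Sum>i\<le>p. x i)" unfolding sum_distrib_left using c(1) by (intro sum.cong) auto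
 hence "(\<Sum>i\<le>p. l i k * x i) = c" using x by (simp add: standard_simplex_def)
 thus "zc (%k. \<Sum>i\<le>p. l i k * x i) j ~= 0" using k c(2) by (auto simp: zc_def complex_eq_iff)
qed

lemma simplex_path_sx:
 assumes "t \<in> {0..1}"
 shows "simplex_path (sx 1 l) t = PP (%k. (1 - t) * l 0 k + t * l 1 k)"
proof -
 have "(\<Sum>i\<le>1. l i k * edge_point t i) = (1 - t) * l 0 k + t * l 1 k" for k
  by (simp add: edge_point_def mult.commute)
 thus ?thesis unfolding simplex_path_edge_point sx_apply[OF edge_point_simplex[OF assms]] by simp
qed

lemma zc_convex: "zc (%k. (1 - t) * x k + t * y k) j = linepath (zc x j) (zc y j) t"
 by (simp add: zc_def linepath_def complex_eq_iff)

lemma edge_away: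
 assumes j: "j < length w" and seg: "0 \<notin> closed_segment (zc (l 0) j) (zc (l 1) j)"
 shows "smp 1 (Ch C0 \<inter> away (w ! j)) (sx 1 l)"
proof (rule sx_singular_sub, rule PP_away[OF j])
 fix x :: "nat => real" assume x: "x \<in> standard_simplex 1"
 have x0: "x 0 = 1 - x 1" "0 <= x 1" "x 1 <= 1" using x by (auto simp: standard_simplex_def)
 have "(%k. \<Sum>i\<le>1. l i k * x i) = (%k. (1 - x 1) * l 0 k + x 1 * l 1 k)"
  using x0(1) by (simp add: mult.commute)
 hence "zc (%k. \<Sum>i\<le>1. l i k * x i) j = linepath (zc (l 0) j) (zc (l 1) j) (x 1)" by (simp only: zc_convex)
 moreover have "linepath (zc (l 0) j) (zc (l 1) j) (x 1) \<in> closed_segment (zc (l 0) j) (zc (l 1) j)"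
  using x0 by (auto simp: linepath_in_path)
 ultimately show "zc (%k. \<Sum>i\<le>1. l i k * x i) j ~= 0" using seg by auto
qed

text \<open>The triangle may meet the divisor, but its edges do not. On an edge the corrected
  primitive is the winding number of the local equation, which in this chart is the coordinate j,
  and along an affine edge this coordinate runs through a segment.\<close>

lemma triangle_value:
 assumes j: "j < length w" and E: "eqn (w ! j) m b c"
  and e: "!!s. smp 1 (Ch C0 \<inter> away (w ! j)) s ==> b C0 s - e s = wn (chi (m C0) \<circ> simplex_path s)"
  and seg: "0 \<notin> closed_segment (zc (l 1) j) (zc (l 2) j)" "0 \<notin> closed_segment (zc (l 0) j) (zc (l 2) j)" "0 \<notin> closed_segment (zc (l 0) j) (zc (l 1) j)"
 shows "c (sx 2 l) - coboundary 1 e (sx 2 l) = tri_wn (zc (l 0) j) (zc (l 1) j) (zc (l 2) j)"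
proof -
 have edge: "b C0 (sx 1 l') - e (sx 1 l') = seg_wn (zc (l' 0) j) (zc (l' 1) j)"
  if s: "0 \<notin> closed_segment (zc (l' 0) j) (zc (l' 1) j)" for l'
 proof -
  have "wn (chi (m C0) \<circ> simplex_path (sx 1 l')) = wn (linepath (zc (l' 0) j) (zc (l' 1) j))"
  proof (rule winding_number_cong)
  fix t :: real assume "0 <= t" "t <= 1"
  hence "simplex_path (sx 1 l') t = cp (zc (%k. (1 - t) * l' 0 k + t * l' 1 k))"
  using simplex_path_sx[of t l'] by (simp add: PP_def)
  hence "chi (m C0) (simplex_path (sx 1 l') t) = zc (%k. (1 - t) * l' 0 k + t * l' 1 k) j"
  by (simp only:) (intro chi_cp_dual(3)[OF j] eqnD(2)[OF E C0(1)], simp add: C0(2))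
  thus "(chi (m C0) \<circ> simplex_path (sx 1 l')) t = linepath (zc (l' 0) j) (zc (l' 1) j) t" by (simp add: zc_convex)
  qed
  thus ?thesis using e[OF edge_away[OF j s]] by (simp add: seg_wn_def)
 qed
 have face: "singular_face 2 k (sx 2 l) = sx 1 (%j. if j < k then l j else l (Suc j))" if "k <= 2" for k
  using singular_face_sx[of 2 k l] that by simp
 have E0: "b C0 (singular_face 2 0 (sx 2 l)) - e (singular_face 2 0 (sx 2 l)) = seg_wn (zc (l 1) j) (zc (l 2) j)"
  unfolding face[OF le0] by (subst edge) (use seg in \<open>simp_all add: numeral_2_eq_2\<close>)
 have E1: "b C0 (singular_face 2 1 (sx 2 l)) - e (singular_face 2 1 (sx 2 l)) = seg_wn (zc (l 0) j) (zc (l 2) j)"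
  unfolding face[OF one_le_numeral] by (subst edge) (use seg in \<open>simp_all add: numeral_2_eq_2\<close>)
 have E2: "b C0 (singular_face 2 2 (sx 2 l)) - e (singular_face 2 2 (sx 2 l)) = seg_wn (zc (l 0) j) (zc (l 1) j)"
  unfolding face[OF order_refl] by (subst edge) (use seg in \<open>simp_all add: numeral_2_eq_2\<close>)
 have k2: "{..Suc 1} = {0, 1, 2::nat}" by auto
 have "c (sx 2 l) - coboundary 1 e (sx 2 l) = coboundary 1 (%s. b C0 s - e s) (sx 2 l)"
  unfolding coboundary_diff using eqnD(3)[OF E C0(1) sx_chart] by simp
 also have "... = (b C0 (singular_face 2 0 (sx 2 l)) - e (singular_face 2 0 (sx 2 l))) -
  (b C0 (singular_face 2 1 (sx 2 l)) - e (singular_face 2 1 (sx 2 l))) + (b C0 (singular_face 2 2 (sx 2 l)) - e (singular_face 2 2 (sx 2 l)))"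
  unfolding coboundary_sum k2 by (simp add: numeral_2_eq_2)
 also have "... = tri_wn (zc (l 0) j) (zc (l 1) j) (zc (l 2) j)"
  unfolding E0 E1 E2 tri_wn_def ..
 finally show ?thesis .
qed

end

section \<open>The cube around the fixed point and the normalization\<close>

abbreviation pinv :: "(nat => nat) => nat => nat" where "pinv \<equiv> inv_into UNIV"

context toric_facet
begin

abbreviation N :: nat where "N \<equiv> 2 * length w"

abbreviation Perm :: "(nat => nat) set" where "Perm \<equiv> {\<pi>. \<pi> permutes {1..N}}"

text \<open>
 The vertices of the path from the lowest to the highest vertex of the cube
 \<open>\<Prod>\<^sub>k [k - N - 1, k]\<close> whose \<open>i\<close>-th step runs in the direction \<open>\<pi> i\<close>. The position of the
 origin in the cube is such that it lies in the interior of the simplex of the identity.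
\<close>

definition vx :: "(nat => nat) => nat => nat => real" where
 "vx \<pi> i k = - (real N + 1 - real k) + (real N + 1) * (if pinv \<pi> k <= i then 1 else 0)"

text \<open>Freudenthal's triangulation of the cube, with one simplex for each order of the N
  coordinate steps; the signs of the permutations orient the simplices coherently.\<close>

definition cube_chain :: "'n toric_point chain" where
 "cube_chain = (\<Sum>\<pi>\<in>Perm. frag_cmul (sign \<pi>) (frag_of (sx N (vx \<pi>))))"

lemma pinv_id:
 assumes "\<pi> \<in> Perm" "pinv \<pi> = id"
 shows "\<pi> = id"
proof
 fix x
 have "bij \<pi>" using assms(1) permutes_bij by blast
 hence "pinv \<pi> (\<pi> x) = x" by (simp add: bij_is_inj)
 thus "\<pi> x = id x" unfolding assms(2) by simp
qed

lemma wne: "w ~= []"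
 using lw by auto

abbreviation fc where "fc k \<pi> \<equiv> singular_face N k (sx N (vx \<pi>))"

lemma finite_Perm: "finite Perm"
 by (rule finite_permutations) simp

lemma vx_transpose:
 assumes \<pi>: "\<pi> \<in> Perm" and k: "k \<in> {1..<N}" and i: "i ~= k"
 shows "vx (\<pi> \<circ> Transposition.transpose k (Suc k)) i = vx \<pi> i"
proof
 fix c
 have "bij \<pi>" using \<pi> permutes_bij by blast
 hence "pinv (\<pi> \<circ> Transposition.transpose k (Suc k)) = Transposition.transpose k (Suc k) \<circ> pinv \<pi>"
  by (subst o_inv_distrib) (auto simp: inv_transpose_eq bij_swap_iff)
 moreover have "Transposition.transpose k (Suc k) x <= i \<longleftrightarrow> x <= i" for x using i by (auto simp: Transposition.transpose_def)
 ultimately show "vx (\<pi> \<circ> Transposition.transpose k (Suc k)) i c = vx \<pi> i c" by (simp add: vx_def)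
qed

text \<open>Exchanging the steps k and k + 1 changes only the vertex k of the path. The two
  simplices share the face opposite to this vertex and carry opposite signs.\<close>

lemma interior_faces_cancel:
 assumes k: "k \<in> {1..<N}"
 shows "(\<Sum>\<pi>\<in>Perm. frag_cmul (sign \<pi>) (frag_of (fc k \<pi>))) = 0"
proof -
 define \<tau> where "\<tau> = Transposition.transpose k (Suc k)"
 define f where "f \<pi> = frag_cmul (sign \<pi>) (frag_of (fc k \<pi>))" for \<pi>
 have \<tau>: "\<tau> permutes {1..N}" unfolding \<tau>_def by (rule permutes_swap_id) (use k in auto)
 have \<tau>\<tau>: "\<tau> \<circ> \<tau> = id" by (simp add: \<tau>_def)
 have f: "f (\<pi> \<circ> \<tau>) = - f \<pi>" if \<pi>: "\<pi> \<in> Perm" for \<pi>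
 proof -
  have p: "permutation \<pi>" "permutation \<tau>" using \<pi> \<tau> by (auto simp: permutation_permutes)
  have "sign (\<pi> \<circ> \<tau>) = - sign \<pi>"
  unfolding sign_compose[OF p] by (simp add: \<tau>_def sign_swap_id)
  moreover have "singular_face N k (sx N (vx (\<pi> \<circ> \<tau>))) = fc k \<pi>"
  proof -
  have "(%j. if j < k then vx (\<pi> \<circ> \<tau>) j else vx (\<pi> \<circ> \<tau>) (Suc j)) = (%j. if j < k then vx \<pi> j else vx \<pi> (Suc j))"
  using vx_transpose[OF \<pi> k] by (auto simp: \<tau>_def fun_eq_iff)
  moreover have "1 <= N" "k <= N" using k by auto
  ultimately show ?thesis by (simp only: singular_face_sx)
  qed
  ultimately show ?thesis by (simp add: f_def)
 qed
 have "(\<Sum>\<pi>\<in>Perm. f \<pi>) = (\<Sum>\<pi>\<in>Perm. f (\<pi> \<circ> \<tau>))"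
 proof (rule sum.reindex_bij_witness[of _ "%\<pi>. \<pi> \<circ> \<tau>" "%\<pi>. \<pi> \<circ> \<tau>"])
  show "\<pi> \<circ> \<tau> \<in> Perm" if "\<pi> \<in> Perm" for \<pi> using that permutes_compose[OF \<tau>] by simp
  thus "\<pi> \<circ> \<tau> \<in> Perm" if "\<pi> \<in> Perm" for \<pi> using that .
 qed (simp_all add: o_assoc[symmetric] \<tau>\<tau>)
 also have "... = - (\<Sum>\<pi>\<in>Perm. f \<pi>)" using f by (simp add: sum_negf)
 finally have eq: "(\<Sum>\<pi>\<in>Perm. f \<pi>) = - (\<Sum>\<pi>\<in>Perm. f \<pi>)" .
 have "(\<Sum>\<pi>\<in>Perm. f \<pi>) = 0"
 proof (rule poly_mapping_eqI)
  fix s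
  have "Poly_Mapping.lookup (\<Sum>\<pi>\<in>Perm. f \<pi>) s = - Poly_Mapping.lookup (\<Sum>\<pi>\<in>Perm. f \<pi>) s"
  by (subst eq) (rule lookup_uminus)
  thus "Poly_Mapping.lookup (\<Sum>\<pi>\<in>Perm. f \<pi>) s = Poly_Mapping.lookup 0 s" by simp
 qed
 thus ?thesis by (simp add: f_def)
qed

lemma frag_cmul_sum_left: "frag_cmul c (\<Sum>i\<in>I. f i) = (\<Sum>i\<in>I. frag_cmul c (f i))"
 by (induction I rule: infinite_finite_induct) (auto simp: frag_cmul_distrib2)

lemma boundary_cube_chain:
 "chain_boundary N cube_chain =
  (\<Sum>(k, \<pi>)\<in>{0, N} \<times> Perm. frag_cmul ((-1) ^ k * sign \<pi>) (frag_of (fc k \<pi>)))"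
proof -
 let ?F = "%k. \<Sum>\<pi>\<in>Perm. frag_cmul (sign \<pi>) (frag_of (fc k \<pi>))"
 have "chain_boundary N cube_chain = (\<Sum>\<pi>\<in>Perm. frag_cmul (sign \<pi>) (\<Sum>k\<le>N. frag_cmul ((-1) ^ k) (frag_of (fc k \<pi>))))"
  unfolding cube_chain_def chain_boundary_sum by (simp add: chain_boundary_cmul chain_boundary_of o_def wne)
 also have "... = (\<Sum>k\<le>N. frag_cmul ((-1) ^ k) (?F k))"
  unfolding frag_cmul_sum_left by (subst sum.swap) (simp add: mult.commute)
 also have "... = (\<Sum>k\<in>{0, N}. frag_cmul ((-1) ^ k) (?F k))"
 proof (rule sum.mono_neutral_right)
  show "\<forall>k\<in>{..N} - {0, N}. frag_cmul ((-1) ^ k) (?F k) = 0"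
  proof
  fix k assume "k \<in> {..N} - {0, N}"
  hence "k \<in> {1..<N}" by auto
  thus "frag_cmul ((-1) ^ k) (?F k) = 0" by (simp only: interior_faces_cancel frag_cmul_zero2)
  qed
 qed auto
 also have "... = (\<Sum>(k, \<pi>)\<in>{0, N} \<times> Perm. frag_cmul ((-1) ^ k * sign \<pi>) (frag_of (fc k \<pi>)))"
  unfolding frag_cmul_sum_left sum.cartesian_product[symmetric] by simp
 finally show ?thesis .
qed

definition slot :: "nat => nat" where "slot c = (c - 1) div 2"

lemma slot:
 assumes "c \<in> {1..N}"
 shows "slot c < length w" "c = 2 * slot c + 1 \<or> c = 2 * slot c + 2"
 using assms lw unfolding slot_def by auto

text \<open>On an outer face of the cube one real coordinate is constant and not 0, so the complex
  coordinate containing it has no zero there.\<close>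

lemma boundary_face_away:
 assumes \<pi>: "\<pi> \<in> Perm" and k: "k \<in> {0, N}"
 shows "\<exists>j<length w. smp (N - 1) (Ch C0 \<inter> away (w ! j)) (fc k \<pi>)"
proof -
 have N: "1 <= N" using lw by simp
 have bij: "bij \<pi>" using \<pi> permutes_bij by blast
 have inv: "pinv \<pi> (\<pi> x) = x" for x using bij by (simp add: bij_is_inj)
 \<comment> \<open>Without the first vertex the coordinate of the first step is always at its upper
   value; without the last vertex the coordinate of the last step is always at its lower
   value.\<close>
 define c where "c = (if k = 0 then \<pi> 1 else \<pi> N)"
 have c: "c \<in> {1..N}" unfolding c_def using permutes_in_image[of \<pi> "{1..N}"] \<pi> N by auto
 define x where "x = (if k = 0 then real c else - (real N + 1 - real c))"
 have face: "fc k \<pi> = sx (N - 1) (%j. if j < k then vx \<pi> j else vx \<pi> (Suc j))"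
  by (rule singular_face_sx) (use N k in auto)
 have "smp (N - 1) (Ch C0 \<inter> away (w ! slot c)) (sx (N - 1) (%j. if j < k then vx \<pi> j else vx \<pi> (Suc j)))"
 proof (rule sx_away_const[OF slot[OF c], where c = x])
  show "(if i < k then vx \<pi> i else vx \<pi> (Suc i)) c = x" if "i <= N - 1" for i
  proof (cases "k = 0")
  case True
  thus ?thesis using inv[of 1] by (simp add: vx_def x_def c_def)
  next
  case False
  hence "k = N" using k by simp
  moreover have "pinv \<pi> c = N" using inv[of N] False by (simp add: c_def)
  moreover have "i < N" using that N by linarith
  ultimately show ?thesis using False by (simp add: vx_def x_def)
  qed
  show "x ~= 0" using c by (auto simp: x_def)
 qed
 thus ?thesis unfolding face using slot(1)[OF c] by blast
qed

text \<open>If the origin lay in the simplex of \<open>\<pi>\<close>, the tail sums g of its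
  barycentric coordinates would equal (N + 1 - k)/(N + 1) at \<open>pinv \<pi> k\<close>. As tail
  sums decrease, \<open>pinv \<pi>\<close> would be increasing, hence the identity. The off-centre
  position of the cube produces these distinct values.\<close>

lemma avoid_p0:
 assumes \<pi>: "\<pi> \<in> Perm" and ne: "\<pi> ~= id"
 shows "smp N (topspace X - {p0}) (sx N (vx \<pi>))"
proof (rule sx_singular_sub)
 fix x :: "nat => real" assume x: "x \<in> standard_simplex N"
 have x0: "0 <= x i" for i using x by (simp add: standard_simplex_def)
 have sx1: "(\<Sum>i\<le>N. x i) = 1" using x by (simp add: standard_simplex_def)
 have "PP (%k. \<Sum>i\<le>N. vx \<pi> i k * x i) ~= p0"
 proof
  assume eq: "PP (%k. \<Sum>i\<le>N. vx \<pi> i k * x i) = p0"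
  define g where "g j = (\<Sum>i\<le>N. if j <= i then x i else 0)" for j :: nat
  have gm: "g j' <= g j" if "j <= j'" for j j'
  unfolding g_def using x0 that by (intro sum_mono) auto
  have gk: "(real N + 1) * g (pinv \<pi> k) = real N + 1 - real k" if k: "k \<in> {1..N}" for k
  proof -
  have "zc (%k. \<Sum>i\<le>N. vx \<pi> i k * x i) (slot k) = 0"
  using eq slot(1)[OF k] unfolding PP_def by (rule cp_eq_p0)
  hence "(\<Sum>i\<le>N. vx \<pi> i k * x i) = 0" using slot(2)[OF k] by (auto simp: zc_def complex_eq_iff)
  moreover have "(\<Sum>i\<le>N. vx \<pi> i k * x i) = - (real N + 1 - real k) * (\<Sum>i\<le>N. x i) + (real N + 1) * g (pinv \<pi> k)"
  unfolding g_def sum_distrib_left sum.distrib[symmetric]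
  by (intro sum.cong refl) (auto simp: vx_def algebra_simps)
  ultimately show ?thesis using sx1 by simp
  qed
  have mono: "pinv \<pi> k < pinv \<pi> (Suc k)" if k: "k \<in> {1..N}" "Suc k \<in> {1..N}" for k
  proof (rule ccontr)
  assume "\<not> pinv \<pi> k < pinv \<pi> (Suc k)"
  hence "g (pinv \<pi> k) <= g (pinv \<pi> (Suc k))" by (intro gm) simp
  hence "(real N + 1) * g (pinv \<pi> k) <= (real N + 1) * g (pinv \<pi> (Suc k))" by (intro mult_left_mono) auto
  thus False unfolding gk[OF k(1)] gk[OF k(2)] by simp
  qed
  have ip: "pinv \<pi> permutes {1..N}" using \<pi> permutes_inv by blast
  have "k <= pinv \<pi> k" if "k \<in> {1..N}" for k
  using that
  proof (induction k)
  case (Suc k)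
  show ?case
  proof (cases "k = 0")
  case True
  have "pinv \<pi> 1 \<in> {1..N}" using permutes_in_image[OF ip, of 1] Suc.prems by simp
  thus ?thesis using True by simp
  next
  case False
  hence k: "k \<in> {1..N}" using Suc.prems by simp
  show ?thesis using Suc.IH[OF k] mono[OF k Suc.prems] by simp
  qed
  qed simp
  hence "pinv \<pi> = id" using permutes_natset_ge[OF ip] by blast
  thus False using ne pinv_id \<pi> by blast
 qed
 thus "PP (%k. \<Sum>i\<le>N. vx \<pi> i k * x i) \<in> topspace X - {p0}"
  unfolding PP_def using cp_topspace by simp
qed

text \<open>Real coordinates of the orientation simplex as a function of the barycentric
  coordinates; \<open>f1\<close> does the same for the simplex of the identity.\<close>

definition f0 :: "(nat => real) => nat => real" where "f0 t k = - 1 + (real N + 1) * t k"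

definition f1 :: "(nat => real) => nat => real" where "f1 t k = (\<Sum>i\<le>N. vx id i k * t i)"

lemma orientation_simplex_eq:
 "frag_of (orientation_simplex Fn w (%_. 0)) = chain_map N (PP \<circ> f0) (frag_of (restrict id (standard_simplex N)))"
proof -
 have "zc (f0 t) = (%j. 0 - Complex 1 1 + of_nat (2 * length w + 1) * Complex (t (2 * j + 1)) (t (2 * j + 2)))" for t
  using lw by (auto simp: zc_def f0_def complex_eq_iff fun_eq_iff)
 hence c: "cp (%j. 0 - Complex 1 1 + of_nat (2 * length w + 1) * Complex (t (2 * j + 1)) (t (2 * j + 2))) = PP (f0 t)" for t
  unfolding PP_def by (simp only:)
 have "orientation_simplex Fn w (%_. 0) = simplex_map N (PP \<circ> f0) (restrict id (standard_simplex N))"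
  unfolding orientation_simplex_def c simplex_map_def by (rule restrict_ext) simp
 thus ?thesis by simp
qed

lemma sx_id_eq: "frag_of (sx N (vx id)) = chain_map N (PP \<circ> f1) (frag_of (restrict id (standard_simplex N)))"
proof -
 have "sx N (vx id) = simplex_map N (PP \<circ> f1) (restrict id (standard_simplex N))"
  by (auto simp: sx_def simplex_map_def oriented_simplex_def f1_def[abs_def] fun_eq_iff)
 thus ?thesis by simp
qed

text \<open>Downward induction on the index: if t i = 1/(N + 1) for all i > k, then
  \<open>f0 t k\<close> and \<open>f1 t k\<close> agree, so both are 0 and t k has this value too.
  The barycentre is thus the only possible zero throughout the homotopy, and it is not on the
  boundary.\<close>

lemma homotopy_zero:
 assumes t: "t \<in> standard_simplex N" and z: "!!k. k \<in> {1..N} ==> (1 - u) * f0 t k + u * f1 t k = 0"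
  and i: "i <= N"
 shows "0 < t i"
proof -
 define s where "s = 1 / (real N + 1)"
 have st: "(\<Sum>i\<le>N. t i) = 1" using t by (simp add: standard_simplex_def)
 have ts: "t k = s" if "k \<in> {1..N}" for k
  using that
 proof (induction "N - k" arbitrary: k rule: less_induct)
  case less
  have IH: "t i = s" if "i \<in> {Suc k..N}" for i
  proof (rule less.hyps)
  show "N - i < N - k" "i \<in> {1..N}" using that less.prems by auto
  qed
  have "f1 t k = (\<Sum>i\<le>N. - (real N + 1 - real k) * t i + (real N + 1) * (if k <= i then t i else 0))"
  unfolding f1_def by (intro sum.cong refl) (auto simp: vx_def algebra_simps)
  also have "... = - (real N + 1 - real k) + (real N + 1) * (\<Sum>i\<le>N. if k <= i then t i else 0)"
  unfolding sum.distrib sum_distrib_left[symmetric] st by simp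
  also have "(\<Sum>i\<le>N. if k <= i then t i else 0) = (\<Sum>i\<in>{k..N}. t i)"
  unfolding sum.If_cases[OF finite_atMost] using less.prems by (auto intro: sum.cong)
  also have "{k..N} = insert k {Suc k..N}" using less.prems by auto
  also have "(\<Sum>i\<in>insert k {Suc k..N}. t i) = t k + (\<Sum>i\<in>{Suc k..N}. t i)" by simp
  also have "(\<Sum>i\<in>{Suc k..N}. t i) = (real N - real k) * s" using IH less.prems by (simp add: of_nat_diff)
  also have "- (real N + 1 - real k) + (real N + 1) * (t k + (real N - real k) * s) = f0 t k"
  proof -
  have "(real N + 1) * s = 1" by (simp add: s_def)
  hence "(real N + 1) * ((real N - real k) * s) = real N - real k" by (metis mult.left_commute mult.right_neutral)
  thus ?thesis unfolding distrib_left f0_def by linarith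
  qed
  finally have "f1 t k = f0 t k" .
  hence "f0 t k = 0" using z[OF less.prems] by (simp add: algebra_simps)
  thus "t k = s" by (simp add: f0_def s_def field_simps)
 qed
 have "{..N} = insert 0 {1..N}" by auto
 hence "1 = t 0 + (\<Sum>i\<in>{1..N}. t i)" using st by simp
 also have "(\<Sum>i\<in>{1..N}. t i) = real N * s" using ts by simp
 finally have "t 0 = s" by (simp add: s_def field_simps)
 hence "t i = s" using ts i by (cases "i = 0") auto
 thus ?thesis by (simp add: s_def)
qed

text \<open>The straight homotopy between the two affine simplices keeps the boundary away from the
  fixed point, so both define the same local class.\<close>

lemma homologous_simplices:
 "homologous_rel N X (topspace X - {p0}) (frag_of (orientation_simplex Fn w (%_. 0))) (frag_of (sx N (vx id)))"
 unfolding orientation_simplex_eq sx_id_eq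
proof (rule homotopic_imp_homologous_rel_chain_maps)
 let ?S = "subtopology (powertop_real UNIV) (standard_simplex N)"
 let ?T = "{t \<in> standard_simplex N. \<exists>i\<le>N. t i = 0}"
 define h where "h = (%(u, t). PP (%k. (1 - u) * f0 t k + u * f1 t k))"
 let ?Y = "prod_topology (top_of_set {0..1::real}) ?S"
 show "homotopic_with (%h. h \<in> ?T \<rightarrow> topspace X - {p0}) ?S X (PP \<circ> f0) (PP \<circ> f1)"
  unfolding homotopic_with_def
 proof (intro exI[of _ h] conjI allI ballI)
  have u: "continuous_map ?Y euclideanreal fst"
  using continuous_map_fst[of "top_of_set {0..1::real}" ?S] by (simp add: continuous_map_in_subtopology)
  have t: "continuous_map ?Y euclideanreal (%y. snd y i)" for i
  using continuous_map_compose[OF continuous_map_snd continuous_map_powertop_component] by (simp add: o_def)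
  have c0: "continuous_map ?Y euclideanreal (%y. f0 (snd y) k)" for k
  unfolding f0_def using t by (intro continuous_map_add continuous_map_real_mult) auto
  have c1: "continuous_map ?Y euclideanreal (%y. f1 (snd y) k)" for k
  unfolding f1_def using t by (intro continuous_map_sum continuous_map_real_mult) auto
  have c: "continuous_map ?Y euclideanreal (%y. (1 - fst y) * f0 (snd y) k + fst y * f1 (snd y) k)" for k
  using u c0 c1 by (intro continuous_map_add continuous_map_real_mult continuous_map_diff) auto
  have "continuous_map ?Y X (%y. cp (zc (%k. (1 - fst y) * f0 (snd y) k + fst y * f1 (snd y) k)))"
  unfolding zc_def by (intro continuous_map_cp continuous_map_Complex c)
  thus "continuous_map ?Y X h" by (simp add: h_def PP_def case_prod_unfold)
  show "h (0, x) = (PP \<circ> f0) x" "h (1, x) = (PP \<circ> f1) x" for x by (simp_all add: h_def)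
  show "(%x. h (u, x)) \<in> ?T \<rightarrow> topspace X - {p0}" if "u \<in> {0..1}" for u
  proof
  fix t assume t: "t \<in> ?T"
  have "h (u, t) ~= p0"
  proof
  assume "h (u, t) = p0"
  hence e: "cp (zc (%k. (1 - u) * f0 t k + u * f1 t k)) = p0" by (simp add: h_def PP_def)
  have "(1 - u) * f0 t k + u * f1 t k = 0" if k: "k \<in> {1..N}" for k
  using cp_eq_p0[OF e slot(1)[OF k]] slot(2)[OF k] by (auto simp: zc_def complex_eq_iff)
  hence "0 < t i" if "i <= N" for i using homotopy_zero[of t u i] t that by blast
  thus False using t by force
  qed
  thus "h (u, t) \<in> topspace X - {p0}" by (simp add: h_def PP_def cp_topspace)
  qed
 qed
 have id: "singular_simplex N ?S (restrict id (standard_simplex N))"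
  unfolding singular_simplex_def by (auto intro: continuous_map_eq[OF continuous_map_id])
 have N: "1 <= N" using lw by simp
 show "singular_relcycle N ?S ?T (frag_of (restrict id (standard_simplex N)))"
  unfolding singular_relcycle
 proof
  show "singular_chain N ?S (frag_of (restrict id (standard_simplex N)))" using id by (simp add: singular_chain_of)
  have face: "singular_simplex (N - 1) (subtopology ?S ?T) (singular_face N k (restrict id (standard_simplex N)))" if k: "k <= N" for k
  proof (rule singular_simplex_subtopology[THEN iffD2], rule conjI)
  show "singular_simplex (N - 1) ?S (singular_face N k (restrict id (standard_simplex N)))"
  using singular_simplex_singular_face[OF id N k] by simp
  show "singular_face N k (restrict id (standard_simplex N)) ` standard_simplex (N - 1) \<subseteq> ?T"
  proof (rule image_subsetI)
  fix x assume x: "x \<in> standard_simplex (N - 1)"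
  have "simplical_face k x \<in> standard_simplex N"
  by (rule simplical_face_in_standard_simplex) (use x k N in auto)
  moreover have "simplical_face k x k = 0" by (simp add: simplical_face_def)
  ultimately show "singular_face N k (restrict id (standard_simplex N)) x \<in> ?T"
  using x k by (auto simp: singular_face_def)
  qed
  qed
  show "singular_chain (N - 1) (subtopology ?S ?T) (chain_boundary N (frag_of (restrict id (standard_simplex N))))"
  unfolding chain_boundary_of using face
  by (auto intro!: singular_chain_sum singular_chain_cmul simp: singular_chain_of)
 qed
qed

definition pos :: "(nat => nat) => nat => nat => bool" where
 "pos \<pi> k i \<longleftrightarrow> pinv \<pi> k <= i"

text \<open>Between the vertices 2j and 2j + 2 of the path, coordinate j moves between corners of a
  square. A non-degenerate triangle arises only if both steps belong to this coordinate, and it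
  encloses the origin only if the real step comes before the imaginary one.\<close>

lemma factor_value:
 assumes j: "j < length w" and \<pi>: "\<pi> \<in> Perm" and E: "eqn (w ! j) m b c"
  and e: "!!s. smp 1 (Ch C0 \<inter> away (w ! j)) s ==> b C0 s - e s = wn (chi (m C0) \<circ> simplex_path s)"
 defines "D' \<equiv> %s. c s - coboundary 1 e s"
 shows "D' (back_face (2 * j) 2 (sx N (vx \<pi>))) = (if pinv \<pi> (2 * j + 1) = 2 * j + 1 \<and> pinv \<pi> (2 * j + 2) = 2 * j + 2 then 1 else 0)"
proof -
 \<comment> \<open>The lower corner of the square is (-A, -B), from the values N + 1 - k at k = 2j +
   1 and k = 2j + 2; the side is K. Their difference of one is what gives B < A.\<close>
 define A B K where "A = real N - 2 * real j" and "B = real N - 2 * real j - 1" and "K = real N + 1"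
 have "2 * real j + 2 <= real N" using j by linarith
 hence AB: "0 < B" "B < A" "A < K" by (auto simp: A_def B_def K_def)
 define a1 b1 where "a1 = pinv \<pi> (2 * j + 1)" and "b1 = pinv \<pi> (2 * j + 2)"
 have "pinv \<pi> permutes {1..N}" using \<pi> permutes_inv by blast
 hence "inj (pinv \<pi>)" by (rule permutes_inj)
 hence ab: "a1 ~= b1" unfolding a1_def b1_def by (simp add: inj_eq)
 define \<alpha> \<beta> where "\<alpha> i = (if a1 <= i then 1 else 0 :: real)" and "\<beta> i = (if b1 <= i then 1 else 0 :: real)" for i
 define Z where "Z i = Complex (- A + K * \<alpha> i) (- B + K * \<beta> i)" for i
 define l where "l i = vx \<pi> (2 * j + i)" for i
 have zl: "zc (l i) j = Z (2 * j + i)" for i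
  by (simp add: zc_def l_def vx_def Z_def \<alpha>_def \<beta>_def A_def B_def K_def a1_def b1_def complex_eq_iff)
 have seg: "0 \<notin> closed_segment (Z i) (Z i')" if "i <= i'" for i i'
  unfolding Z_def by (rule square_segment[OF AB]) (use that in \<open>auto simp: \<alpha>_def \<beta>_def\<close>)
 have nz: "Z i ~= 0" for i using seg[of i i] by simp
 have "2 * j + 2 <= N" using j by simp
 hence "D' (back_face (2 * j) 2 (sx N (vx \<pi>))) = c (sx 2 l) - coboundary 1 e (sx 2 l)"
  unfolding D'_def l_def[abs_def] by (simp only: back_face_sx)
 also have "... = tri_wn (zc (l 0) j) (zc (l 1) j) (zc (l 2) j)"
  by (rule triangle_value[OF j E e], assumption) (unfold zl, (rule seg, simp)+)
 also have "... = tri_wn (Z (2 * j)) (Z (2 * j + 1)) (Z (2 * j + 2))" by (simp only: zl add_0_right)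
 finally have val: "D' (back_face (2 * j) 2 (sx N (vx \<pi>))) = tri_wn (Z (2 * j)) (Z (2 * j + 1)) (Z (2 * j + 2))" .
 \<comment> \<open>In the third case step 2j + 1 leaves this coordinate fixed, in the fourth step 2j
   + 2 does, and two vertices of the triangle coincide.\<close>
 consider "a1 = 2 * j + 1 \<and> b1 = 2 * j + 2" | "a1 = 2 * j + 2 \<and> b1 = 2 * j + 1"
  | "\<not> (a1 = 2 * j + 1 \<and> b1 = 2 * j + 2)" "a1 ~= 2 * j + 1" "b1 ~= 2 * j + 1"
  | "\<not> (a1 = 2 * j + 1 \<and> b1 = 2 * j + 2)" "a1 ~= 2 * j + 2" "b1 ~= 2 * j + 2"
  using ab by (cases "a1 = 2 * j + 1"; cases "b1 = 2 * j + 1"; cases "a1 = 2 * j + 2"; cases "b1 = 2 * j + 2") auto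
 hence "tri_wn (Z (2 * j)) (Z (2 * j + 1)) (Z (2 * j + 2)) = (if a1 = 2 * j + 1 \<and> b1 = 2 * j + 2 then 1 else 0)"
 proof cases
  case 1
  hence "Z (2 * j) = Complex (- A) (- B)" "Z (2 * j + 1) = Complex (K - A) (- B)" "Z (2 * j + 2) = Complex (K - A) (K - B)"
  by (simp_all add: Z_def \<alpha>_def \<beta>_def)
  thus ?thesis using tri_wn_positive[OF AB] 1 by simp
 next
  case 2
  hence "Z (2 * j) = Complex (- A) (- B)" "Z (2 * j + 1) = Complex (- A) (K - B)" "Z (2 * j + 2) = Complex (K - A) (K - B)"
  by (simp_all add: Z_def \<alpha>_def \<beta>_def)
  thus ?thesis using tri_wn_negative[OF AB] 2 by simp
 next
  case 3
  hence "Z (2 * j) = Z (2 * j + 1)" by (auto simp: Z_def \<alpha>_def \<beta>_def)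
  thus ?thesis using tri_wn_degenerate(1)[OF nz] 3(1) by simp
 next
  case 4
  hence "Z (2 * j + 1) = Z (2 * j + 2)" by (auto simp: Z_def \<alpha>_def \<beta>_def)
  thus ?thesis using tri_wn_degenerate(2)[OF nz] 4(1) by simp
 qed
 thus ?thesis unfolding val a1_def b1_def .
qed

abbreviation slot_of where
 "slot_of k \<pi> \<equiv> SOME j. j < length w \<and> smp (N - 1) (Ch C0 \<inter> away (w ! j)) (fc k \<pi>)"

text \<open>After correction every factor is supported near its divisor, so only the local class of
  the cycle at the fixed point counts, and the cube may replace the cycle. In the cube a simplex
  contributes only if its steps 2j + 1 and 2j + 2 are those of coordinate j, in this order, for
  every j; then \<open>\<pi>\<close> is the identity and each factor is 1.\<close>

theorem normalization:
 assumes D: "!!d. d \<in> Rays ==> \<exists>m b. eqn d m b (D d)" and \<mu>: "fundamental_cycle Fn \<mu>"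
 shows "eval_chain (word D w) \<mu> = 1"
proof -
 have wR: "set w \<subseteq> Rays" using gens_Rays[of C0] C0(2) by simp
 have cyc: "singular_relcycle N X {} \<mu>" using \<mu> lw by (simp add: fundamental_cycle_def)
 have "\<forall>d\<in>Rays. \<exists>m. \<exists>b. eqn d m b (D d)" using D by blast
 then obtain m where "\<forall>d\<in>Rays. \<exists>b. eqn d (m d) b (D d)" by (rule bchoice[THEN exE])
 then obtain b where E: "\<forall>d\<in>Rays. eqn d (m d) (b d) (D d)" by (rule bchoice[THEN exE])
 have "\<forall>d\<in>Rays. \<exists>e. tame d (%s. D d s - coboundary 1 e s) \<and>
  (\<forall>C\<in>Fn. \<forall>s. smp 1 (Ch C \<inter> away d) s --> b d C s - e s = wn (chi (m d C) \<circ> simplex_path s))"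
  using E tame_cohomologous by blast
 then obtain e where e: "\<forall>d\<in>Rays. tame d (%s. D d s - coboundary 1 (e d) s) \<and>
  (\<forall>C\<in>Fn. \<forall>s. smp 1 (Ch C \<inter> away d) s --> b d C s - e d s = wn (chi (m d C) \<circ> simplex_path s))"
  by (rule bchoice[THEN exE])
 define D' where "D' d s = D d s - coboundary 1 (e d) s" for d s
 have cD: "cocycle 2 X (D d)" if "d \<in> Rays" for d using E that eqnD(1) by blast
 have cD': "cocycle 2 X (D' d)" if "d \<in> Rays" for d
  unfolding D'_def[abs_def] by (rule cocycle_minus_coboundary[OF cD[OF that]])
 have tame: "tame d (D' d)" if "d \<in> Rays" for d using e that unfolding D'_def[abs_def] by blast
 have "eval_chain (word D w) \<mu> = eval_chain (word D' w) \<mu>"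
 proof (rule eval_word_cohomologous)
  show "cohomologous X (D d) (D' d)" for d unfolding D'_def[abs_def] by (rule cohomologous_coboundary)
 qed (use cD cD' wR lw cyc in auto)
 \<comment> \<open>The cube chain is not a cycle; it is admissible because each face in its boundary
   lies in a single set on which the product vanishes.\<close>
 also have "... = eval_chain (word D' w) cube_chain"
 proof (rule cocycle_eval_local[where \<U> = "cover_of w" and X = X and n = N
  and I = "{0, N} \<times> Perm" and \<rho> = "%(k, \<pi>). frag_cmul ((-1) ^ k * sign \<pi>) (frag_of (fc k \<pi>))"
  and V = "%(k, \<pi>). Ch C0 \<inter> away (w ! slot_of k \<pi>)"])
  have "cocycle (2 * length (map D' w)) X (wc (map D' w))" by (rule cocycle_wc) (use cD' wR in auto)
  thus "cocycle N X (word D' w)" using lw by (simp add: word_def)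
  show "0 < N" using lw by simp
  show "singular_relcycle N X {} \<mu>" by (rule cyc)
  show "openin X V" if "V \<in> cover_of w" for V using openin_chart_away that by blast
  show "word D' w s = 0" if V: "V \<in> cover_of w" and s: "smp N V s" for V s
  proof -
  obtain C d where Cd: "C \<in> Fn" "d \<in> set w" "V = Ch C \<inter> away d" using V by blast
  have "tame d (D' d)" using tame Cd(2) wR by blast
  from word_tame_vanish[of C d w D', OF Cd(1,2) this] show ?thesis using s Cd(3) lw by simp
  qed
  have j: "slot_of k \<pi> < length w \<and>
  smp (N - 1) (Ch C0 \<inter> away (w ! slot_of k \<pi>)) (fc k \<pi>)"
  if "k \<in> {0, N}" "\<pi> \<in> Perm" for k \<pi>
  by (rule someI_ex) (rule boundary_face_away[OF that(2,1)])
  show "singular_chain (N - 1) (subtopology X (case i of (k, \<pi>) => Ch C0 \<inter> away (w ! slot_of k \<pi>)))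
  (case i of (k, \<pi>) => frag_cmul ((-1) ^ k * sign \<pi>) (frag_of (fc k \<pi>)))" if "i \<in> {0, N} \<times> Perm" for i
  proof -
  obtain k \<pi> where i: "i = (k, \<pi>)" "k \<in> {0, N}" "\<pi> \<in> Perm" using \<open>i \<in> {0, N} \<times> Perm\<close> by blast
  show ?thesis unfolding i(1) split_conv
  by (rule singular_chain_cmul) (rule singular_chain_of[THEN iffD2], rule j[OF i(2,3), THEN conjunct2])
  qed
  show "word D' w s = 0" if "i \<in> {0, N} \<times> Perm" "smp N (case i of (k, \<pi>) => Ch C0 \<inter> away (w ! slot_of k \<pi>)) s" for i s
  proof -
  obtain k \<pi> where i: "i = (k, \<pi>)" "k \<in> {0, N}" "\<pi> \<in> Perm" using \<open>i \<in> {0, N} \<times> Perm\<close> by blast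
  define jj where "jj = slot_of k \<pi>"
  have jw: "w ! jj \<in> set w" using j[OF i(2,3)] unfolding jj_def[symmetric] by simp
  have "smp N (Ch C0 \<inter> away (w ! jj)) s"
  using that(2) unfolding i(1) split_conv jj_def .
  thus ?thesis using word_tame_vanish[of C0 "w ! jj" w D' s, OF C0(1) jw] tame wR jw lw by auto
  qed
  show "chain_boundary N cube_chain = (\<Sum>i\<in>{0, N} \<times> Perm. case i of (k, \<pi>) => frag_cmul ((-1) ^ k * sign \<pi>) (frag_of (fc k \<pi>)))"
  by (rule boundary_cube_chain)
  show "singular_chain N X cube_chain" unfolding cube_chain_def
  by (intro singular_chain_sum singular_chain_cmul) (simp add: singular_chain_of sx_singular)
  show "homologous_rel N X (\<Union>(cover_of w)) \<mu> cube_chain"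
  unfolding complement_p0
  proof -
  let ?V = "topspace X - {p0}"
  have "homologous_rel N X (topspace X - {cp (%_. 0)}) \<mu> (frag_of (orientation_simplex Fn w (%_. 0)))"
  proof -
  have "distinct w \<and> lattice_basis (set w) \<and> convex_cone hull (rvec ` set w) \<in> Fn"
  using dw basis C0(1) by (simp add: C0_def pos_cone_def)
  thus ?thesis using \<mu> unfolding fundamental_cycle_def lw by blast
  qed
  hence "homologous_rel N X ?V \<mu> (frag_of (orientation_simplex Fn w (%_. 0)))" unfolding p0_def .
  hence h: "homologous_rel N X ?V \<mu> (frag_of (sx N (vx id)))" using homologous_simplices homologous_rel_trans by blast
  have idP: "id \<in> Perm" by (simp add: permutes_id)
  \<comment> \<open>The other simplices miss the fixed point and do not affect the local class; the
    simplex of the identity alone represents the orientation.\<close>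
  define R where "R = (\<Sum>\<pi>\<in>Perm - {id}. frag_cmul (sign \<pi>) (frag_of (sx N (vx \<pi>))))"
  have cc: "cube_chain = frag_of (sx N (vx id)) + R"
  unfolding cube_chain_def R_def by (subst sum.remove[OF finite_Perm idP]) (simp add: sign_id)
  have "singular_chain N (subtopology X ?V) R" unfolding R_def
  by (intro singular_chain_sum singular_chain_cmul) (use avoid_p0 in \<open>auto simp: singular_chain_of\<close>)
  hence rR: "singular_relboundary N X ?V R" by (rule singular_chain_imp_relboundary)
  have "singular_relboundary N X ?V (\<mu> - frag_of (sx N (vx id)))" using h by (simp add: homologous_rel_def)
  hence "singular_relboundary N X ?V ((\<mu> - frag_of (sx N (vx id))) - R)" by (rule singular_relboundary_diff[OF _ rR])
  moreover have "(\<mu> - frag_of (sx N (vx id))) - R = \<mu> - cube_chain" by (simp add: cc)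
  ultimately show "homologous_rel N X ?V \<mu> cube_chain" by (simp only: homologous_rel_def)
  qed
 qed
 also have "... = (\<Sum>\<pi>\<in>Perm. of_int (sign \<pi>) * word D' w (sx N (vx \<pi>)))"
  unfolding cube_chain_def eval_chain_sum by (simp add: eval_chain_cmul)
 also have "... = (\<Sum>\<pi>\<in>Perm. if \<pi> = id then 1 else 0)"
 proof (intro sum.cong refl)
  fix \<pi> assume \<pi>: "\<pi> \<in> Perm"
  have "word D' w (sx N (vx \<pi>)) = (\<Prod>j<length w. D' (w ! j) (back_face (2 * j) 2 (sx N (vx \<pi>))))"
  unfolding word_def wc_prod by simp
  also have "... = (\<Prod>j<length w. if pinv \<pi> (2 * j + 1) = 2 * j + 1 \<and> pinv \<pi> (2 * j + 2) = 2 * j + 2 then 1 else 0)"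
  proof (intro prod.cong refl)
  fix j assume "j \<in> {..<length w}"
  hence j: "j < length w" by simp
  hence jR: "w ! j \<in> Rays" using wR by auto
  show "D' (w ! j) (back_face (2 * j) 2 (sx N (vx \<pi>))) = (if pinv \<pi> (2 * j + 1) = 2 * j + 1 \<and> pinv \<pi> (2 * j + 2) = 2 * j + 2 then 1 else 0)"
  unfolding D'_def[abs_def] by (rule factor_value[OF j \<pi>]) (use E e jR C0(1) in blast)+
  qed
  also have "... = (if \<pi> = id then 1 else 0)"
  proof (cases "\<pi> = id")
  case False
  have "\<exists>j<length w. \<not> (pinv \<pi> (2 * j + 1) = 2 * j + 1 \<and> pinv \<pi> (2 * j + 2) = 2 * j + 2)"
  proof (rule ccontr)
  assume "\<not> (\<exists>j<length w. \<not> (pinv \<pi> (2 * j + 1) = 2 * j + 1 \<and> pinv \<pi> (2 * j + 2) = 2 * j + 2))"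
  hence all: "pinv \<pi> (2 * j + 1) = 2 * j + 1" "pinv \<pi> (2 * j + 2) = 2 * j + 2" if "j < length w" for j using that by blast+
  have ip: "pinv \<pi> permutes {1..N}" using \<pi> permutes_inv by blast
  have "k <= pinv \<pi> k" if k: "k \<in> {1..N}" for k
  using all[OF slot(1)[OF k]] slot(2)[OF k] by (metis order_refl)
  hence "pinv \<pi> = id" using permutes_natset_ge[OF ip] by blast
  thus False using False pinv_id \<pi> by blast
  qed
  thus ?thesis using False by (auto intro!: prod_zero)
  qed simp
  finally show "of_int (sign \<pi>) * word D' w (sx N (vx \<pi>)) = (if \<pi> = id then 1 else 0)" by (simp add: sign_id)
 qed
 also have "... = 1" using finite_Perm permutes_id[of "{1..N}"] by simp
 finally show ?thesis .
qed

end

section \<open>Intersection numbers and the limit formula\<close>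

lemma (in nonsingular_toric) intersection_numbers:
 assumes D: "\<forall>d\<in>ray_generators Fn. divisor_cocycle Fn d (D d)" and \<mu>: "fundamental_cycle Fn \<mu>"
  and v: "nc.generic v" and w: "set w \<subseteq> ray_generators Fn" "length w = CARD('n)"
 shows "eval_chain (wc (map D w)) \<mu> = of_real (nc.Lw v w)"
proof -
 have rays: "nc.rays = Rays" by (simp add: nc.rays_def ray_generators_gens Rays_def)
 have E: "\<exists>m b. eqn d m b (D d)" if "d \<in> Rays" for d
  using divisor_cocycle_eqn[OF that] D that by (simp add: Rays_def)
 have cyc: "singular_relcycle (2 * CARD('n)) X {} \<mu>" using \<mu> by (simp add: fundamental_cycle_def)
 have "eval_chain (word D w) \<mu> = of_real (nc.Lw v w)"
 proof (rule nc.intersection_numbers_unique[OF v, where J = "%w. eval_chain (word D w) \<mu>"])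
  fix n u u' assume u: "set u \<subseteq> nc.rays" "set u' \<subseteq> nc.rays" "length u + length u' + 1 = CARD('n)"
  show "(\<Sum>d\<in>nc.rays. of_int (pairing n d) * eval_chain (word D (u @ d # u')) \<mu>) = 0"
  unfolding rays by (rule linear_relation[OF E _ _ u(3) cyc]) (use u rays in auto)
 next
  fix w assume w: "set w \<subseteq> nc.rays" "length w = CARD('n)" "set w \<notin> G ` Fn"
  show "eval_chain (word D w) \<mu> = 0"
  by (rule vanishing[OF E _ w(2,3) cyc]) (use w(1) rays in auto)
 next
  fix w assume w: "set w \<in> G ` Fn" "length w = CARD('n)" "distinct w"
  interpret toric_facet Fn w using w by unfold_locales auto
  show "eval_chain (word D w) \<mu> = 1" by (rule normalization[OF E \<mu>])
 qed (use w rays in \<open>auto simp: Rays_def\<close>)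
 thus ?thesis by (simp add: word_def)
qed

theorem theorem3p5:
  fixes \<Sigma> \<Sigma>' :: "(real ^ 'n) set set"
    and dg dg1 :: "int ^ 'n \<Rightarrow> complex"
    and ds :: "(int ^ 'n) list"
    and D :: "int ^ 'n \<Rightarrow> 'n toric_point cochain"
    and \<mu> :: "'n toric_point chain"
  assumes "complete_fan \<Sigma>" and "simplicial_fan \<Sigma>"
    and "linear_on_cones \<Sigma> dg"
    and "\<forall>d\<in>ray_generators \<Sigma>. dg d \<notin> \<int>"
    and "is_fan \<Sigma>'" and "refinement_of \<Sigma>' \<Sigma>" and "nonsingular_fan \<Sigma>'"
    and "distinct ds" and "set ds = ray_generators \<Sigma>'"
    and "linear_on_cones \<Sigma> dg1"
    and "\<forall>d\<in>set ds. dg1 d \<noteq> 0"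
    and "\<forall>d\<in>set ds. divisor_cocycle \<Sigma>' d (D d)"
    and "fundamental_cycle \<Sigma>' \<mu>"
  shows "\<exists>\<delta>>0. \<forall>\<tau> q. Im \<tau> > 0 \<and> q = exp (2 * of_real pi * \<i> * \<tau>) \<and> norm q < \<delta> \<longrightarrow>
     toric_form_term \<Sigma> dg q summable_on UNIV \<and>
     ((\<lambda>\<epsilon>. toric_integral \<mu>
         (cup_prod (map (\<lambda>d. fps_at (theta_factor \<tau> (dg d + \<epsilon> * dg1 d))
                                 (in_degree 2 (\<lambda>s. D d s / (2 * of_real pi * \<i>)))) ds)))
       \<longlongrightarrow> toric_form \<Sigma> dg q) (at 0)"
proof -
 have fan': "complete_fan \<Sigma>'" using assms(1,5,6) by (simp add: complete_fan_def refinement_of_def)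
 interpret nonsingular_toric \<Sigma>' by unfold_locales (fact fan', fact assms(7))
 \<comment> \<open>An auxiliary direction: by the next statement the localization numbers of words
   of length r are values of cochains on the cycle, hence do not depend on it.\<close>
 obtain v where v: "nc.generic v" using nc.generic_exists by blast
 have I: "eval_chain (wc (map D w)) \<mu> = of_real (nc.Lw v w)" if "length w = CARD('n)" "set w \<subseteq> set ds" for w
  by (rule intersection_numbers[OF _ assms(13) v]) (use that assms(9,12) in auto)
 have n0: "\<forall>d\<in>ray_generators \<Sigma>'. dg1 d ~= 0" using assms(9,11) by simp
 obtain \<delta> where \<delta>: "\<delta> > 0" "\<delta> <= exp (- 30)" and P: "\<forall>\<tau>. norm (ee \<tau>) < \<delta> -->
  toric_form_term \<Sigma> dg (ee \<tau>) summable_on UNIV \<and>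
  (\<forall>\<^sub>F \<epsilon> in at 0. \<exists>c>0. \<forall>d\<in>ray_generators \<Sigma>'. sep (ee \<tau>) (ee (dg d + \<epsilon> * dg1 d)) c) \<and>
  ((%\<epsilon>. toric_form \<Sigma>' (%d. dg d + \<epsilon> * dg1 d) (ee \<tau>)) \<longlongrightarrow> toric_form \<Sigma> dg (ee \<tau>)) (at 0)"
  using toric_form_perturbation[OF assms(1,2) fan' simpl assms(6,3,10,4) n0] by blast
 have "toric_form_term \<Sigma> dg q summable_on UNIV \<and>
  ((%\<epsilon>. toric_integral \<mu>
  (cup_prod (map (%d. fps_at (theta_factor \<tau> (dg d + \<epsilon> * dg1 d))
  (in_degree 2 (%s. D d s / (2 * of_real pi * \<i>)))) ds)))
  \<longlongrightarrow> toric_form \<Sigma> dg q) (at 0)"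
  if \<tau>: "Im \<tau> > 0" and q: "q = exp (2 * of_real pi * \<i> * \<tau>)" "norm q < \<delta>" for \<tau> q
 proof -
  have qe: "q = ee \<tau>" by (simp add: q(1) ee_def)
  have small: "norm (ee \<tau>) < \<delta>" using q(2) unfolding qe .
  hence q30: "norm (ee \<tau>) < exp (- 30)" using \<delta>(2) by simp
  note Q = P[rule_format, OF small]
  \<comment> \<open>For such \<open>\<epsilon>\<close> the perturbed degrees are separated from the
    powers of q on all rays of the refinement, so the integral is exactly the toric form of the
    refinement; the limit is then that of \<open>toric_form_perturbation\<close>.\<close>
  have "\<forall>\<^sub>F \<epsilon> in at 0. toric_integral \<mu>
  (cup_prod (map (%d. fps_at (theta_factor \<tau> (dg d + \<epsilon> * dg1 d)) (in_degree 2 (%s. D d s / (2 * of_real pi * \<i>)))) ds)) =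
  toric_form \<Sigma>' (%d. dg d + \<epsilon> * dg1 d) (ee \<tau>)"
  using conjunct1[OF conjunct2[OF Q]]
  proof eventually_elim
  case (elim \<epsilon>)
  then obtain c where c: "c > 0" "\<forall>d\<in>ray_generators \<Sigma>'. sep (ee \<tau>) (ee (dg d + \<epsilon> * dg1 d)) c" by blast
  have lin: "linear_on_cones \<Sigma>' (%d. dg d + \<epsilon> * dg1 d)"
  by (rule linear_on_cones_refinement[OF assms(6) linear_on_cones_add[OF assms(3,10)]])
  let ?c = "%d. fps_nth (theta_factor \<tau> (dg d + \<epsilon> * dg1 d))"
  have "wexp ?c ds CARD('n) (%w. eval_chain (wc (map D w)) \<mu>) = wexp ?c ds CARD('n) (%w. of_real (nc.Lw v w))"
  by (rule wexp_cong) (rule I)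
  thus ?case
  unfolding toric_integral_def eval_cup_prod
  using toric_form_nonsingular[OF fan' assms(7) lin \<tau> q30 c v assms(8,9)] by simp
  qed
  thus ?thesis using Q unfolding qe by (simp add: tendsto_cong)
 qed
 thus ?thesis using \<delta>(1) by blast
qed

end
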